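(* Let $(X,T^*_{X,-})$ be a model with vanishing first obstruction cohomology, ${\bf H}^1_\partial(X,\mathcal A_{T^*_{X,-}})=(0)$. Then $(X,T^*_{X,-})$ is projectable, i.e. every supermanifold modelled on $(X,T^*_{X,-})$ is projectable.
   Context: A model $(X,T^*_{X,-})$ is a complex manifold $X$ with a holomorphic vector bundle $T^*_{X,-}$ (identified with its locally free sheaf of sections). Let $J=\bigoplus_{j>0}\wedge^jT^*_{X,-}\subset\wedge^\bullet T^*_{X,-}$ and $J^k=\bigoplus_{j\ge k}\wedge^jT^*_{X,-}$. For $k\ge2$ let $\mathrm G_k=\mathrm G_{T^*_{X,-},k}$ be the sheaf of groups of automorphisms $\alpha$ of $\wedge^\bullet T^*_{X,-}$ (as a sheaf of $\mathbb C$-algebras, preserving the $\mathbb Z_2$-grading) with $\alpha(u)-u\in J^k$ for all $u$. Then $\mathrm G_2\supseteq\mathrm G_3\supseteq\cdots$ is a descending series of sheaves of normal subgroups of $\mathrm G_2$, trivial for $k>\operatorname{rank}T^*_{X,-}$, and the quotients $\mathrm G_j/\mathrm G_{j+1},\dots,\mathrm G_j/\mathrm G_{j+4}$ are abelian. The obstruction sheaf is the $\mathbb Z$-graded abelian sheaf $\mathcal A_{T^*_{X,-}}=\bigoplus_j\mathcal A_j$, with $\mathcal A_j=\mathrm G_j/\mathrm G_{j+1}$ for $j\ge2$ and $\mathcal A_j=0$ for $j<2$. Obstruction complex: $\partial:H^n(X,\mathcal A_j)\to H^{n+1}(X,\mathcal A_{j+1})$ is the connecting map of $0\to\mathcal A_{j+1}\to\mathrm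 G_j/\mathrm G_{j+2}\to\mathcal A_j\to0$ (zero for $j<2$); $\partial\circ\partial=0$. The first obstruction cohomology is ${\bf H}^1_\partial=\bigoplus_j\ker\{\partial:H^1(X,\mathcal A_j)\to H^2(X,\mathcal A_{j+1})\}/\operatorname{im}\{\partial:H^0(X,\mathcal A_{j-1})\to H^1(X,\mathcal A_j)\}$. A supermanifold $\mathfrak X=(X,\mathcal O_{\mathfrak X})$ modelled on $(X,T^*_{X,-})$ is a locally ringed space with $\mathbb Z_2$-graded (supercommutative) structure sheaf, locally isomorphic to the split model $(X,\wedge^\bullet T^*_{X,-})$; with $\mathcal J\subset\mathcal O_{\mathfrak X}$ the ideal generated by odd sections, $\mathcal O_{\mathfrak X}/\mathcal J=\mathcal O_X$ and $\mathcal J/\mathcal J^2\cong T^*_{X,-}$. Isomorphism classes of supermanifolds modelled on $(X,T^*_{X,-})$ correspond bijectively to the orbit set $\check H^1(X,\mathrm G_2)/\operatorname{Aut}T^*_{X,-}$, the base-point corresponding to the split model (Green). Let $i:X\to\mathfrak X$ be the embedding defined by $\mathcal J$. The supermanifold $\mathfrak X$ is projectable if there is a morphism $\pi:\mathfrak X\to X$ with $\pi\circ i={\bf 1}_X$. *)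

theory Defs
  imports "HOL-Analysis.Analysis" "HOL-Algebra.Algebra"
begin

section \<open>Complex manifolds\<close>

text \<open>The space is a (Hausdorff, second countable) type; \<open>\<complex>\<^sup>n\<close> is the set of sequences
  vanishing from index \<open>n\<close> on, so that \<open>n = 0\<close> is allowed.\<close>

definition Cn :: "nat \<Rightarrow> (nat \<Rightarrow> complex) set" where
  "Cn n = {z. \<forall>i\<ge>n. z i = 0}"

text \<open>Holomorphic functions of several variables: continuous and holomorphic in each variable
  separately. It is only used on open subsets of \<open>\<complex>\<^sup>n\<close>.\<close>

definition holomorphic_Cn :: "nat \<Rightarrow> (nat \<Rightarrow> complex) set \<Rightarrow> ((nat \<Rightarrow> complex) \<Rightarrow> complex) \<Rightarrow> bool" where
  "holomorphic_Cn n W f \<longleftrightarrow> continuous_on W f \<and>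
     (\<forall>z\<in>W. \<forall>i<n. (\<lambda>t. f (z(i := t))) field_differentiable (at (z i)))"

record 'a cmanifold =
  cdim :: nat
  charts :: "('a set \<times> ('a \<Rightarrow> nat \<Rightarrow> complex)) set"

definition holomorphic_fun ::
  "'a::topological_space cmanifold \<Rightarrow> 'a set \<Rightarrow> ('a \<Rightarrow> complex) \<Rightarrow> bool" where
  "holomorphic_fun M U f \<longleftrightarrow>
     (\<forall>(D, \<phi>)\<in>charts M. holomorphic_Cn (cdim M) (\<phi> ` (D \<inter> U)) (f \<circ> inv_into D \<phi>))"

definition complex_manifold :: "'a::{t2_space,second_countable_topology} cmanifold \<Rightarrow> bool" where
  "complex_manifold M \<longleftrightarrow>
     (\<Union>(D, \<phi>)\<in>charts M. D) = UNIV \<and>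
     (\<forall>(D, \<phi>)\<in>charts M. open D \<and> openin (top_of_set (Cn (cdim M))) (\<phi> ` D) \<and>
        homeomorphism D (\<phi> ` D) \<phi> (inv_into D \<phi>) \<and>
        (\<forall>i<cdim M. holomorphic_fun M D (\<lambda>x. \<phi> x i)))"


section \<open>Presheaves of groups, stalks, sheafification, quotients\<close>

text \<open>In a presheaf only the values on open sets matter; the stage \<open>'m\<close> is a record of
  algebraic structure on the section type \<open>'s\<close>.\<close>

record ('a, 'm, 's) presheaf =
  sec :: "'a set \<Rightarrow> 'm"
  res :: "'a set \<Rightarrow> 'a set \<Rightarrow> 's \<Rightarrow> 's"

type_synonym ('a, 'g) gpresheaf = "('a, 'g monoid, 'g) presheaf"

text \<open>Direct limit of groups \<open>G i\<close>, \<open>i \<in> I\<close>, along \<open>r i j : G i \<rightarrow> G j\<close> for \<open>lq i j\<close>, where \<open>lq\<close> is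
  a directed preorder on \<open>I\<close>. Its elements are equivalence classes of pairs \<open>(i, g)\<close>.\<close>

definition dl_class :: "'i set \<Rightarrow> ('i \<Rightarrow> 'i \<Rightarrow> bool) \<Rightarrow> ('i \<Rightarrow> 'g monoid) \<Rightarrow> ('i \<Rightarrow> 'i \<Rightarrow> 'g \<Rightarrow> 'g)
    \<Rightarrow> 'i \<times> 'g \<Rightarrow> ('i \<times> 'g) set" where
  "dl_class I lq G r = (\<lambda>(i, g). {(j, h). j \<in> I \<and> h \<in> carrier (G j) \<and>
      (\<exists>k\<in>I. lq i k \<and> lq j k \<and> r i k g = r j k h)})"

definition direct_limit :: "'i set \<Rightarrow> ('i \<Rightarrow> 'i \<Rightarrow> bool) \<Rightarrow> ('i \<Rightarrow> 'g monoid) \<Rightarrow> ('i \<Rightarrow> 'i \<Rightarrow> 'g \<Rightarrow> 'g)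
    \<Rightarrow> ('i \<times> 'g) set monoid" where
  "direct_limit I lq G r =
     \<lparr>carrier = {dl_class I lq G r (i, g) | i g. i \<in> I \<and> g \<in> carrier (G i)},
      monoid.mult = (\<lambda>A B. \<Union>{dl_class I lq G r (k, r i k g \<otimes>\<^bsub>G k\<^esub> r j k h) | i g j h k.
                  (i, g) \<in> A \<and> (j, h) \<in> B \<and> k \<in> I \<and> lq i k \<and> lq j k}),
      one = (\<Union>i\<in>I. dl_class I lq G r (i, \<one>\<^bsub>G i\<^esub>))\<rparr>"

definition nbhds :: "'a::topological_space \<Rightarrow> 'a set set" where
  "nbhds x = {U. open U \<and> x \<in> U}"

definition germ :: "('a::topological_space, 'g) gpresheaf \<Rightarrow> 'a \<Rightarrow> 'a set \<times> 'g \<Rightarrow> ('a set \<times> 'g) set" where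
  "germ P x = dl_class (nbhds x) (\<lambda>U V. V \<subseteq> U) (sec P) (res P)"

definition stalk :: "('a::topological_space, 'g) gpresheaf \<Rightarrow> 'a \<Rightarrow> ('a set \<times> 'g) set monoid" where
  "stalk P x = direct_limit (nbhds x) (\<lambda>U V. V \<subseteq> U) (sec P) (res P)"

definition sheafify :: "('a::topological_space, 'g) gpresheaf \<Rightarrow> ('a, 'a \<Rightarrow> ('a set \<times> 'g) set) gpresheaf" where
  "sheafify P =
     \<lparr>sec = (\<lambda>U. (product_group U (stalk P))
        \<lparr>carrier := {s \<in> (\<Pi>\<^sub>E x\<in>U. carrier (stalk P x)).
           \<forall>x\<in>U. \<exists>V f. open V \<and> x \<in> V \<and> V \<subseteq> U \<and> f \<in> carrier (sec P V) \<and> (\<forall>y\<in>V. s y = germ P y (V, f))}\<rparr>),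
      res = (\<lambda>U V s. restrict s V)\<rparr>"

definition quot_presheaf :: "('a, 'g) gpresheaf \<Rightarrow> ('a, 'g) gpresheaf \<Rightarrow> ('a, 'g set) gpresheaf" where
  "quot_presheaf F N =
     \<lparr>sec = (\<lambda>U. sec F U Mod carrier (sec N U)),
      res = (\<lambda>U V K. carrier (sec N V) <#>\<^bsub>sec F V\<^esub> (res F U V ` K))\<rparr>"

definition quot_sheaf :: "('a::topological_space, 'g) gpresheaf \<Rightarrow> ('a, 'g) gpresheaf
    \<Rightarrow> ('a, 'a \<Rightarrow> ('a set \<times> 'g set) set) gpresheaf" where
  "quot_sheaf F N = sheafify (quot_presheaf F N)"

text \<open>The map \<open>F/N \<rightarrow> F'/N'\<close> induced by inclusions \<open>F \<subseteq> F'\<close>, \<open>N \<subseteq> N'\<close>; on cosets over \<open>U\<close> it is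
  \<open>K \<mapsto> N'(U) \<cdot> K\<close>.\<close>

definition quot_map :: "('a::topological_space, 'g) gpresheaf \<Rightarrow> ('a, 'g) gpresheaf
    \<Rightarrow> 'a set \<Rightarrow> ('a \<Rightarrow> ('a set \<times> 'g set) set) \<Rightarrow> ('a \<Rightarrow> ('a set \<times> 'g set) set)" where
  "quot_map F' N' U s = (\<lambda>x\<in>U. \<Union>(V, K)\<in>s x.
      germ (quot_presheaf F' N') x (V, carrier (sec N' V) <#>\<^bsub>sec F' V\<^esub> K))"

definition zero_sheaf :: "('a, 'g) gpresheaf" where
  "zero_sheaf = \<lparr>sec = (\<lambda>U. \<lparr>carrier = {undefined}, monoid.mult = (\<lambda>_ _. undefined), one = undefined\<rparr>),
                 res = (\<lambda>U V s. s)\<rparr>"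


section \<open>Cech cohomology of sheaves of abelian groups (written multiplicatively)\<close>

text \<open>Open covers are indexed by the points of the space, \<open>U x\<close> being a neighbourhood of \<open>x\<close>.
  Every open cover is refined by one of these, and among these refinement can be taken with the
  identity on indices, so the direct limit over them is Cech cohomology.\<close>

definition pcover :: "('a::topological_space \<Rightarrow> 'a set) \<Rightarrow> bool" where
  "pcover U \<longleftrightarrow> (\<forall>x. open (U x) \<and> x \<in> U x)"

definition cap :: "('a \<Rightarrow> 'a set) \<Rightarrow> 'a list \<Rightarrow> 'a set" where
  "cap U xs = (\<Inter>x\<in>set xs. U x)"

definition simplices :: "nat \<Rightarrow> 'a list set" where
  "simplices n = {xs. length xs = Suc n}"

definition cochains :: "nat \<Rightarrow> ('a \<Rightarrow> 'a set) \<Rightarrow> ('a, 'g) gpresheaf \<Rightarrow> ('a list \<Rightarrow> 'g) monoid" where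
  "cochains n U F = product_group (simplices n) (\<lambda>xs. sec F (cap U xs))"

definition face :: "nat \<Rightarrow> 'a list \<Rightarrow> 'a list" where
  "face i xs = take i xs @ drop (Suc i) xs"

definition cobd :: "nat \<Rightarrow> ('a \<Rightarrow> 'a set) \<Rightarrow> ('a, 'g) gpresheaf \<Rightarrow> ('a list \<Rightarrow> 'g) \<Rightarrow> 'a list \<Rightarrow> 'g" where
  "cobd n U F c = (\<lambda>xs\<in>simplices (Suc n).
     finprod (sec F (cap U xs))
       (\<lambda>i. let y = res F (cap U (face i xs)) (cap U xs) (c (face i xs))
            in if even i then y else inv\<^bsub>sec F (cap U xs)\<^esub> y) {..Suc n})"

definition cocycles :: "nat \<Rightarrow> ('a \<Rightarrow> 'a set) \<Rightarrow> ('a, 'g) gpresheaf \<Rightarrow> ('a list \<Rightarrow> 'g) set" where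
  "cocycles n U F = {c \<in> carrier (cochains n U F). cobd n U F c = \<one>\<^bsub>cochains (Suc n) U F\<^esub>}"

definition coboundaries :: "nat \<Rightarrow> ('a \<Rightarrow> 'a set) \<Rightarrow> ('a, 'g) gpresheaf \<Rightarrow> ('a list \<Rightarrow> 'g) set" where
  "coboundaries n U F = (case n of 0 \<Rightarrow> {\<one>\<^bsub>cochains 0 U F\<^esub>}
     | Suc m \<Rightarrow> cobd m U F ` carrier (cochains m U F))"

definition cover_cohom :: "nat \<Rightarrow> ('a, 'g) gpresheaf \<Rightarrow> ('a \<Rightarrow> 'a set) \<Rightarrow> ('a list \<Rightarrow> 'g) set monoid" where
  "cover_cohom n F U = (cochains n U F)\<lparr>carrier := cocycles n U F\<rparr> Mod coboundaries n U F"

definition refine_cochain :: "nat \<Rightarrow> ('a, 'g) gpresheaf \<Rightarrow> ('a \<Rightarrow> 'a set) \<Rightarrow> ('a \<Rightarrow> 'a set)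
    \<Rightarrow> ('a list \<Rightarrow> 'g) \<Rightarrow> 'a list \<Rightarrow> 'g" where
  "refine_cochain n F U V c = (\<lambda>xs\<in>simplices n. res F (cap U xs) (cap V xs) (c xs))"

definition refine_class :: "nat \<Rightarrow> ('a, 'g) gpresheaf \<Rightarrow> ('a \<Rightarrow> 'a set) \<Rightarrow> ('a \<Rightarrow> 'a set)
    \<Rightarrow> ('a list \<Rightarrow> 'g) set \<Rightarrow> ('a list \<Rightarrow> 'g) set" where
  "refine_class n F U V K = coboundaries n V F <#>\<^bsub>cochains n V F\<^esub> (refine_cochain n F U V ` K)"

definition cohom :: "nat \<Rightarrow> ('a::topological_space, 'g) gpresheaf
    \<Rightarrow> (('a \<Rightarrow> 'a set) \<times> ('a list \<Rightarrow> 'g) set) set monoid" where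
  "cohom n F = direct_limit (Collect pcover) (\<lambda>U V. \<forall>x. V x \<subseteq> U x) (cover_cohom n F) (refine_class n F)"

definition cohom_class :: "nat \<Rightarrow> ('a::topological_space, 'g) gpresheaf \<Rightarrow> ('a \<Rightarrow> 'a set)
    \<Rightarrow> ('a list \<Rightarrow> 'g) \<Rightarrow> (('a \<Rightarrow> 'a set) \<times> ('a list \<Rightarrow> 'g) set) set" where
  "cohom_class n F U c = dl_class (Collect pcover) (\<lambda>U V. \<forall>x. V x \<subseteq> U x) (cover_cohom n F) (refine_class n F)
     (U, coboundaries n U F #>\<^bsub>cochains n U F\<^esub> c)"

definition map_cochain :: "nat \<Rightarrow> ('a \<Rightarrow> 'a set) \<Rightarrow> ('a set \<Rightarrow> 'g \<Rightarrow> 'h) \<Rightarrow> ('a list \<Rightarrow> 'g) \<Rightarrow> 'a list \<Rightarrow> 'h" where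
  "map_cochain n U \<phi> c = (\<lambda>xs\<in>simplices n. \<phi> (cap U xs) (c xs))"

text \<open>The connecting map \<open>H\<^sup>n(F'') \<rightarrow> H\<^sup>n\<^sup>+\<^sup>1(F')\<close> of a short exact sequence
  \<open>0 \<rightarrow> F' \<rightarrow> F \<rightarrow> F'' \<rightarrow> 0\<close> of sheaves with maps \<open>\<iota>\<close> and \<open>\<pi>\<close>: lift a representing cocycle to a
  cochain \<open>a\<close> of \<open>F\<close> (possible on some cover, the space being paracompact) and take the class of
  the cochain of \<open>F'\<close> which \<open>\<iota>\<close> sends to the coboundary of \<open>a\<close>.\<close>

definition connecting :: "nat \<Rightarrow> ('a::topological_space, 'f) gpresheaf \<Rightarrow> ('a, 'g) gpresheaf \<Rightarrow> ('a, 'h) gpresheaf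
    \<Rightarrow> ('a set \<Rightarrow> 'f \<Rightarrow> 'g) \<Rightarrow> ('a set \<Rightarrow> 'g \<Rightarrow> 'h)
    \<Rightarrow> (('a \<Rightarrow> 'a set) \<times> ('a list \<Rightarrow> 'h) set) set \<Rightarrow> (('a \<Rightarrow> 'a set) \<times> ('a list \<Rightarrow> 'f) set) set" where
  "connecting n F' F F'' \<iota> \<pi> \<xi> = (THE \<eta>. \<exists>U a b. pcover U \<and>
      a \<in> carrier (cochains n U F) \<and> map_cochain n U \<pi> a \<in> cocycles n U F'' \<and>
      \<xi> = cohom_class n F'' U (map_cochain n U \<pi> a) \<and>
      b \<in> cocycles (Suc n) U F' \<and> map_cochain (Suc n) U \<iota> b = cobd n U F a \<and>
      \<eta> = cohom_class (Suc n) F' U b)"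


section \<open>Sheaves of complex superalgebras and superspaces\<close>

definition complex_ring :: "complex ring" where
  "complex_ring = \<lparr>carrier = UNIV, monoid.mult = (*), one = 1, ring.zero = 0, ring.add = (+)\<rparr>"

record 's superalg = "(complex, 's) module" +
  evens :: "'s set"
  odds :: "'s set"

definition superalgebra :: "'s superalg \<Rightarrow> bool" where
  "superalgebra A \<longleftrightarrow> ring A \<and> Module.module complex_ring A \<and>
     (\<forall>c. \<forall>x\<in>carrier A. \<forall>y\<in>carrier A.
        c \<odot>\<^bsub>A\<^esub> (x \<otimes>\<^bsub>A\<^esub> y) = (c \<odot>\<^bsub>A\<^esub> x) \<otimes>\<^bsub>A\<^esub> y \<and> c \<odot>\<^bsub>A\<^esub> (x \<otimes>\<^bsub>A\<^esub> y) = x \<otimes>\<^bsub>A\<^esub> (c \<odot>\<^bsub>A\<^esub> y)) \<and>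
     submodule (evens A) complex_ring A \<and> submodule (odds A) complex_ring A \<and>
     (\<forall>x\<in>carrier A. \<exists>!p. p \<in> evens A \<times> odds A \<and> x = fst p \<oplus>\<^bsub>A\<^esub> snd p) \<and>
     \<one>\<^bsub>A\<^esub> \<in> evens A \<and>
     (\<forall>x\<in>evens A. \<forall>y\<in>evens A. x \<otimes>\<^bsub>A\<^esub> y \<in> evens A \<and> x \<otimes>\<^bsub>A\<^esub> y = y \<otimes>\<^bsub>A\<^esub> x) \<and>
     (\<forall>x\<in>evens A. \<forall>y\<in>odds A. x \<otimes>\<^bsub>A\<^esub> y \<in> odds A \<and> x \<otimes>\<^bsub>A\<^esub> y = y \<otimes>\<^bsub>A\<^esub> x) \<and>
     (\<forall>x\<in>odds A. \<forall>y\<in>odds A. x \<otimes>\<^bsub>A\<^esub> y \<in> evens A \<and> x \<otimes>\<^bsub>A\<^esub> y = \<ominus>\<^bsub>A\<^esub> (y \<otimes>\<^bsub>A\<^esub> x))"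

definition super_hom :: "'s superalg \<Rightarrow> 't superalg \<Rightarrow> ('s \<Rightarrow> 't) set" where
  "super_hom A B = {h \<in> ring_hom A B.
     (\<forall>c. \<forall>x\<in>carrier A. h (c \<odot>\<^bsub>A\<^esub> x) = c \<odot>\<^bsub>B\<^esub> h x) \<and> h ` evens A \<subseteq> evens B \<and> h ` odds A \<subseteq> odds B}"

type_synonym ('a, 's) spresheaf = "('a, 's superalg, 's) presheaf"

definition super_sheaf :: "('a::topological_space, 's) spresheaf \<Rightarrow> bool" where
  "super_sheaf S \<longleftrightarrow>
     (\<forall>U. open U \<longrightarrow> superalgebra (sec S U)) \<and>
     (\<forall>U V. open U \<and> open V \<and> V \<subseteq> U \<longrightarrow> res S U V \<in> super_hom (sec S U) (sec S V)) \<and>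
     (\<forall>U. open U \<longrightarrow> (\<forall>s\<in>carrier (sec S U). res S U U s = s)) \<and>
     (\<forall>U V W. open U \<and> open V \<and> open W \<and> W \<subseteq> V \<and> V \<subseteq> U \<longrightarrow>
        (\<forall>s\<in>carrier (sec S U). res S V W (res S U V s) = res S U W s)) \<and>
     (\<forall>\<U>. (\<forall>V\<in>\<U>. open V) \<longrightarrow>
        (\<forall>s. (\<forall>V\<in>\<U>. s V \<in> carrier (sec S V)) \<and>
             (\<forall>V\<in>\<U>. \<forall>W\<in>\<U>. res S V (V \<inter> W) (s V) = res S W (V \<inter> W) (s W)) \<longrightarrow>
           (\<exists>!t. t \<in> carrier (sec S (\<Union>\<U>)) \<and> (\<forall>V\<in>\<U>. res S (\<Union>\<U>) V t = s V))))"

definition unit_at :: "('a::topological_space, 's) spresheaf \<Rightarrow> 'a \<Rightarrow> 'a set \<Rightarrow> 's \<Rightarrow> bool" where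
  "unit_at S x U f \<longleftrightarrow> (\<exists>W. open W \<and> x \<in> W \<and> W \<subseteq> U \<and> res S U W f \<in> Units (sec S W))"

text \<open>Locality of the stalks, in terms of sections: the stalk is non-zero, and if a sum of two
  germs is invertible, then one of them is.\<close>

definition locally_ringed :: "('a::topological_space, 's) spresheaf \<Rightarrow> bool" where
  "locally_ringed S \<longleftrightarrow> (\<forall>x U. open U \<and> x \<in> U \<longrightarrow>
     \<one>\<^bsub>sec S U\<^esub> \<noteq> \<zero>\<^bsub>sec S U\<^esub> \<and>
     (\<forall>f\<in>carrier (sec S U). \<forall>g\<in>carrier (sec S U).
        unit_at S x U (f \<oplus>\<^bsub>sec S U\<^esub> g) \<longrightarrow> unit_at S x U f \<or> unit_at S x U g))"

definition superspace :: "('a::topological_space, 's) spresheaf \<Rightarrow> bool" where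
  "superspace S \<longleftrightarrow> super_sheaf S \<and> locally_ringed S"

text \<open>Morphisms \<open>(f, f\<^sup>#)\<close> of superspaces; the second component sends sections over an open \<open>V\<close> of
  the target to sections over the preimage of \<open>V\<close>. The last clause says that the stalk maps are
  local homomorphisms.\<close>

definition superspace_morphism :: "('a::topological_space, 's) spresheaf \<Rightarrow> ('b::topological_space, 't) spresheaf
    \<Rightarrow> ('a \<Rightarrow> 'b) \<times> ('b set \<Rightarrow> 't \<Rightarrow> 's) \<Rightarrow> bool" where
  "superspace_morphism S T = (\<lambda>(f, \<Phi>).
     continuous_on UNIV f \<and>
     (\<forall>V. open V \<longrightarrow> \<Phi> V \<in> super_hom (sec T V) (sec S (f -` V))) \<and>
     (\<forall>V W. open V \<and> open W \<and> W \<subseteq> V \<longrightarrow>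
        (\<forall>t\<in>carrier (sec T V). \<Phi> W (res T V W t) = res S (f -` V) (f -` W) (\<Phi> V t))) \<and>
     (\<forall>V x. open V \<and> f x \<in> V \<longrightarrow>
        (\<forall>t\<in>carrier (sec T V). unit_at S x (f -` V) (\<Phi> V t) \<longrightarrow> unit_at T (f x) V t)))"

definition mor_comp :: "('b \<Rightarrow> 'c) \<times> ('c set \<Rightarrow> 'u \<Rightarrow> 't) \<Rightarrow> ('a \<Rightarrow> 'b) \<times> ('b set \<Rightarrow> 't \<Rightarrow> 's)
    \<Rightarrow> ('a \<Rightarrow> 'c) \<times> ('c set \<Rightarrow> 'u \<Rightarrow> 's)" where
  "mor_comp = (\<lambda>(g, \<Psi>) (f, \<Phi>). (g \<circ> f, \<lambda>V. \<Phi> (g -` V) \<circ> \<Psi> V))"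

definition is_identity_morphism :: "('a::topological_space, 's) spresheaf \<Rightarrow> ('a \<Rightarrow> 'a) \<times> ('a set \<Rightarrow> 's \<Rightarrow> 's) \<Rightarrow> bool" where
  "is_identity_morphism S = (\<lambda>(f, \<Phi>). f = id \<and> (\<forall>V. open V \<longrightarrow> (\<forall>s\<in>carrier (sec S V). \<Phi> V s = s)))"

text \<open>Isomorphisms \<open>S|\<^sub>U \<rightarrow> T|\<^sub>U\<close> of sheaves of superalgebras.\<close>

definition super_iso_on :: "'a::topological_space set \<Rightarrow> ('a, 's) spresheaf \<Rightarrow> ('a, 't) spresheaf
    \<Rightarrow> ('a set \<Rightarrow> 's \<Rightarrow> 't) \<Rightarrow> bool" where
  "super_iso_on U S T \<theta> \<longleftrightarrow>
     (\<forall>V. open V \<and> V \<subseteq> U \<longrightarrow> \<theta> V \<in> super_hom (sec S V) (sec T V) \<and>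
        bij_betw (\<theta> V) (carrier (sec S V)) (carrier (sec T V)) \<and>
        \<theta> V ` evens (sec S V) = evens (sec T V) \<and> \<theta> V ` odds (sec S V) = odds (sec T V)) \<and>
     (\<forall>V W. open V \<and> open W \<and> W \<subseteq> V \<and> V \<subseteq> U \<longrightarrow>
        (\<forall>s\<in>carrier (sec S V). \<theta> W (res S V W s) = res T V W (\<theta> V s)))"

text \<open>The sheaf of groups of automorphisms: a section over \<open>U\<close> is an automorphism of \<open>S|\<^sub>U\<close>,
  normalised to be undefined where it does not matter.\<close>

definition aut_norm :: "('a::topological_space, 's) spresheaf \<Rightarrow> 'a set \<Rightarrow> ('a set \<Rightarrow> 's \<Rightarrow> 's) \<Rightarrow> 'a set \<Rightarrow> 's \<Rightarrow> 's" where
  "aut_norm S U \<alpha> = (\<lambda>V. if open V \<and> V \<subseteq> U then restrict (\<alpha> V) (carrier (sec S V)) else (\<lambda>_. undefined))"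

definition aut_sheaf :: "('a::topological_space, 's) spresheaf \<Rightarrow> ('a, 'a set \<Rightarrow> 's \<Rightarrow> 's) gpresheaf" where
  "aut_sheaf S =
     \<lparr>sec = (\<lambda>U. \<lparr>carrier = {\<alpha>. super_iso_on U S S \<alpha> \<and> aut_norm S U \<alpha> = \<alpha>},
                  monoid.mult = (\<lambda>\<alpha> \<beta>. aut_norm S U (\<lambda>V. \<alpha> V \<circ> \<beta> V)),
                  one = aut_norm S U (\<lambda>V. id)\<rparr>),
      res = (\<lambda>U V. aut_norm S V)\<rparr>"

text \<open>The ideal sheaf generated by the odd sections, and its square: both are the sheaf-theoretic
  notions, i.e. membership is tested locally.\<close>

definition odd_ideal :: "('a::topological_space, 's) spresheaf \<Rightarrow> 'a set \<Rightarrow> 's set" where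
  "odd_ideal S U = {s \<in> carrier (sec S U). \<forall>x\<in>U. \<exists>W. open W \<and> x \<in> W \<and> W \<subseteq> U \<and>
      res S U W s \<in> genideal (sec S W) (odds (sec S W))}"

definition odd_ideal_sq :: "('a::topological_space, 's) spresheaf \<Rightarrow> 'a set \<Rightarrow> 's set" where
  "odd_ideal_sq S U = {s \<in> carrier (sec S U). \<forall>x\<in>U. \<exists>W. open W \<and> x \<in> W \<and> W \<subseteq> U \<and>
      res S U W s \<in> genideal (sec S W) {a \<otimes>\<^bsub>sec S W\<^esub> b | a b. a \<in> odd_ideal S W \<and> b \<in> odd_ideal S W}}"

text \<open>The structure sheaf of a complex manifold, as a purely even superspace. Sections over \<open>U\<close>
  are extended by \<open>0\<close> outside \<open>U\<close>.\<close>

definition hol_sheaf :: "'a::topological_space cmanifold \<Rightarrow> ('a, 'a \<Rightarrow> complex) spresheaf" where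
  "hol_sheaf M =
     \<lparr>sec = (\<lambda>U. \<lparr>carrier = {f. (\<forall>x. x \<notin> U \<longrightarrow> f x = 0) \<and> holomorphic_fun M U f},
                  monoid.mult = (\<lambda>f g x. f x * g x), one = (\<lambda>x. if x \<in> U then 1 else 0),
                  ring.zero = (\<lambda>x. 0), ring.add = (\<lambda>f g x. f x + g x),
                  smult = (\<lambda>c f x. c * f x),
                  evens = {f. (\<forall>x. x \<notin> U \<longrightarrow> f x = 0) \<and> holomorphic_fun M U f},
                  odds = {\<lambda>x. 0}\<rparr>),
      res = (\<lambda>U V f x. if x \<in> V then f x else 0)\<rparr>"


section \<open>Holomorphic vector bundles and their exterior algebras\<close>

text \<open>A bundle is given by transition matrices: \<open>transition E i j x k l\<close> is the \<open>(k, l)\<close> entry of the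
  matrix expressing the coordinates over \<open>patch E i\<close> by those over \<open>patch E j\<close>.\<close>

record ('a, 'i) vbundle =
  bdl_rank :: nat
  patch :: "'i \<Rightarrow> 'a set"
  transition :: "'i \<Rightarrow> 'i \<Rightarrow> 'a \<Rightarrow> nat \<Rightarrow> nat \<Rightarrow> complex"

definition holomorphic_bundle :: "'a::topological_space cmanifold \<Rightarrow> ('a, 'i) vbundle \<Rightarrow> bool" where
  "holomorphic_bundle M E \<longleftrightarrow>
     (\<forall>i. open (patch E i)) \<and> (\<Union>i. patch E i) = UNIV \<and>
     (\<forall>i j. \<forall>k<bdl_rank E. \<forall>l<bdl_rank E.
        holomorphic_fun M (patch E i \<inter> patch E j) (\<lambda>x. transition E i j x k l)) \<and>
     (\<forall>i. \<forall>x\<in>patch E i. \<forall>k<bdl_rank E. \<forall>l<bdl_rank E.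
        transition E i i x k l = (if k = l then 1 else 0)) \<and>
     (\<forall>i j m. \<forall>x\<in>patch E i \<inter> patch E j \<inter> patch E m. \<forall>k<bdl_rank E. \<forall>l<bdl_rank E.
        transition E i m x k l = (\<Sum>p<bdl_rank E. transition E i j x k p * transition E j m x p l))"

text \<open>Sections of the bundle over \<open>U\<close>, as families of coordinate vectors.\<close>

definition bdl_sections :: "'a::topological_space cmanifold \<Rightarrow> ('a, 'i) vbundle \<Rightarrow> 'a set
    \<Rightarrow> ('i \<Rightarrow> 'a \<Rightarrow> nat \<Rightarrow> complex) set" where
  "bdl_sections M E U = {s.
     (\<forall>i x k. \<not> (x \<in> U \<inter> patch E i \<and> k < bdl_rank E) \<longrightarrow> s i x k = 0) \<and>
     (\<forall>i k. holomorphic_fun M (U \<inter> patch E i) (\<lambda>x. s i x k)) \<and>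
     (\<forall>i j. \<forall>x\<in>U \<inter> patch E i \<inter> patch E j. \<forall>k<bdl_rank E.
        s i x k = (\<Sum>l<bdl_rank E. transition E i j x k l * s j x l))}"

text \<open>The exterior algebra of \<open>\<complex>\<^sup>r\<close>: \<open>u I\<close> is the coefficient of
  \<open>e\<^sub>I = e\<^sub>i \<and> e\<^sub>j \<and> \<dots>\<close> where \<open>I = {i < j < \<dots>}\<close> is a subset of \<open>{..<r}\<close>.\<close>

definition ext_sign :: "nat set \<Rightarrow> nat set \<Rightarrow> complex" where
  "ext_sign I J = (-1) ^ card {(i, j). i \<in> I \<and> j \<in> J \<and> j < i}"

definition wedge :: "(nat set \<Rightarrow> complex) \<Rightarrow> (nat set \<Rightarrow> complex) \<Rightarrow> nat set \<Rightarrow> complex" where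
  "wedge u v K = (\<Sum>I\<in>Pow K. ext_sign I (K - I) * u I * v (K - I))"

definition ext_one :: "nat set \<Rightarrow> complex" where
  "ext_one K = (if K = {} then 1 else 0)"

definition ext_vec :: "nat \<Rightarrow> (nat \<Rightarrow> complex) \<Rightarrow> nat set \<Rightarrow> complex" where
  "ext_vec r v K = (\<Sum>k<r. if K = {k} then v k else 0)"

text \<open>The algebra endomorphism of the exterior algebra induced by the matrix \<open>A\<close>:
  \<open>e\<^sub>I\<close> is sent to the wedge product of the columns of \<open>A\<close> with indices in \<open>I\<close>.\<close>

definition ext_map :: "nat \<Rightarrow> (nat \<Rightarrow> nat \<Rightarrow> complex) \<Rightarrow> (nat set \<Rightarrow> complex) \<Rightarrow> nat set \<Rightarrow> complex" where
  "ext_map r A u K = (\<Sum>I\<in>Pow {..<r}. u I *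
     foldr (\<lambda>l. wedge (ext_vec r (\<lambda>k. A k l))) (sorted_list_of_set I) ext_one K)"

definition ext_sections :: "'a::topological_space cmanifold \<Rightarrow> ('a, 'i) vbundle \<Rightarrow> 'a set
    \<Rightarrow> ('i \<Rightarrow> 'a \<Rightarrow> nat set \<Rightarrow> complex) set" where
  "ext_sections M E U = {s.
     (\<forall>i x K. \<not> (x \<in> U \<inter> patch E i \<and> K \<subseteq> {..<bdl_rank E}) \<longrightarrow> s i x K = 0) \<and>
     (\<forall>i K. holomorphic_fun M (U \<inter> patch E i) (\<lambda>x. s i x K)) \<and>
     (\<forall>i j. \<forall>x\<in>U \<inter> patch E i \<inter> patch E j. s i x = ext_map (bdl_rank E) (transition E i j x) (s j x))}"

text \<open>The structure sheaf of the split model.\<close>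

definition ext_sheaf :: "'a::topological_space cmanifold \<Rightarrow> ('a, 'i) vbundle
    \<Rightarrow> ('a, 'i \<Rightarrow> 'a \<Rightarrow> nat set \<Rightarrow> complex) spresheaf" where
  "ext_sheaf M E =
     \<lparr>sec = (\<lambda>U. \<lparr>carrier = ext_sections M E U,
                  monoid.mult = (\<lambda>s t i x. wedge (s i x) (t i x)),
                  one = (\<lambda>i x K. if x \<in> U \<inter> patch E i then ext_one K else 0),
                  ring.zero = (\<lambda>i x K. 0), ring.add = (\<lambda>s t i x K. s i x K + t i x K),
                  smult = (\<lambda>c s i x K. c * s i x K),
                  evens = {s \<in> ext_sections M E U. \<forall>i x K. odd (card K) \<longrightarrow> s i x K = 0},
                  odds = {s \<in> ext_sections M E U. \<forall>i x K. even (card K) \<longrightarrow> s i x K = 0}\<rparr>),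
      res = (\<lambda>U V s i x K. if x \<in> V then s i x K else 0)\<rparr>"

definition ext_filtration :: "'a::topological_space cmanifold \<Rightarrow> ('a, 'i) vbundle \<Rightarrow> nat \<Rightarrow> 'a set
    \<Rightarrow> ('i \<Rightarrow> 'a \<Rightarrow> nat set \<Rightarrow> complex) set" where
  "ext_filtration M E k U = {s \<in> ext_sections M E U. \<forall>i x K. card K < k \<longrightarrow> s i x K = 0}"


section \<open>The obstruction complex\<close>

definition G_sheaf :: "'a::topological_space cmanifold \<Rightarrow> ('a, 'i) vbundle \<Rightarrow> nat
    \<Rightarrow> ('a, 'a set \<Rightarrow> ('i \<Rightarrow> 'a \<Rightarrow> nat set \<Rightarrow> complex) \<Rightarrow> ('i \<Rightarrow> 'a \<Rightarrow> nat set \<Rightarrow> complex)) gpresheaf" where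
  "G_sheaf M E k = (let \<Lambda> = ext_sheaf M E in
     \<lparr>sec = (\<lambda>U. (sec (aut_sheaf \<Lambda>) U)\<lparr>carrier := {\<alpha> \<in> carrier (sec (aut_sheaf \<Lambda>) U).
          \<forall>V u. open V \<and> V \<subseteq> U \<and> u \<in> carrier (sec \<Lambda> V) \<longrightarrow>
            \<alpha> V u \<ominus>\<^bsub>sec \<Lambda> V\<^esub> u \<in> ext_filtration M E k V}\<rparr>),
      res = res (aut_sheaf \<Lambda>)\<rparr>)"

definition obstruction_sheaf where
  "obstruction_sheaf M E (j::int) =
     (if j < 2 then zero_sheaf else quot_sheaf (G_sheaf M E (nat j)) (G_sheaf M E (nat j + 1)))"

definition obstruction_bd where
  "obstruction_bd M E n (j::int) \<xi> =
     (if j < 2 then \<one>\<^bsub>cohom (Suc n) (obstruction_sheaf M E (j + 1))\<^esub>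
      else connecting n
        (obstruction_sheaf M E (j + 1))
        (quot_sheaf (G_sheaf M E (nat j)) (G_sheaf M E (nat j + 2)))
        (obstruction_sheaf M E j)
        (quot_map (G_sheaf M E (nat j)) (G_sheaf M E (nat j + 2)))
        (quot_map (G_sheaf M E (nat j)) (G_sheaf M E (nat j + 1)))
        \<xi>)"

definition first_obstruction_cohomology where
  "first_obstruction_cohomology M E = sum_group (UNIV :: int set) (\<lambda>j.
     (cohom 1 (obstruction_sheaf M E j))
       \<lparr>carrier := {\<xi> \<in> carrier (cohom 1 (obstruction_sheaf M E j)).
          obstruction_bd M E 1 j \<xi> = \<one>\<^bsub>cohom 2 (obstruction_sheaf M E (j + 1))\<^esub>}\<rparr>
     Mod (obstruction_bd M E 0 (j - 1) ` carrier (cohom 0 (obstruction_sheaf M E (j - 1)))))"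


section \<open>Supermanifolds and projectability\<close>

text \<open>A supermanifold modelled on \<open>(M, E)\<close> is a superspace with structure sheaf \<open>S\<close> on the space of
  \<open>M\<close>, together with \<open>\<rho> : S \<rightarrow> \<O>\<^sub>M\<close> exhibiting \<open>\<O>\<^sub>M\<close> as \<open>S/J\<close>, where \<open>J\<close> is generated by the odd
  sections; the embedding \<open>i\<close> of the manifold is \<open>(id, \<rho>)\<close>. The isomorphism \<open>J/J\<^sup>2 \<cong> E\<close> of
  \<open>\<O>\<^sub>M\<close>-modules is given as a locally surjective map \<open>q : J \<rightarrow> E\<close> with kernel \<open>J\<^sup>2\<close>, linear over
  \<open>\<rho>\<close>.\<close>

definition supermanifold_modelled_on :: "'a::topological_space cmanifold \<Rightarrow> ('a, 'i) vbundle
    \<Rightarrow> ('a, 's) spresheaf \<Rightarrow> ('a set \<Rightarrow> 's \<Rightarrow> 'a \<Rightarrow> complex) \<Rightarrow> bool" where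
  "supermanifold_modelled_on M E S \<rho> \<longleftrightarrow>
     superspace S \<and>
     (\<forall>x. \<exists>U \<theta>. open U \<and> x \<in> U \<and> super_iso_on U S (ext_sheaf M E) \<theta>) \<and>
     superspace_morphism (hol_sheaf M) S (id, \<rho>) \<and>
     (\<forall>U. open U \<longrightarrow> {s \<in> carrier (sec S U). \<rho> U s = \<zero>\<^bsub>sec (hol_sheaf M) U\<^esub>} = odd_ideal S U) \<and>
     (\<forall>U f. open U \<and> f \<in> carrier (sec (hol_sheaf M) U) \<longrightarrow>
        (\<forall>x\<in>U. \<exists>W s. open W \<and> x \<in> W \<and> W \<subseteq> U \<and> s \<in> carrier (sec S W) \<and> \<rho> W s = res (hol_sheaf M) U W f)) \<and>
     (\<exists>q :: 'a set \<Rightarrow> 's \<Rightarrow> 'i \<Rightarrow> 'a \<Rightarrow> nat \<Rightarrow> complex.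
        (\<forall>U. open U \<longrightarrow>
           q U \<in> odd_ideal S U \<rightarrow> bdl_sections M E U \<and>
           (\<forall>s\<in>odd_ideal S U. \<forall>t\<in>odd_ideal S U. \<forall>i x k. q U (s \<oplus>\<^bsub>sec S U\<^esub> t) i x k = q U s i x k + q U t i x k) \<and>
           (\<forall>a\<in>carrier (sec S U). \<forall>s\<in>odd_ideal S U. \<forall>i x k. q U (a \<otimes>\<^bsub>sec S U\<^esub> s) i x k = \<rho> U a x * q U s i x k) \<and>
           {s \<in> odd_ideal S U. \<forall>i x k. q U s i x k = 0} = odd_ideal_sq S U \<and>
           (\<forall>e\<in>bdl_sections M E U. \<forall>x\<in>U. \<exists>W s. open W \<and> x \<in> W \<and> W \<subseteq> U \<and> s \<in> odd_ideal S W \<and>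
              q W s = (\<lambda>i y k. if y \<in> W then e i y k else 0))) \<and>
        (\<forall>U V. open U \<and> open V \<and> V \<subseteq> U \<longrightarrow> (\<forall>s\<in>odd_ideal S U.
           q V (res S U V s) = (\<lambda>i y k. if y \<in> V then q U s i y k else 0))))"

definition projectable :: "'a::topological_space cmanifold \<Rightarrow> ('a, 's) spresheaf
    \<Rightarrow> ('a set \<Rightarrow> 's \<Rightarrow> 'a \<Rightarrow> complex) \<Rightarrow> bool" where
  "projectable M S \<rho> \<longleftrightarrow> (\<exists>\<pi>. superspace_morphism S (hol_sheaf M) \<pi> \<and>
     is_identity_morphism (hol_sheaf M) (mor_comp \<pi> (id, \<rho>)))"

end

theory Submission
  imports Defs
begin

text \<open>
  The vanishing hypothesis makes every Cech 1-cocycle with values in \<open>G\<^sub>2\<close> a coboundary. The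
  transition functions between suitable local trivialisations of a supermanifold form such a
  cocycle; once it is split, the trivialisations can be changed so that they agree on overlaps, and
  the functions on the manifold, which sit in the exterior algebra as its degree 0 part, can be
  pulled back along them and glued.

  \<^emph>\<open>Splitting cocycles.\<close> Let \<open>g\<close> be a cocycle in \<open>G\<^sub>k\<close>, with class \<open>\<omega>\<close> in
  \<open>H\<^sup>1(G\<^sub>k/G\<^sub>k\<^sub>+\<^sub>1)\<close>. The image of \<open>g\<close> modulo \<open>G\<^sub>k\<^sub>+\<^sub>2\<close> is still a cocycle and lifts \<open>\<omega>\<close>, so
  \<open>\<partial>\<omega> = 1\<close>. By hypothesis \<open>\<omega> = \<partial>\<nu>\<close> for some \<open>\<nu>\<close> in \<open>H\<^sup>0(G\<^sub>k\<^sub>-\<^sub>1/G\<^sub>k)\<close>, and \<open>\<omega> = 1\<close> if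
  \<open>k = 2\<close>. Writing out the connecting map, this says that the image of \<open>g\<close> in
  \<open>G\<^sub>k\<^sub>-\<^sub>1/G\<^sub>k\<^sub>+\<^sub>1\<close> is the coboundary of a 0-cochain; a local lift of this cochain to \<open>G\<^sub>k\<^sub>-\<^sub>1\<close>
  conjugates \<open>g\<close> into \<open>G\<^sub>k\<^sub>+\<^sub>1\<close> (\<open>cocycle_step\<close>). Repeating this until \<open>k\<close> exceeds the rank, where
  \<open>G\<^sub>k\<close> is trivial, gives \<open>cocycle_splits\<close>. Covers are indexed by points, so that a section known
  to lift near every point lifts to a cochain on a finer cover.

  The quotients \<open>G\<^sub>k/G\<^sub>k\<^sub>+\<^sub>2\<close> are abelian because an automorphism in \<open>G\<^sub>j\<close> differs from the identity
  by an operator which raises the degree by at least \<open>2\<lfloor>j/2\<rfloor>\<close> (\<open>G_raises_degree\<close>); a commutator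
  of two elements of \<open>G\<^sub>k\<close> therefore lies in \<open>G\<^sub>k\<^sub>+\<^sub>2\<close>.

  \<^emph>\<open>The cocycle of a supermanifold.\<close> For every isomorphism \<open>\<theta>\<close> from the structure sheaf to the
  exterior algebra, the degree 0 part of \<open>\<theta> s\<close> is the function \<open>\<rho> s\<close>, because the stalk maps of \<open>\<rho>\<close>
  are local (\<open>degree_0_value\<close>). The degree 1 part of \<open>\<theta>\<close> on the odd ideal and the given
  identification \<open>q\<close> of the conormal bundle differ by an invertible matrix of holomorphic functions;
  composing \<open>\<theta>\<close> with the automorphism induced by this matrix makes them equal (\<open>adapted_chart\<close>).
  Two trivialisations adapted in this way agree in degrees 0 and 1, so their transition functions
  lie in \<open>G\<^sub>2\<close> (\<open>adapted_transition\<close>).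

  \<^emph>\<open>The projection.\<close> Let \<open>\<tau>\<^sub>x\<close> be trivialisations which agree on overlaps (\<open>compatible_charts_exist\<close>).
  A function \<open>f\<close> is sent to the section which every \<open>\<tau>\<^sub>x\<close> carries to \<open>f\<close>, placed in degree 0. This is
  a morphism of superspaces, and it is a left inverse of the embedding since the degree 0 part of
  \<open>\<tau>\<^sub>x s\<close> is \<open>\<rho> s\<close>.
\<close>

section \<open>Direct limits of groups\<close>

locale direct_system =
  fixes I :: "'i set" and lq :: "'i \<Rightarrow> 'i \<Rightarrow> bool"
    and G :: "'i \<Rightarrow> 'g monoid" and r :: "'i \<Rightarrow> 'i \<Rightarrow> 'g \<Rightarrow> 'g"
  assumes lq_refl: "i \<in> I \<Longrightarrow> lq i i"
    and lq_trans: "lq i j \<Longrightarrow> lq j k \<Longrightarrow> lq i k"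
    and directed: "i \<in> I \<Longrightarrow> j \<in> I \<Longrightarrow> \<exists>k\<in>I. lq i k \<and> lq j k"
    and r_closed: "\<lbrakk>i \<in> I; j \<in> I; lq i j; g \<in> carrier (G i)\<rbrakk> \<Longrightarrow> r i j g \<in> carrier (G j)"
    and r_comp: "\<lbrakk>i \<in> I; j \<in> I; k \<in> I; lq i j; lq j k; g \<in> carrier (G i)\<rbrakk> \<Longrightarrow> r j k (r i j g) = r i k g"
begin

abbreviation cl :: "'i \<times> 'g \<Rightarrow> ('i \<times> 'g) set" where
  "cl \<equiv> dl_class I lq G r"

lemma mem_cl: "(j, h) \<in> cl (i, g) \<longleftrightarrow>
    j \<in> I \<and> h \<in> carrier (G j) \<and> (\<exists>k\<in>I. lq i k \<and> lq j k \<and> r i k g = r j k h)"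
  by (simp add: dl_class_def)

lemma cl_self: "i \<in> I \<Longrightarrow> g \<in> carrier (G i) \<Longrightarrow> (i, g) \<in> cl (i, g)"
  using lq_refl by (auto simp: mem_cl)

lemma cl_subset:
  assumes "i \<in> I" "j \<in> I" "g \<in> carrier (G i)" "h \<in> carrier (G j)"
    and "k \<in> I" "lq i k" "lq j k" "r i k g = r j k h"
  shows "cl (i, g) \<subseteq> cl (j, h)"
proof
  fix p assume p: "p \<in> cl (i, g)"
  obtain l f where pl: "p = (l, f)" by force
  from p obtain m where m: "l \<in> I" "f \<in> carrier (G l)" "m \<in> I" "lq i m" "lq l m" "r i m g = r l m f"
    by (auto simp: pl mem_cl)
  obtain n where n: "n \<in> I" "lq k n" "lq m n"
    using directed assms m by blast
  have "r j n h = r k n (r j k h)" using assms n by (simp add: r_comp)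
  also have "\<dots> = r i n g" using assms n by (metis r_comp)
  also have "\<dots> = r m n (r i m g)"
    by (rule r_comp[symmetric]) (use assms m n in auto)
  also have "\<dots> = r l n f" using m n by (simp add: r_comp)
  finally show "p \<in> cl (j, h)"
    using m n assms lq_trans unfolding pl mem_cl by blast
qed

text \<open>Directedness is what makes the relation transitive: two witnesses for equality have a common
  upper bound, where both can be compared.\<close>

lemma cl_eq_iff:
  assumes "i \<in> I" "j \<in> I" "g \<in> carrier (G i)" "h \<in> carrier (G j)"
  shows "cl (i, g) = cl (j, h) \<longleftrightarrow> (\<exists>k\<in>I. lq i k \<and> lq j k \<and> r i k g = r j k h)"
proof
  assume "cl (i, g) = cl (j, h)"
  then have "(j, h) \<in> cl (i, g)" using cl_self assms by simp
  then show "\<exists>k\<in>I. lq i k \<and> lq j k \<and> r i k g = r j k h" by (simp add: mem_cl)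
next
  assume "\<exists>k\<in>I. lq i k \<and> lq j k \<and> r i k g = r j k h"
  then obtain k where "k \<in> I" "lq i k" "lq j k" "r i k g = r j k h" by blast
  then show "cl (i, g) = cl (j, h)"
    using cl_subset[of i j g h k] cl_subset[of j i h g k] assms by auto
qed

lemma mem_cl_eq:
  assumes "(j, h) \<in> cl (i, g)" "i \<in> I" "g \<in> carrier (G i)"
  shows "j \<in> I" "h \<in> carrier (G j)" "cl (j, h) = cl (i, g)"
  using assms cl_eq_iff[of i j g h] by (auto simp: mem_cl)

lemma cl_push:
  assumes "i \<in> I" "j \<in> I" "lq i j" "g \<in> carrier (G i)"
  shows "cl (j, r i j g) = cl (i, g)"
proof -
  have "r j j (r i j g) = r i j g" using assms lq_refl by (simp add: r_comp)
  then show ?thesis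
    using assms lq_refl r_closed by (subst cl_eq_iff) auto
qed

lemma carrier_direct_limit:
  "carrier (direct_limit I lq G r) = {cl (i, g) | i g. i \<in> I \<and> g \<in> carrier (G i)}"
  by (simp add: direct_limit_def)

lemma one_direct_limit:
  assumes "i \<in> I"
    and one_closed: "\<And>i. i \<in> I \<Longrightarrow> \<one>\<^bsub>G i\<^esub> \<in> carrier (G i)"
    and r_one: "\<And>i j. \<lbrakk>i \<in> I; j \<in> I; lq i j\<rbrakk> \<Longrightarrow> r i j \<one>\<^bsub>G i\<^esub> = \<one>\<^bsub>G j\<^esub>"
  shows "\<one>\<^bsub>direct_limit I lq G r\<^esub> = cl (i, \<one>\<^bsub>G i\<^esub>)"
proof -
  have "cl (j, \<one>\<^bsub>G j\<^esub>) = cl (i, \<one>\<^bsub>G i\<^esub>)" if j: "j \<in> I" for j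
  proof -
    obtain k where "k \<in> I" "lq i k" "lq j k" using directed assms(1) j by blast
    then show ?thesis using j assms by (subst cl_eq_iff) auto
  qed
  then have "(\<Union>j\<in>I. cl (j, \<one>\<^bsub>G j\<^esub>)) = (\<Union>j\<in>I. cl (i, \<one>\<^bsub>G i\<^esub>))"
    by (rule SUP_cong[OF refl])
  also have "\<dots> = cl (i, \<one>\<^bsub>G i\<^esub>)" using assms(1) by blast
  finally show ?thesis by (simp only: direct_limit_def monoid.simps)
qed

end

locale direct_system_groups = direct_system +
  assumes G_group: "i \<in> I \<Longrightarrow> group (G i)"
    and r_mult: "\<lbrakk>i \<in> I; j \<in> I; lq i j; g \<in> carrier (G i); h \<in> carrier (G i)\<rbrakk>
      \<Longrightarrow> r i j (g \<otimes>\<^bsub>G i\<^esub> h) = r i j g \<otimes>\<^bsub>G j\<^esub> r i j h"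
begin

abbreviation L where "L \<equiv> direct_limit I lq G r"

lemma r_one: "\<lbrakk>i \<in> I; j \<in> I; lq i j\<rbrakk> \<Longrightarrow> r i j \<one>\<^bsub>G i\<^esub> = \<one>\<^bsub>G j\<^esub>"
proof -
  assume ij: "i \<in> I" "j \<in> I" "lq i j"
  interpret Gi: group "G i" by (rule G_group) fact
  interpret Gj: group "G j" by (rule G_group) fact
  have c: "r i j \<one>\<^bsub>G i\<^esub> \<in> carrier (G j)" using ij r_closed by simp
  have "r i j \<one>\<^bsub>G i\<^esub> \<otimes>\<^bsub>G j\<^esub> r i j \<one>\<^bsub>G i\<^esub> = r i j \<one>\<^bsub>G i\<^esub>"
    using r_mult[OF ij, of "\<one>\<^bsub>G i\<^esub>" "\<one>\<^bsub>G i\<^esub>"] by simp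
  then show ?thesis using c by (metis Gj.l_cancel_one)
qed

lemma one_L: "i \<in> I \<Longrightarrow> \<one>\<^bsub>L\<^esub> = cl (i, \<one>\<^bsub>G i\<^esub>)"
  by (rule one_direct_limit) (simp_all add: r_one monoid.one_closed[OF group.is_monoid[OF G_group]])

text \<open>The product of the direct limit is a union over all representatives and all upper bounds; any
  two of them give the same class, so the union is over copies of one class.\<close>

lemma mult_L:
  assumes i: "i \<in> I" and g: "g \<in> carrier (G i)" and h: "h \<in> carrier (G i)"
  shows "cl (i, g) \<otimes>\<^bsub>L\<^esub> cl (i, h) = cl (i, g \<otimes>\<^bsub>G i\<^esub> h)"
proof -
  let ?S = "{cl (k, r i' k g' \<otimes>\<^bsub>G k\<^esub> r j k h') | i' g' j h' k.
                  (i', g') \<in> cl (i, g) \<and> (j, h') \<in> cl (i, h) \<and> k \<in> I \<and> lq i' k \<and> lq j k}"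
  interpret Gi: group "G i" by (rule G_group) fact
  have "cl (k, r i' k g' \<otimes>\<^bsub>G k\<^esub> r j k h') = cl (i, g \<otimes>\<^bsub>G i\<^esub> h)"
    if a: "(i', g') \<in> cl (i, g)" "(j, h') \<in> cl (i, h)" and k: "k \<in> I" "lq i' k" "lq j k"
    for i' g' j h' k
  proof -
    interpret Gk: group "G k" by (rule G_group) fact
    note g' = mem_cl_eq[OF a(1) i g] and h' = mem_cl_eq[OF a(2) i h]
    obtain m where m: "m \<in> I" "lq i m" "lq i' m" "r i m g = r i' m g'"
      using a(1) by (auto simp: mem_cl)
    obtain n where n: "n \<in> I" "lq i n" "lq j n" "r i n h = r j n h'"
      using a(2) by (auto simp: mem_cl)
    obtain p where p: "p \<in> I" "lq m p" "lq n p" using m n directed by blast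
    obtain q where q: "q \<in> I" "lq p q" "lq k q" using p k directed by blast
    have mq: "lq m q" "lq n q" "lq i q" "lq i' q" "lq j q" using p q m n lq_trans by blast+
    have 1: "r i' q g' = r i q g" using r_comp[of i' m q g'] r_comp[of i m q g] m q mq g g' i by simp
    have 2: "r j q h' = r i q h" using r_comp[of j n q h'] r_comp[of i n q h] n q mq h h' i by simp
    have "r k q (r i' k g' \<otimes>\<^bsub>G k\<^esub> r j k h') = r i' q g' \<otimes>\<^bsub>G q\<^esub> r j q h'"
      using k q g' h' by (simp add: r_mult r_closed r_comp)
    also have "\<dots> = r i q (g \<otimes>\<^bsub>G i\<^esub> h)" using 1 2 i q mq g h by (simp add: r_mult)
    finally have "\<exists>q\<in>I. lq k q \<and> lq i q \<and>
        r k q (r i' k g' \<otimes>\<^bsub>G k\<^esub> r j k h') = r i q (g \<otimes>\<^bsub>G i\<^esub> h)"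
      using q mq by blast
    then show ?thesis using k i g h g' h' by (subst cl_eq_iff) (auto simp: r_closed)
  qed
  moreover have "cl (i, r i i g \<otimes>\<^bsub>G i\<^esub> r i i h) \<in> ?S"
    using cl_self i g h lq_refl by blast
  ultimately have "?S = {cl (i, g \<otimes>\<^bsub>G i\<^esub> h)}" by blast
  then show ?thesis by (simp add: direct_limit_def)
qed

lemma L_elem:
  assumes "A \<in> carrier L" obtains i g where "i \<in> I" "g \<in> carrier (G i)" "A = cl (i, g)"
  using assms by (auto simp: carrier_direct_limit)

lemma cl_in_L: "i \<in> I \<Longrightarrow> g \<in> carrier (G i) \<Longrightarrow> cl (i, g) \<in> carrier L"
  by (auto simp: carrier_direct_limit)

lemma L_elem_above:
  assumes "A \<in> carrier L" "i \<in> I"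
  obtains j g where "j \<in> I" "lq i j" "g \<in> carrier (G j)" "A = cl (j, g)"
proof -
  from assms(1) obtain k g where k: "k \<in> I" "g \<in> carrier (G k)" "A = cl (k, g)" by (rule L_elem)
  obtain j where j: "j \<in> I" "lq i j" "lq k j" using directed assms(2) k by blast
  show ?thesis using that[of j "r k j g"] j k by (simp add: cl_push r_closed)
qed

lemma L_elem2:
  assumes "A \<in> carrier L" "B \<in> carrier L"
  obtains i g h where "i \<in> I" "g \<in> carrier (G i)" "h \<in> carrier (G i)" "A = cl (i, g)" "B = cl (i, h)"
proof -
  obtain i g where i: "i \<in> I" "g \<in> carrier (G i)" "A = cl (i, g)" using assms(1) by (rule L_elem)
  obtain j h where j: "j \<in> I" "lq i j" "h \<in> carrier (G j)" "B = cl (j, h)"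
    using L_elem_above[OF assms(2) i(1)] .
  show ?thesis using that[of j "r i j g" h] i j by (simp add: cl_push r_closed)
qed

lemma L_elem3:
  assumes "A \<in> carrier L" "B \<in> carrier L" "C \<in> carrier L"
  obtains i g h f where "i \<in> I" "g \<in> carrier (G i)" "h \<in> carrier (G i)" "f \<in> carrier (G i)"
    "A = cl (i, g)" "B = cl (i, h)" "C = cl (i, f)"
proof -
  obtain i g h where i: "i \<in> I" "g \<in> carrier (G i)" "h \<in> carrier (G i)" "A = cl (i, g)" "B = cl (i, h)"
    using L_elem2[OF assms(1,2)] .
  obtain j f where j: "j \<in> I" "lq i j" "f \<in> carrier (G j)" "C = cl (j, f)"
    using L_elem_above[OF assms(3) i(1)] .
  show ?thesis using that[of j "r i j g" "r i j h" f] i j by (simp add: cl_push r_closed)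
qed

lemma group_L: assumes "I \<noteq> {}" shows "group L"
proof -
  obtain i0 where i0: "i0 \<in> I" using assms by blast
  note mon = group.is_monoid[OF G_group]
  show ?thesis
  proof (rule groupI)
    show "A \<otimes>\<^bsub>L\<^esub> B \<in> carrier L" if "A \<in> carrier L" "B \<in> carrier L" for A B
      by (rule L_elem2[OF that]) (simp add: mult_L cl_in_L monoid.m_closed[OF mon])
    show "\<one>\<^bsub>L\<^esub> \<in> carrier L" using i0 by (simp add: one_L[of i0] cl_in_L monoid.one_closed[OF mon])
    show "A \<otimes>\<^bsub>L\<^esub> B \<otimes>\<^bsub>L\<^esub> C = A \<otimes>\<^bsub>L\<^esub> (B \<otimes>\<^bsub>L\<^esub> C)"
      if ABC: "A \<in> carrier L" "B \<in> carrier L" "C \<in> carrier L" for A B C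
    proof -
      from ABC obtain i g h f where i: "i \<in> I" "g \<in> carrier (G i)" "h \<in> carrier (G i)" "f \<in> carrier (G i)"
        and e: "A = cl (i, g)" "B = cl (i, h)" "C = cl (i, f)" by (rule L_elem3)
      then show ?thesis by (simp add: mult_L monoid.m_closed[OF mon] monoid.m_assoc[OF mon])
    qed
    show "\<one>\<^bsub>L\<^esub> \<otimes>\<^bsub>L\<^esub> A = A" if A: "A \<in> carrier L" for A
    proof -
      from A obtain i g where i: "i \<in> I" "g \<in> carrier (G i)" "A = cl (i, g)" by (rule L_elem)
      then show ?thesis by (simp add: one_L[of i] mult_L monoid.one_closed[OF mon] monoid.l_one[OF mon])
    qed
    show "\<exists>B\<in>carrier L. B \<otimes>\<^bsub>L\<^esub> A = \<one>\<^bsub>L\<^esub>" if A: "A \<in> carrier L" for A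
    proof -
      from A obtain i g where i: "i \<in> I" "g \<in> carrier (G i)" "A = cl (i, g)" by (rule L_elem)
      then have "cl (i, inv\<^bsub>G i\<^esub> g) \<otimes>\<^bsub>L\<^esub> A = \<one>\<^bsub>L\<^esub>"
        by (simp add: one_L[of i] mult_L group.inv_closed[OF G_group] group.l_inv[OF G_group])
      then show ?thesis using i by (blast intro: cl_in_L group.inv_closed[OF G_group])
    qed
  qed
qed

lemma comm_group_L:
  assumes "I \<noteq> {}" and "\<And>i. i \<in> I \<Longrightarrow> comm_group (G i)" shows "comm_group L"
proof (rule group.group_comm_groupI[OF group_L[OF assms(1)]])
  fix A B assume "A \<in> carrier L" "B \<in> carrier L"
  then obtain i g h where i: "i \<in> I" "g \<in> carrier (G i)" "h \<in> carrier (G i)" "A = cl (i, g)" "B = cl (i, h)"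
    by (rule L_elem2)
  interpret comm_group "G i" using assms i by simp
  show "A \<otimes>\<^bsub>L\<^esub> B = B \<otimes>\<^bsub>L\<^esub> A" using i by (simp add: mult_L m_comm)
qed

lemma inv_L:
  assumes "i \<in> I" "g \<in> carrier (G i)"
  shows "inv\<^bsub>L\<^esub> (cl (i, g)) = cl (i, inv\<^bsub>G i\<^esub> g)"
proof -
  interpret L: group L using group_L assms by blast
  interpret Gi: group "G i" using G_group assms by simp
  show ?thesis
    by (rule L.inv_equality) (use assms in \<open>auto simp: mult_L one_L[of i] cl_in_L\<close>)
qed

end

section \<open>Presheaves of groups and their associated sheaves\<close>

locale group_presheaf =
  fixes P :: "('a::topological_space, 'g) gpresheaf"
  assumes sec_group: "open U \<Longrightarrow> group (sec P U)"
    and res_hom: "\<lbrakk>open U; open V; V \<subseteq> U\<rbrakk> \<Longrightarrow> res P U V \<in> hom (sec P U) (sec P V)"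
    and res_id: "\<lbrakk>open U; f \<in> carrier (sec P U)\<rbrakk> \<Longrightarrow> res P U U f = f"
    and res_comp: "\<lbrakk>open U; open V; open W; V \<subseteq> U; W \<subseteq> V; f \<in> carrier (sec P U)\<rbrakk>
      \<Longrightarrow> res P V W (res P U V f) = res P U W f"
begin

lemma res_closed: "\<lbrakk>open U; open V; V \<subseteq> U; f \<in> carrier (sec P U)\<rbrakk> \<Longrightarrow> res P U V f \<in> carrier (sec P V)"
  using hom_in_carrier[OF res_hom] .

lemma res_mult: "\<lbrakk>open U; open V; V \<subseteq> U; f \<in> carrier (sec P U); g \<in> carrier (sec P U)\<rbrakk>
    \<Longrightarrow> res P U V (f \<otimes>\<^bsub>sec P U\<^esub> g) = res P U V f \<otimes>\<^bsub>sec P V\<^esub> res P U V g"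
  using hom_mult[OF res_hom] .

lemma res_inv: "\<lbrakk>open U; open V; V \<subseteq> U; f \<in> carrier (sec P U)\<rbrakk>
    \<Longrightarrow> res P U V (inv\<^bsub>sec P U\<^esub> f) = inv\<^bsub>sec P V\<^esub> res P U V f"
  using group_hom.hom_inv[of "sec P U" "sec P V" "res P U V" f] res_hom sec_group
  by (simp add: group_hom_def group_hom_axioms_def)

sublocale st: direct_system_groups "nbhds x" "\<lambda>U V. V \<subseteq> U" "sec P" "res P" for x
proof (intro direct_system_groups.intro direct_system.intro direct_system_groups_axioms.intro)
  show "\<exists>k\<in>nbhds x. k \<subseteq> U \<and> k \<subseteq> V" if "U \<in> nbhds x" "V \<in> nbhds x" for U V
    using that by (intro bexI[of _ "U \<inter> V"]) (auto simp: nbhds_def)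
qed (auto simp: nbhds_def res_closed res_comp sec_group res_mult)

lemma stalk_group: "group (stalk P x)"
  unfolding stalk_def by (rule st.group_L) (auto simp: nbhds_def)

lemma germ_in_stalk: "\<lbrakk>open U; x \<in> U; f \<in> carrier (sec P U)\<rbrakk> \<Longrightarrow> germ P x (U, f) \<in> carrier (stalk P x)"
  unfolding stalk_def germ_def by (rule st.cl_in_L) (auto simp: nbhds_def)

lemma stalk_elem:
  assumes "A \<in> carrier (stalk P x)"
  obtains U f where "open U" "x \<in> U" "f \<in> carrier (sec P U)" "A = germ P x (U, f)"
  using assms that unfolding stalk_def st.carrier_direct_limit germ_def by (auto simp: nbhds_def)

lemma germ_eq_iff:
  assumes "open U" "x \<in> U" "f \<in> carrier (sec P U)" "open V" "x \<in> V" "g \<in> carrier (sec P V)"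
  shows "germ P x (U, f) = germ P x (V, g) \<longleftrightarrow>
    (\<exists>W. open W \<and> x \<in> W \<and> W \<subseteq> U \<and> W \<subseteq> V \<and> res P U W f = res P V W g)"
  unfolding germ_def by (subst st.cl_eq_iff) (use assms in \<open>auto simp: nbhds_def\<close>)

lemma germ_res:
  assumes "open U" "open V" "V \<subseteq> U" "x \<in> V" "f \<in> carrier (sec P U)"
  shows "germ P x (V, res P U V f) = germ P x (U, f)"
  unfolding germ_def by (rule st.cl_push) (use assms in \<open>auto simp: nbhds_def\<close>)

lemma germ_mult:
  assumes "open U" "x \<in> U" "f \<in> carrier (sec P U)" "g \<in> carrier (sec P U)"
  shows "germ P x (U, f) \<otimes>\<^bsub>stalk P x\<^esub> germ P x (U, g) = germ P x (U, f \<otimes>\<^bsub>sec P U\<^esub> g)"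
  unfolding stalk_def germ_def by (rule st.mult_L) (use assms in \<open>auto simp: nbhds_def\<close>)

lemma germ_inv: "\<lbrakk>open U; x \<in> U; f \<in> carrier (sec P U)\<rbrakk>
    \<Longrightarrow> inv\<^bsub>stalk P x\<^esub> germ P x (U, f) = germ P x (U, inv\<^bsub>sec P U\<^esub> f)"
  unfolding stalk_def germ_def by (rule st.inv_L) (auto simp: nbhds_def)

lemma mem_germ:
  assumes "(V, g) \<in> germ P x (U, f)" "open U" "x \<in> U" "f \<in> carrier (sec P U)"
  shows "open V" "x \<in> V" "g \<in> carrier (sec P V)" "germ P x (V, g) = germ P x (U, f)"
  using st.mem_cl_eq[of V g x U f] assms unfolding germ_def by (auto simp: nbhds_def)

lemma germ_self: "\<lbrakk>open U; x \<in> U; f \<in> carrier (sec P U)\<rbrakk> \<Longrightarrow> (U, f) \<in> germ P x (U, f)"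
  unfolding germ_def by (rule st.cl_self) (auto simp: nbhds_def)

abbreviation sheaf :: "('a, 'a \<Rightarrow> ('a set \<times> 'g) set) gpresheaf" where
  "sheaf \<equiv> sheafify P"

definition gsec :: "'a set \<Rightarrow> 'g \<Rightarrow> 'a \<Rightarrow> ('a set \<times> 'g) set" where
  "gsec U f = (\<lambda>y\<in>U. germ P y (U, f))"

lemma carrier_sheaf: "s \<in> carrier (sec sheaf U) \<longleftrightarrow> s \<in> (\<Pi>\<^sub>E x\<in>U. carrier (stalk P x)) \<and>
    (\<forall>x\<in>U. \<exists>V f. open V \<and> x \<in> V \<and> V \<subseteq> U \<and> f \<in> carrier (sec P V) \<and> (\<forall>y\<in>V. s y = germ P y (V, f)))"
  by (simp add: sheafify_def)

lemma sheaf_mult: "s \<otimes>\<^bsub>sec sheaf U\<^esub> t = (\<lambda>x\<in>U. s x \<otimes>\<^bsub>stalk P x\<^esub> t x)"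
  and sheaf_one: "\<one>\<^bsub>sec sheaf U\<^esub> = (\<lambda>x\<in>U. \<one>\<^bsub>stalk P x\<^esub>)"
  and res_sheaf: "res sheaf U V s = restrict s V"
  by (simp_all add: sheafify_def)

lemma sheaf_ext:
  assumes "s \<in> carrier (sec sheaf U)" "t \<in> carrier (sec sheaf U)" "\<And>x. x \<in> U \<Longrightarrow> s x = t x"
  shows "s = t"
  using assms by (auto simp: carrier_sheaf intro: PiE_ext)

lemma sheaf_local:
  assumes "s \<in> carrier (sec sheaf U)" "x \<in> U"
  obtains V f where "open V" "x \<in> V" "V \<subseteq> U" "f \<in> carrier (sec P V)" "res sheaf U V s = gsec V f"
proof -
  from assms obtain V f where "open V" "x \<in> V" "V \<subseteq> U" "f \<in> carrier (sec P V)" "\<forall>y\<in>V. s y = germ P y (V, f)"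
    unfolding carrier_sheaf by blast
  then have "res sheaf U V s = gsec V f"
    unfolding res_sheaf gsec_def by (intro restrict_ext) simp
  then show ?thesis using that \<open>open V\<close> \<open>x \<in> V\<close> \<open>V \<subseteq> U\<close> \<open>f \<in> carrier (sec P V)\<close> by blast
qed

lemma sheafI:
  assumes "s \<in> extensional U"
    and "\<And>x. x \<in> U \<Longrightarrow> \<exists>V f. open V \<and> x \<in> V \<and> V \<subseteq> U \<and> f \<in> carrier (sec P V) \<and> (\<forall>y\<in>V. s y = germ P y (V, f))"
  shows "s \<in> carrier (sec sheaf U)"
  unfolding carrier_sheaf
proof (intro conjI ballI PiE_I)
  fix x assume "x \<in> U"
  from assms(2)[OF this] show "s x \<in> carrier (stalk P x)" by (auto intro: germ_in_stalk)
qed (use assms in \<open>auto simp: extensional_def\<close>)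

lemma gsec_closed: "open U \<Longrightarrow> f \<in> carrier (sec P U) \<Longrightarrow> gsec U f \<in> carrier (sec sheaf U)"
  by (rule sheafI) (auto simp: gsec_def)

lemma res_gsec: "\<lbrakk>open U; open V; V \<subseteq> U; f \<in> carrier (sec P U)\<rbrakk>
    \<Longrightarrow> res sheaf U V (gsec U f) = gsec V (res P U V f)"
  by (simp add: res_sheaf gsec_def germ_res restrict_def fun_eq_iff subset_iff)

lemma sheaf_local2:
  assumes "s \<in> carrier (sec sheaf U)" "t \<in> carrier (sec sheaf U)" "x \<in> U"
  obtains V f g where "open V" "x \<in> V" "V \<subseteq> U" "f \<in> carrier (sec P V)" "g \<in> carrier (sec P V)"
    "\<And>y. y \<in> V \<Longrightarrow> s y = germ P y (V, f)" "\<And>y. y \<in> V \<Longrightarrow> t y = germ P y (V, g)"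
proof -
  from assms obtain V f where V: "open V" "x \<in> V" "V \<subseteq> U" "f \<in> carrier (sec P V)" "\<forall>y\<in>V. s y = germ P y (V, f)"
    unfolding carrier_sheaf by blast
  from assms obtain W g where W: "open W" "x \<in> W" "W \<subseteq> U" "g \<in> carrier (sec P W)" "\<forall>y\<in>W. t y = germ P y (W, g)"
    unfolding carrier_sheaf by blast
  show ?thesis
    by (rule that[of "V \<inter> W" "res P V (V \<inter> W) f" "res P W (V \<inter> W) g"])
       (use V W in \<open>simp_all add: germ_res res_closed open_Int le_infI1\<close>)
qed

lemma subgroup_sheaf: "open U \<Longrightarrow> subgroup (carrier (sec sheaf U)) (product_group U (stalk P))"
proof (rule group.subgroupI)
  assume U: "open U"
  note grp = sec_group and st_grp = stalk_group
  show "group (product_group U (stalk P))" by (simp add: stalk_group)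
  show "carrier (sec sheaf U) \<subseteq> carrier (product_group U (stalk P))"
    by (rule subsetI) (simp add: carrier_sheaf)
  have "gsec U \<one>\<^bsub>sec P U\<^esub> \<in> carrier (sec sheaf U)"
    using gsec_closed[OF U] monoid.one_closed[OF group.is_monoid[OF sec_group[OF U]]] .
  then show "carrier (sec sheaf U) \<noteq> {}" by blast
next
  fix s assume U: "open U" and s: "s \<in> carrier (sec sheaf U)"
  then have "s \<in> (\<Pi>\<^sub>E i\<in>U. carrier (stalk P i))" by (simp add: carrier_sheaf)
  then have e: "inv\<^bsub>product_group U (stalk P)\<^esub> s = (\<lambda>x\<in>U. inv\<^bsub>stalk P x\<^esub> s x)"
    by (simp add: stalk_group)
  show "inv\<^bsub>product_group U (stalk P)\<^esub> s \<in> carrier (sec sheaf U)"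
    unfolding e
  proof (rule sheafI)
    fix x assume "x \<in> U"
    with s obtain V f g where V: "open V" "x \<in> V" "V \<subseteq> U" "f \<in> carrier (sec P V)"
      "\<And>y. y \<in> V \<Longrightarrow> s y = germ P y (V, f)"
      using sheaf_local2[of s U s x] by metis
    show "\<exists>V f. open V \<and> x \<in> V \<and> V \<subseteq> U \<and> f \<in> carrier (sec P V) \<and> (\<forall>y\<in>V. (\<lambda>x\<in>U. inv\<^bsub>stalk P x\<^esub> s x) y = germ P y (V, f))"
      by (intro exI[of _ V] exI[of _ "inv\<^bsub>sec P V\<^esub> f"])
         (use V in \<open>auto simp: germ_inv group.inv_closed[OF sec_group]\<close>)
  qed auto
next
  fix s t assume U: "open U" and s: "s \<in> carrier (sec sheaf U)" and t: "t \<in> carrier (sec sheaf U)"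
  show "s \<otimes>\<^bsub>product_group U (stalk P)\<^esub> t \<in> carrier (sec sheaf U)"
  proof (rule sheafI)
    fix x assume "x \<in> U"
    from sheaf_local2[OF s t this] obtain V f g where V: "open V" "x \<in> V" "V \<subseteq> U"
      "f \<in> carrier (sec P V)" "g \<in> carrier (sec P V)"
      "\<And>y. y \<in> V \<Longrightarrow> s y = germ P y (V, f)" "\<And>y. y \<in> V \<Longrightarrow> t y = germ P y (V, g)"
      by metis
    show "\<exists>V f. open V \<and> x \<in> V \<and> V \<subseteq> U \<and> f \<in> carrier (sec P V) \<and>
        (\<forall>y\<in>V. (s \<otimes>\<^bsub>product_group U (stalk P)\<^esub> t) y = germ P y (V, f))"
      by (intro exI[of _ V] exI[of _ "f \<otimes>\<^bsub>sec P V\<^esub> g"])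
         (use V in \<open>auto simp: germ_mult monoid.m_closed[OF group.is_monoid[OF sec_group]]\<close>)
  qed auto
qed

lemma sec_sheaf_eq: "sec sheaf U = (product_group U (stalk P))\<lparr>carrier := carrier (sec sheaf U)\<rparr>"
  by (simp add: sheafify_def)

lemma sheaf_group: "open U \<Longrightarrow> group (sec sheaf U)"
  by (subst sec_sheaf_eq) (rule subgroup.subgroup_is_group[OF subgroup_sheaf], auto simp: stalk_group)

lemma sheaf_presheaf: "group_presheaf sheaf"
proof (rule group_presheaf.intro)
  show "res sheaf U V \<in> hom (sec sheaf U) (sec sheaf V)" if "open U" "open V" "V \<subseteq> U" for U V
  proof (rule homI)
    fix s assume s: "s \<in> carrier (sec sheaf U)"
    show "res sheaf U V s \<in> carrier (sec sheaf V)"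
    proof (rule sheafI)
      fix x assume x: "x \<in> V"
      then have "x \<in> U" using that by blast
      from sheaf_local2[OF s s this] obtain W f where W: "open W" "x \<in> W" "W \<subseteq> U" "f \<in> carrier (sec P W)"
        "\<And>y. y \<in> W \<Longrightarrow> s y = germ P y (W, f)" by metis
      have "\<forall>y\<in>V \<inter> W. res sheaf U V s y = germ P y (V \<inter> W, res P W (V \<inter> W) f)"
        using W that by (simp add: res_sheaf germ_res open_Int)
      moreover have "res P W (V \<inter> W) f \<in> carrier (sec P (V \<inter> W))"
        using W that by (simp add: res_closed open_Int)
      ultimately show "\<exists>W f. open W \<and> x \<in> W \<and> W \<subseteq> V \<and> f \<in> carrier (sec P W) \<and> (\<forall>y\<in>W. res sheaf U V s y = germ P y (W, f))"
        using W x that by (intro exI[of _ "V \<inter> W"] exI[of _ "res P W (V \<inter> W) f"]) (simp add: open_Int)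
    qed (auto simp: res_sheaf)
  next
    fix s t
    show "res sheaf U V (s \<otimes>\<^bsub>sec sheaf U\<^esub> t) = res sheaf U V s \<otimes>\<^bsub>sec sheaf V\<^esub> res sheaf U V t"
      using that by (simp add: res_sheaf sheaf_mult restrict_def fun_eq_iff subset_iff)
  qed
  show "res sheaf U U s = s" if "s \<in> carrier (sec sheaf U)" for U s
    using that by (simp add: res_sheaf carrier_sheaf PiE_def extensional_restrict)
qed (simp_all add: sheaf_group res_sheaf Int_absorb1)

lemma sheaf_comm_group:
  assumes "open U" and comm: "\<And>V. open V \<Longrightarrow> comm_group (sec P V)"
  shows "comm_group (sec sheaf U)"
proof (rule group.group_comm_groupI[OF sheaf_group[OF assms(1)]])
  fix s t assume st: "s \<in> carrier (sec sheaf U)" "t \<in> carrier (sec sheaf U)"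
  show "s \<otimes>\<^bsub>sec sheaf U\<^esub> t = t \<otimes>\<^bsub>sec sheaf U\<^esub> s"
    unfolding sheaf_mult
  proof (rule restrict_ext)
    fix x assume x: "x \<in> U"
    have "comm_group (stalk P x)"
      unfolding stalk_def by (rule st.comm_group_L) (auto simp: nbhds_def comm)
    then show "s x \<otimes>\<^bsub>stalk P x\<^esub> t x = t x \<otimes>\<^bsub>stalk P x\<^esub> s x"
      using st x unfolding carrier_sheaf
      by (intro comm_monoid.m_comm comm_group.axioms(1)) (auto dest: PiE_mem)
  qed
qed

lemma gsec_hom: "open U \<Longrightarrow> gsec U \<in> hom (sec P U) (sec sheaf U)"
  by (rule homI) (simp_all add: gsec_closed, simp add: gsec_def sheaf_mult germ_mult cong: restrict_cong)

text \<open>The local agreement on the right becomes equality of cosets when one divides by a locally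
  determined subgroup, see \<open>cls_eq_iff\<close>.\<close>

lemma gsec_eq_iff:
  assumes "open U" "f \<in> carrier (sec P U)" "g \<in> carrier (sec P U)"
  shows "gsec U f = gsec U g \<longleftrightarrow>
    (\<forall>x\<in>U. \<exists>V. open V \<and> x \<in> V \<and> V \<subseteq> U \<and> res P U V f = res P U V g)"
proof -
  have "gsec U f = gsec U g \<longleftrightarrow> (\<forall>x\<in>U. germ P x (U, f) = germ P x (U, g))"
    by (simp add: gsec_def fun_eq_iff restrict_def Ball_def)
  then show ?thesis using assms by (simp add: germ_eq_iff)
qed

end

section \<open>Quotients by locally determined normal subgroups\<close>

lemma set_mult_hom_coset:
  assumes G: "group G" and H: "group H" and h: "h \<in> hom G H"
    and N: "subgroup N G" and N': "subgroup N' H" and sub: "h ` N \<subseteq> N'" and f: "f \<in> carrier G"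
  shows "N' <#>\<^bsub>H\<^esub> (h ` (N #>\<^bsub>G\<^esub> f)) = N' #>\<^bsub>H\<^esub> h f"
proof (intro subset_antisym subsetI)
  interpret H: group H by (rule H)
  have hf: "h f \<in> carrier H" using hom_in_carrier[OF h f] .
  fix z assume "z \<in> N' <#>\<^bsub>H\<^esub> (h ` (N #>\<^bsub>G\<^esub> f))"
  then obtain n m where nm: "n \<in> N'" "m \<in> N" "z = n \<otimes>\<^bsub>H\<^esub> h (m \<otimes>\<^bsub>G\<^esub> f)"
    by (auto simp: set_mult_def r_coset_def)
  have m: "h m \<in> N'" "m \<in> carrier G" using nm sub subgroup.mem_carrier[OF N] by auto
  have "z = (n \<otimes>\<^bsub>H\<^esub> h m) \<otimes>\<^bsub>H\<^esub> h f"
    using nm m hf f subgroup.mem_carrier[OF N'] by (simp add: hom_mult[OF h] H.m_assoc)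
  then show "z \<in> N' #>\<^bsub>H\<^esub> h f"
    using subgroup.m_closed[OF N' nm(1) m(1)] by (auto simp: r_coset_def)
next
  fix z assume "z \<in> N' #>\<^bsub>H\<^esub> h f"
  then obtain n where "n \<in> N'" "z = n \<otimes>\<^bsub>H\<^esub> h f" by (auto simp: r_coset_def)
  then show "z \<in> N' <#>\<^bsub>H\<^esub> (h ` (N #>\<^bsub>G\<^esub> f))"
    using group.rcos_self[OF G f N] by (auto simp: set_mult_def)
qed

text \<open>Membership in the subgroup \<open>N\<close> can be tested locally. This ensures that the kernel of the map
  from \<open>F\<close> to the quotient sheaf is \<open>N\<close> itself, although the quotient presheaf need not be a
  sheaf.\<close>

locale sheaf_quotient = group_presheaf F for F :: "('a::topological_space, 'g) gpresheaf" +
  fixes N :: "('a, 'g) gpresheaf"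
  assumes N_normal: "open U \<Longrightarrow> carrier (sec N U) \<lhd> sec F U"
    and N_res: "\<lbrakk>open U; open V; V \<subseteq> U; f \<in> carrier (sec N U)\<rbrakk> \<Longrightarrow> res F U V f \<in> carrier (sec N V)"
    and N_local: "\<lbrakk>open U; f \<in> carrier (sec F U);
        \<And>x. x \<in> U \<Longrightarrow> \<exists>V. open V \<and> x \<in> V \<and> V \<subseteq> U \<and> res F U V f \<in> carrier (sec N V)\<rbrakk>
      \<Longrightarrow> f \<in> carrier (sec N U)"
begin

abbreviation coset :: "'a set \<Rightarrow> 'g \<Rightarrow> 'g set" where
  "coset U f \<equiv> carrier (sec N U) #>\<^bsub>sec F U\<^esub> f"

abbreviation Q :: "('a, 'g set) gpresheaf" where "Q \<equiv> quot_presheaf F N"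

lemma N_sub: "open U \<Longrightarrow> subgroup (carrier (sec N U)) (sec F U)"
  using N_normal by (simp add: normal_def)

lemma sec_Q: "sec Q U = sec F U Mod carrier (sec N U)"
  by (simp add: quot_presheaf_def)

lemma carrier_Q: "carrier (sec Q U) = {coset U f | f. f \<in> carrier (sec F U)}"
  by (auto simp: sec_Q FactGroup_def RCOSETS_def)

lemma res_Q:
  assumes "open U" "open V" "V \<subseteq> U" "f \<in> carrier (sec F U)"
  shows "res Q U V (coset U f) = coset V (res F U V f)"
proof -
  have "res F U V ` carrier (sec N U) \<subseteq> carrier (sec N V)" using N_res[OF assms(1-3)] by auto
  then show ?thesis
    using set_mult_hom_coset[OF sec_group sec_group res_hom N_sub N_sub _ assms(4)] assms
    by (simp add: quot_presheaf_def)
qed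

lemma coset_mult:
  assumes "open U" "f \<in> carrier (sec F U)" "g \<in> carrier (sec F U)"
  shows "coset U f \<otimes>\<^bsub>sec Q U\<^esub> coset U g = coset U (f \<otimes>\<^bsub>sec F U\<^esub> g)"
  using normal.rcos_sum[OF N_normal] assms by (simp add: sec_Q FactGroup_def)

lemma coset_eq_iff:
  assumes "open U" "f \<in> carrier (sec F U)" "g \<in> carrier (sec F U)"
  shows "coset U f = coset U g \<longleftrightarrow> f \<otimes>\<^bsub>sec F U\<^esub> inv\<^bsub>sec F U\<^esub> g \<in> carrier (sec N U)"
proof -
  interpret U: group "sec F U" by (rule sec_group) (use assms in simp)
  interpret NU: subgroup "carrier (sec N U)" "sec F U" by (rule N_sub) (use assms in simp)
  show ?thesis
    using U.repr_independence[OF _ assms(3) N_sub[OF assms(1)], of f] U.rcos_self[OF assms(2) N_sub[OF assms(1)]]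
      NU.rcos_module[OF U.group_axioms assms(3,2)]
    by metis
qed

lemma Q_presheaf: "group_presheaf Q"
proof (rule group_presheaf.intro)
  show "group (sec Q U)" if "open U" for U
    unfolding sec_Q by (rule normal.factorgroup_is_group[OF N_normal[OF that]])
  show "res Q U V \<in> hom (sec Q U) (sec Q V)" if "open U" "open V" "V \<subseteq> U" for U V
  proof (rule homI)
    fix A B assume "A \<in> carrier (sec Q U)" "B \<in> carrier (sec Q U)"
    then obtain f g where fg: "A = coset U f" "B = coset U g" "f \<in> carrier (sec F U)" "g \<in> carrier (sec F U)"
      by (auto simp: carrier_Q)
    then show "res Q U V (A \<otimes>\<^bsub>sec Q U\<^esub> B) = res Q U V A \<otimes>\<^bsub>sec Q V\<^esub> res Q U V B"
      using that by (simp add: coset_mult res_Q monoid.m_closed[OF group.is_monoid[OF sec_group]] res_mult res_closed)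
  next
    fix A assume "A \<in> carrier (sec Q U)"
    then obtain f where "A = coset U f" "f \<in> carrier (sec F U)" by (auto simp: carrier_Q)
    then have "res Q U V A = coset V (res F U V f)" "res F U V f \<in> carrier (sec F V)"
      using that by (simp_all add: res_Q res_closed)
    then show "res Q U V A \<in> carrier (sec Q V)" unfolding carrier_Q by blast
  qed
  show "res Q U U A = A" if "open U" "A \<in> carrier (sec Q U)" for U A
  proof -
    from that obtain f where "A = coset U f" "f \<in> carrier (sec F U)" by (auto simp: carrier_Q)
    then show ?thesis using that by (simp add: res_Q res_id)
  qed
  show "res Q V W (res Q U V A) = res Q U W A"
    if "open U" "open V" "open W" "V \<subseteq> U" "W \<subseteq> V" "A \<in> carrier (sec Q U)" for U V W A
  proof -
    from that obtain f where "A = coset U f" "f \<in> carrier (sec F U)" by (auto simp: carrier_Q)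
    moreover from this have "res F U V f \<in> carrier (sec F V)" using that by (simp add: res_closed)
    moreover have "W \<subseteq> U" using that by blast
    ultimately show ?thesis using that by (simp add: res_Q res_comp)
  qed
qed

sublocale Q: group_presheaf Q by (rule Q_presheaf)

definition cls :: "'a set \<Rightarrow> 'g \<Rightarrow> 'a \<Rightarrow> ('a set \<times> 'g set) set" where
  "cls U f = Q.gsec U (coset U f)"

lemma quot_sheaf_eq: "quot_sheaf F N = Q.sheaf"
  by (simp add: quot_sheaf_def)

lemma coset_in_Q: "f \<in> carrier (sec F U) \<Longrightarrow> coset U f \<in> carrier (sec Q U)"
  by (auto simp: carrier_Q)

lemma quot_presheaf_group: "group_presheaf (quot_sheaf F N)"
  unfolding quot_sheaf_eq by (rule Q.sheaf_presheaf)

lemma cls_closed: "open U \<Longrightarrow> f \<in> carrier (sec F U) \<Longrightarrow> cls U f \<in> carrier (sec (quot_sheaf F N) U)"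
  by (simp add: cls_def quot_sheaf_eq Q.gsec_closed coset_in_Q)

lemma cls_mult: "\<lbrakk>open U; f \<in> carrier (sec F U); g \<in> carrier (sec F U)\<rbrakk>
    \<Longrightarrow> cls U (f \<otimes>\<^bsub>sec F U\<^esub> g) = cls U f \<otimes>\<^bsub>sec (quot_sheaf F N) U\<^esub> cls U g"
  using hom_mult[OF Q.gsec_hom, of U "coset U f" "coset U g"]
  by (simp add: cls_def quot_sheaf_eq coset_in_Q coset_mult)

lemma cls_hom: "open U \<Longrightarrow> cls U \<in> hom (sec F U) (sec (quot_sheaf F N) U)"
  by (rule homI) (simp_all add: cls_closed cls_mult)

lemma res_cls: "\<lbrakk>open U; open V; V \<subseteq> U; f \<in> carrier (sec F U)\<rbrakk>
    \<Longrightarrow> res (quot_sheaf F N) U V (cls U f) = cls V (res F U V f)"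
  by (simp add: cls_def quot_sheaf_eq Q.res_gsec coset_in_Q res_Q)

lemma cls_locally:
  assumes "s \<in> carrier (sec (quot_sheaf F N) U)" "x \<in> U"
  obtains V f where "open V" "x \<in> V" "V \<subseteq> U" "f \<in> carrier (sec F V)" "res (quot_sheaf F N) U V s = cls V f"
proof (rule Q.sheaf_local[OF assms[unfolded quot_sheaf_eq]])
  fix V A assume V: "open V" "x \<in> V" "V \<subseteq> U" "A \<in> carrier (sec Q V)" "res Q.sheaf U V s = Q.gsec V A"
  then obtain f where "A = coset V f" "f \<in> carrier (sec F V)" by (auto simp: carrier_Q)
  then show thesis using that[of V f] V by (simp add: cls_def quot_sheaf_eq)
qed

text \<open>Equality of germs gives membership of \<open>f g\<^sup>-\<^sup>1\<close> in \<open>N\<close> near every point, and \<open>N_local\<close> passes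
  from there to the whole open set.\<close>

lemma cls_eq_iff:
  assumes U: "open U" and f: "f \<in> carrier (sec F U)" and g: "g \<in> carrier (sec F U)"
  shows "cls U f = cls U g \<longleftrightarrow> f \<otimes>\<^bsub>sec F U\<^esub> inv\<^bsub>sec F U\<^esub> g \<in> carrier (sec N U)"
proof
  interpret U: group "sec F U" by (rule sec_group) (use assms in simp)
  assume e: "cls U f = cls U g"
  show "f \<otimes>\<^bsub>sec F U\<^esub> inv\<^bsub>sec F U\<^esub> g \<in> carrier (sec N U)"
  proof (rule N_local[OF U])
    fix x assume "x \<in> U"
    then obtain V where V: "open V" "x \<in> V" "V \<subseteq> U" "coset V (res F U V f) = coset V (res F U V g)"
      using e assms by (auto simp: cls_def Q.gsec_eq_iff coset_in_Q res_Q)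
    then have "res F U V f \<otimes>\<^bsub>sec F V\<^esub> inv\<^bsub>sec F V\<^esub> res F U V g \<in> carrier (sec N V)"
      using assms by (simp add: coset_eq_iff res_closed)
    then have "res F U V (f \<otimes>\<^bsub>sec F U\<^esub> inv\<^bsub>sec F U\<^esub> g) \<in> carrier (sec N V)"
      using V assms by (simp add: res_mult res_inv)
    then show "\<exists>V. open V \<and> x \<in> V \<and> V \<subseteq> U \<and> res F U V (f \<otimes>\<^bsub>sec F U\<^esub> inv\<^bsub>sec F U\<^esub> g) \<in> carrier (sec N V)"
      using V by blast
  qed (use f g in simp)
next
  assume "f \<otimes>\<^bsub>sec F U\<^esub> inv\<^bsub>sec F U\<^esub> g \<in> carrier (sec N U)"
  then have "coset U f = coset U g" using coset_eq_iff assms by blast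
  then show "cls U f = cls U g" by (simp add: cls_def)
qed

lemma cls_eq_one_iff:
  assumes U: "open U" and f: "f \<in> carrier (sec F U)"
  shows "cls U f = \<one>\<^bsub>sec (quot_sheaf F N) U\<^esub> \<longleftrightarrow> f \<in> carrier (sec N U)"
proof -
  interpret U: group "sec F U" by (rule sec_group) (use assms in simp)
  have "cls U \<one>\<^bsub>sec F U\<^esub> = \<one>\<^bsub>sec (quot_sheaf F N) U\<^esub>"
    by (rule hom_one[OF cls_hom sec_group group_presheaf.sec_group[OF quot_presheaf_group]]) (use U in auto)
  then show ?thesis using cls_eq_iff[OF assms U.one_closed] f by simp
qed

text \<open>Commutators are written as \<open>(f g) (g f)\<^sup>-\<^sup>1\<close>, which is the form in which they are estimated
  for automorphisms.\<close>

lemma quot_comm_group: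
  assumes comm: "\<And>V f g. \<lbrakk>open V; f \<in> carrier (sec F V); g \<in> carrier (sec F V)\<rbrakk>
      \<Longrightarrow> (f \<otimes>\<^bsub>sec F V\<^esub> g) \<otimes>\<^bsub>sec F V\<^esub> inv\<^bsub>sec F V\<^esub> (g \<otimes>\<^bsub>sec F V\<^esub> f) \<in> carrier (sec N V)"
    and "open U"
  shows "comm_group (sec (quot_sheaf F N) U)"
  unfolding quot_sheaf_eq
proof (rule Q.sheaf_comm_group[OF assms(2)])
  fix V :: "'a set" assume V: "open V"
  interpret V: group "sec F V" using sec_group V .
  show "comm_group (sec Q V)"
  proof (rule group.group_comm_groupI[OF Q.sec_group[OF V]])
    fix A B assume "A \<in> carrier (sec Q V)" "B \<in> carrier (sec Q V)"
    then obtain f g where fg: "A = coset V f" "B = coset V g" "f \<in> carrier (sec F V)" "g \<in> carrier (sec F V)"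
      by (auto simp: carrier_Q)
    then show "A \<otimes>\<^bsub>sec Q V\<^esub> B = B \<otimes>\<^bsub>sec Q V\<^esub> A"
      using V comm by (simp add: coset_mult coset_eq_iff)
  qed
qed

end

section \<open>Maps between quotient sheaves\<close>

locale quotient_inclusion = A: sheaf_quotient F N + B: sheaf_quotient F' N'
  for F :: "('a::topological_space, 'g) gpresheaf" and N and F' :: "('a, 'g) gpresheaf" and N' +
  assumes F_subset: "open U \<Longrightarrow> carrier (sec F U) \<subseteq> carrier (sec F' U)"
    and N_subset: "open U \<Longrightarrow> carrier (sec N U) \<subseteq> carrier (sec N' U)"
    and mult_eq: "open U \<Longrightarrow> (\<otimes>\<^bsub>sec F U\<^esub>) = (\<otimes>\<^bsub>sec F' U\<^esub>)"
    and res_eq: "res F = res F'"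
begin

definition smap :: "'a \<Rightarrow> ('a set \<times> 'g set) set \<Rightarrow> ('a set \<times> 'g set) set" where
  "smap x A = (\<Union>(V, K)\<in>A. germ B.Q x (V, carrier (sec N' V) <#>\<^bsub>sec F' V\<^esub> K))"

abbreviation qmap :: "'a set \<Rightarrow> ('a \<Rightarrow> ('a set \<times> 'g set) set) \<Rightarrow> 'a \<Rightarrow> ('a set \<times> 'g set) set" where
  "qmap \<equiv> quot_map F' N'"

lemma quot_map_smap: "qmap U s = (\<lambda>x\<in>U. smap x (s x))"
  by (simp add: quot_map_def smap_def)

lemma mem_F': "open U \<Longrightarrow> f \<in> carrier (sec F U) \<Longrightarrow> f \<in> carrier (sec F' U)"
  using F_subset by blast

lemma one_eq: assumes "open U" shows "\<one>\<^bsub>sec F U\<^esub> = \<one>\<^bsub>sec F' U\<^esub>"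
proof -
  interpret X: group "sec F U" by (rule A.sec_group[OF assms])
  interpret Y: group "sec F' U" by (rule B.sec_group[OF assms])
  have "\<one>\<^bsub>sec F U\<^esub> \<otimes>\<^bsub>sec F' U\<^esub> \<one>\<^bsub>sec F U\<^esub> = \<one>\<^bsub>sec F U\<^esub>"
    using X.l_one[OF X.one_closed] mult_eq[OF assms] by simp
  then show ?thesis using Y.l_cancel_one[OF mem_F'[OF assms X.one_closed] mem_F'[OF assms X.one_closed]] by simp
qed

lemma inv_eq: assumes "open U" "f \<in> carrier (sec F U)" shows "inv\<^bsub>sec F U\<^esub> f = inv\<^bsub>sec F' U\<^esub> f"
proof -
  interpret X: group "sec F U" by (rule A.sec_group[OF assms(1)])
  interpret Y: group "sec F' U" by (rule B.sec_group[OF assms(1)])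
  have "inv\<^bsub>sec F U\<^esub> f \<otimes>\<^bsub>sec F' U\<^esub> f = \<one>\<^bsub>sec F' U\<^esub>"
    using X.l_inv[OF assms(2)] mult_eq[OF assms(1)] one_eq[OF assms(1)] by simp
  then show ?thesis using Y.inv_equality mem_F' assms X.inv_closed by metis
qed

lemma N'_mult_coset:
  assumes U: "open U" and f: "f \<in> carrier (sec F U)"
  shows "carrier (sec N' U) <#>\<^bsub>sec F' U\<^esub> A.coset U f = B.coset U f"
proof -
  have "id \<in> hom (sec F U) (sec F' U)"
    using mem_F'[OF U] by (intro homI) (auto simp: mult_eq[OF U])
  from set_mult_hom_coset[OF A.sec_group[OF U] B.sec_group[OF U] this A.N_sub[OF U] B.N_sub[OF U] _ f]
  show ?thesis using N_subset[OF U] by simp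
qed

lemma coset_eq_mono:
  assumes "open U" "f \<in> carrier (sec F U)" "g \<in> carrier (sec F U)" "A.coset U f = A.coset U g"
  shows "B.coset U f = B.coset U g"
  using assms N_subset[OF assms(1)] mem_F'[OF assms(1)]
  by (auto simp: A.coset_eq_iff B.coset_eq_iff mult_eq inv_eq)

lemma germ_mono:
  assumes "open U" "x \<in> U" "f \<in> carrier (sec F U)" "open V" "x \<in> V" "g \<in> carrier (sec F V)"
    and "germ A.Q x (U, A.coset U f) = germ A.Q x (V, A.coset V g)"
  shows "germ B.Q x (U, B.coset U f) = germ B.Q x (V, B.coset V g)"
proof -
  obtain W where W: "open W" "x \<in> W" "W \<subseteq> U" "W \<subseteq> V"
    and "res A.Q U W (A.coset U f) = res A.Q V W (A.coset V g)"
    using assms by (auto simp: A.Q.germ_eq_iff A.coset_in_Q)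
  then have e: "A.coset W (res F U W f) = A.coset W (res F V W g)"
    using assms by (simp add: A.res_Q)
  have c: "res F U W f \<in> carrier (sec F W)" "res F V W g \<in> carrier (sec F W)"
    using W assms by (simp_all add: A.res_closed)
  have "B.coset W (res F' U W f) = B.coset W (res F' V W g)"
    using coset_eq_mono[OF W(1) c e] by (simp only: res_eq)
  then show ?thesis
    using W assms mem_F'
    by (subst B.Q.germ_eq_iff) (simp_all add: B.coset_in_Q, metis B.res_Q)
qed

text \<open>The union in the definition of the stalk map is over all representatives of a germ; by
  \<open>germ_mono\<close> all of them have the same image.\<close>

lemma smap_germ:
  assumes "open U" "x \<in> U" "f \<in> carrier (sec F U)"
  shows "smap x (germ A.Q x (U, A.coset U f)) = germ B.Q x (U, B.coset U f)"
proof -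
  have "germ B.Q x (V, carrier (sec N' V) <#>\<^bsub>sec F' V\<^esub> K) = germ B.Q x (U, B.coset U f)"
    if "(V, K) \<in> germ A.Q x (U, A.coset U f)" for V K
  proof -
    note * = A.Q.mem_germ[OF that assms(1,2) A.coset_in_Q[OF assms(3)]]
    then obtain g where g: "g \<in> carrier (sec F V)" "K = A.coset V g" by (auto simp: A.carrier_Q)
    show ?thesis
      unfolding g(2) N'_mult_coset[OF *(1) g(1)]
      by (rule germ_mono) (use * g assms in auto)
  qed
  moreover have "(U, A.coset U f) \<in> germ A.Q x (U, A.coset U f)"
    using assms by (intro A.Q.germ_self) (auto simp: A.coset_in_Q)
  ultimately show ?thesis unfolding smap_def by (intro subset_antisym UN_least) blast+
qed

lemma sheaf_local2':
  assumes "s \<in> carrier (sec (quot_sheaf F N) U)" "t \<in> carrier (sec (quot_sheaf F N) U)" "x \<in> U"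
  obtains V f g where "open V" "x \<in> V" "V \<subseteq> U" "f \<in> carrier (sec F V)" "g \<in> carrier (sec F V)"
    "\<And>y. y \<in> V \<Longrightarrow> s y = germ A.Q y (V, A.coset V f)" "\<And>y. y \<in> V \<Longrightarrow> t y = germ A.Q y (V, A.coset V g)"
proof (rule A.Q.sheaf_local2[OF assms[unfolded A.quot_sheaf_eq]])
  fix V K L assume V: "open V" "x \<in> V" "V \<subseteq> U" "K \<in> carrier (sec A.Q V)" "L \<in> carrier (sec A.Q V)"
    "\<And>y. y \<in> V \<Longrightarrow> s y = germ A.Q y (V, K)" "\<And>y. y \<in> V \<Longrightarrow> t y = germ A.Q y (V, L)"
  then obtain f g where "K = A.coset V f" "f \<in> carrier (sec F V)" "L = A.coset V g" "g \<in> carrier (sec F V)"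
    by (auto simp: A.carrier_Q)
  then show thesis using that[of V f g] V by simp
qed

lemma qmap_closed:
  assumes "s \<in> carrier (sec (quot_sheaf F N) U)"
  shows "qmap U s \<in> carrier (sec (quot_sheaf F' N') U)"
  unfolding B.quot_sheaf_eq
proof (rule B.Q.sheafI)
  fix x assume x: "x \<in> U"
  from sheaf_local2'[OF assms assms x] obtain V f where V: "open V" "x \<in> V" "V \<subseteq> U" "f \<in> carrier (sec F V)"
    "\<And>y. y \<in> V \<Longrightarrow> s y = germ A.Q y (V, A.coset V f)" by metis
  then have "\<forall>y\<in>V. qmap U s y = germ B.Q y (V, B.coset V f)"
    by (simp add: quot_map_smap smap_germ subset_iff)
  then show "\<exists>V K. open V \<and> x \<in> V \<and> V \<subseteq> U \<and> K \<in> carrier (sec B.Q V) \<and> (\<forall>y\<in>V. qmap U s y = germ B.Q y (V, K))"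
    using V by (intro exI[of _ V] exI[of _ "B.coset V f"]) (simp add: mem_F' B.coset_in_Q)
qed (simp add: quot_map_smap)

lemma qmap_cls:
  assumes "open U" "f \<in> carrier (sec F U)"
  shows "qmap U (A.cls U f) = B.cls U f"
  using assms by (simp add: quot_map_smap A.cls_def B.cls_def A.Q.gsec_def B.Q.gsec_def smap_germ cong: restrict_cong)

lemma qmap_res: "V \<subseteq> U \<Longrightarrow> qmap V (res (quot_sheaf F N) U V s) = res (quot_sheaf F' N') U V (qmap U s)"
  by (simp add: quot_map_smap A.quot_sheaf_eq B.quot_sheaf_eq A.Q.res_sheaf B.Q.res_sheaf restrict_def fun_eq_iff subset_iff)

lemma qmap_hom: "open U \<Longrightarrow> qmap U \<in> hom (sec (quot_sheaf F N) U) (sec (quot_sheaf F' N') U)"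
proof (rule homI)
  fix s t assume U: "open U" and st: "s \<in> carrier (sec (quot_sheaf F N) U)" "t \<in> carrier (sec (quot_sheaf F N) U)"
  show "qmap U (s \<otimes>\<^bsub>sec (quot_sheaf F N) U\<^esub> t) = qmap U s \<otimes>\<^bsub>sec (quot_sheaf F' N') U\<^esub> qmap U t"
    unfolding quot_map_smap A.quot_sheaf_eq B.quot_sheaf_eq A.Q.sheaf_mult B.Q.sheaf_mult
  proof (rule restrict_ext)
    fix x assume x: "x \<in> U"
    from sheaf_local2'[OF st x] obtain V f g where V: "open V" "x \<in> V" "V \<subseteq> U"
      "f \<in> carrier (sec F V)" "g \<in> carrier (sec F V)"
      "s x = germ A.Q x (V, A.coset V f)" "t x = germ A.Q x (V, A.coset V g)" by metis
    have fg: "f \<otimes>\<^bsub>sec F V\<^esub> g \<in> carrier (sec F V)"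
      using V monoid.m_closed[OF group.is_monoid[OF A.sec_group]] by blast
    show "smap x ((\<lambda>x\<in>U. s x \<otimes>\<^bsub>stalk A.Q x\<^esub> t x) x) =
      (\<lambda>x\<in>U. smap x (s x)) x \<otimes>\<^bsub>stalk B.Q x\<^esub> (\<lambda>x\<in>U. smap x (t x)) x"
      using x V fg mem_F'[OF V(1)]
      by (simp add: smap_germ A.Q.germ_mult A.coset_in_Q A.coset_mult B.Q.germ_mult B.coset_in_Q B.coset_mult mult_eq)
  qed
qed (auto simp: qmap_closed)

text \<open>The kernel of \<open>F/N \<rightarrow> F'/N'\<close> is \<open>(F \<inter> N')/N\<close>.\<close>

lemma smap_inj:
  assumes inter: "\<And>U. open U \<Longrightarrow> carrier (sec F U) \<inter> carrier (sec N' U) \<subseteq> carrier (sec N U)"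
  shows "inj_on (smap x) (carrier (stalk A.Q x))"
proof (rule inj_onI)
  fix a b assume a: "a \<in> carrier (stalk A.Q x)" "b \<in> carrier (stalk A.Q x)" "smap x a = smap x b"
  from a(1) obtain U f where U: "open U" "x \<in> U" "f \<in> carrier (sec F U)" "a = germ A.Q x (U, A.coset U f)"
    by (rule A.Q.stalk_elem) (auto simp: A.carrier_Q)
  from a(2) obtain V g where V: "open V" "x \<in> V" "g \<in> carrier (sec F V)" "b = germ A.Q x (V, A.coset V g)"
    by (rule A.Q.stalk_elem) (auto simp: A.carrier_Q)
  have "germ B.Q x (U, B.coset U f) = germ B.Q x (V, B.coset V g)"
    using a(3) U V by (simp add: smap_germ)
  then obtain W where W: "open W" "x \<in> W" "W \<subseteq> U" "W \<subseteq> V"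
    and "res B.Q U W (B.coset U f) = res B.Q V W (B.coset V g)"
    using U V mem_F' by (auto simp: B.Q.germ_eq_iff B.coset_in_Q)
  then have e: "B.coset W (res F U W f) = B.coset W (res F V W g)"
    unfolding res_eq using U V mem_F' by (simp add: B.res_Q)
  have fg: "res F U W f \<in> carrier (sec F W)" "res F V W g \<in> carrier (sec F W)"
    using U V W by (simp_all add: A.res_closed)
  interpret X: group "sec F W" by (rule A.sec_group[OF W(1)])
  have "res F U W f \<otimes>\<^bsub>sec F W\<^esub> inv\<^bsub>sec F W\<^esub> res F V W g \<in> carrier (sec N' W)"
    using e fg mem_F'[OF W(1)] W by (simp add: B.coset_eq_iff mult_eq inv_eq)
  then have "A.coset W (res F U W f) = A.coset W (res F V W g)"
    using fg W inter[OF W(1)] by (auto simp: A.coset_eq_iff)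
  then show "a = b"
    unfolding U(4) V(4) using U V W
    by (subst A.Q.germ_eq_iff) (auto simp: A.coset_in_Q A.res_Q)
qed

end

text \<open>The assumption \<open>p_surj\<close> is local because a surjective map of sheaves need not be surjective
  on sections.\<close>

locale exact_sequence =
  S: group_presheaf S + T: group_presheaf T + R: group_presheaf R
  for S :: "('a::topological_space, 'f) gpresheaf" and T :: "('a, 'g) gpresheaf" and R :: "('a, 'h) gpresheaf" +
  fixes \<iota> :: "'a set \<Rightarrow> 'f \<Rightarrow> 'g" and \<pi> :: "'a set \<Rightarrow> 'g \<Rightarrow> 'h"
  assumes comm: "open U \<Longrightarrow> comm_group (sec S U)" "open U \<Longrightarrow> comm_group (sec T U)" "open U \<Longrightarrow> comm_group (sec R U)"
    and i_hom: "open U \<Longrightarrow> \<iota> U \<in> hom (sec S U) (sec T U)"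
    and i_res: "\<lbrakk>open U; open V; V \<subseteq> U; s \<in> carrier (sec S U)\<rbrakk> \<Longrightarrow> \<iota> V (res S U V s) = res T U V (\<iota> U s)"
    and i_inj: "open U \<Longrightarrow> inj_on (\<iota> U) (carrier (sec S U))"
    and p_hom: "open U \<Longrightarrow> \<pi> U \<in> hom (sec T U) (sec R U)"
    and p_res: "\<lbrakk>open U; open V; V \<subseteq> U; t \<in> carrier (sec T U)\<rbrakk> \<Longrightarrow> \<pi> V (res T U V t) = res R U V (\<pi> U t)"
    and p_i: "\<lbrakk>open U; s \<in> carrier (sec S U)\<rbrakk> \<Longrightarrow> \<pi> U (\<iota> U s) = \<one>\<^bsub>sec R U\<^esub>"
    and ker: "\<lbrakk>open U; t \<in> carrier (sec T U); \<pi> U t = \<one>\<^bsub>sec R U\<^esub>\<rbrakk> \<Longrightarrow> t \<in> \<iota> U ` carrier (sec S U)"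
    and p_surj: "\<lbrakk>open U; r \<in> carrier (sec R U); x \<in> U\<rbrakk> \<Longrightarrow>
      \<exists>V t. open V \<and> x \<in> V \<and> V \<subseteq> U \<and> t \<in> carrier (sec T V) \<and> \<pi> V t = res R U V r"

text \<open>The third isomorphism theorem for sheaves, \<open>1 \<rightarrow> B/C \<rightarrow> A/C \<rightarrow> A/B \<rightarrow> 1\<close>. A section of \<open>A/C\<close>
  which dies in \<open>A/B\<close> comes locally from \<open>B\<close>; the local preimages in \<open>B/C\<close> are unique by
  injectivity on stalks and hence define a section.\<close>

lemma quotient_exact_sequence:
  fixes A B C :: "('a::topological_space, 'g) gpresheaf"
  assumes i: "quotient_inclusion B C A C" and p: "quotient_inclusion A C A B"
    and comm: "\<And>U. open U \<Longrightarrow> comm_group (sec (quot_sheaf B C) U)"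
      "\<And>U. open U \<Longrightarrow> comm_group (sec (quot_sheaf A C) U)"
      "\<And>U. open U \<Longrightarrow> comm_group (sec (quot_sheaf A B) U)"
  shows "exact_sequence (quot_sheaf B C) (quot_sheaf A C) (quot_sheaf A B) (quot_map A C) (quot_map A B)"
proof -
  interpret i: quotient_inclusion B C A C by (rule i)
  interpret p: quotient_inclusion A C A B by (rule p)
  have sinj: "inj_on (i.smap x) (carrier (stalk i.A.Q x))" for x
    by (rule i.smap_inj) auto
  show ?thesis
  proof (intro exact_sequence.intro exact_sequence_axioms.intro)
    show "inj_on (quot_map A C U) (carrier (sec (quot_sheaf B C) U))" if U: "open U" for U
    proof (rule inj_onI)
      fix s t assume s: "s \<in> carrier (sec (quot_sheaf B C) U)" "t \<in> carrier (sec (quot_sheaf B C) U)"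
        and e: "quot_map A C U s = quot_map A C U t"
      show "s = t"
      proof (rule i.A.Q.sheaf_ext[OF s[unfolded i.A.quot_sheaf_eq]])
        fix x assume x: "x \<in> U"
        have "i.smap x (s x) = i.smap x (t x)" using fun_cong[OF e, of x] x by (simp add: i.quot_map_smap)
        moreover have "s x \<in> carrier (stalk i.A.Q x)" "t x \<in> carrier (stalk i.A.Q x)"
          using s x by (auto simp: i.A.quot_sheaf_eq i.A.Q.carrier_sheaf)
        ultimately show "s x = t x" by (rule inj_onD[OF sinj])
      qed
    qed
    have pi_one: "quot_map A B U (quot_map A C U s) = \<one>\<^bsub>sec (quot_sheaf A B) U\<^esub>"
      if U: "open U" and s: "s \<in> carrier (sec (quot_sheaf B C) U)" for U s
      unfolding p.B.quot_sheaf_eq p.B.Q.sheaf_one p.quot_map_smap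
    proof (rule restrict_ext)
      fix x assume x: "x \<in> U"
      from i.sheaf_local2'[OF s s x] obtain V f where V: "open V" "x \<in> V" "V \<subseteq> U" "f \<in> carrier (sec B V)"
        "s x = germ i.A.Q x (V, i.A.coset V f)" by metis
      have "p.B.cls V f = \<one>\<^bsub>sec (quot_sheaf A B) V\<^esub>"
        using V i.mem_F' by (simp add: p.B.cls_eq_one_iff)
      then have "germ p.B.Q x (V, p.B.coset V f) = \<one>\<^bsub>stalk p.B.Q x\<^esub>"
        using V by (auto simp: p.B.cls_def p.B.Q.gsec_def p.B.quot_sheaf_eq p.B.Q.sheaf_one fun_eq_iff restrict_def split: if_splits)
      then show "p.smap x (quot_map A C U s x) = \<one>\<^bsub>stalk p.B.Q x\<^esub>"
        using x V i.mem_F' by (simp add: i.quot_map_smap i.smap_germ p.smap_germ)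
    qed
    then show "quot_map A B U (quot_map A C U s) = \<one>\<^bsub>sec (quot_sheaf A B) U\<^esub>"
      if "open U" "s \<in> carrier (sec (quot_sheaf B C) U)" for U s using that .
    show "t \<in> quot_map A C U ` carrier (sec (quot_sheaf B C) U)"
      if U: "open U" and t: "t \<in> carrier (sec (quot_sheaf A C) U)"
        and one: "quot_map A B U t = \<one>\<^bsub>sec (quot_sheaf A B) U\<^esub>" for U t
    proof -
      define s where "s = (\<lambda>x\<in>U. THE a. a \<in> carrier (stalk i.A.Q x) \<and> i.smap x a = t x)"
      have loc: "\<exists>V f. open V \<and> x \<in> V \<and> V \<subseteq> U \<and> f \<in> carrier (sec B V) \<and>
          (\<forall>y\<in>V. t y = germ i.B.Q y (V, i.B.coset V f))" if x: "x \<in> U" for x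
      proof -
        from p.sheaf_local2'[OF t t x] obtain V f where V: "open V" "x \<in> V" "V \<subseteq> U" "f \<in> carrier (sec A V)"
          "\<And>y. y \<in> V \<Longrightarrow> t y = germ i.B.Q y (V, i.B.coset V f)" by metis
        have "p.B.cls V f = \<one>\<^bsub>sec (quot_sheaf A B) V\<^esub>"
          unfolding p.B.quot_sheaf_eq p.B.Q.sheaf_one p.B.cls_def p.B.Q.gsec_def
        proof (rule restrict_ext)
          fix y assume y: "y \<in> V"
          then have "quot_map A B U t y = germ p.B.Q y (V, p.B.coset V f)"
            using V by (simp add: p.quot_map_smap p.smap_germ subset_iff)
          then show "germ p.B.Q y (V, p.B.coset V f) = \<one>\<^bsub>stalk p.B.Q y\<^esub>"
            using one y V by (simp add: p.B.quot_sheaf_eq p.B.Q.sheaf_one subset_iff)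
        qed
        then have "f \<in> carrier (sec B V)" using V by (simp add: p.B.cls_eq_one_iff)
        then show ?thesis using V by (intro exI[of _ V] exI[of _ f]) simp
      qed
      have s_loc: "s y = germ i.A.Q y (V, i.A.coset V f) \<and> i.smap y (s y) = t y"
        if V: "open V" "V \<subseteq> U" "f \<in> carrier (sec B V)" "\<forall>y\<in>V. t y = germ i.B.Q y (V, i.B.coset V f)" and y: "y \<in> V"
        for y V f
      proof -
        let ?a = "germ i.A.Q y (V, i.A.coset V f)"
        have c: "i.A.coset V f \<in> carrier (sec i.A.Q V)"
          by (rule i.A.coset_in_Q[OF V(3)])
        have a1: "?a \<in> carrier (stalk i.A.Q y)"
          by (rule i.A.Q.germ_in_stalk[OF V(1) y c])
        have a2: "i.smap y ?a = germ i.B.Q y (V, i.B.coset V f)"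
          by (rule i.smap_germ[OF V(1) y V(3)])
        have a3: "t y = germ i.B.Q y (V, i.B.coset V f)"
          by (rule bspec[OF V(4) y])
        have a4: "i.smap y ?a = t y" unfolding a2 a3 ..
        note a = a1 a4
        have "(THE a. a \<in> carrier (stalk i.A.Q y) \<and> i.smap y a = t y) = ?a"
        proof (rule the_equality)
          fix b assume "b \<in> carrier (stalk i.A.Q y) \<and> i.smap y b = t y"
          then have b: "b \<in> carrier (stalk i.A.Q y)" "i.smap y b = i.smap y ?a" unfolding a4 by blast+
          show "b = ?a" by (rule inj_onD[OF sinj b(2) b(1) a1])
        qed (rule conjI[OF a1 a4])
        moreover have "y \<in> U" using y V(2) by blast
        ultimately have "s y = ?a" unfolding s_def by simp
        then show ?thesis unfolding a4[symmetric] by simp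
      qed
      have "s \<in> carrier (sec (quot_sheaf B C) U)"
        unfolding i.A.quot_sheaf_eq
      proof (rule i.A.Q.sheafI)
        fix x assume "x \<in> U"
        from loc[OF this] obtain V f where V: "open V" "x \<in> V" "V \<subseteq> U" "f \<in> carrier (sec B V)"
          "\<forall>y\<in>V. t y = germ i.B.Q y (V, i.B.coset V f)" by metis
        then have "\<forall>y\<in>V. s y = germ i.A.Q y (V, i.A.coset V f)" using s_loc[OF V(1,3,4,5)] by simp
        then show "\<exists>V K. open V \<and> x \<in> V \<and> V \<subseteq> U \<and> K \<in> carrier (sec i.A.Q V) \<and> (\<forall>y\<in>V. s y = germ i.A.Q y (V, K))"
          using V by (intro exI[of _ V] exI[of _ "i.A.coset V f"]) (simp add: i.A.coset_in_Q)
      qed (simp add: s_def)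
      moreover have "quot_map A C U s = t"
      proof (rule i.B.Q.sheaf_ext)
        show "quot_map A C U s \<in> carrier (sec i.B.Q.sheaf U)"
          using i.qmap_closed[OF \<open>s \<in> _\<close>] by (simp add: i.B.quot_sheaf_eq)
        show "t \<in> carrier (sec i.B.Q.sheaf U)" using t by (simp add: i.B.quot_sheaf_eq)
        fix x assume x: "x \<in> U"
        have "i.smap x (s x) = t x" using loc[OF x] s_loc by metis
        then show "quot_map A C U s x = t x" using x by (simp add: i.quot_map_smap)
      qed
      ultimately show ?thesis by blast
    qed
    show "\<exists>V t. open V \<and> x \<in> V \<and> V \<subseteq> U \<and> t \<in> carrier (sec (quot_sheaf A C) V) \<and>
        quot_map A B V t = res (quot_sheaf A B) U V r"
      if "open U" "r \<in> carrier (sec (quot_sheaf A B) U)" "x \<in> U" for U r x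
    proof -
      from p.B.cls_locally[OF that(2,3)] obtain V f where V: "open V" "x \<in> V" "V \<subseteq> U"
        "f \<in> carrier (sec A V)" "res (quot_sheaf A B) U V r = p.B.cls V f" .
      then show ?thesis
        by (intro exI[of _ V] exI[of _ "i.B.cls V f"]) (simp add: i.B.cls_closed p.qmap_cls)
    qed
  qed (simp_all add: comm i.A.quot_presheaf_group i.B.quot_presheaf_group p.B.quot_presheaf_group
        i.qmap_hom p.qmap_hom i.qmap_res p.qmap_res)
qed

section \<open>Cech cohomology in low degrees\<close>

lemma finprod_hom:
  assumes "comm_group G" "comm_group H" "h \<in> hom G H" "f \<in> A \<rightarrow> carrier G"
  shows "h (finprod G f A) = finprod H (\<lambda>x. h (f x)) A"
proof -
  interpret G: comm_group G by fact
  interpret H: comm_group H by fact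
  have h1: "h \<one>\<^bsub>G\<^esub> = \<one>\<^bsub>H\<^esub>" by (rule hom_one[OF assms(3) G.group_axioms H.group_axioms])
  show ?thesis
    using assms(4)
  proof (induction A rule: infinite_finite_induct)
    case (insert x A)
    have "finprod G f A \<in> carrier G" using insert by (intro G.finprod_closed) auto
    moreover have "(\<lambda>x. h (f x)) \<in> A \<rightarrow> carrier H" "h (f x) \<in> carrier H"
      using insert hom_in_carrier[OF assms(3)] by (auto simp: Pi_iff)
    ultimately show ?case
      using insert hom_mult[OF assms(3)] by (simp add: Pi_iff)
  qed (simp_all add: h1)
qed

lemma (in comm_monoid) finprod_atMost_1:
  assumes "f 0 \<in> carrier G" "f (Suc 0) \<in> carrier G"
  shows "finprod G f {..Suc 0} = f (Suc 0) \<otimes> f 0"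
  using assms by (subst finprod_Suc) (auto simp: le_Suc_eq Pi_iff)

lemma (in comm_monoid) finprod_atMost_2:
  assumes "f 0 \<in> carrier G" "f (Suc 0) \<in> carrier G" "f (Suc (Suc 0)) \<in> carrier G"
  shows "finprod G f {..Suc (Suc 0)} = f (Suc (Suc 0)) \<otimes> (f (Suc 0) \<otimes> f 0)"
  using assms by (subst finprod_Suc) (auto simp: le_Suc_eq Pi_iff finprod_atMost_1)

text \<open>The identity behind \<open>\<delta>\<^sup>1 \<delta>\<^sup>0 = 1\<close>, for the values \<open>c\<close>, \<open>b\<close>, \<open>a\<close> of a 0-cochain at the three
  vertices of a simplex.\<close>

lemma (in comm_group) cocycle_identity:
  assumes "a \<in> carrier G" "b \<in> carrier G" "c \<in> carrier G"
  shows "a \<otimes> inv b \<otimes> inv (a \<otimes> inv c) \<otimes> (b \<otimes> inv c) = \<one>"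
proof -
  have "a \<otimes> inv b \<otimes> inv (a \<otimes> inv c) \<otimes> (b \<otimes> inv c) = (a \<otimes> inv a) \<otimes> ((b \<otimes> inv b) \<otimes> (c \<otimes> inv c))"
    using assms by (simp only: inv_mult inv_inv inv_closed m_closed m_ac)
  then show ?thesis using assms by simp
qed

lemma comm_group_product_group:
  assumes "\<And>i. i \<in> I \<Longrightarrow> comm_group (G i)"
  shows "comm_group (product_group I G)"
proof (rule group.group_comm_groupI)
  show "group (product_group I G)" using assms by (simp add: comm_group.axioms(2))
  show "x \<otimes>\<^bsub>product_group I G\<^esub> y = y \<otimes>\<^bsub>product_group I G\<^esub> x"
    if "x \<in> carrier (product_group I G)" "y \<in> carrier (product_group I G)" for x y
    unfolding mult_product_group
  proof (rule restrict_ext)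
    fix i assume i: "i \<in> I"
    interpret comm_group "G i" by (rule assms[OF i])
    have "x i \<in> carrier (G i)" "y i \<in> carrier (G i)" using that i by auto
    then show "x i \<otimes>\<^bsub>G i\<^esub> y i = y i \<otimes>\<^bsub>G i\<^esub> x i" by (rule m_comm)
  qed
qed

lemma open_cap: "pcover U \<Longrightarrow> open (cap U xs)"
  unfolding cap_def pcover_def by (intro open_INT) auto

lemma cap_mono: "(\<And>x. V x \<subseteq> U x) \<Longrightarrow> cap V xs \<subseteq> cap U xs"
  unfolding cap_def by blast

lemma set_face: "set (face i xs) \<subseteq> set xs"
  unfolding face_def by (auto dest: in_set_takeD in_set_dropD)

lemma cap_face: "cap U xs \<subseteq> cap U (face i xs)"
  using set_face[of i xs] unfolding cap_def by blast

lemma face_simplices: "xs \<in> simplices (Suc n) \<Longrightarrow> i \<le> Suc n \<Longrightarrow> face i xs \<in> simplices n"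
  by (auto simp: simplices_def face_def)

lemma pcover_Int: "pcover U \<Longrightarrow> pcover V \<Longrightarrow> pcover (\<lambda>x. U x \<inter> V x)"
  unfolding pcover_def by auto

text \<open>The sign \<open>(-1)\<^sup>i\<close>, written multiplicatively.\<close>

definition lift_sign :: "('g, 'm) monoid_scheme \<Rightarrow> nat \<Rightarrow> 'g \<Rightarrow> 'g" where
  "lift_sign G i y = (if even i then y else inv\<^bsub>G\<^esub> y)"

lemma cobd_def': "cobd n U F c = (\<lambda>xs\<in>simplices (Suc n).
     finprod (sec F (cap U xs))
       (\<lambda>i. lift_sign (sec F (cap U xs)) i (res F (cap U (face i xs)) (cap U xs) (c (face i xs)))) {..Suc n})"
  by (simp add: cobd_def lift_sign_def Let_def)

locale abelian_presheaf = group_presheaf A for A :: "('a::topological_space, 'g) gpresheaf" +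
  assumes sec_comm: "open U \<Longrightarrow> comm_group (sec A U)"
begin

abbreviation C :: "nat \<Rightarrow> ('a \<Rightarrow> 'a set) \<Rightarrow> ('a list \<Rightarrow> 'g) monoid" where
  "C n U \<equiv> cochains n U A"

abbreviation \<delta> :: "nat \<Rightarrow> ('a \<Rightarrow> 'a set) \<Rightarrow> ('a list \<Rightarrow> 'g) \<Rightarrow> 'a list \<Rightarrow> 'g" where
  "\<delta> n U \<equiv> cobd n U A"

lemma C_comm: "pcover U \<Longrightarrow> comm_group (C n U)"
  unfolding cochains_def by (rule comm_group_product_group) (simp add: sec_comm open_cap)

lemma C_iff: "c \<in> carrier (C n U) \<longleftrightarrow> c \<in> extensional (simplices n) \<and>
    (\<forall>xs\<in>simplices n. c xs \<in> carrier (sec A (cap U xs)))"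
  by (auto simp: cochains_def PiE_iff)

lemma C_mult: "c \<otimes>\<^bsub>C n U\<^esub> d = (\<lambda>xs\<in>simplices n. c xs \<otimes>\<^bsub>sec A (cap U xs)\<^esub> d xs)"
  and C_one: "\<one>\<^bsub>C n U\<^esub> = (\<lambda>xs\<in>simplices n. \<one>\<^bsub>sec A (cap U xs)\<^esub>)"
  by (simp_all add: cochains_def)

lemma lift_sign_closed: "open U \<Longrightarrow> y \<in> carrier (sec A U) \<Longrightarrow> lift_sign (sec A U) i y \<in> carrier (sec A U)"
  by (simp add: lift_sign_def group.inv_closed[OF sec_group])

lemma face_term_closed:
  assumes "pcover U" "c \<in> carrier (C n U)" "xs \<in> simplices (Suc n)" "i \<le> Suc n"
  shows "res A (cap U (face i xs)) (cap U xs) (c (face i xs)) \<in> carrier (sec A (cap U xs))"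
  using assms by (intro res_closed) (auto simp: open_cap cap_face[THEN subsetD] C_iff face_simplices)

lemma cobd_closed: "pcover U \<Longrightarrow> c \<in> carrier (C n U) \<Longrightarrow> \<delta> n U c \<in> carrier (C (Suc n) U)"
  unfolding C_iff[where n="Suc n"]
proof (intro conjI ballI)
  fix xs :: "'a list" assume a: "pcover U" "c \<in> carrier (C n U)" "xs \<in> simplices (Suc n)"
  interpret comm_group "sec A (cap U xs)" by (rule sec_comm) (simp add: open_cap a)
  have "finprod (sec A (cap U xs)) (\<lambda>i. lift_sign (sec A (cap U xs)) i
      (res A (cap U (face i xs)) (cap U xs) (c (face i xs)))) {..Suc n} \<in> carrier (sec A (cap U xs))"
    by (rule finprod_closed) (use a in \<open>auto intro!: lift_sign_closed face_term_closed open_cap\<close>)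
  then show "\<delta> n U c xs \<in> carrier (sec A (cap U xs))" using a by (simp add: cobd_def')
qed (simp add: cobd_def)

text \<open>The coboundary is a product of homomorphisms into an abelian group.\<close>

lemma cobd_mult:
  assumes U: "pcover U" and c: "c \<in> carrier (C n U)" and d: "d \<in> carrier (C n U)"
  shows "\<delta> n U (c \<otimes>\<^bsub>C n U\<^esub> d) = \<delta> n U c \<otimes>\<^bsub>C (Suc n) U\<^esub> \<delta> n U d"
  unfolding C_mult[where n="Suc n"]
proof (subst cobd_def', rule restrict_ext)
  fix xs :: "'a list" assume xs: "xs \<in> simplices (Suc n)"
  let ?G = "sec A (cap U xs)"
  interpret comm_group ?G by (rule sec_comm) (simp add: open_cap U)
  have o: "open (cap U ys)" for ys using open_cap[OF U] .
  let ?t = "\<lambda>c i. lift_sign ?G i (res A (cap U (face i xs)) (cap U xs) (c (face i xs)))"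
  have cl: "?t e i \<in> carrier ?G" if "e \<in> carrier (C n U)" "i \<le> Suc n" for e i
    using that xs U by (auto intro!: lift_sign_closed face_term_closed o)
  have "?t (c \<otimes>\<^bsub>C n U\<^esub> d) i = ?t c i \<otimes>\<^bsub>?G\<^esub> ?t d i" if i: "i \<le> Suc n" for i
  proof -
    have f: "face i xs \<in> simplices n" using face_simplices xs i .
    have "res A (cap U (face i xs)) (cap U xs) ((c \<otimes>\<^bsub>C n U\<^esub> d) (face i xs)) =
      res A (cap U (face i xs)) (cap U xs) (c (face i xs)) \<otimes>\<^bsub>?G\<^esub> res A (cap U (face i xs)) (cap U xs) (d (face i xs))"
      using f c d by (simp add: C_mult res_mult o cap_face C_iff)
    then show ?thesis
      using face_term_closed[OF U c xs i] face_term_closed[OF U d xs i]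
      by (simp add: lift_sign_def inv_mult)
  qed
  then have "finprod ?G (?t (c \<otimes>\<^bsub>C n U\<^esub> d)) {..Suc n} = finprod ?G (\<lambda>i. ?t c i \<otimes>\<^bsub>?G\<^esub> ?t d i) {..Suc n}"
    by (intro finprod_cong') (use cl c d in auto)
  also have "\<dots> = finprod ?G (?t c) {..Suc n} \<otimes>\<^bsub>?G\<^esub> finprod ?G (?t d) {..Suc n}"
    by (rule finprod_multf) (use cl c d in auto)
  finally show "finprod ?G (?t (c \<otimes>\<^bsub>C n U\<^esub> d)) {..Suc n} = \<delta> n U c xs \<otimes>\<^bsub>?G\<^esub> \<delta> n U d xs"
    using xs by (simp add: cobd_def')
qed

lemma cobd_hom: "pcover U \<Longrightarrow> \<delta> n U \<in> hom (C n U) (C (Suc n) U)"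
  by (rule homI) (simp_all add: cobd_closed cobd_mult)

lemma cobd_one: "pcover U \<Longrightarrow> \<delta> n U \<one>\<^bsub>C n U\<^esub> = \<one>\<^bsub>C (Suc n) U\<^esub>"
  by (rule hom_one[OF cobd_hom]) (simp_all add: comm_group.axioms(2)[OF C_comm])

abbreviation rf :: "nat \<Rightarrow> ('a \<Rightarrow> 'a set) \<Rightarrow> ('a \<Rightarrow> 'a set) \<Rightarrow> ('a list \<Rightarrow> 'g) \<Rightarrow> 'a list \<Rightarrow> 'g" where
  "rf n U V \<equiv> refine_cochain n A U V"

lemma refine_closed:
  "\<lbrakk>pcover U; pcover V; \<forall>x. V x \<subseteq> U x; c \<in> carrier (C n U)\<rbrakk> \<Longrightarrow> rf n U V c \<in> carrier (C n V)"
  by (simp add: C_iff refine_cochain_def open_cap cap_mono res_closed)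

lemma refine_mult:
  "\<lbrakk>pcover U; pcover V; \<forall>x. V x \<subseteq> U x; c \<in> carrier (C n U); d \<in> carrier (C n U)\<rbrakk>
    \<Longrightarrow> rf n U V (c \<otimes>\<^bsub>C n U\<^esub> d) = rf n U V c \<otimes>\<^bsub>C n V\<^esub> rf n U V d"
  unfolding C_mult refine_cochain_def
  by (rule restrict_ext) (simp add: C_iff open_cap cap_mono res_mult)

lemma refine_hom: "\<lbrakk>pcover U; pcover V; \<forall>x. V x \<subseteq> U x\<rbrakk> \<Longrightarrow> rf n U V \<in> hom (C n U) (C n V)"
  by (rule homI) (simp_all add: refine_closed refine_mult)

lemma refine_one: "\<lbrakk>pcover U; pcover V; \<forall>x. V x \<subseteq> U x\<rbrakk> \<Longrightarrow> rf n U V \<one>\<^bsub>C n U\<^esub> = \<one>\<^bsub>C n V\<^esub>"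
  by (rule hom_one[OF refine_hom]) (simp_all add: comm_group.axioms(2)[OF C_comm])

lemma refine_refine: "\<lbrakk>pcover U; pcover V; pcover W; \<forall>x. V x \<subseteq> U x; \<forall>x. W x \<subseteq> V x; c \<in> carrier (C n U)\<rbrakk>
    \<Longrightarrow> rf n V W (rf n U V c) = rf n U W c"
  unfolding refine_cochain_def
  by (rule restrict_ext) (simp add: C_iff open_cap cap_mono res_comp)

lemma refine_cobd:
  assumes U: "pcover U" and V: "pcover V" and UV: "\<forall>x. V x \<subseteq> U x" and c: "c \<in> carrier (C n U)"
  shows "rf (Suc n) U V (\<delta> n U c) = \<delta> n V (rf n U V c)"
  unfolding refine_cochain_def[where n="Suc n"]
proof (subst (2) cobd_def', rule restrict_ext)
  fix xs :: "'a list" assume xs: "xs \<in> simplices (Suc n)"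
  have o: "open (cap U ys)" "open (cap V ys)" for ys using open_cap U V by auto
  have s: "cap V ys \<subseteq> cap U ys" for ys using UV cap_mono[of V U] by blast
  have r: "res A (cap U xs) (cap V xs) (lift_sign (sec A (cap U xs)) i (res A (cap U (face i xs)) (cap U xs) (c (face i xs))))
      = lift_sign (sec A (cap V xs)) i (res A (cap V (face i xs)) (cap V xs) (rf n U V c (face i xs)))"
    if i: "i \<le> Suc n" for i
  proof -
    have f: "face i xs \<in> simplices n" using face_simplices xs i .
    have cf: "c (face i xs) \<in> carrier (sec A (cap U (face i xs)))" using c f by (simp add: C_iff)
    have "cap V xs \<subseteq> cap V (face i xs)" "cap U xs \<subseteq> cap U (face i xs)" by (simp_all add: cap_face)
    then have "res A (cap V (face i xs)) (cap V xs) (rf n U V c (face i xs)) =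
       res A (cap U xs) (cap V xs) (res A (cap U (face i xs)) (cap U xs) (c (face i xs)))"
      using f cf by (simp add: refine_cochain_def res_comp o s)
    then show ?thesis
      using face_term_closed[OF U c xs i] by (simp add: lift_sign_def res_inv o s)
  qed
  interpret V: comm_group "sec A (cap V xs)" by (rule sec_comm[OF o(2)])
  have cl: "lift_sign (sec A (cap U xs)) i (res A (cap U (face i xs)) (cap U xs) (c (face i xs))) \<in> carrier (sec A (cap U xs))"
    if "i \<le> Suc n" for i using that face_term_closed[OF U c xs] lift_sign_closed o by simp
  have "res A (cap U xs) (cap V xs) (\<delta> n U c xs) = finprod (sec A (cap V xs))
     (\<lambda>i. res A (cap U xs) (cap V xs) (lift_sign (sec A (cap U xs)) i (res A (cap U (face i xs)) (cap U xs) (c (face i xs))))) {..Suc n}"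
    using xs by (subst finprod_hom[OF sec_comm sec_comm res_hom, symmetric]) (simp_all add: o s cl cobd_def')
  also have "\<dots> = finprod (sec A (cap V xs))
     (\<lambda>i. lift_sign (sec A (cap V xs)) i (res A (cap V (face i xs)) (cap V xs) (rf n U V c (face i xs)))) {..Suc n}"
  proof (rule V.finprod_cong'[OF refl])
    show "(\<lambda>i. lift_sign (sec A (cap V xs)) i (res A (cap V (face i xs)) (cap V xs) (rf n U V c (face i xs)))) \<in> {..Suc n} \<rightarrow> carrier (sec A (cap V xs))"
      using face_term_closed[OF V refine_closed[OF U V UV c] xs] lift_sign_closed[OF o(2)] by (simp add: Pi_iff)
  qed (simp add: r)
  finally show "res A (cap U xs) (cap V xs) (\<delta> n U c xs) = \<dots>" .
qed

text \<open>The later vertex comes first: \<open>(\<delta>c)(x, y) = c(y) c(x)\<^sup>-\<^sup>1\<close>. This order decides on which side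
  cocycles have to be twisted.\<close>

lemma cobd_0:
  assumes "pcover U" "c \<in> carrier (C 0 U)"
  shows "\<delta> 0 U c [x, y] = res A (U y) (U x \<inter> U y) (c [y]) \<otimes>\<^bsub>sec A (U x \<inter> U y)\<^esub>
    inv\<^bsub>sec A (U x \<inter> U y)\<^esub> res A (U x) (U x \<inter> U y) (c [x])"
proof -
  have o: "open (U x)" "open (U y)" using assms(1) by (auto simp: pcover_def)
  interpret comm_group "sec A (U x \<inter> U y)" by (rule sec_comm) (use o in auto)
  have f: "face 0 [x, y] = [y]" "face (Suc 0) [x, y] = [x]" by (simp_all add: face_def)
  have k: "cap U [x, y] = U x \<inter> U y" "cap U [x] = U x" "cap U [y] = U y" by (auto simp: cap_def)
  have "c [x] \<in> carrier (sec A (U x))" "c [y] \<in> carrier (sec A (U y))"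
    using assms(2) C_iff[of c 0 U] by (auto simp: simplices_def cap_def dest: spec[of _ "[x]"] spec[of _ "[y]"])
  then have cl: "res A (U x) (U x \<inter> U y) (c [x]) \<in> carrier (sec A (U x \<inter> U y))"
    "res A (U y) (U x \<inter> U y) (c [y]) \<in> carrier (sec A (U x \<inter> U y))"
    using o by (auto intro!: res_closed)
  have "[x, y] \<in> simplices (Suc 0)" by (simp add: simplices_def)
  then show ?thesis using cl by (simp add: cobd_def' finprod_atMost_1 f k lift_sign_def m_comm)
qed

lemma cobd_1:
  assumes "pcover U" "c \<in> carrier (C 1 U)"
  defines "W \<equiv> \<lambda>x y z. U x \<inter> U y \<inter> U z"
  shows "\<delta> 1 U c [x, y, z] = (res A (U y \<inter> U z) (W x y z) (c [y, z]) \<otimes>\<^bsub>sec A (W x y z)\<^esub>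
    inv\<^bsub>sec A (W x y z)\<^esub> res A (U x \<inter> U z) (W x y z) (c [x, z]))
    \<otimes>\<^bsub>sec A (W x y z)\<^esub> res A (U x \<inter> U y) (W x y z) (c [x, y])"
proof -
  have o: "open (U x)" "open (U y)" "open (U z)" using assms(1) by (auto simp: pcover_def)
  interpret comm_group "sec A (W x y z)" by (rule sec_comm) (use o in \<open>auto simp: W_def\<close>)
  have f: "face 0 [x, y, z] = [y, z]" "face (Suc 0) [x, y, z] = [x, z]" "face (Suc (Suc 0)) [x, y, z] = [x, y]"
    by (simp_all add: face_def)
  have k: "cap U [x, y, z] = W x y z" "\<And>x y. cap U [x, y] = U x \<inter> U y" by (auto simp: cap_def W_def)
  have c2: "c [x, y] \<in> carrier (sec A (U x \<inter> U y))" for x y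
    using assms(2) C_iff[of c 1 U] by (auto simp: simplices_def cap_def dest: spec[of _ "[x, y]"])
  have cl: "res A (U y \<inter> U z) (W x y z) (c [y, z]) \<in> carrier (sec A (W x y z))"
    "res A (U x \<inter> U z) (W x y z) (c [x, z]) \<in> carrier (sec A (W x y z))"
    "res A (U x \<inter> U y) (W x y z) (c [x, y]) \<in> carrier (sec A (W x y z))"
    using o c2 by (auto intro!: res_closed simp: W_def)
  have "[x, y, z] \<in> simplices (Suc (Suc 0))" by (simp add: simplices_def)
  then show ?thesis using cl
    by (simp add: cobd_def' finprod_atMost_2 f k lift_sign_def m_ac)
qed

lemma simplices_1E: assumes "xs \<in> simplices (Suc 0)" obtains x y where "xs = [x, y]"
  using assms by (auto simp: simplices_def length_Suc_conv)

lemma simplices_2E: assumes "xs \<in> simplices (Suc (Suc 0))" obtains x y z where "xs = [x, y, z]"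
  using assms by (auto simp: simplices_def length_Suc_conv)

text \<open>By the explicit formulas in degrees 0 and 1 this is \<open>cocycle_identity\<close> at the three vertices.
  The connecting maps out of \<open>H\<^sup>0\<close> and \<open>H\<^sup>1\<close> rest on it.\<close>

lemma cobd_cobd:
  assumes U: "pcover U" and c: "c \<in> carrier (C 0 U)"
  shows "\<delta> 1 U (\<delta> 0 U c) = \<one>\<^bsub>C 2 U\<^esub>"
proof (rule extensionalityI)
  show "\<delta> 1 U (\<delta> 0 U c) \<in> extensional (simplices 2)" by (simp add: cobd_def numeral_2_eq_2)
  show "\<one>\<^bsub>C 2 U\<^esub> \<in> extensional (simplices 2)" by (simp add: C_one)
  fix xs :: "'a list" assume xs: "xs \<in> simplices 2"
  then obtain x y z where e: "xs = [x, y, z]" by (auto simp: numeral_2_eq_2 elim: simplices_2E)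
  have o: "open (U x)" for x using U by (auto simp: pcover_def)
  let ?W = "U x \<inter> U y \<inter> U z"
  interpret comm_group "sec A ?W" by (rule sec_comm) (use o in auto)
  have c1: "c [u] \<in> carrier (sec A (U u))" for u
    using c C_iff[of c 0 U] by (auto simp: simplices_def cap_def dest: spec[of _ "[u]"])
  have t: "res A (U u \<inter> U v) ?W (\<delta> 0 U c [u, v]) =
     res A (U v) ?W (c [v]) \<otimes>\<^bsub>sec A ?W\<^esub> inv\<^bsub>sec A ?W\<^esub> res A (U u) ?W (c [u])"
    if "?W \<subseteq> U u" "?W \<subseteq> U v" for u v
  proof -
    have "res A (U v) (U u \<inter> U v) (c [v]) \<in> carrier (sec A (U u \<inter> U v))"
      "res A (U u) (U u \<inter> U v) (c [u]) \<in> carrier (sec A (U u \<inter> U v))"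
      using o c1 by (auto intro!: res_closed)
    then show ?thesis
      using that o c1 by (simp add: cobd_0[OF U c] res_mult res_inv open_Int group.inv_closed[OF sec_group] res_comp)
  qed
  have "res A (U u) ?W (c [u]) \<in> carrier (sec A ?W)" if "?W \<subseteq> U u" for u
    using that o c1 by (intro res_closed) auto
  then have cl: "res A (U x) ?W (c [x]) \<in> carrier (sec A ?W)" "res A (U y) ?W (c [y]) \<in> carrier (sec A ?W)"
    "res A (U z) ?W (c [z]) \<in> carrier (sec A ?W)" by auto
  have "\<delta> 1 U (\<delta> 0 U c) xs = \<one>\<^bsub>sec A ?W\<^esub>"
    using cl cobd_1[OF U cobd_closed[OF U c, folded One_nat_def], of x y z] unfolding e
    by (simp add: t le_infI1 le_infI2 cocycle_identity)
  then show "\<delta> 1 U (\<delta> 0 U c) xs = \<one>\<^bsub>C 2 U\<^esub> xs"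
    using xs by (simp add: C_one e cap_def Int_assoc)
qed

end

context abelian_presheaf
begin

abbreviation Z :: "nat \<Rightarrow> ('a \<Rightarrow> 'a set) \<Rightarrow> ('a list \<Rightarrow> 'g) set" where
  "Z n U \<equiv> cocycles n U A"

abbreviation B :: "nat \<Rightarrow> ('a \<Rightarrow> 'a set) \<Rightarrow> ('a list \<Rightarrow> 'g) set" where
  "B n U \<equiv> coboundaries n U A"

abbreviation kls :: "nat \<Rightarrow> ('a \<Rightarrow> 'a set) \<Rightarrow> ('a list \<Rightarrow> 'g) \<Rightarrow> ('a list \<Rightarrow> 'g) set" where
  "kls n U c \<equiv> B n U #>\<^bsub>C n U\<^esub> c"

lemma C_group: "pcover U \<Longrightarrow> group (C n U)"
  using C_comm comm_group.axioms(2) by blast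

lemma cobd_group_hom: "pcover U \<Longrightarrow> group_hom (C n U) (C (Suc n) U) (\<delta> n U)"
  by (simp add: group_hom_def group_hom_axioms_def C_group cobd_hom)

lemma Z_subgroup: "pcover U \<Longrightarrow> subgroup (Z n U) (C n U)"
  using group_hom.subgroup_kernel[OF cobd_group_hom] by (simp add: cocycles_def kernel_def)

lemma Z_carrier: "c \<in> Z n U \<Longrightarrow> c \<in> carrier (C n U)"
  by (simp add: cocycles_def)

lemma B_subgroup: "pcover U \<Longrightarrow> subgroup (B n U) (C n U)"
  by (cases n) (simp_all add: coboundaries_def group.triv_subgroup[OF C_group]
      group_hom.img_is_subgroup[OF cobd_group_hom])

lemma refine_Z:
  assumes "pcover U" "pcover V" "\<forall>x. V x \<subseteq> U x" "c \<in> Z n U"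
  shows "rf n U V c \<in> Z n V"
  using assms refine_cobd[of U V c n] refine_closed[of U V c n] refine_one[of U V "Suc n"]
  by (simp add: cocycles_def)

lemma refine_B:
  assumes "pcover U" "pcover V" "\<forall>x. V x \<subseteq> U x"
  shows "rf n U V ` B n U \<subseteq> B n V"
proof (cases n)
  case 0
  then show ?thesis using refine_one[OF assms, of 0] by (simp add: coboundaries_def)
next
  case (Suc m)
  have "rf (Suc m) U V (\<delta> m U c) \<in> \<delta> m V ` carrier (C m V)" if "c \<in> carrier (C m U)" for c
    using refine_cobd[OF assms that] refine_closed[OF assms that] by simp
  then show ?thesis using Suc by (auto simp: coboundaries_def)
qed

lemma refine_class_kls:
  assumes "pcover U" "pcover V" "\<forall>x. V x \<subseteq> U x" "c \<in> carrier (C n U)"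
  shows "refine_class n A U V (kls n U c) = kls n V (rf n U V c)"
  unfolding refine_class_def
  by (rule set_mult_hom_coset)
     (use assms in \<open>simp_all add: C_group refine_hom B_subgroup refine_B\<close>)

lemma carrier_cover_cohom: "carrier (cover_cohom n A U) = kls n U ` Z n U"
  by (auto simp: cover_cohom_def FactGroup_def RCOSETS_def r_coset_def)

lemma one_cover_cohom: "pcover U \<Longrightarrow> \<one>\<^bsub>cover_cohom n A U\<^esub> = kls n U \<one>\<^bsub>C n U\<^esub>"
  using group.coset_mult_one[OF C_group, of U "B n U"] subgroup.subset[OF B_subgroup]
  by (simp add: cover_cohom_def FactGroup_def)

sublocale coh: direct_system "Collect pcover" "\<lambda>U V. \<forall>x. V x \<subseteq> U x" "cover_cohom n A" "refine_class n A" for n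
proof (rule direct_system.intro)
  show "\<exists>W\<in>Collect pcover. (\<forall>x. W x \<subseteq> U x) \<and> (\<forall>x. W x \<subseteq> V x)"
    if "U \<in> Collect pcover" "V \<in> Collect pcover" for U V :: "'a \<Rightarrow> 'a set"
    using that by (intro bexI[of _ "\<lambda>x. U x \<inter> V x"]) (auto simp: pcover_Int)
  show "refine_class n A U V K \<in> carrier (cover_cohom n A V)"
    if "U \<in> Collect pcover" "V \<in> Collect pcover" "\<forall>x. V x \<subseteq> U x" "K \<in> carrier (cover_cohom n A U)" for U V K
    using that by (auto simp: carrier_cover_cohom refine_class_kls Z_carrier refine_Z)
  show "refine_class n A V W (refine_class n A U V K) = refine_class n A U W K"
    if "U \<in> Collect pcover" "V \<in> Collect pcover" "W \<in> Collect pcover" "\<forall>x. V x \<subseteq> U x" "\<forall>x. W x \<subseteq> V x"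
      "K \<in> carrier (cover_cohom n A U)" for U V W K
  proof -
    from that obtain c where c: "c \<in> Z n U" "K = kls n U c" by (auto simp: carrier_cover_cohom)
    have "\<forall>x. W x \<subseteq> U x" using that by blast
    then show ?thesis
      using that c by (simp add: refine_class_kls Z_carrier refine_closed refine_refine)
  qed
qed blast+

abbreviation hclass :: "nat \<Rightarrow> ('a \<Rightarrow> 'a set) \<Rightarrow> ('a list \<Rightarrow> 'g) \<Rightarrow> (('a \<Rightarrow> 'a set) \<times> ('a list \<Rightarrow> 'g) set) set" where
  "hclass n U c \<equiv> cohom_class n A U c"

lemma hclass_eq: "hclass n U c = coh.cl n (U, kls n U c)"
  by (simp add: cohom_class_def)

lemma kls_in: "c \<in> Z n U \<Longrightarrow> kls n U c \<in> carrier (cover_cohom n A U)"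
  by (auto simp: carrier_cover_cohom)

lemma hclass_refine:
  assumes "pcover U" "pcover V" "\<forall>x. V x \<subseteq> U x" "c \<in> Z n U"
  shows "hclass n V (rf n U V c) = hclass n U c"
  using coh.cl_push[of U V "kls n U c" n] assms
  by (simp add: hclass_eq kls_in refine_class_kls Z_carrier)

lemma kls_eq_iff:
  assumes U: "pcover U" and c: "c \<in> carrier (C n U)" and d: "d \<in> carrier (C n U)"
  shows "kls n U c = kls n U d \<longleftrightarrow> (\<exists>b\<in>B n U. c = b \<otimes>\<^bsub>C n U\<^esub> d)"
proof
  assume "kls n U c = kls n U d"
  then have "c \<in> kls n U d" using group.rcos_self[OF C_group[OF U] c B_subgroup[OF U]] by simp
  then show "\<exists>b\<in>B n U. c = b \<otimes>\<^bsub>C n U\<^esub> d" by (auto simp: r_coset_def)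
next
  assume "\<exists>b\<in>B n U. c = b \<otimes>\<^bsub>C n U\<^esub> d"
  then have "c \<in> kls n U d" by (auto simp: r_coset_def)
  then show "kls n U c = kls n U d"
    using group.repr_independence[OF C_group[OF U] _ d B_subgroup[OF U]] by blast
qed

text \<open>Unfolding the direct limit: classes over two covers agree if they become cohomologous on a
  common refinement.\<close>

lemma hclass_eq_iff:
  assumes "pcover U" "c \<in> Z n U" "pcover V" "d \<in> Z n V"
  shows "hclass n U c = hclass n V d \<longleftrightarrow> (\<exists>W. pcover W \<and> (\<forall>x. W x \<subseteq> U x) \<and> (\<forall>x. W x \<subseteq> V x) \<and>
    (\<exists>b\<in>B n W. rf n U W c = b \<otimes>\<^bsub>C n W\<^esub> rf n V W d))"
proof -
  have "hclass n U c = hclass n V d \<longleftrightarrow> (\<exists>W. pcover W \<and> (\<forall>x. W x \<subseteq> U x) \<and> (\<forall>x. W x \<subseteq> V x) \<and>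
     kls n W (rf n U W c) = kls n W (rf n V W d))"
    unfolding hclass_eq
    by (subst coh.cl_eq_iff) (use assms in \<open>auto simp: kls_in refine_class_kls Z_carrier\<close>)
  also have "\<dots> \<longleftrightarrow> (\<exists>W. pcover W \<and> (\<forall>x. W x \<subseteq> U x) \<and> (\<forall>x. W x \<subseteq> V x) \<and>
    (\<exists>b\<in>B n W. rf n U W c = b \<otimes>\<^bsub>C n W\<^esub> rf n V W d))"
    using assms by (metis (no_types, lifting) kls_eq_iff refine_closed Z_carrier)
  finally show ?thesis .
qed

lemma cohom_elem:
  assumes "\<xi> \<in> carrier (cohom n A)"
  obtains U c where "pcover U" "c \<in> Z n U" "\<xi> = hclass n U c"
  using assms that unfolding cohom_def coh.carrier_direct_limit
  by (auto simp: carrier_cover_cohom hclass_eq)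

lemma hclass_in_cohom: "pcover U \<Longrightarrow> c \<in> Z n U \<Longrightarrow> hclass n U c \<in> carrier (cohom n A)"
  unfolding cohom_def coh.carrier_direct_limit hclass_eq using kls_in by blast

lemma one_Z: "pcover U \<Longrightarrow> \<one>\<^bsub>C n U\<^esub> \<in> Z n U"
  using subgroup.one_closed[OF Z_subgroup] .

lemma cohom_one: "pcover U \<Longrightarrow> \<one>\<^bsub>cohom n A\<^esub> = hclass n U \<one>\<^bsub>C n U\<^esub>"
  unfolding cohom_def
  by (subst coh.one_direct_limit[of U])
     (auto simp: one_cover_cohom kls_in one_Z refine_class_kls Z_carrier refine_one hclass_eq)

text \<open>Coboundaries are cocycles in this degree by \<open>cobd_cobd\<close>, so \<open>H\<^sup>1\<close> is a direct limit of
  quotient groups.\<close>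

lemma cohom1_group: "group (cohom 1 A)"
proof -
  have nrm: "normal (B 1 U) ((C 1 U)\<lparr>carrier := Z 1 U\<rparr>)" if U: "pcover U" for U
  proof -
    interpret comm_group "C 1 U" by (rule C_comm[OF U])
    have "B 1 U \<subseteq> Z 1 U"
      using cobd_cobd[OF U] cobd_closed[OF U, of _ 0]
      by (auto simp: coboundaries_def cocycles_def numeral_2_eq_2)
    then have "subgroup (B 1 U) ((C 1 U)\<lparr>carrier := Z 1 U\<rparr>)"
      by (rule subgroup_incl[OF B_subgroup[OF U] Z_subgroup[OF U]])
    moreover have "comm_group ((C 1 U)\<lparr>carrier := Z 1 U\<rparr>)"
      by (rule group.group_comm_groupI[OF subgroup.subgroup_is_group[OF Z_subgroup[OF U] group_axioms]])
         (simp add: m_comm Z_carrier del: One_nat_def)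
    ultimately show ?thesis by (simp add: comm_group.normal_iff_subgroup)
  qed
  have kls_mult: "kls 1 U c \<otimes>\<^bsub>cover_cohom 1 A U\<^esub> kls 1 U d = kls 1 U (c \<otimes>\<^bsub>C 1 U\<^esub> d)"
    if U: "pcover U" and "c \<in> Z 1 U" "d \<in> Z 1 U" for U c d
    using normal.rcos_sum[OF nrm[OF U], of c d] that
    by (simp add: cover_cohom_def FactGroup_def r_coset_def)
  have "direct_system_groups (Collect pcover) (\<lambda>U V. \<forall>x. V x \<subseteq> U x) (cover_cohom 1 A) (refine_class 1 A)"
  proof (intro direct_system_groups.intro direct_system_groups_axioms.intro coh.direct_system_axioms)
    show "group (cover_cohom 1 A U)" if "U \<in> Collect pcover" for U
      unfolding cover_cohom_def using normal.factorgroup_is_group[OF nrm] that by simp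
    show "refine_class 1 A U V (K \<otimes>\<^bsub>cover_cohom 1 A U\<^esub> L) =
        refine_class 1 A U V K \<otimes>\<^bsub>cover_cohom 1 A V\<^esub> refine_class 1 A U V L"
      if "U \<in> Collect pcover" "V \<in> Collect pcover" "\<forall>x. V x \<subseteq> U x"
        "K \<in> carrier (cover_cohom 1 A U)" "L \<in> carrier (cover_cohom 1 A U)" for U V K L
    proof -
      from that obtain c d where cd: "c \<in> Z 1 U" "K = kls 1 U c" "d \<in> Z 1 U" "L = kls 1 U d"
        by (auto simp: carrier_cover_cohom)
      have "c \<otimes>\<^bsub>C 1 U\<^esub> d \<in> Z 1 U" using subgroup.m_closed[OF Z_subgroup] that cd by blast
      then show ?thesis using that(1-3) cd
        by (simp add: kls_mult refine_class_kls Z_carrier refine_Z refine_mult del: One_nat_def)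
    qed
  qed
  then interpret g: direct_system_groups "Collect pcover" "\<lambda>U V. \<forall>x. V x \<subseteq> U x" "cover_cohom 1 A" "refine_class 1 A" .
  have "pcover (\<lambda>x::'a. UNIV)" by (simp add: pcover_def)
  then show ?thesis unfolding cohom_def using g.group_L by blast
qed

end

locale abelian_presheaf_hom = P: abelian_presheaf P + Q: abelian_presheaf Q
  for P :: "('a::topological_space, 'g) gpresheaf" and Q :: "('a, 'h) gpresheaf" +
  fixes \<phi> :: "'a set \<Rightarrow> 'g \<Rightarrow> 'h"
  assumes hom: "open U \<Longrightarrow> \<phi> U \<in> hom (sec P U) (sec Q U)"
    and natural: "\<lbrakk>open U; open V; V \<subseteq> U; s \<in> carrier (sec P U)\<rbrakk> \<Longrightarrow> \<phi> V (res P U V s) = res Q U V (\<phi> U s)"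
begin

abbreviation mc :: "nat \<Rightarrow> ('a \<Rightarrow> 'a set) \<Rightarrow> ('a list \<Rightarrow> 'g) \<Rightarrow> 'a list \<Rightarrow> 'h" where
  "mc n U \<equiv> map_cochain n U \<phi>"

lemma mc_closed: "pcover U \<Longrightarrow> c \<in> carrier (P.C n U) \<Longrightarrow> mc n U c \<in> carrier (Q.C n U)"
  by (simp add: P.C_iff Q.C_iff map_cochain_def hom_in_carrier[OF hom] open_cap)

lemma mc_mult: "\<lbrakk>pcover U; c \<in> carrier (P.C n U); d \<in> carrier (P.C n U)\<rbrakk> \<Longrightarrow>
    mc n U (c \<otimes>\<^bsub>P.C n U\<^esub> d) = mc n U c \<otimes>\<^bsub>Q.C n U\<^esub> mc n U d"
  unfolding P.C_mult Q.C_mult map_cochain_def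
  by (rule restrict_ext) (simp add: P.C_iff hom_mult[OF hom] open_cap)

lemma mc_hom: "pcover U \<Longrightarrow> mc n U \<in> hom (P.C n U) (Q.C n U)"
  by (rule homI) (simp_all add: mc_closed mc_mult)

lemma mc_one: "pcover U \<Longrightarrow> mc n U \<one>\<^bsub>P.C n U\<^esub> = \<one>\<^bsub>Q.C n U\<^esub>"
  by (rule hom_one[OF mc_hom]) (simp_all add: P.C_group Q.C_group)

lemma mc_inv: "pcover U \<Longrightarrow> c \<in> carrier (P.C n U) \<Longrightarrow> mc n U (inv\<^bsub>P.C n U\<^esub> c) = inv\<^bsub>Q.C n U\<^esub> mc n U c"
  using group_hom.hom_inv[of "P.C n U" "Q.C n U" "mc n U" c]
  by (simp add: group_hom_def group_hom_axioms_def P.C_group Q.C_group mc_hom)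

lemma mc_refine: "\<lbrakk>pcover U; pcover V; \<forall>x. V x \<subseteq> U x; c \<in> carrier (P.C n U)\<rbrakk> \<Longrightarrow>
    mc n V (P.rf n U V c) = Q.rf n U V (mc n U c)"
  unfolding map_cochain_def refine_cochain_def
  by (rule restrict_ext) (simp add: P.C_iff natural open_cap cap_mono)

lemma mc_cobd:
  assumes U: "pcover U" and c: "c \<in> carrier (P.C n U)"
  shows "mc (Suc n) U (P.\<delta> n U c) = Q.\<delta> n U (mc n U c)"
  unfolding map_cochain_def[of "Suc n"]
proof (subst (2) cobd_def', rule restrict_ext)
  fix xs :: "'a list" assume xs: "xs \<in> simplices (Suc n)"
  let ?W = "cap U xs"
  have o: "open (cap U ys)" for ys using open_cap U by auto
  interpret Q: comm_group "sec Q ?W" by (rule Q.sec_comm[OF o])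
  have inv: "\<phi> ?W (inv\<^bsub>sec P ?W\<^esub> y) = inv\<^bsub>sec Q ?W\<^esub> \<phi> ?W y" if "y \<in> carrier (sec P ?W)" for y
    using group_hom.hom_inv[of "sec P ?W" "sec Q ?W" "\<phi> ?W" y] that
    by (simp add: group_hom_def group_hom_axioms_def P.sec_group[OF o] Q.group_axioms hom[OF o])
  have r: "\<phi> ?W (lift_sign (sec P ?W) i (res P (cap U (face i xs)) ?W (c (face i xs))))
      = lift_sign (sec Q ?W) i (res Q (cap U (face i xs)) ?W (mc n U c (face i xs)))"
    if i: "i \<le> Suc n" for i
  proof -
    have f: "face i xs \<in> simplices n" using face_simplices xs i .
    have cf: "c (face i xs) \<in> carrier (sec P (cap U (face i xs)))" using c f by (simp add: P.C_iff)
    show ?thesis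
      using f cf P.face_term_closed[OF U c xs i]
      by (simp add: lift_sign_def inv natural o cap_face map_cochain_def)
  qed
  have cl: "lift_sign (sec P ?W) i (res P (cap U (face i xs)) ?W (c (face i xs))) \<in> carrier (sec P ?W)"
    if "i \<le> Suc n" for i using that P.face_term_closed[OF U c xs] P.lift_sign_closed o by simp
  have "\<phi> ?W (P.\<delta> n U c xs) = finprod (sec Q ?W)
     (\<lambda>i. \<phi> ?W (lift_sign (sec P ?W) i (res P (cap U (face i xs)) ?W (c (face i xs))))) {..Suc n}"
    using xs by (subst finprod_hom[OF P.sec_comm Q.sec_comm hom, symmetric]) (simp_all add: o cl cobd_def')
  also have "\<dots> = finprod (sec Q ?W)
     (\<lambda>i. lift_sign (sec Q ?W) i (res Q (cap U (face i xs)) ?W (mc n U c (face i xs)))) {..Suc n}"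
  proof (rule Q.finprod_cong'[OF refl])
    show "(\<lambda>i. lift_sign (sec Q ?W) i (res Q (cap U (face i xs)) ?W (mc n U c (face i xs)))) \<in> {..Suc n} \<rightarrow> carrier (sec Q ?W)"
      using Q.face_term_closed[OF U mc_closed[OF U c] xs] Q.lift_sign_closed[OF o] by (simp add: Pi_iff)
  qed (simp add: r)
  finally show "\<phi> ?W (P.\<delta> n U c xs) = \<dots>" .
qed

end

section \<open>The connecting map\<close>

context exact_sequence
begin

sublocale aS: abelian_presheaf S
  by (intro abelian_presheaf.intro abelian_presheaf_axioms.intro comm(1)) (unfold_locales)
sublocale aT: abelian_presheaf T
  by (intro abelian_presheaf.intro abelian_presheaf_axioms.intro comm(2)) (unfold_locales)
sublocale aR: abelian_presheaf R
  by (intro abelian_presheaf.intro abelian_presheaf_axioms.intro comm(3)) (unfold_locales)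
sublocale i: abelian_presheaf_hom S T \<iota>
  by (intro abelian_presheaf_hom.intro abelian_presheaf_hom_axioms.intro i_hom i_res) (unfold_locales)
sublocale p: abelian_presheaf_hom T R \<pi>
  by (intro abelian_presheaf_hom.intro abelian_presheaf_hom_axioms.intro p_hom p_res) (unfold_locales)

lemma mc_inj: "pcover U \<Longrightarrow> inj_on (i.mc n U) (carrier (aS.C n U))"
proof (rule inj_onI)
  fix c d assume U: "pcover U" and c: "c \<in> carrier (aS.C n U)" and d: "d \<in> carrier (aS.C n U)"
    and e: "i.mc n U c = i.mc n U d"
  show "c = d"
  proof (rule extensionalityI[of _ "simplices n"])
    fix xs :: "'a list" assume xs: "xs \<in> simplices n"
    have "\<iota> (cap U xs) (c xs) = \<iota> (cap U xs) (d xs)" using fun_cong[OF e, of xs] xs by (simp add: map_cochain_def)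
    then show "c xs = d xs" using i_inj[OF open_cap[OF U]] c d xs by (auto simp: aS.C_iff inj_on_def)
  qed (use c d in \<open>auto simp: aS.C_iff\<close>)
qed

lemma mc_ker:
  assumes U: "pcover U" and c: "c \<in> carrier (aT.C n U)" and one: "p.mc n U c = \<one>\<^bsub>aR.C n U\<^esub>"
  obtains f where "f \<in> carrier (aS.C n U)" "i.mc n U f = c"
proof -
  have "\<exists>f\<in>carrier (sec S (cap U xs)). \<iota> (cap U xs) f = c xs" if xs: "xs \<in> simplices n" for xs
  proof -
    have "\<pi> (cap U xs) (c xs) = \<one>\<^bsub>sec R (cap U xs)\<^esub>"
      using fun_cong[OF one, of xs] xs by (simp add: map_cochain_def aR.C_one)
    then have "c xs \<in> \<iota> (cap U xs) ` carrier (sec S (cap U xs))"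
      using ker[OF open_cap[OF U]] c xs by (simp add: aT.C_iff)
    then show ?thesis by auto
  qed
  then obtain f where f: "\<And>xs. xs \<in> simplices n \<Longrightarrow> f xs \<in> carrier (sec S (cap U xs)) \<and> \<iota> (cap U xs) (f xs) = c xs"
    by metis
  have "restrict f (simplices n) \<in> carrier (aS.C n U)" using f by (simp add: aS.C_iff)
  moreover have "i.mc n U (restrict f (simplices n)) = c"
    by (rule extensionalityI[of _ "simplices n"]) (use f c in \<open>auto simp: map_cochain_def aT.C_iff\<close>)
  ultimately show ?thesis using that by blast
qed

text \<open>A 0-cochain assigns a section to each point \<open>x\<close> of the space, so lifting it near \<open>x\<close> for each
  \<open>x\<close> separately yields a cochain on a finer cover of the same kind.\<close>

lemma lift_0_cochain:
  assumes U: "pcover U" and r: "r \<in> carrier (aR.C 0 U)"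
  obtains V t where "pcover V" "\<forall>x. V x \<subseteq> U x" "t \<in> carrier (aT.C 0 V)" "p.mc 0 V t = aR.rf 0 U V r"
proof -
  have "\<exists>V t. open V \<and> x \<in> V \<and> V \<subseteq> U x \<and> t \<in> carrier (sec T V) \<and> \<pi> V t = res R (U x) V (r [x])" for x
  proof (rule p_surj)
    show "open (U x)" "x \<in> U x" using U by (auto simp: pcover_def)
    have "[x] \<in> simplices 0" by (simp add: simplices_def)
    then show "r [x] \<in> carrier (sec R (U x))" using r unfolding aR.C_iff by (auto simp: cap_def)
  qed
  then obtain V t where V: "\<And>x. open (V x) \<and> x \<in> V x \<and> V x \<subseteq> U x \<and> t x \<in> carrier (sec T (V x)) \<and>
      \<pi> (V x) (t x) = res R (U x) (V x) (r [x])"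
    by metis
  have hd: "cap W xs = W (hd xs)" "xs = [hd xs]" if "xs \<in> simplices 0" for W and xs :: "'a list"
    using that by (auto simp: simplices_def length_Suc_conv cap_def)
  show ?thesis
  proof (rule that[of V "\<lambda>xs\<in>simplices 0. t (hd xs)"])
    show "pcover V" "\<forall>x. V x \<subseteq> U x" using V by (auto simp: pcover_def)
    show "(\<lambda>xs\<in>simplices 0. t (hd xs)) \<in> carrier (aT.C 0 V)"
      using V by (simp add: aT.C_iff hd)
    show "p.mc 0 V (\<lambda>xs\<in>simplices 0. t (hd xs)) = aR.rf 0 U V r"
      unfolding map_cochain_def refine_cochain_def
    proof (rule restrict_ext)
      fix xs :: "'a list" assume xs: "xs \<in> simplices 0"
      have "r xs = r [hd xs]" using hd(2)[OF xs] by simp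
      then show "\<pi> (cap V xs) ((\<lambda>xs\<in>simplices 0. t (hd xs)) xs) = res R (cap U xs) (cap V xs) (r xs)"
        using V xs by (simp add: hd(1))
    qed
  qed
qed

text \<open>The data from which the connecting map is computed: \<open>a\<close> lifts a cocycle of \<open>R\<close>, and \<open>b\<close> is
  the coboundary of \<open>a\<close>, seen in \<open>S\<close>.\<close>

definition represents :: "nat \<Rightarrow> ('a \<Rightarrow> 'a set) \<Rightarrow> ('a list \<Rightarrow> 'g) \<Rightarrow> ('a list \<Rightarrow> 'f) \<Rightarrow> bool" where
  "represents n U a b \<longleftrightarrow> pcover U \<and> a \<in> carrier (aT.C n U) \<and> p.mc n U a \<in> aR.Z n U \<and>
     b \<in> aS.Z (Suc n) U \<and> i.mc (Suc n) U b = aT.\<delta> n U a"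

lemma represents_refine:
  assumes "represents n U a b" "pcover V" "\<forall>x. V x \<subseteq> U x"
  shows "represents n V (aT.rf n U V a) (aS.rf (Suc n) U V b)"
  using assms aS.Z_carrier[of b "Suc n" U] unfolding represents_def
  by (simp add: aT.refine_closed aR.refine_Z aS.refine_Z p.mc_refine i.mc_refine aT.refine_cobd)

text \<open>If the projections of \<open>a\<close> and \<open>a'\<close> differ by that of a cocycle \<open>k\<close> of \<open>T\<close>, then \<open>a = f k a'\<close>
  with \<open>f\<close> a cochain of \<open>S\<close>, and \<open>\<delta>k = 1\<close> gives \<open>b = \<delta>f b'\<close>.\<close>

lemma represents_unique_aux:
  assumes W: "pcover W" and ab: "represents n W a b" "represents n W a' b'"
    and k: "k \<in> carrier (aT.C n W)" "aT.\<delta> n W k = \<one>\<^bsub>aT.C (Suc n) W\<^esub>"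
    and e: "p.mc n W a = p.mc n W k \<otimes>\<^bsub>aR.C n W\<^esub> p.mc n W a'"
  shows "aS.hclass (Suc n) W b = aS.hclass (Suc n) W b'"
proof -
  interpret Tn: comm_group "aT.C n W" by (rule aT.C_comm[OF W])
  interpret Tm: comm_group "aT.C (Suc n) W" by (rule aT.C_comm[OF W])
  interpret Rn: comm_group "aR.C n W" by (rule aR.C_comm[OF W])
  interpret Sm: comm_group "aS.C (Suc n) W" by (rule aS.C_comm[OF W])
  have a: "a \<in> carrier (aT.C n W)" "a' \<in> carrier (aT.C n W)"
    and b: "b \<in> aS.Z (Suc n) W" "b' \<in> aS.Z (Suc n) W" "i.mc (Suc n) W b = aT.\<delta> n W a" "i.mc (Suc n) W b' = aT.\<delta> n W a'"
    using ab by (auto simp: represents_def)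
  note bc = aS.Z_carrier[OF b(1)] aS.Z_carrier[OF b(2)]
  let ?k = "k \<otimes>\<^bsub>aT.C n W\<^esub> a'"
  have kc: "?k \<in> carrier (aT.C n W)" using k a by simp
  have "p.mc n W (a \<otimes>\<^bsub>aT.C n W\<^esub> inv\<^bsub>aT.C n W\<^esub> ?k) = p.mc n W ?k \<otimes>\<^bsub>aR.C n W\<^esub> inv\<^bsub>aR.C n W\<^esub> p.mc n W ?k"
    using k a kc by (simp add: p.mc_mult p.mc_inv W e del: Tn.inv_mult)
  also have "\<dots> = \<one>\<^bsub>aR.C n W\<^esub>" using p.mc_closed[OF W kc] by simp
  finally obtain f where f: "f \<in> carrier (aS.C n W)" "i.mc n W f = a \<otimes>\<^bsub>aT.C n W\<^esub> inv\<^bsub>aT.C n W\<^esub> ?k"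
    using mc_ker[OF W] a kc by (metis Tn.inv_closed Tn.m_closed)
  have "a = i.mc n W f \<otimes>\<^bsub>aT.C n W\<^esub> ?k"
    using f a kc by (simp add: Tn.m_assoc del: Tn.inv_mult)
  then have "aT.\<delta> n W a = aT.\<delta> n W (i.mc n W f \<otimes>\<^bsub>aT.C n W\<^esub> ?k)" by (rule arg_cong)
  also have "\<dots> = aT.\<delta> n W (i.mc n W f) \<otimes>\<^bsub>aT.C (Suc n) W\<^esub> aT.\<delta> n W ?k"
    by (rule aT.cobd_mult[OF W i.mc_closed[OF W f(1)] kc])
  also have "aT.\<delta> n W ?k = aT.\<delta> n W k \<otimes>\<^bsub>aT.C (Suc n) W\<^esub> aT.\<delta> n W a'"
    by (rule aT.cobd_mult[OF W k(1) a(2)])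
  finally have "aT.\<delta> n W a = aT.\<delta> n W (i.mc n W f) \<otimes>\<^bsub>aT.C (Suc n) W\<^esub> (aT.\<delta> n W k \<otimes>\<^bsub>aT.C (Suc n) W\<^esub> aT.\<delta> n W a')" .
  then have "i.mc (Suc n) W b = i.mc (Suc n) W (aS.\<delta> n W f) \<otimes>\<^bsub>aT.C (Suc n) W\<^esub> i.mc (Suc n) W b'"
    using k a aT.cobd_closed[OF W a(2)] by (simp add: b i.mc_cobd[OF W f(1)])
  then have "i.mc (Suc n) W b = i.mc (Suc n) W (aS.\<delta> n W f \<otimes>\<^bsub>aS.C (Suc n) W\<^esub> b')"
    using aS.cobd_closed[OF W f(1)] bc by (simp add: i.mc_mult W)
  then have "b = aS.\<delta> n W f \<otimes>\<^bsub>aS.C (Suc n) W\<^esub> b'"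
    by (rule inj_onD[OF mc_inj[OF W] _ bc(1) Sm.m_closed[OF aS.cobd_closed[OF W f(1)] bc(2)]])
  then have "aS.kls (Suc n) W b = aS.kls (Suc n) W b'"
    using f bc by (subst aS.kls_eq_iff[OF W]) (auto simp: coboundaries_def)
  then show ?thesis by (simp add: aS.hclass_eq)
qed

text \<open>Cohomologous cocycles of \<open>R\<close> differ, on some cover, by a coboundary \<open>r\<close>. In degree 0 it is
  trivial; in degree 1 it is \<open>\<delta>r\<^sub>0\<close>, and \<open>r\<^sub>0\<close> lifts to a cochain \<open>t\<close> of \<open>T\<close> on a finer cover, so
  that \<open>r\<close> lifts to the cocycle \<open>\<delta>t\<close>.\<close>

lemma represents_unique:
  assumes n: "n \<le> 1" and ab: "represents n U a b" "represents n U' a' b'"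
    and e: "aR.hclass n U (p.mc n U a) = aR.hclass n U' (p.mc n U' a')"
  shows "aS.hclass (Suc n) U b = aS.hclass (Suc n) U' b'"
proof -
  have U: "pcover U" "pcover U'" and Z: "p.mc n U a \<in> aR.Z n U" "p.mc n U' a' \<in> aR.Z n U'"
    and a: "a \<in> carrier (aT.C n U)" "a' \<in> carrier (aT.C n U')"
    and b: "b \<in> aS.Z (Suc n) U" "b' \<in> aS.Z (Suc n) U'"
    using ab by (auto simp: represents_def)
  from e obtain V r where V: "pcover V" "\<forall>x. V x \<subseteq> U x" "\<forall>x. V x \<subseteq> U' x" and r: "r \<in> aR.B n V"
    and eq: "aR.rf n U V (p.mc n U a) = r \<otimes>\<^bsub>aR.C n V\<^esub> aR.rf n U' V (p.mc n U' a')"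
    using aR.hclass_eq_iff[OF U(1) Z(1) U(2) Z(2)] by blast
  have "\<exists>W k. pcover W \<and> (\<forall>x. W x \<subseteq> V x) \<and> k \<in> carrier (aT.C n W) \<and>
      aT.\<delta> n W k = \<one>\<^bsub>aT.C (Suc n) W\<^esub> \<and> p.mc n W k = aR.rf n V W r"
  proof (cases n)
    case 0
    interpret T: comm_group "aT.C 0 V" by (rule aT.C_comm[OF V(1)])
    have "r = \<one>\<^bsub>aR.C 0 V\<^esub>" using r 0 by (simp add: coboundaries_def)
    then show ?thesis
      using V(1) 0 by (intro exI[of _ V] exI[of _ "\<one>\<^bsub>aT.C 0 V\<^esub>"]) (simp add: aT.cobd_one p.mc_one aR.refine_one)
  next
    case (Suc m)
    with n have n1: "n = 1" by simp
    obtain r0 where r0: "r0 \<in> carrier (aR.C 0 V)" "r = aR.\<delta> 0 V r0"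
      using r by (auto simp: n1 coboundaries_def)
    obtain W t where W: "pcover W" "\<forall>x. W x \<subseteq> V x" "t \<in> carrier (aT.C 0 W)" "p.mc 0 W t = aR.rf 0 V W r0"
      using lift_0_cochain[OF V(1) r0(1)] .
    then show ?thesis
      using aT.cobd_cobd[OF W(1,3)] aT.cobd_closed[OF W(1,3)] p.mc_cobd[OF W(1,3)] aR.refine_cobd[OF V(1) W(1,2) r0(1)]
      unfolding n1 r0(2)
      by (intro exI[of _ W] exI[of _ "aT.\<delta> 0 W t"]) (simp add: numeral_2_eq_2)
  qed
  then obtain W k where W: "pcover W" "\<forall>x. W x \<subseteq> V x" and k: "k \<in> carrier (aT.C n W)"
    "aT.\<delta> n W k = \<one>\<^bsub>aT.C (Suc n) W\<^esub>" "p.mc n W k = aR.rf n V W r" by blast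
  have WU: "\<forall>x. W x \<subseteq> U x" "\<forall>x. W x \<subseteq> U' x" using V W by blast+
  have rc: "r \<in> carrier (aR.C n V)" using r subgroup.mem_carrier[OF aR.B_subgroup[OF V(1)]] by blast
  have "aR.rf n U W (p.mc n U a) = aR.rf n V W (aR.rf n U V (p.mc n U a))"
    using aR.refine_refine U V W aR.Z_carrier[OF Z(1)] by metis
  also have "\<dots> = aR.rf n V W r \<otimes>\<^bsub>aR.C n W\<^esub> aR.rf n V W (aR.rf n U' V (p.mc n U' a'))"
    unfolding eq using rc V W U aR.Z_carrier[OF Z(2)] by (simp add: aR.refine_mult aR.refine_closed)
  also have "aR.rf n V W (aR.rf n U' V (p.mc n U' a')) = aR.rf n U' W (p.mc n U' a')"
    using aR.refine_refine U V W aR.Z_carrier[OF Z(2)] by metis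
  finally have "p.mc n W (aT.rf n U W a) = p.mc n W k \<otimes>\<^bsub>aR.C n W\<^esub> p.mc n W (aT.rf n U' W a')"
    by (simp add: p.mc_refine U W WU a k)
  from represents_unique_aux[OF W(1) represents_refine[OF ab(1) W(1) WU(1)] represents_refine[OF ab(2) W(1) WU(2)] k(1,2) this]
  show ?thesis
    using aS.hclass_refine[OF U(1) W(1) WU(1) b(1)] aS.hclass_refine[OF U(2) W(1) WU(2) b(2)] by simp
qed

text \<open>The definite description in \<open>connecting\<close> is met by any representing data: \<open>represents_unique\<close>
  is the uniqueness.\<close>

lemma connecting_eq:
  assumes "n \<le> 1" "represents n U a b"
  shows "connecting n S T R \<iota> \<pi> (aR.hclass n U (p.mc n U a)) = aS.hclass (Suc n) U b"
  unfolding connecting_def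
proof (rule the_equality)
  show "\<exists>U' a' b'. pcover U' \<and> a' \<in> carrier (aT.C n U') \<and> p.mc n U' a' \<in> aR.Z n U' \<and>
      aR.hclass n U (p.mc n U a) = aR.hclass n U' (p.mc n U' a') \<and> b' \<in> aS.Z (Suc n) U' \<and>
      i.mc (Suc n) U' b' = aT.\<delta> n U' a' \<and> aS.hclass (Suc n) U b = aS.hclass (Suc n) U' b'"
    using assms(2) by (intro exI[of _ U] exI[of _ a] exI[of _ b]) (simp add: represents_def)
next
  fix \<eta> assume "\<exists>U' a' b'. pcover U' \<and> a' \<in> carrier (aT.C n U') \<and> p.mc n U' a' \<in> aR.Z n U' \<and>
      aR.hclass n U (p.mc n U a) = aR.hclass n U' (p.mc n U' a') \<and> b' \<in> aS.Z (Suc n) U' \<and>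
      i.mc (Suc n) U' b' = aT.\<delta> n U' a' \<and> \<eta> = aS.hclass (Suc n) U' b'"
  then obtain U' a' b' where "represents n U' a' b'" "\<eta> = aS.hclass (Suc n) U' b'"
    "aR.hclass n U (p.mc n U a) = aR.hclass n U' (p.mc n U' a')" unfolding represents_def by blast
  then show "\<eta> = aS.hclass (Suc n) U b" using represents_unique[OF assms] by simp
qed

lemma represents_one: "pcover U \<Longrightarrow> represents n U \<one>\<^bsub>aT.C n U\<^esub> \<one>\<^bsub>aS.C (Suc n) U\<^esub>"
  unfolding represents_def
  by (simp add: monoid.one_closed[OF group.is_monoid[OF aT.C_group]] p.mc_one i.mc_one aR.one_Z aS.one_Z aT.cobd_one)

lemma connecting_one: "n \<le> 1 \<Longrightarrow> connecting n S T R \<iota> \<pi> \<one>\<^bsub>cohom n R\<^esub> = \<one>\<^bsub>cohom (Suc n) S\<^esub>"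
proof -
  assume n: "n \<le> 1"
  have U: "pcover (\<lambda>x::'a. UNIV)" by (simp add: pcover_def)
  show ?thesis
    using connecting_eq[OF n represents_one[OF U]] aR.cohom_one[OF U, of n] aS.cohom_one[OF U, of "Suc n"] p.mc_one[OF U, of n]
    by simp
qed

text \<open>The lift \<open>a\<close> of a 0-cocycle of \<open>R\<close> has a coboundary which dies in \<open>R\<close> and so comes from \<open>S\<close>.\<close>

lemma represents_0_ex:
  assumes "\<xi> \<in> carrier (cohom 0 R)"
  obtains U a b where "represents 0 U a b" "\<xi> = aR.hclass 0 U (p.mc 0 U a)"
proof -
  obtain U c where U: "pcover U" and c: "c \<in> aR.Z 0 U" "\<xi> = aR.hclass 0 U c"
    using assms by (rule aR.cohom_elem)
  obtain V a where V: "pcover V" "\<forall>x. V x \<subseteq> U x" "a \<in> carrier (aT.C 0 V)" "p.mc 0 V a = aR.rf 0 U V c"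
    using lift_0_cochain[OF U aR.Z_carrier[OF c(1)]] .
  have Z: "p.mc 0 V a \<in> aR.Z 0 V" using aR.refine_Z[OF U V(1,2) c(1)] V(4) by simp
  have d: "aT.\<delta> 0 V a \<in> carrier (aT.C (Suc 0) V)" using aT.cobd_closed[OF V(1,3)] .
  have "p.mc (Suc 0) V (aT.\<delta> 0 V a) = \<one>\<^bsub>aR.C (Suc 0) V\<^esub>"
    using Z by (simp add: p.mc_cobd[OF V(1,3)] cocycles_def)
  then obtain b where b: "b \<in> carrier (aS.C (Suc 0) V)" "i.mc (Suc 0) V b = aT.\<delta> 0 V a"
    using mc_ker[OF V(1) d] by blast
  have "i.mc (Suc (Suc 0)) V (aS.\<delta> (Suc 0) V b) = \<one>\<^bsub>aT.C (Suc (Suc 0)) V\<^esub>"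
    using aT.cobd_cobd[OF V(1,3)] by (simp add: i.mc_cobd[OF V(1) b(1)] b(2) numeral_2_eq_2)
  then have "aS.\<delta> (Suc 0) V b = \<one>\<^bsub>aS.C (Suc (Suc 0)) V\<^esub>"
    using aS.cobd_closed[OF V(1) b(1)] i.mc_one[OF V(1), of "Suc (Suc 0)"]
      monoid.one_closed[OF group.is_monoid[OF aS.C_group[OF V(1)]], of "Suc (Suc 0)"]
    by (intro inj_onD[OF mc_inj[OF V(1)]]) simp_all
  then have "represents 0 V a b" using V Z b by (simp add: represents_def cocycles_def)
  moreover have "\<xi> = aR.hclass 0 V (p.mc 0 V a)"
    using aR.hclass_refine[OF U V(1,2) c(1)] c(2) V(4) by simp
  ultimately show ?thesis using that by blast
qed

end

section \<open>Trivialising cocycles along a filtration\<close>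

lemma hom_inv_group: "\<lbrakk>group G; group H; h \<in> hom G H; x \<in> carrier G\<rbrakk> \<Longrightarrow> h (inv\<^bsub>G\<^esub> x) = inv\<^bsub>H\<^esub> h x"
  by (rule group_hom.hom_inv) (auto simp: group_hom_def group_hom_axioms_def)

lemma (in group) mult_cancel_middle:
  assumes "a \<in> carrier G" "b \<in> carrier G" "c \<in> carrier G" "g \<in> carrier G" "f \<in> carrier G"
  shows "(a \<otimes> g \<otimes> inv b) \<otimes> (b \<otimes> f \<otimes> inv c) = a \<otimes> (g \<otimes> f) \<otimes> inv c"
proof -
  have "inv b \<otimes> (b \<otimes> (f \<otimes> inv c)) = f \<otimes> inv c" using assms by (simp add: m_assoc[symmetric])
  then show ?thesis using assms by (simp add: m_assoc)
qed

lemma (in comm_group) mult_inv_cancel: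
  assumes "a \<in> carrier G" "b \<in> carrier G"
  shows "a \<otimes> (b \<otimes> inv a) \<otimes> inv b = \<one>" "b \<otimes> inv (a \<otimes> b) \<otimes> a = \<one>"
proof -
  have "a \<otimes> (b \<otimes> inv a) \<otimes> inv b = (a \<otimes> inv a) \<otimes> (b \<otimes> inv b)"
    using assms by (simp only: m_ac inv_closed m_closed)
  then show "a \<otimes> (b \<otimes> inv a) \<otimes> inv b = \<one>" using assms by simp
  have "b \<otimes> inv (a \<otimes> b) \<otimes> a = inv (a \<otimes> b) \<otimes> (a \<otimes> b)"
    using assms by (simp only: m_ac inv_closed m_closed)
  then show "b \<otimes> inv (a \<otimes> b) \<otimes> a = \<one>" using assms by simp
qed

text \<open>Commutators go up by 2, so that \<open>N k / N (k + 2)\<close> is abelian. The last condition gives the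
  quotients by \<open>N k\<close> the locality which \<open>sheaf_quotient\<close> asks for.\<close>

locale group_filtration = group_presheaf P for P :: "('a::topological_space, 'g) gpresheaf" +
  fixes N :: "nat \<Rightarrow> 'a set \<Rightarrow> 'g set"
  assumes N_subgroup: "\<lbrakk>open U; 2 \<le> k\<rbrakk> \<Longrightarrow> subgroup (N k U) (sec P U)"
    and N_decreasing: "\<lbrakk>open U; 2 \<le> k\<rbrakk> \<Longrightarrow> N (Suc k) U \<subseteq> N k U"
    and N_res: "\<lbrakk>open U; open V; V \<subseteq> U; 2 \<le> k; f \<in> N k U\<rbrakk> \<Longrightarrow> res P U V f \<in> N k V"
    and N_commute: "\<lbrakk>open U; 2 \<le> k; f \<in> N k U; g \<in> N k U\<rbrakk> \<Longrightarrow>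
      (f \<otimes>\<^bsub>sec P U\<^esub> g) \<otimes>\<^bsub>sec P U\<^esub> inv\<^bsub>sec P U\<^esub> (g \<otimes>\<^bsub>sec P U\<^esub> f) \<in> N (k + 2) U"
    and N_local: "\<lbrakk>open U; 2 \<le> k; f \<in> N 2 U;
        \<And>x. x \<in> U \<Longrightarrow> \<exists>V. open V \<and> x \<in> V \<and> V \<subseteq> U \<and> res P U V f \<in> N k V\<rbrakk> \<Longrightarrow> f \<in> N k U"
begin

definition Gr :: "nat \<Rightarrow> ('a, 'g) gpresheaf" where
  "Gr k = \<lparr>sec = \<lambda>U. (sec P U)\<lparr>carrier := N k U\<rparr>, res = res P\<rparr>"

lemma Gr_simps [simp]:
  "carrier (sec (Gr k) U) = N k U" "x \<otimes>\<^bsub>sec (Gr k) U\<^esub> y = x \<otimes>\<^bsub>sec P U\<^esub> y"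
  "\<one>\<^bsub>sec (Gr k) U\<^esub> = \<one>\<^bsub>sec P U\<^esub>" "res (Gr k) = res P"
  by (simp_all add: Gr_def)

lemma N_mono:
  assumes "open U" "2 \<le> k" "k \<le> l"
  shows "N l U \<subseteq> N k U"
  using assms(3)
proof (induction l rule: dec_induct)
  case (step l)
  then show ?case using N_decreasing[of U l] assms by auto
qed simp

lemma N_carrier: "\<lbrakk>open U; 2 \<le> k; f \<in> N k U\<rbrakk> \<Longrightarrow> f \<in> carrier (sec P U)"
  using subgroup.mem_carrier[OF N_subgroup] .

lemma inv_Gr: "\<lbrakk>open U; 2 \<le> k; f \<in> N k U\<rbrakk> \<Longrightarrow> inv\<^bsub>sec (Gr k) U\<^esub> f = inv\<^bsub>sec P U\<^esub> f"
  unfolding Gr_def using group.m_inv_consistent[OF sec_group N_subgroup] by simp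

lemma Gr_group: "\<lbrakk>open U; 2 \<le> k\<rbrakk> \<Longrightarrow> group (sec (Gr k) U)"
  unfolding Gr_def using subgroup.subgroup_is_group[OF N_subgroup sec_group] by simp

lemma Gr_presheaf: "2 \<le> k \<Longrightarrow> group_presheaf (Gr k)"
proof (rule group_presheaf.intro)
  assume k: "2 \<le> k"
  show "res (Gr k) U V \<in> hom (sec (Gr k) U) (sec (Gr k) V)" if "open U" "open V" "V \<subseteq> U" for U V
    using that k by (intro homI) (simp_all add: N_res res_mult N_carrier)
  show "res (Gr k) U U f = f" if "open U" "f \<in> carrier (sec (Gr k) U)" for U f
    using that k by (simp add: res_id N_carrier)
  show "res (Gr k) V W (res (Gr k) U V f) = res (Gr k) U W f"
    if "open U" "open V" "open W" "V \<subseteq> U" "W \<subseteq> V" "f \<in> carrier (sec (Gr k) U)" for U V W f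
    using that k by (simp add: res_comp N_carrier)
qed (rule Gr_group)

lemma Gr_commute:
  assumes "2 \<le> k" "l \<le> k + 2" "2 \<le> l" "open U" "f \<in> N k U" "g \<in> N k U"
  shows "(f \<otimes>\<^bsub>sec P U\<^esub> g) \<otimes>\<^bsub>sec P U\<^esub> inv\<^bsub>sec P U\<^esub> (g \<otimes>\<^bsub>sec P U\<^esub> f) \<in> N l U"
  using N_commute[of U k f g] N_mono[of U l "k + 2"] assms by blast

lemma Gr_quotient:
  assumes k: "2 \<le> k" and l: "k \<le> l" "l \<le> k + 2"
  shows "sheaf_quotient (Gr k) (Gr l)"
proof (intro sheaf_quotient.intro sheaf_quotient_axioms.intro Gr_presheaf k)
  fix U :: "'a set" assume U: "open U"
  interpret P: group "sec P U" by (rule sec_group[OF U])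
  interpret G: group "sec (Gr k) U" by (rule Gr_group[OF U k])
  have l2: "2 \<le> l" using k l by simp
  interpret Nl: subgroup "N l U" "sec P U" by (rule N_subgroup[OF U l2])
  have sub: "subgroup (N l U) (sec (Gr k) U)"
    unfolding Gr_def using P.subgroup_incl[OF N_subgroup[OF U l2] N_subgroup[OF U k] N_mono[OF U k l(1)]] by simp
  have "x \<otimes>\<^bsub>sec P U\<^esub> h \<otimes>\<^bsub>sec P U\<^esub> inv\<^bsub>sec P U\<^esub> x \<in> N l U" if x: "x \<in> N k U" and h: "h \<in> N l U" for x h
  proof -
    have hk: "h \<in> N k U" using h N_mono[OF U k l(1)] by blast
    note c = N_carrier[OF U k x] N_carrier[OF U k hk]
    have "x \<otimes>\<^bsub>sec P U\<^esub> h \<otimes>\<^bsub>sec P U\<^esub> inv\<^bsub>sec P U\<^esub> x =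
       ((x \<otimes>\<^bsub>sec P U\<^esub> h) \<otimes>\<^bsub>sec P U\<^esub> inv\<^bsub>sec P U\<^esub> (h \<otimes>\<^bsub>sec P U\<^esub> x)) \<otimes>\<^bsub>sec P U\<^esub> h"
      using c by (simp add: P.inv_mult_group P.m_assoc)
    also have "\<dots> \<in> N l U"
      using Nl.m_closed[OF Gr_commute[OF k l(2) l2 U x hk] h] .
    finally show ?thesis .
  qed
  then show "carrier (sec (Gr l) U) \<lhd> sec (Gr k) U"
    using sub by (simp add: G.normal_inv_iff inv_Gr[OF U k])
next
  show "res (Gr k) U V f \<in> carrier (sec (Gr l) V)"
    if "open U" "open V" "V \<subseteq> U" "f \<in> carrier (sec (Gr l) U)" for U V f
    using that k l by (simp add: N_res)
  show "f \<in> carrier (sec (Gr l) U)"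
    if "open U" "f \<in> carrier (sec (Gr k) U)"
      "\<And>x. x \<in> U \<Longrightarrow> \<exists>V. open V \<and> x \<in> V \<and> V \<subseteq> U \<and> res (Gr k) U V f \<in> carrier (sec (Gr l) V)" for U f
    using that N_local[of U l f] N_mono[of U 2 k] k l by auto
qed

abbreviation Quo :: "nat \<Rightarrow> nat \<Rightarrow> ('a, 'a \<Rightarrow> ('a set \<times> 'g set) set) gpresheaf" where
  "Quo k l \<equiv> quot_sheaf (Gr k) (Gr l)"

lemma Quo_comm:
  assumes "2 \<le> k" "k \<le> l" "l \<le> k + 2" "open U"
  shows "comm_group (sec (Quo k l) U)"
proof (rule sheaf_quotient.quot_comm_group[OF Gr_quotient[OF assms(1-3)] _ assms(4)])
  fix V f g assume V: "open V" and fg: "f \<in> carrier (sec (Gr k) V)" "g \<in> carrier (sec (Gr k) V)"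
  have "g \<otimes>\<^bsub>sec P V\<^esub> f \<in> N k V" using fg subgroup.m_closed[OF N_subgroup[OF V assms(1)]] by simp
  then show "(f \<otimes>\<^bsub>sec (Gr k) V\<^esub> g) \<otimes>\<^bsub>sec (Gr k) V\<^esub> inv\<^bsub>sec (Gr k) V\<^esub> (g \<otimes>\<^bsub>sec (Gr k) V\<^esub> f) \<in> carrier (sec (Gr l) V)"
    using fg assms Gr_commute[of k l V f g] V by (simp add: inv_Gr)
qed

lemma Quo_inclusion:
  assumes "2 \<le> k" "k \<le> l" "l \<le> k + 2" "2 \<le> k'" "k' \<le> l'" "l' \<le> k' + 2" "k' \<le> k" "l' \<le> l"
  shows "quotient_inclusion (Gr k) (Gr l) (Gr k') (Gr l')"
proof (intro quotient_inclusion.intro Gr_quotient quotient_inclusion_axioms.intro)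
  show "carrier (sec (Gr k) U) \<subseteq> carrier (sec (Gr k') U)" if "open U" for U
    using N_mono[of U k' k] that assms by simp
  show "carrier (sec (Gr l) U) \<subseteq> carrier (sec (Gr l') U)" if "open U" for U
    using N_mono[of U l' l] that assms by simp
qed (use assms in \<open>simp_all add: fun_eq_iff\<close>)

lemma Quo_exact:
  assumes "2 \<le> k"
  shows "exact_sequence (Quo (k + 1) (k + 2)) (Quo k (k + 2)) (Quo k (k + 1))
    (quot_map (Gr k) (Gr (k + 2))) (quot_map (Gr k) (Gr (k + 1)))"
  by (rule quotient_exact_sequence) (use assms in \<open>auto intro!: Quo_inclusion Quo_comm\<close>)

abbreviation bd :: "nat \<Rightarrow> nat \<Rightarrow> _" where
  "bd n k \<equiv> connecting n (Quo (k + 1) (k + 2)) (Quo k (k + 2)) (Quo k (k + 1))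
    (quot_map (Gr k) (Gr (k + 2))) (quot_map (Gr k) (Gr (k + 1)))"

definition cocycle :: "nat \<Rightarrow> ('a \<Rightarrow> 'a set) \<Rightarrow> ('a \<Rightarrow> 'a \<Rightarrow> 'g) \<Rightarrow> bool" where
  "cocycle k U g \<longleftrightarrow> pcover U \<and> (\<forall>x y. g x y \<in> N k (U x \<inter> U y)) \<and>
    (\<forall>x y z. let W = U x \<inter> U y \<inter> U z in
      res P (U x \<inter> U y) W (g x y) \<otimes>\<^bsub>sec P W\<^esub> res P (U y \<inter> U z) W (g y z) = res P (U x \<inter> U z) W (g x z))"

text \<open>The cocycle \<open>h\<^sub>x g\<^sub>x\<^sub>y h\<^sub>y\<^sup>-\<^sup>1\<close> on a finer cover, cohomologous to \<open>g\<close>.\<close>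

definition twist :: "('a \<Rightarrow> 'a set) \<Rightarrow> ('a \<Rightarrow> 'a set) \<Rightarrow> ('a \<Rightarrow> 'a \<Rightarrow> 'g) \<Rightarrow> ('a \<Rightarrow> 'g) \<Rightarrow> 'a \<Rightarrow> 'a \<Rightarrow> 'g" where
  "twist U V g h x y = (let W = V x \<inter> V y in
     (res P (V x) W (h x) \<otimes>\<^bsub>sec P W\<^esub> res P (U x \<inter> U y) W (g x y)) \<otimes>\<^bsub>sec P W\<^esub> inv\<^bsub>sec P W\<^esub> res P (V y) W (h y))"

lemma pcover_open: "pcover U \<Longrightarrow> open (U x)"
  by (simp add: pcover_def)

lemma twist_closed:
  assumes "pcover U" "pcover V" "\<And>x. V x \<subseteq> U x" "2 \<le> k" "\<And>x. h x \<in> N k (V x)" "\<And>x y. g x y \<in> N k (U x \<inter> U y)"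
  shows "twist U V g h x y \<in> N k (V x \<inter> V y)"
proof -
  have o: "open (V x)" "open (V y)" "open (V x \<inter> V y)" "open (U x \<inter> U y)"
    by (intro open_Int pcover_open assms(1,2))+
  have s: "V x \<inter> V y \<subseteq> U x \<inter> U y" using assms(3) by blast
  interpret subgroup "N k (V x \<inter> V y)" "sec P (V x \<inter> V y)" by (rule N_subgroup[OF o(3) assms(4)])
  show ?thesis
    unfolding twist_def Let_def
    by (intro m_closed m_inv_closed N_res) (use o s assms in auto)
qed

lemma twist_cocycle:
  assumes g: "cocycle k U g" and k: "2 \<le> k" and V: "pcover V" "\<And>x. V x \<subseteq> U x" and h: "\<And>x. h x \<in> N 2 (V x)"
    and l: "2 \<le> l" "\<And>x y. twist U V g h x y \<in> N l (V x \<inter> V y)"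
  shows "cocycle l V (twist U V g h)"
  unfolding cocycle_def
proof (intro conjI allI V l(2), unfold Let_def)
  fix x y z
  let ?W = "V x \<inter> V y \<inter> V z" and ?W' = "U x \<inter> U y \<inter> U z"
  have o: "open (V u)" "open (U u)" for u using V(1) g pcover_open by (auto simp: cocycle_def)
  interpret W: group "sec P ?W" by (rule sec_group) (simp add: o open_Int)
  have gc: "g u v \<in> carrier (sec P (U u \<inter> U v))" for u v
    using g N_carrier[OF _ k, of "U u \<inter> U v"] o by (simp add: cocycle_def open_Int)
  have hc: "h u \<in> carrier (sec P (V u))" for u using h N_carrier[of _ 2] o by auto
  let ?h = "\<lambda>u. res P (V u) ?W (h u)" and ?g = "\<lambda>u v. res P (U u \<inter> U v) ?W (g u v)"
  have t: "res P (V u \<inter> V v) ?W (twist U V g h u v) = (?h u \<otimes>\<^bsub>sec P ?W\<^esub> ?g u v) \<otimes>\<^bsub>sec P ?W\<^esub> inv\<^bsub>sec P ?W\<^esub> ?h v"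
    if uv: "?W \<subseteq> V u \<inter> V v" for u v
  proof -
    let ?A = "V u \<inter> V v"
    interpret A: group "sec P ?A" by (rule sec_group) (simp add: o open_Int)
    have s: "?A \<subseteq> U u \<inter> U v" "?W \<subseteq> V u" "?W \<subseteq> V v" using V(2) uv by blast+
    have c: "res P (V u) ?A (h u) \<in> carrier (sec P ?A)" "res P (V v) ?A (h v) \<in> carrier (sec P ?A)"
      "res P (U u \<inter> U v) ?A (g u v) \<in> carrier (sec P ?A)"
      using s gc hc o by (auto intro!: res_closed open_Int)
    show ?thesis
      unfolding twist_def Let_def
      using c uv s gc hc o by (simp add: res_mult res_inv open_Int res_comp)
  qed
  have hW: "?h x \<in> carrier (sec P ?W)" "?h y \<in> carrier (sec P ?W)" "?h z \<in> carrier (sec P ?W)"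
    using hc o by (auto intro!: res_closed open_Int)
  have WW: "?W \<subseteq> ?W'" using V(2) by blast
  have sub: "?W \<subseteq> U x \<inter> U y" "?W \<subseteq> U y \<inter> U z" "?W \<subseteq> U x \<inter> U z" using V(2) by blast+
  have gW: "?g x y \<in> carrier (sec P ?W)" "?g y z \<in> carrier (sec P ?W)" "?g x z \<in> carrier (sec P ?W)"
    using gc o sub by (auto intro!: res_closed open_Int)
  have "res P ?W' ?W (res P (U x \<inter> U y) ?W' (g x y) \<otimes>\<^bsub>sec P ?W'\<^esub> res P (U y \<inter> U z) ?W' (g y z)) =
      res P ?W' ?W (res P (U x \<inter> U z) ?W' (g x z))"
    using g by (simp add: cocycle_def Let_def)
  moreover have "?W' \<subseteq> U x \<inter> U y" "?W' \<subseteq> U y \<inter> U z" "?W' \<subseteq> U x \<inter> U z" by blast+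
  ultimately have coc: "?g x y \<otimes>\<^bsub>sec P ?W\<^esub> ?g y z = ?g x z"
    using WW gc o by (simp add: res_mult res_closed res_comp open_Int)
  have "(?h x \<otimes>\<^bsub>sec P ?W\<^esub> ?g x y \<otimes>\<^bsub>sec P ?W\<^esub> inv\<^bsub>sec P ?W\<^esub> ?h y) \<otimes>\<^bsub>sec P ?W\<^esub>
      (?h y \<otimes>\<^bsub>sec P ?W\<^esub> ?g y z \<otimes>\<^bsub>sec P ?W\<^esub> inv\<^bsub>sec P ?W\<^esub> ?h z) =
      ?h x \<otimes>\<^bsub>sec P ?W\<^esub> (?g x y \<otimes>\<^bsub>sec P ?W\<^esub> ?g y z) \<otimes>\<^bsub>sec P ?W\<^esub> inv\<^bsub>sec P ?W\<^esub> ?h z"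
    by (rule W.mult_cancel_middle[OF hW gW(1,2)])
  also have "\<dots> = ?h x \<otimes>\<^bsub>sec P ?W\<^esub> ?g x z \<otimes>\<^bsub>sec P ?W\<^esub> inv\<^bsub>sec P ?W\<^esub> ?h z" by (simp only: coc)
  finally show "res P (V x \<inter> V y) ?W (twist U V g h x y) \<otimes>\<^bsub>sec P ?W\<^esub> res P (V y \<inter> V z) ?W (twist U V g h y z) =
      res P (V x \<inter> V z) ?W (twist U V g h x z)"
    by (simp add: t le_infI1 le_infI2)
qed

text \<open>By the convention for \<open>\<delta>\<close>, the class of \<open>g\<^sub>x\<^sub>y\<close> in the abelian quotient is \<open>E\<^sub>y E\<^sub>x\<^sup>-\<^sup>1\<close>. For
  a local lift \<open>t\<close> of \<open>E\<close> the class of \<open>t\<^sub>x g\<^sub>x\<^sub>y t\<^sub>y\<^sup>-\<^sup>1\<close> is then trivial. The lift lies in \<open>N m\<close>,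
  where \<open>m\<close> may be \<open>k - 1\<close>; the quotient \<open>N m / N l\<close> is abelian since \<open>l \<le> m + 2\<close>.\<close>

lemma adjust:
  assumes m: "2 \<le> m" "m \<le> k" "k \<le> m + 1" and l: "l = k + 1" and g: "cocycle k U g"
    and W: "pcover W" "\<And>x. W x \<subseteq> U x" and E: "E \<in> carrier (cochains 0 W (Quo m l))"
    and eq: "\<And>x y. sheaf_quotient.cls (Gr m) (Gr l) (W x \<inter> W y) (res P (U x \<inter> U y) (W x \<inter> W y) (g x y)) =
      cobd 0 W (Quo m l) E [x, y]"
  obtains V h where "pcover V" "\<And>x. V x \<subseteq> U x" "\<And>x. h x \<in> N 2 (V x)"
    "\<And>x y. twist U V g h x y \<in> N l (V x \<inter> V y)"
proof -
  let ?Q = "Quo m l"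
  interpret q: sheaf_quotient "Gr m" "Gr l" by (rule Gr_quotient) (use m l in auto)
  interpret Q: abelian_presheaf ?Q
    by (intro abelian_presheaf.intro abelian_presheaf_axioms.intro q.quot_presheaf_group Quo_comm) (use m l in auto)
  have Wo: "open (W x)" for x using W(1) pcover_open by blast
  have Uo: "open (U x)" for x using g pcover_open[of U] by (simp add: cocycle_def)
  have Ex: "E [x] \<in> carrier (sec ?Q (W x))" for x
    using E Q.C_iff[of E 0 W] by (auto simp: simplices_def cap_def dest: spec[of _ "[x]"])
  \<comment> \<open>a lift near each point; the neighbourhoods form the finer cover\<close>
  have "\<exists>V t. open V \<and> x \<in> V \<and> V \<subseteq> W x \<and> t \<in> N m V \<and> res ?Q (W x) V (E [x]) = q.cls V t" for x
  proof -
    have "x \<in> W x" using W(1) by (simp add: pcover_def)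
    from q.cls_locally[OF Ex this] show ?thesis by (metis Gr_simps(1))
  qed
  then obtain V t where Vl: "\<And>x. open (V x) \<and> x \<in> V x \<and> V x \<subseteq> W x \<and> t x \<in> N m (V x) \<and> res ?Q (W x) (V x) (E [x]) = q.cls (V x) (t x)"
    by metis
  show ?thesis
  proof (rule that[of V t])
    show V: "pcover V" using Vl by (simp add: pcover_def)
    show "V x \<subseteq> U x" for x using Vl W(2) by blast
    show "t x \<in> N 2 (V x)" for x using Vl N_mono[of "V x" 2 m] m by blast
    fix x y
    let ?A = "V x \<inter> V y" and ?B = "W x \<inter> W y"
    have o: "open ?A" "open ?B" "open (V x)" "open (V y)" "open (U x \<inter> U y)" using Vl Wo Uo by (auto simp: open_Int)
    have s: "?A \<subseteq> ?B" "?A \<subseteq> W x" "?A \<subseteq> W y" "?B \<subseteq> U x \<inter> U y" "?A \<subseteq> U x \<inter> U y" "V x \<subseteq> W x" "V y \<subseteq> W y"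
      using Vl W(2) by blast+
    let ?g = "res P (U x \<inter> U y) ?A (g x y)" and ?lx = "res P (V x) ?A (t x)" and ?ly = "res P (V y) ?A (t y)"
    have gm: "g x y \<in> N m (U x \<inter> U y)" using g N_mono[OF o(5) m(1,2)] by (auto simp: cocycle_def)
    have mem: "?g \<in> N m ?A" "?lx \<in> N m ?A" "?ly \<in> N m ?A" "res P (U x \<inter> U y) ?B (g x y) \<in> N m ?B"
      using Vl o s gm m(1) by (auto intro!: N_res)
    have mem': "?g \<in> carrier (sec (Gr m) ?A)" "?lx \<in> carrier (sec (Gr m) ?A)" "?ly \<in> carrier (sec (Gr m) ?A)"
      using mem by simp_all
    interpret A: group "sec P ?A" by (rule sec_group[OF o(1)])
    interpret G: group "sec (Gr m) ?A" by (rule q.sec_group[OF o(1)])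
    interpret QA: comm_group "sec ?Q ?A" by (rule Q.sec_comm[OF o(1)])
    have inv: "q.cls ?A (inv\<^bsub>sec (Gr m) ?A\<^esub> f) = inv\<^bsub>sec ?Q ?A\<^esub> q.cls ?A f" if "f \<in> carrier (sec (Gr m) ?A)" for f
      by (rule hom_inv_group[OF G.group_axioms Q.sec_group[OF o(1)] q.cls_hom[OF o(1)] that])
    have rE: "res ?Q ?B ?A (res ?Q (W u) ?B (E [u])) = q.cls ?A (res P (V u) ?A (t u))" if u: "u = x \<or> u = y" for u
    proof -
      have s': "?A \<subseteq> V u" "?B \<subseteq> W u" using u by auto
      have "res ?Q ?B ?A (res ?Q (W u) ?B (E [u])) = res ?Q (W u) ?A (E [u])"
        using s s' o Ex Wo by (simp add: Q.res_comp)
      also have "\<dots> = res ?Q (V u) ?A (res ?Q (W u) (V u) (E [u]))"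
        by (rule Q.res_comp[symmetric]) (use s' o Ex Wo Vl in auto)
      also have "\<dots> = q.cls ?A (res P (V u) ?A (t u))"
        using Vl o s' q.res_cls[of "V u" ?A "t u"] by simp
      finally show ?thesis .
    qed
    have cE: "res ?Q (W u) ?B (E [u]) \<in> carrier (sec ?Q ?B)" if u: "u = x \<or> u = y" for u
      using u Ex Wo o by (intro Q.res_closed) auto
    have "q.cls ?A ?g = res ?Q ?B ?A (q.cls ?B (res P (U x \<inter> U y) ?B (g x y)))"
      using mem o s gm N_carrier[OF o(5) m(1) gm] by (simp add: q.res_cls res_comp)
    also have "\<dots> = q.cls ?A ?ly \<otimes>\<^bsub>sec ?Q ?A\<^esub> inv\<^bsub>sec ?Q ?A\<^esub> q.cls ?A ?lx"
      unfolding eq Q.cobd_0[OF W(1) E]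
      using o s cE[of x] cE[of y] rE[of x] rE[of y] by (simp add: Q.res_mult Q.res_inv group.inv_closed[OF Q.sec_group])
    finally have e: "q.cls ?A ?g = q.cls ?A ?ly \<otimes>\<^bsub>sec ?Q ?A\<^esub> inv\<^bsub>sec ?Q ?A\<^esub> q.cls ?A ?lx" .
    note cl = q.cls_closed[OF o(1) mem'(1)] q.cls_closed[OF o(1) mem'(2)] q.cls_closed[OF o(1) mem'(3)]
    have "q.cls ?A ((?lx \<otimes>\<^bsub>sec (Gr m) ?A\<^esub> ?g) \<otimes>\<^bsub>sec (Gr m) ?A\<^esub> inv\<^bsub>sec (Gr m) ?A\<^esub> ?ly) =
        (q.cls ?A ?lx \<otimes>\<^bsub>sec ?Q ?A\<^esub> q.cls ?A ?g) \<otimes>\<^bsub>sec ?Q ?A\<^esub> inv\<^bsub>sec ?Q ?A\<^esub> q.cls ?A ?ly"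
      using q.cls_mult[OF o(1)] mem' G.m_closed G.inv_closed inv by (simp del: Gr_simps)
    also have "\<dots> = \<one>\<^bsub>sec ?Q ?A\<^esub>"
      unfolding e by (rule QA.mult_inv_cancel(1)[OF cl(2,3)])
    finally have "(?lx \<otimes>\<^bsub>sec (Gr m) ?A\<^esub> ?g) \<otimes>\<^bsub>sec (Gr m) ?A\<^esub> inv\<^bsub>sec (Gr m) ?A\<^esub> ?ly \<in> carrier (sec (Gr l) ?A)"
      using q.cls_eq_one_iff[OF o(1)] mem' G.m_closed G.inv_closed by (simp del: Gr_simps)
    then show "twist U V g t x y \<in> N l ?A"
      using mem o m(1) by (simp add: twist_def Let_def inv_Gr)
  qed
qed

text \<open>The cocycle \<open>g\<close> defines a cocycle \<open>c\<close> of \<open>N k / N (k + 1)\<close> and a cocycle \<open>a\<close> of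
  \<open>N k / N (k + 2)\<close> which lifts it, so the connecting map sends the class of \<open>c\<close> to 1 and the
  vanishing assumption applies to it. The result is a 0-cochain \<open>E\<close> whose coboundary is \<open>g\<close>, with
  values in \<open>N k / N (k + 1)\<close> if \<open>k = 2\<close> and in \<open>N (k - 1) / N (k + 1)\<close> otherwise; \<open>adjust\<close>
  concludes.\<close>

lemma cocycle_step:
  assumes van: "\<And>\<xi>. \<lbrakk>\<xi> \<in> carrier (cohom 1 (Quo k (k + 1))); bd 1 k \<xi> = \<one>\<^bsub>cohom 2 (Quo (k + 1) (k + 2))\<^esub>\<rbrakk> \<Longrightarrow>
      if k = 2 then \<xi> = \<one>\<^bsub>cohom 1 (Quo k (k + 1))\<^esub> else \<xi> \<in> bd 0 (k - 1) ` carrier (cohom 0 (Quo (k - 1) k))"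
    and k: "2 \<le> k" and g: "cocycle k U g"
  obtains V h where "pcover V" "\<And>x. V x \<subseteq> U x" "\<And>x. h x \<in> N 2 (V x)"
    "\<And>x y. twist U V g h x y \<in> N (k + 1) (V x \<inter> V y)"
proof -
  define l where l: "l = k + 1"
  define l2 where l2: "l2 = k + 2"
  have U: "pcover U" and gN: "g x y \<in> N k (U x \<inter> U y)" for x y using g by (auto simp: cocycle_def)
  have Uo: "open (U x)" for x using pcover_open[OF U] .
  interpret ex: exact_sequence "Quo l l2" "Quo k l2" "Quo k l" "quot_map (Gr k) (Gr l2)" "quot_map (Gr k) (Gr l)"
    using Quo_exact[OF k] by (simp only: l l2)
  interpret q: sheaf_quotient "Gr k" "Gr l" by (rule Gr_quotient) (use k l in auto)
  interpret q2: sheaf_quotient "Gr k" "Gr l2" by (rule Gr_quotient) (use k l2 in auto)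
  interpret incl: quotient_inclusion "Gr k" "Gr l2" "Gr k" "Gr l" by (rule Quo_inclusion) (use k l l2 in auto)
  have gG: "g x y \<in> carrier (sec (Gr k) (U x \<inter> U y))" for x y using gN by simp
  define c where "c = (\<lambda>xs\<in>simplices 1. q.cls (cap U xs) (g (xs ! 0) (xs ! 1)))"
  define a where "a = (\<lambda>xs\<in>simplices 1. q2.cls (cap U xs) (g (xs ! 0) (xs ! 1)))"
  have cap2: "cap U [x, y] = U x \<inter> U y" for x y by (auto simp: cap_def)
  have s1: "[x, y] \<in> simplices 1" for x y :: 'a by (simp add: simplices_def)
  have gxs: "g (xs ! 0) (xs ! 1) \<in> carrier (sec (Gr k) (cap U xs))" if "xs \<in> simplices 1" for xs
    using that gG by (auto simp: cap2 elim!: ex.aT.simplices_1E)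
  have aC: "a \<in> carrier (ex.aT.C 1 U)"
    using gxs by (simp add: ex.aT.C_iff a_def q2.cls_closed open_cap[OF U] del: Gr_simps)
  have mc: "ex.p.mc 1 U a = c"
    unfolding map_cochain_def a_def c_def using gxs
    by (intro restrict_ext) (simp add: incl.qmap_cls open_cap[OF U] del: Gr_simps)
  \<comment> \<open>the cocycle identity of \<open>g\<close>, read in the abelian quotient\<close>
  have da: "ex.aT.\<delta> 1 U a = \<one>\<^bsub>ex.aT.C 2 U\<^esub>"
  proof (rule extensionalityI)
    show "ex.aT.\<delta> 1 U a \<in> extensional (simplices 2)" by (simp add: cobd_def numeral_2_eq_2)
    show "\<one>\<^bsub>ex.aT.C 2 U\<^esub> \<in> extensional (simplices 2)" by (simp add: ex.aT.C_one)
    fix xs :: "'a list" assume xs: "xs \<in> simplices 2"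
    then obtain x y z where e: "xs = [x, y, z]" by (auto simp: numeral_2_eq_2 elim: ex.aT.simplices_2E)
    let ?W = "U x \<inter> U y \<inter> U z"
    have o: "open ?W" "open (U u \<inter> U v)" for u v using Uo by (auto intro: open_Int)
    interpret T: comm_group "sec (Quo k l2) ?W" by (rule ex.comm(2)[OF o(1)])
    have r: "res (Quo k l2) (U u \<inter> U v) ?W (a [u, v]) = q2.cls ?W (res P (U u \<inter> U v) ?W (g u v))"
      if "?W \<subseteq> U u \<inter> U v" for u v
      using q2.res_cls[OF o(2) o(1) that gG] by (simp add: a_def s1[simplified] cap2)
    have m: "res P (U u \<inter> U v) ?W (g u v) \<in> carrier (sec (Gr k) ?W)" if "?W \<subseteq> U u \<inter> U v" for u v
      using N_res[OF o(2) o(1) that k gN] by simp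
    have sub: "?W \<subseteq> U x \<inter> U y" "?W \<subseteq> U y \<inter> U z" "?W \<subseteq> U x \<inter> U z" by blast+
    note mm = m[OF sub(1)] m[OF sub(2)] m[OF sub(3)]
    note cc = q2.cls_closed[OF o(1) mm(1)] q2.cls_closed[OF o(1) mm(2)] q2.cls_closed[OF o(1) mm(3)]
    have "res P (U x \<inter> U y) ?W (g x y) \<otimes>\<^bsub>sec (Gr k) ?W\<^esub> res P (U y \<inter> U z) ?W (g y z) = res P (U x \<inter> U z) ?W (g x z)"
      using g by (simp add: cocycle_def Let_def)
    then have "q2.cls ?W (res P (U x \<inter> U z) ?W (g x z)) =
        q2.cls ?W (res P (U x \<inter> U y) ?W (g x y)) \<otimes>\<^bsub>sec (Quo k l2) ?W\<^esub> q2.cls ?W (res P (U y \<inter> U z) ?W (g y z))"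
      using q2.cls_mult[OF o(1) mm(1,2)] by metis
    then have "ex.aT.\<delta> 1 U a xs = \<one>\<^bsub>sec (Quo k l2) ?W\<^esub>"
      unfolding e ex.aT.cobd_1[OF U aC] r[OF sub(1)] r[OF sub(2)] r[OF sub(3)]
      using T.mult_inv_cancel(2)[OF cc(1,2)] by simp
    then show "ex.aT.\<delta> 1 U a xs = \<one>\<^bsub>ex.aT.C 2 U\<^esub> xs"
      using xs by (simp add: ex.aT.C_one e cap_def Int_assoc)
  qed
  have dc: "ex.aR.\<delta> 1 U c = \<one>\<^bsub>ex.aR.C 2 U\<^esub>"
    using ex.p.mc_cobd[OF U aC] ex.p.mc_one[OF U, of 2] da mc by (simp add: numeral_2_eq_2)
  then have cZ: "c \<in> ex.aR.Z 1 U"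
    using ex.p.mc_closed[OF U aC] unfolding mc by (simp add: cocycles_def numeral_2_eq_2)
  have "ex.represents 1 U a \<one>\<^bsub>ex.aS.C 2 U\<^esub>"
    using U aC cZ da ex.aS.one_Z[OF U, of 2] ex.i.mc_one[OF U, of 2] unfolding ex.represents_def mc
    by (simp add: numeral_2_eq_2)
  then have "connecting 1 (Quo l l2) (Quo k l2) (Quo k l) (quot_map (Gr k) (Gr l2)) (quot_map (Gr k) (Gr l))
      (ex.aR.hclass 1 U c) = ex.aS.hclass (Suc 1) U \<one>\<^bsub>ex.aS.C 2 U\<^esub>"
    using ex.connecting_eq[of 1 U a "\<one>\<^bsub>ex.aS.C 2 U\<^esub>"] unfolding mc by blast
  also have "\<dots> = \<one>\<^bsub>cohom 2 (Quo l l2)\<^esub>"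
    unfolding ex.aS.cohom_one[OF U, of 2] by (simp add: numeral_2_eq_2)
  finally have "bd 1 k (ex.aR.hclass 1 U c) = \<one>\<^bsub>cohom 2 (Quo l l2)\<^esub>" unfolding l l2 .
  from van[of "ex.aR.hclass 1 U c"] ex.aR.hclass_in_cohom[OF U cZ] this
  have cases: "if k = 2 then ex.aR.hclass 1 U c = \<one>\<^bsub>cohom 1 (Quo k l)\<^esub>
      else ex.aR.hclass 1 U c \<in> bd 0 (k - 1) ` carrier (cohom 0 (Quo (k - 1) k))"
    unfolding l l2 by blast
  have "\<exists>m W E. 2 \<le> m \<and> m \<le> k \<and> k \<le> m + 1 \<and> pcover W \<and> (\<forall>x. W x \<subseteq> U x) \<and> E \<in> carrier (cochains 0 W (Quo m l)) \<and>
      (\<forall>x y. sheaf_quotient.cls (Gr m) (Gr l) (W x \<inter> W y) (res P (U x \<inter> U y) (W x \<inter> W y) (g x y)) = cobd 0 W (Quo m l) E [x, y])"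
  proof -
    have rc: "ex.aR.rf 1 U W c [x, y] = q.cls (W x \<inter> W y) (res P (U x \<inter> U y) (W x \<inter> W y) (g x y))"
      if W: "pcover W" "\<forall>x. W x \<subseteq> U x" for W x y
    proof -
      have "W x \<inter> W y \<subseteq> U x \<inter> U y" using W by blast
      then show ?thesis
        using q.res_cls[of "U x \<inter> U y" "W x \<inter> W y" "g x y"] gG Uo pcover_open[OF W(1)] s1[of x y]
        by (simp add: refine_cochain_def c_def cap2 open_Int) (simp add: cap_def)
    qed
    show ?thesis
    proof (cases "k = 2")
      case True
      then have "ex.aR.hclass 1 U c = ex.aR.hclass 1 U \<one>\<^bsub>ex.aR.C 1 U\<^esub>" using cases ex.aR.cohom_one[OF U, of 1] by simp
      then obtain W b where W: "pcover W" "\<forall>x. W x \<subseteq> U x" "b \<in> ex.aR.B 1 W"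
        "ex.aR.rf 1 U W c = b \<otimes>\<^bsub>ex.aR.C 1 W\<^esub> ex.aR.rf 1 U W \<one>\<^bsub>ex.aR.C 1 U\<^esub>"
        using ex.aR.hclass_eq_iff[OF U cZ U ex.aR.one_Z[OF U]] by blast
      obtain E where E: "E \<in> carrier (ex.aR.C 0 W)" "b = ex.aR.\<delta> 0 W E"
        using W(3) by (auto simp: coboundaries_def)
      have "ex.aR.rf 1 U W c = ex.aR.\<delta> 0 W E"
        unfolding W(4) ex.aR.refine_one[OF U W(1,2)] E(2)
        using monoid.r_one[OF group.is_monoid[OF ex.aR.C_group[OF W(1)]]] ex.aR.cobd_closed[OF W(1) E(1)] by simp
      then show ?thesis
        using k W E rc[OF W(1,2)] by (intro exI[of _ k] exI[of _ W] exI[of _ E]) simp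
    next
      case False
      define m where m: "m = k - 1"
      have m2: "2 \<le> m" "m + 1 = k" "m + 2 = l" using False k by (auto simp: m l)
      interpret ey: exact_sequence "Quo k l" "Quo m l" "Quo m k" "quot_map (Gr m) (Gr l)" "quot_map (Gr m) (Gr k)"
        using Quo_exact[OF m2(1)] by (simp only: m2)
      interpret qm: sheaf_quotient "Gr m" "Gr l" by (rule Gr_quotient) (use m2 in auto)
      interpret im: quotient_inclusion "Gr k" "Gr l" "Gr m" "Gr l" by (rule Quo_inclusion) (use k l m2 in auto)
      obtain \<nu> where nu: "\<nu> \<in> carrier (cohom 0 (Quo m k))" "ex.aR.hclass 1 U c = bd 0 m \<nu>"
        using cases False by (auto simp: m)
      obtain U' a' b' where r: "ey.represents 0 U' a' b'" "\<nu> = ey.aR.hclass 0 U' (ey.p.mc 0 U' a')"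
        using ey.represents_0_ex[OF nu(1)] .
      have "bd 0 m \<nu> = ex.aR.hclass 1 U' b'"
        using ey.connecting_eq[OF _ r(1)] unfolding r(2) m2 by simp
      then have eq: "ex.aR.hclass 1 U c = ex.aR.hclass 1 U' b'" using nu(2) by simp
      have U': "pcover U'" "b' \<in> ex.aR.Z 1 U'" "a' \<in> carrier (ey.aT.C 0 U')" "ey.i.mc 1 U' b' = ey.aT.\<delta> 0 U' a'"
        using r(1) by (auto simp: ey.represents_def)
      obtain W b where W: "pcover W" "\<forall>x. W x \<subseteq> U x" "\<forall>x. W x \<subseteq> U' x" "b \<in> ex.aR.B 1 W"
        "ex.aR.rf 1 U W c = b \<otimes>\<^bsub>ex.aR.C 1 W\<^esub> ex.aR.rf 1 U' W b'"
        using eq ex.aR.hclass_eq_iff[OF U cZ U'(1,2)] by blast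
      obtain e where e: "e \<in> carrier (ex.aR.C 0 W)" "b = ex.aR.\<delta> 0 W e"
        using W(4) by (auto simp: coboundaries_def)
      \<comment> \<open>\<open>g\<close> and the representative \<open>b'\<close> of \<open>\<partial>\<nu>\<close> differ by \<open>\<delta>e\<close>, and \<open>b'\<close> itself is \<open>\<delta>a'\<close> one step lower in the filtration; so \<open>g\<close> is the coboundary of the product of \<open>e\<close> and \<open>a'\<close>\<close>
      let ?E = "ey.i.mc 0 W e \<otimes>\<^bsub>ey.aT.C 0 W\<^esub> ey.aT.rf 0 U' W a'"
      have cl: "ey.i.mc 0 W e \<in> carrier (ey.aT.C 0 W)" "ey.aT.rf 0 U' W a' \<in> carrier (ey.aT.C 0 W)"
        using ey.i.mc_closed[OF W(1) e(1)] ey.aT.refine_closed[OF U'(1) W(1,3) U'(3)] .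
      have "ey.i.mc 1 W (ex.aR.rf 1 U W c) = ey.i.mc 1 W b \<otimes>\<^bsub>ey.aT.C 1 W\<^esub> ey.i.mc 1 W (ex.aR.rf 1 U' W b')"
        unfolding W(5) e(2)
        using ex.aR.cobd_closed[OF W(1) e(1)] ex.aR.refine_closed[OF U'(1) W(1,3) ex.aR.Z_carrier[OF U'(2)]]
        by (intro ey.i.mc_mult[OF W(1)]) simp_all
      also have "ey.i.mc 1 W b = ey.aT.\<delta> 0 W (ey.i.mc 0 W e)"
        unfolding e(2) using ey.i.mc_cobd[OF W(1) e(1)] by simp
      also have "ey.i.mc 1 W (ex.aR.rf 1 U' W b') = ey.aT.\<delta> 0 W (ey.aT.rf 0 U' W a')"
        using ey.i.mc_refine[OF U'(1) W(1,3) ex.aR.Z_carrier[OF U'(2)]] ey.aT.refine_cobd[OF U'(1) W(1,3) U'(3)] U'(4) by simp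
      also have "ey.aT.\<delta> 0 W (ey.i.mc 0 W e) \<otimes>\<^bsub>ey.aT.C 1 W\<^esub> ey.aT.\<delta> 0 W (ey.aT.rf 0 U' W a') = ey.aT.\<delta> 0 W ?E"
        using ey.aT.cobd_mult[OF W(1) cl] by simp
      finally have E: "ey.i.mc 1 W (ex.aR.rf 1 U W c) = ey.aT.\<delta> 0 W ?E" .
      have "qm.cls (W x \<inter> W y) (res P (U x \<inter> U y) (W x \<inter> W y) (g x y)) = ey.aT.\<delta> 0 W ?E [x, y]" for x y
      proof -
        have o: "open (W x \<inter> W y)" "open (U x \<inter> U y)" using pcover_open[OF W(1)] Uo by (auto intro: open_Int)
        have "W x \<inter> W y \<subseteq> U x \<inter> U y" using W(2) by blast
        then have "res P (U x \<inter> U y) (W x \<inter> W y) (g x y) \<in> carrier (sec (Gr k) (W x \<inter> W y))"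
          using N_res[OF o(2,1) _ k gN] by simp
        moreover have "ey.i.mc 1 W (ex.aR.rf 1 U W c) [x, y] = quot_map (Gr m) (Gr l) (W x \<inter> W y) (ex.aR.rf 1 U W c [x, y])"
          using s1[of x y] by (simp add: map_cochain_def cap_def)
        ultimately show ?thesis
          using rc[OF W(1,2)] im.qmap_cls[OF o(1)] E by simp
      qed
      moreover have "?E \<in> carrier (ey.aT.C 0 W)"
        using monoid.m_closed[OF group.is_monoid[OF ey.aT.C_group[OF W(1)]] cl] .
      ultimately show ?thesis
        using k m2 W(1,2) by (intro exI[of _ m] exI[of _ W] exI[of _ ?E]) simp
    qed
  qed
  then obtain m W E where m: "2 \<le> m" "m \<le> k" "k \<le> m + 1" and W: "pcover W" "\<And>x. W x \<subseteq> U x"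
    and E: "E \<in> carrier (cochains 0 W (Quo m l))"
    and eq: "\<And>x y. sheaf_quotient.cls (Gr m) (Gr l) (W x \<inter> W y) (res P (U x \<inter> U y) (W x \<inter> W y) (g x y)) = cobd 0 W (Quo m l) E [x, y]"
    by blast
  from adjust[OF m l g W E eq] that show ?thesis unfolding l by metis
qed

lemma res_trans_twist:
  assumes "pcover U" "pcover V" "pcover W" "\<And>x. V x \<subseteq> U x" "\<And>x. W x \<subseteq> V x"
    and "\<And>x. h x \<in> N 2 (V x)" "\<And>x. h' x \<in> N 2 (W x)" "\<And>x y. g x y \<in> N 2 (U x \<inter> U y)"
  shows "twist V W (twist U V g h) h' x y = twist U W g (\<lambda>x. h' x \<otimes>\<^bsub>sec P (W x)\<^esub> res P (V x) (W x) (h x)) x y"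
proof -
  let ?A = "V x \<inter> V y" and ?B = "W x \<inter> W y"
  have o: "open (U u)" "open (V u)" "open (W u)" for u using assms pcover_open by blast+
  note oi = open_Int[OF o(1) o(1)] open_Int[OF o(2) o(2)] open_Int[OF o(3) o(3)]
  have s: "?B \<subseteq> ?A" "?A \<subseteq> U x \<inter> U y" "?B \<subseteq> U x \<inter> U y" "?B \<subseteq> V x" "?B \<subseteq> V y" "W x \<subseteq> V x" "W y \<subseteq> V y"
    using assms(4,5) by blast+
  interpret B: group "sec P ?B" by (rule sec_group[OF oi(3)])
  interpret A: group "sec P ?A" by (rule sec_group[OF oi(2)])
  have c: "h u \<in> carrier (sec P (V u))" "h' u \<in> carrier (sec P (W u))" "g x y \<in> carrier (sec P (U x \<inter> U y))" for u
    using assms(6,7,8) N_carrier[of _ 2] o oi by auto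
  have cA: "res P (V x) ?A (h x) \<in> carrier (sec P ?A)" "res P (V y) ?A (h y) \<in> carrier (sec P ?A)"
    "res P (U x \<inter> U y) ?A (g x y) \<in> carrier (sec P ?A)"
    by (rule res_closed; use c o oi s in blast)+
  have cW: "res P (V u) (W u) (h u) \<in> carrier (sec P (W u))" for u
    by (rule res_closed) (use c o assms(5) in auto)
  have cB: "res P (V x) ?B (h x) \<in> carrier (sec P ?B)" "res P (V y) ?B (h y) \<in> carrier (sec P ?B)"
    "res P (U x \<inter> U y) ?B (g x y) \<in> carrier (sec P ?B)"
    "res P (W x) ?B (h' x) \<in> carrier (sec P ?B)" "res P (W y) ?B (h' y) \<in> carrier (sec P ?B)"
    by (rule res_closed; use c o oi s in blast)+
  have 1: "res P ?A ?B (twist U V g h x y) =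
      (res P (V x) ?B (h x) \<otimes>\<^bsub>sec P ?B\<^esub> res P (U x \<inter> U y) ?B (g x y)) \<otimes>\<^bsub>sec P ?B\<^esub> inv\<^bsub>sec P ?B\<^esub> res P (V y) ?B (h y)"
    unfolding twist_def Let_def using cA c o oi s by (simp add: res_mult res_inv res_comp)
  have 2: "res P (W u) ?B (h' u \<otimes>\<^bsub>sec P (W u)\<^esub> res P (V u) (W u) (h u)) =
      res P (W u) ?B (h' u) \<otimes>\<^bsub>sec P ?B\<^esub> res P (V u) ?B (h u)" if "?B \<subseteq> W u" for u
    using c cW o oi assms(5) that by (simp add: res_mult res_comp)
  show ?thesis
    unfolding twist_def[of V W] twist_def[of U W] Let_def 1
    using cB by (simp add: 2 B.m_assoc B.inv_mult_group)
qed

text \<open>Induction on \<open>k\<close>; successive twists compose to a single one.\<close>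

theorem cocycle_trivialisation:
  assumes van: "\<And>k \<xi>. \<lbrakk>2 \<le> k; \<xi> \<in> carrier (cohom 1 (Quo k (k + 1))); bd 1 k \<xi> = \<one>\<^bsub>cohom 2 (Quo (k + 1) (k + 2))\<^esub>\<rbrakk> \<Longrightarrow>
      if k = 2 then \<xi> = \<one>\<^bsub>cohom 1 (Quo k (k + 1))\<^esub> else \<xi> \<in> bd 0 (k - 1) ` carrier (cohom 0 (Quo (k - 1) k))"
    and g: "cocycle 2 U g" and k: "2 \<le> k"
  shows "\<exists>V h. pcover V \<and> (\<forall>x. V x \<subseteq> U x) \<and> (\<forall>x. h x \<in> N 2 (V x)) \<and> cocycle k V (twist U V g h)"
  using k
proof (induction k rule: dec_induct)
  case base
  have U: "pcover U" "\<And>x y. g x y \<in> N 2 (U x \<inter> U y)" using g by (auto simp: cocycle_def)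
  have h: "\<one>\<^bsub>sec P (U x)\<^esub> \<in> N 2 (U x)" for x
    using subgroup.one_closed[OF N_subgroup] pcover_open[OF U(1)] by blast
  have "cocycle 2 U (twist U U g (\<lambda>x. \<one>\<^bsub>sec P (U x)\<^esub>))"
    by (rule twist_cocycle[OF g _ U(1)]) (use h U twist_closed[OF U(1) U(1)] in auto)
  then show ?case using U(1) h by (intro exI[of _ U] exI[of _ "\<lambda>x. \<one>\<^bsub>sec P (U x)\<^esub>"]) simp
next
  case (step k)
  then obtain V h where V: "pcover V" "\<And>x. V x \<subseteq> U x" "\<And>x. h x \<in> N 2 (V x)" and c: "cocycle k V (twist U V g h)"
    by blast
  have k: "2 \<le> k" using step by simp
  obtain W h' where W: "pcover W" "\<And>x. W x \<subseteq> V x" "\<And>x. h' x \<in> N 2 (W x)"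
    "\<And>x y. twist V W (twist U V g h) h' x y \<in> N (k + 1) (W x \<inter> W y)"
    using cocycle_step[OF van[OF k] k c] by metis
  let ?h = "\<lambda>x. h' x \<otimes>\<^bsub>sec P (W x)\<^esub> res P (V x) (W x) (h x)"
  have U: "pcover U" "\<And>x y. g x y \<in> N 2 (U x \<inter> U y)" using g by (auto simp: cocycle_def)
  have "cocycle (k + 1) W (twist V W (twist U V g h) h')"
    by (rule twist_cocycle[OF c k W(1,2,3) _ W(4)]) (use k in simp)
  moreover have "twist V W (twist U V g h) h' = twist U W g ?h"
    by (intro ext res_trans_twist) (use U V W in auto)
  moreover have "?h x \<in> N 2 (W x)" for x
    using subgroup.m_closed[OF N_subgroup[of "W x" 2]] W V N_res[of "V x" "W x" 2 "h x"]
      pcover_open[OF W(1), of x] pcover_open[OF V(1), of x] by simp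
  moreover have "W x \<subseteq> U x" for x using V W by blast
  ultimately show ?case using W(1) by (intro exI[of _ W] exI[of _ ?h]) simp
qed

end

section \<open>Holomorphic functions on a complex manifold\<close>

lemma holomorphic_Cn_subset: "holomorphic_Cn n W f \<Longrightarrow> W' \<subseteq> W \<Longrightarrow> holomorphic_Cn n W' f"
  unfolding holomorphic_Cn_def using continuous_on_subset by blast

lemma holomorphic_Cn_binary:
  assumes f: "holomorphic_Cn n W f" and g: "holomorphic_Cn n W g"
  shows "holomorphic_Cn n W (\<lambda>z. f z + g z)" "holomorphic_Cn n W (\<lambda>z. f z * g z)"
  using assms unfolding holomorphic_Cn_def
  by (auto intro!: continuous_on_add continuous_on_mult field_differentiable_add field_differentiable_mult)

lemma holomorphic_Cn_inverse:
  assumes f: "holomorphic_Cn n W f" and nz: "\<And>z. z \<in> W \<Longrightarrow> f z \<noteq> 0"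
  shows "holomorphic_Cn n W (\<lambda>z. inverse (f z))"
  using assms unfolding holomorphic_Cn_def
  by (auto intro!: continuous_on_inverse field_differentiable_inverse)

lemma continuous_on_coordinate_line: "continuous_on UNIV (\<lambda>t. z(i := t :: complex))"
proof (rule continuous_on_coordinatewise_then_product)
  fix j show "continuous_on UNIV (\<lambda>t. (z(i := t)) j)" by (cases "j = i") auto
qed

text \<open>Inside \<open>\<complex>\<^sup>n\<close> a relatively open set contains a disc around each of its points in each of the
  first \<open>n\<close> coordinate directions, so continuity and the partial derivatives only depend on the
  function near the point.\<close>

lemma holomorphic_Cn_local:
  assumes W: "W \<subseteq> Cn n"
    and loc: "\<And>z. z \<in> W \<Longrightarrow> \<exists>W' g. z \<in> W' \<and> W' \<subseteq> W \<and> openin (top_of_set (Cn n)) W' \<and>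
      holomorphic_Cn n W' g \<and> (\<forall>w\<in>W'. f w = g w)"
  shows "holomorphic_Cn n W f"
  unfolding holomorphic_Cn_def continuous_on_eq_continuous_within
proof (intro conjI ballI allI impI)
  fix z assume z: "z \<in> W"
  from loc[OF z] obtain W' g where W': "z \<in> W'" "W' \<subseteq> W" "openin (top_of_set (Cn n)) W'"
    and g: "holomorphic_Cn n W' g" "\<And>w. w \<in> W' \<Longrightarrow> f w = g w" by blast
  then obtain T where T: "open T" "W' = Cn n \<inter> T" by (auto simp: openin_open)
  have nh: "at z within W = at z within W'"
    by (rule at_within_nhd[of z T]) (use T W' W in auto)
  have "continuous (at z within W') f"
    using g W' unfolding holomorphic_Cn_def continuous_on_eq_continuous_within
    by (metis (mono_tags, lifting) continuous_on_cong continuous_on_eq_continuous_within)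
  then show "continuous (at z within W) f" by (simp add: continuous_within nh)
  fix i assume i: "i < n"
  let ?S = "(\<lambda>t. z(i := t)) -` T"
  have S: "open ?S" using open_vimage[OF T(1) continuous_on_coordinate_line] .
  have "z(i := t) \<in> W'" if "t \<in> ?S" for t
    using that W' i unfolding T(2) by (auto simp: Cn_def)
  then have e: "g (z(i := t)) = f (z(i := t))" if "t \<in> ?S" for t using g(2) that by simp
  have "z i \<in> ?S" using W'(1) T by simp
  moreover obtain d where "((\<lambda>t. g (z(i := t))) has_field_derivative d) (at (z i))"
    using g(1) W'(1) i unfolding holomorphic_Cn_def field_differentiable_def by blast
  ultimately have "((\<lambda>t. f (z(i := t))) has_field_derivative d) (at (z i))"
    using has_field_derivative_transform_within_open[of "\<lambda>t. g (z(i := t))" d "z i" ?S "\<lambda>t. f (z(i := t))"] S e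
    by blast
  then show "(\<lambda>t. f (z(i := t))) field_differentiable at (z i)"
    by (auto simp: field_differentiable_def)
qed

lemma holomorphic_fun_mono: "holomorphic_fun M U f \<Longrightarrow> V \<subseteq> U \<Longrightarrow> holomorphic_fun M V f"
  unfolding holomorphic_fun_def by (fastforce intro: holomorphic_Cn_subset)

lemma holomorphic_fun_const: "holomorphic_fun M U (\<lambda>x. c)"
  unfolding holomorphic_fun_def holomorphic_Cn_def by (auto simp: comp_def)

lemma holomorphic_fun_add: "\<lbrakk>holomorphic_fun M U f; holomorphic_fun M U g\<rbrakk> \<Longrightarrow> holomorphic_fun M U (\<lambda>x. f x + g x)"
  and holomorphic_fun_mult: "\<lbrakk>holomorphic_fun M U f; holomorphic_fun M U g\<rbrakk> \<Longrightarrow> holomorphic_fun M U (\<lambda>x. f x * g x)"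
  unfolding holomorphic_fun_def comp_def by (fastforce intro: holomorphic_Cn_binary)+

lemma holomorphic_fun_sum:
  "(\<And>i. i \<in> I \<Longrightarrow> holomorphic_fun M U (f i)) \<Longrightarrow> holomorphic_fun M U (\<lambda>x. \<Sum>i\<in>I. f i x)"
  by (induction I rule: infinite_finite_induct) (auto intro: holomorphic_fun_const holomorphic_fun_add)

locale manifold =
  fixes M :: "'a::{t2_space,second_countable_topology} cmanifold"
  assumes manifold: "complex_manifold M"
begin

abbreviation hol :: "'a set \<Rightarrow> ('a \<Rightarrow> complex) \<Rightarrow> bool" where
  "hol \<equiv> holomorphic_fun M"

lemma chart:
  assumes "(D, \<phi>) \<in> charts M"
  shows "open D" "openin (top_of_set (Cn (cdim M))) (\<phi> ` D)" "homeomorphism D (\<phi> ` D) \<phi> (inv_into D \<phi>)"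
  using manifold assms unfolding complex_manifold_def by auto

lemma chart_inv: "(D, \<phi>) \<in> charts M \<Longrightarrow> x \<in> D \<Longrightarrow> inv_into D \<phi> (\<phi> x) = x"
  using chart(3)[of D \<phi>] by (auto simp: homeomorphism_def)

lemma chart_open:
  assumes "(D, \<phi>) \<in> charts M" "open V"
  shows "openin (top_of_set (Cn (cdim M))) (\<phi> ` (D \<inter> V))"
proof -
  have "openin (top_of_set D) (D \<inter> V)" using assms(2) by (auto simp: openin_open)
  from homeomorphism_imp_open_map[OF chart(3)[OF assms(1)] this]
  show ?thesis using chart(2)[OF assms(1)] openin_trans by blast
qed

lemma hol_local:
  assumes loc: "\<And>x. x \<in> U \<Longrightarrow> \<exists>V g. open V \<and> x \<in> V \<and> V \<subseteq> U \<and> hol V g \<and> (\<forall>y\<in>V. f y = g y)"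
  shows "hol U f"
  unfolding holomorphic_fun_def
proof (clarify)
  fix D \<phi> assume ch: "(D, \<phi>) \<in> charts M"
  show "holomorphic_Cn (cdim M) (\<phi> ` (D \<inter> U)) (f \<circ> inv_into D \<phi>)"
  proof (rule holomorphic_Cn_local)
    show "\<phi> ` (D \<inter> U) \<subseteq> Cn (cdim M)" using openin_subset[OF chart(2)[OF ch]] by auto
    fix z assume "z \<in> \<phi> ` (D \<inter> U)"
    then obtain x where x: "x \<in> D" "x \<in> U" "z = \<phi> x" by blast
    from loc[OF x(2)] obtain V g where V: "open V" "x \<in> V" "V \<subseteq> U" "hol V g" "\<forall>y\<in>V. f y = g y" by blast
    have "holomorphic_Cn (cdim M) (\<phi> ` (D \<inter> V)) (g \<circ> inv_into D \<phi>)"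
      using V(4) ch by (auto simp: holomorphic_fun_def)
    moreover have "\<forall>w\<in>\<phi> ` (D \<inter> V). (f \<circ> inv_into D \<phi>) w = (g \<circ> inv_into D \<phi>) w"
      using V(5) chart_inv[OF ch] by auto
    ultimately show "\<exists>W' g. z \<in> W' \<and> W' \<subseteq> \<phi> ` (D \<inter> U) \<and> openin (top_of_set (Cn (cdim M))) W' \<and>
        holomorphic_Cn (cdim M) W' g \<and> (\<forall>w\<in>W'. (f \<circ> inv_into D \<phi>) w = g w)"
      using V x chart_open[OF ch V(1)] by (intro exI[of _ "\<phi> ` (D \<inter> V)"] exI[of _ "g \<circ> inv_into D \<phi>"]) blast
  qed
qed

lemma hol_cong: "open U \<Longrightarrow> hol U g \<Longrightarrow> (\<And>x. x \<in> U \<Longrightarrow> f x = g x) \<Longrightarrow> hol U f"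
  by (rule hol_local) blast

lemma hol_restrict: "open V \<Longrightarrow> hol U f \<Longrightarrow> V \<subseteq> U \<Longrightarrow> hol V (\<lambda>x. if x \<in> V then f x else 0)"
  by (rule hol_cong[OF _ holomorphic_fun_mono]) auto

lemma hol_uminus: "hol U f \<Longrightarrow> hol U (\<lambda>x. - f x)"
  using holomorphic_fun_mult[OF holomorphic_fun_const[of M U "-1"]] by simp

lemma hol_diff: "hol U f \<Longrightarrow> hol U g \<Longrightarrow> hol U (\<lambda>x. f x - g x)"
  using holomorphic_fun_add[OF _ hol_uminus] by simp

lemma hol_inverse:
  assumes "hol U f" "\<And>x. x \<in> U \<Longrightarrow> f x \<noteq> 0"
  shows "hol U (\<lambda>x. inverse (f x))"
  unfolding holomorphic_fun_def
proof (clarify)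
  fix D \<phi> assume ch: "(D, \<phi>) \<in> charts M"
  have "holomorphic_Cn (cdim M) (\<phi> ` (D \<inter> U)) (\<lambda>z. inverse ((f \<circ> inv_into D \<phi>) z))"
  proof (rule holomorphic_Cn_inverse)
    show "holomorphic_Cn (cdim M) (\<phi> ` (D \<inter> U)) (f \<circ> inv_into D \<phi>)"
      using assms(1) ch by (auto simp only: holomorphic_fun_def)
  qed (use assms(2) chart_inv[OF ch] in auto)
  then show "holomorphic_Cn (cdim M) (\<phi> ` (D \<inter> U)) ((\<lambda>x. inverse (f x)) \<circ> inv_into D \<phi>)"
    by (simp add: comp_def)
qed

lemma hol_nonzero_nhd:
  assumes U: "open U" and f: "hol U f" and x: "x \<in> U" "f x \<noteq> 0"
  obtains V where "open V" "x \<in> V" "V \<subseteq> U" "\<And>y. y \<in> V \<Longrightarrow> f y \<noteq> 0"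
proof -
  have "\<exists>D \<phi>. (D, \<phi>) \<in> charts M \<and> x \<in> D"
    using manifold unfolding complex_manifold_def by blast
  then obtain D \<phi> where ch: "(D, \<phi>) \<in> charts M" "x \<in> D" by blast
  have "continuous_on (\<phi> ` (D \<inter> U)) (f \<circ> inv_into D \<phi>)"
    using f ch(1) by (auto simp: holomorphic_fun_def holomorphic_Cn_def)
  moreover have "continuous_on (D \<inter> U) \<phi>"
    using homeomorphism_cont1[OF chart(3)[OF ch(1)]] continuous_on_subset by blast
  ultimately have "continuous_on (D \<inter> U) ((f \<circ> inv_into D \<phi>) \<circ> \<phi>)" using continuous_on_compose by blast
  then have "continuous_on (D \<inter> U) f"
    by (rule continuous_on_eq) (simp add: chart_inv[OF ch(1)])
  moreover have o: "open (D \<inter> U)" using U chart(1)[OF ch(1)] by auto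
  ultimately have "open ((D \<inter> U) \<inter> f -` (- {0}))"
    using continuous_on_open_vimage[of "D \<inter> U" f] by (metis inf_commute open_Compl closed_singleton)
  then show ?thesis using that[of "(D \<inter> U) \<inter> f -` (- {0})"] x ch by auto
qed

end

section \<open>The exterior algebra\<close>

text \<open>Coefficient families supported on subsets of \<open>{..<r}\<close>; on these \<open>ext_one\<close> is a unit for the
  product.\<close>

definition ext_alg :: "nat \<Rightarrow> (nat set \<Rightarrow> complex) set" where
  "ext_alg r = {u. \<forall>K. \<not> K \<subseteq> {..<r} \<longrightarrow> u K = 0}"

lemma ext_zero: "u \<in> ext_alg r \<Longrightarrow> \<not> K \<subseteq> {..<r} \<Longrightarrow> u K = 0"
  by (simp add: ext_alg_def)

lemma ext_one_in: "ext_one \<in> ext_alg r"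
  by (auto simp: ext_alg_def ext_one_def)

lemma ext_vec_in: "ext_vec r v \<in> ext_alg r"
  by (auto simp: ext_alg_def ext_vec_def intro!: sum.neutral)

lemma wedge_in:
  assumes "u \<in> ext_alg r" "v \<in> ext_alg r" shows "wedge u v \<in> ext_alg r"
  unfolding ext_alg_def wedge_def mem_Collect_eq
proof (intro allI impI sum.neutral ballI)
  fix K I assume K: "\<not> K \<subseteq> {..<r}" "I \<in> Pow K"
  then have "\<not> I \<subseteq> {..<r} \<or> \<not> K - I \<subseteq> {..<r}" by blast
  then show "ext_sign I (K - I) * u I * v (K - I) = 0"
    using ext_zero[OF assms(1), of I] ext_zero[OF assms(2), of "K - I"] by auto
qed

lemma wedge_infinite: "infinite K \<Longrightarrow> wedge u v K = 0"
  unfolding wedge_def by (simp add: finite_Pow_iff)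

lemma wedge_add_left: "wedge (\<lambda>K. u K + v K) w K = wedge u w K + wedge v w K"
  and wedge_add_right: "wedge w (\<lambda>K. u K + v K) K = wedge w u K + wedge w v K"
  by (simp_all add: wedge_def algebra_simps sum.distrib)

lemma wedge_scale_left: "wedge (\<lambda>K. c * u K) v K = c * wedge u v K"
  and wedge_scale_right: "wedge u (\<lambda>K. c * v K) K = c * wedge u v K"
  by (simp_all add: wedge_def sum_distrib_left mult_ac)

lemma wedge_sum_left: "wedge (\<lambda>K. \<Sum>j\<in>S. c j * f j K) v = (\<lambda>K. \<Sum>j\<in>S. c j * wedge (f j) v K)"
proof
  fix K
  have "wedge (\<lambda>K. \<Sum>j\<in>S. c j * f j K) v K = (\<Sum>I\<in>Pow K. \<Sum>j\<in>S. c j * (ext_sign I (K - I) * f j I * v (K - I)))"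
    unfolding wedge_def by (rule sum.cong) (simp_all add: sum_distrib_left sum_distrib_right mult_ac)
  also have "\<dots> = (\<Sum>j\<in>S. c j * wedge (f j) v K)"
    by (subst sum.swap) (simp add: wedge_def sum_distrib_left)
  finally show "wedge (\<lambda>K. \<Sum>j\<in>S. c j * f j K) v K = (\<Sum>j\<in>S. c j * wedge (f j) v K)" .
qed

lemma wedge_sum_right: "wedge v (\<lambda>K. \<Sum>j\<in>S. c j * f j K) = (\<lambda>K. \<Sum>j\<in>S. c j * wedge v (f j) K)"
proof
  fix K
  have "wedge v (\<lambda>K. \<Sum>j\<in>S. c j * f j K) K = (\<Sum>I\<in>Pow K. \<Sum>j\<in>S. c j * (ext_sign I (K - I) * v I * f j (K - I)))"
    unfolding wedge_def by (rule sum.cong) (simp_all add: sum_distrib_left mult_ac)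
  also have "\<dots> = (\<Sum>j\<in>S. c j * wedge v (f j) K)"
    by (subst sum.swap) (simp add: wedge_def sum_distrib_left)
  finally show "wedge v (\<lambda>K. \<Sum>j\<in>S. c j * f j K) K = (\<Sum>j\<in>S. c j * wedge v (f j) K)" .
qed

lemma ext_sign_empty [simp]: "ext_sign {} J = 1" "ext_sign I {} = 1"
  by (simp_all add: ext_sign_def)

lemma wedge_one_left: "u \<in> ext_alg r \<Longrightarrow> wedge ext_one u = u"
proof
  fix K assume u: "u \<in> ext_alg r"
  show "wedge ext_one u K = u K"
  proof (cases "finite K")
    case True
    then have "wedge ext_one u K = (\<Sum>I\<in>{{}}. ext_sign I (K - I) * ext_one I * u (K - I))"
      unfolding wedge_def by (intro sum.mono_neutral_right) (auto simp: ext_one_def)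
    then show ?thesis by (simp add: ext_one_def)
  next
    case False
    then have "\<not> K \<subseteq> {..<r}" using finite_subset by blast
    then show ?thesis using u False by (simp add: wedge_infinite ext_zero)
  qed
qed

lemma wedge_one_right: "u \<in> ext_alg r \<Longrightarrow> wedge u ext_one = u"
proof
  fix K assume u: "u \<in> ext_alg r"
  show "wedge u ext_one K = u K"
  proof (cases "finite K")
    case True
    then have "wedge u ext_one K = (\<Sum>I\<in>{K}. ext_sign I (K - I) * u I * ext_one (K - I))"
      unfolding wedge_def by (intro sum.mono_neutral_right) (auto simp: ext_one_def)
    then show ?thesis by (simp add: ext_one_def)
  next
    case False
    then have "\<not> K \<subseteq> {..<r}" using finite_subset by blast
    then show ?thesis using u False by (simp add: wedge_infinite ext_zero)
  qed
qed

text \<open>The number of inversions is additive in disjoint unions. Associativity of the product rests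
  on this.\<close>

lemma ext_sign_Un_left:
  assumes "finite I" "finite J" "finite L" "I \<inter> J = {}"
  shows "ext_sign (I \<union> J) L = ext_sign I L * ext_sign J L"
proof -
  have "{(i, j). i \<in> I \<union> J \<and> j \<in> L \<and> j < i} = {(i, j). i \<in> I \<and> j \<in> L \<and> j < i} \<union> {(i, j). i \<in> J \<and> j \<in> L \<and> j < i}"
    by auto
  moreover have "finite {(i, j). i \<in> I \<and> j \<in> L \<and> j < i}" "finite {(i, j). i \<in> J \<and> j \<in> L \<and> j < i}"
    using assms by (auto intro: finite_subset[of _ "I \<times> L"] finite_subset[of _ "J \<times> L"])
  moreover have "{(i, j). i \<in> I \<and> j \<in> L \<and> j < i} \<inter> {(i, j). i \<in> J \<and> j \<in> L \<and> j < i} = {}"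
    using assms by auto
  ultimately show ?thesis unfolding ext_sign_def by (simp add: card_Un_disjoint power_add)
qed

lemma ext_sign_Un_right:
  assumes "finite I" "finite J" "finite L" "I \<inter> J = {}"
  shows "ext_sign L (I \<union> J) = ext_sign L I * ext_sign L J"
proof -
  have "{(i, j). i \<in> L \<and> j \<in> I \<union> J \<and> j < i} = {(i, j). i \<in> L \<and> j \<in> I \<and> j < i} \<union> {(i, j). i \<in> L \<and> j \<in> J \<and> j < i}"
    by auto
  moreover have "finite {(i, j). i \<in> L \<and> j \<in> I \<and> j < i}" "finite {(i, j). i \<in> L \<and> j \<in> J \<and> j < i}"
    using assms by (auto intro: finite_subset[of _ "L \<times> I"] finite_subset[of _ "L \<times> J"])
  moreover have "{(i, j). i \<in> L \<and> j \<in> I \<and> j < i} \<inter> {(i, j). i \<in> L \<and> j \<in> J \<and> j < i} = {}"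
    using assms by auto
  ultimately show ?thesis unfolding ext_sign_def by (simp add: card_Un_disjoint power_add)
qed

text \<open>Both sides are a sum over the ordered partitions of \<open>K\<close> into three parts; the signs agree
  since the number of inversions is additive.\<close>

lemma wedge_assoc: "wedge (wedge u v) w = wedge u (wedge v w)"
proof
  fix K
  show "wedge (wedge u v) w K = wedge u (wedge v w) K"
  proof (cases "finite K")
    case fin: True
    have "wedge (wedge u v) w K = (\<Sum>A\<in>Pow K. \<Sum>I\<in>Pow A. ext_sign A (K - A) * (ext_sign I (A - I) * u I * v (A - I)) * w (K - A))"
      unfolding wedge_def by (simp add: sum_distrib_left sum_distrib_right)
    also have "\<dots> = (\<Sum>(A, I)\<in>(SIGMA A:Pow K. Pow A). ext_sign A (K - A) * (ext_sign I (A - I) * u I * v (A - I)) * w (K - A))"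
      using fin finite_subset by (subst sum.Sigma) (auto simp: finite_Pow_iff)
    also have "\<dots> = (\<Sum>(I, J)\<in>(SIGMA I:Pow K. Pow (K - I)). ext_sign I (K - I) * u I * (ext_sign J (K - I - J) * v J * w (K - I - J)))"
    proof (rule sum.reindex_bij_witness[of _ "\<lambda>(I, J). (I \<union> J, I)" "\<lambda>(A, I). (I, A - I)"])
      fix p assume "p \<in> (SIGMA A:Pow K. Pow A)"
      then obtain A I where p: "p = (A, I)" "A \<subseteq> K" "I \<subseteq> A" by auto
      have "finite A" using finite_subset[OF p(2) fin] .
      then have f: "finite A" "finite I" "finite (A - I)" "finite (K - A)" using finite_subset[OF p(3)] fin by auto
      have e: "A = I \<union> (A - I)" "K - I = (A - I) \<union> (K - A)" "K - I - (A - I) = K - A" using p by auto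
      have s1: "ext_sign A (K - A) = ext_sign I (K - A) * ext_sign (A - I) (K - A)"
        using ext_sign_Un_left[OF f(2,3,4)] e(1) by auto
      have s2: "ext_sign I (K - I) = ext_sign I (A - I) * ext_sign I (K - A)"
        using ext_sign_Un_right[OF f(3,4,2)] e(2) by auto
      show "(case case p of (A, I) \<Rightarrow> (I, A - I) of (I, J) \<Rightarrow> ext_sign I (K - I) * u I * (ext_sign J (K - I - J) * v J * w (K - I - J))) =
         (case p of (A, I) \<Rightarrow> ext_sign A (K - A) * (ext_sign I (A - I) * u I * v (A - I)) * w (K - A))"
        by (simp add: p e(3) s1 s2 mult_ac)
    qed auto
    also have "\<dots> = (\<Sum>I\<in>Pow K. \<Sum>J\<in>Pow (K - I). ext_sign I (K - I) * u I * (ext_sign J (K - I - J) * v J * w (K - I - J)))"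
      using fin by (subst sum.Sigma) (auto simp: finite_Pow_iff)
    also have "\<dots> = wedge u (wedge v w) K"
      unfolding wedge_def by (simp add: sum_distrib_left)
    finally show ?thesis .
  qed (simp add: wedge_infinite)
qed

definition ext_basis :: "nat set \<Rightarrow> nat set \<Rightarrow> complex" where
  "ext_basis I K = (if K = I then 1 else 0)"

lemma ext_basis_in: "I \<subseteq> {..<r} \<Longrightarrow> ext_basis I \<in> ext_alg r"
  by (auto simp: ext_alg_def ext_basis_def)

lemma ext_basis_empty: "ext_basis {} = ext_one"
  by (auto simp: ext_basis_def ext_one_def)

lemma ext_expand:
  assumes "u \<in> ext_alg r" shows "u = (\<lambda>K. \<Sum>I\<in>Pow {..<r}. u I * ext_basis I K)"
proof
  fix K
  show "u K = (\<Sum>I\<in>Pow {..<r}. u I * ext_basis I K)"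
    using assms ext_zero[OF assms, of K] by (cases "K \<subseteq> {..<r}") (auto simp: ext_basis_def sum.delta' if_distrib cong: if_cong)
qed

lemma wedge_basis:
  assumes "finite I" "finite J"
  shows "wedge (ext_basis I) (ext_basis J) = (\<lambda>K. (if I \<inter> J = {} then ext_sign I J else 0) * ext_basis (I \<union> J) K)"
proof
  fix K
  show "wedge (ext_basis I) (ext_basis J) K = (if I \<inter> J = {} then ext_sign I J else 0) * ext_basis (I \<union> J) K"
  proof (cases "finite K")
    case True
    have "wedge (ext_basis I) (ext_basis J) K = (\<Sum>A\<in>Pow K. if A = I then ext_sign I (K - I) * ext_basis J (K - I) else 0)"
      unfolding wedge_def by (rule sum.cong) (auto simp: ext_basis_def)
    also have "\<dots> = (if I \<subseteq> K then ext_sign I (K - I) * ext_basis J (K - I) else 0)"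
      using True by (simp add: sum.delta')
    also have "\<dots> = (if I \<inter> J = {} then ext_sign I J else 0) * ext_basis (I \<union> J) K"
      by (auto simp: ext_basis_def)
    finally show ?thesis .
  next
    case False
    then have "K \<noteq> I \<union> J" using assms by auto
    then show ?thesis using False by (simp add: wedge_infinite ext_basis_def)
  qed
qed

definition homogeneous :: "nat \<Rightarrow> (nat set \<Rightarrow> complex) \<Rightarrow> bool" where
  "homogeneous d u \<longleftrightarrow> (\<forall>K. card K \<noteq> d \<longrightarrow> u K = 0)"

lemma homogeneous_wedge:
  assumes "homogeneous d u" "homogeneous e v" shows "homogeneous (d + e) (wedge u v)"
  unfolding homogeneous_def
proof (intro allI impI)
  fix K :: "nat set" assume K: "card K \<noteq> d + e"
  show "wedge u v K = 0"
  proof (cases "finite K")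
    case True
    show ?thesis
      unfolding wedge_def
    proof (rule sum.neutral, clarify)
      fix I assume I: "I \<subseteq> K"
      then have "card K = card I + card (K - I)" using True by (metis card_Diff_subset card_mono finite_subset le_add_diff_inverse)
      then have "card I \<noteq> d \<or> card (K - I) \<noteq> e" using K by auto
      then show "ext_sign I (K - I) * u I * v (K - I) = 0" using assms by (auto simp: homogeneous_def)
    qed
  qed (simp add: wedge_infinite)
qed

lemma homogeneous_ext_vec: "homogeneous 1 (ext_vec r v)"
  unfolding homogeneous_def ext_vec_def by (auto intro!: sum.neutral)

lemma homogeneous_basis: "homogeneous (card I) (ext_basis I)"
  by (auto simp: homogeneous_def ext_basis_def)

text \<open>Exchanging two distinct one-element sets exchanges an inversion for none.\<close>

lemma wedge_anticommute:
  assumes "homogeneous 1 u" "homogeneous 1 v"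
  shows "wedge u v K = - wedge v u K"
proof -
  have "wedge u v K = (\<Sum>I\<in>Pow K. ext_sign (K - I) I * u (K - I) * v I)"
    unfolding wedge_def
    by (rule sum.reindex_bij_witness[of _ "\<lambda>I. K - I" "\<lambda>I. K - I"]) (auto simp: double_diff)
  also have "\<dots> = (\<Sum>I\<in>Pow K. - (ext_sign I (K - I) * v I * u (K - I)))"
  proof (rule sum.cong[OF refl])
    fix I assume I: "I \<in> Pow K"
    show "ext_sign (K - I) I * u (K - I) * v I = - (ext_sign I (K - I) * v I * u (K - I))"
    proof (cases "card I = 1 \<and> card (K - I) = 1")
      case True
      then obtain a b where ab: "I = {a}" "K - {a} = {b}" by (metis card_1_singletonE)
      then have "a \<noteq> b" by auto
      have "{(i, j). i = b \<and> j = a \<and> j < i} = (if a < b then {(b, a)} else {})" for a b :: nat by auto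
      then have s: "ext_sign {b} {a} = (if a < b then -1 else 1)" for a b by (simp add: ext_sign_def)
      show ?thesis unfolding ab s using \<open>a \<noteq> b\<close> by auto
    next
      case False
      then show ?thesis using assms by (auto simp: homogeneous_def)
    qed
  qed
  finally show ?thesis by (simp add: wedge_def sum_negf)
qed

lemma wedge_square_zero: "homogeneous 1 u \<Longrightarrow> wedge u u K = 0"
  using wedge_anticommute[of u u K] by simp

subsection \<open>The algebra endomorphism induced by a matrix\<close>

abbreviation mcol :: "nat \<Rightarrow> (nat \<Rightarrow> nat \<Rightarrow> complex) \<Rightarrow> nat \<Rightarrow> nat set \<Rightarrow> complex" where
  "mcol r A l \<equiv> ext_vec r (\<lambda>k. A k l)"

text \<open>The coefficients of this product of columns are the minors of \<open>A\<close> with columns in \<open>I\<close>.\<close>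

definition minor :: "nat \<Rightarrow> (nat \<Rightarrow> nat \<Rightarrow> complex) \<Rightarrow> nat set \<Rightarrow> nat set \<Rightarrow> complex" where
  "minor r A I = foldr (\<lambda>l. wedge (mcol r A l)) (sorted_list_of_set I) ext_one"

lemma ext_map_minor: "ext_map r A u = (\<lambda>K. \<Sum>I\<in>Pow {..<r}. u I * minor r A I K)"
  by (simp add: ext_map_def minor_def fun_eq_iff)

lemma minor_empty [simp]: "minor r A {} = ext_one"
  by (simp add: minor_def)

text \<open>A new smallest index is the head of the sorted list, so its column comes first.\<close>

lemma minor_insert:
  assumes "finite I" "\<And>i. i \<in> I \<Longrightarrow> m < i"
  shows "minor r A (insert m I) = wedge (mcol r A m) (minor r A I)"
proof -
  have "Min (insert m I) = m" using assms by (intro Min_eqI) (auto intro: less_imp_le)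
  moreover have "insert m I - {m} = I" using assms by auto
  ultimately have "sorted_list_of_set (insert m I) = m # sorted_list_of_set I"
    using sorted_list_of_set_nonempty[of "insert m I"] assms by simp
  then show ?thesis by (simp add: minor_def)
qed

lemma finite_min_induct [consumes 1, case_names empty insert]:
  fixes I :: "nat set"
  assumes "finite I" "P {}" "\<And>m I. \<lbrakk>finite I; \<And>i. i \<in> I \<Longrightarrow> m < i; P I\<rbrakk> \<Longrightarrow> P (insert m I)"
  shows "P I"
  using assms(1)
proof (induction "card I" arbitrary: I)
  case 0
  then show ?case using assms(2) by simp
next
  case (Suc n)
  then have ne: "I \<noteq> {}" by auto
  let ?m = "Min I"
  have I: "insert ?m (I - {?m}) = I" using Min_in[OF Suc(3) ne] by auto
  have "P (I - {?m})" using Suc Min_in[OF Suc(3) ne] by simp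
  moreover have "?m < i" if "i \<in> I - {?m}" for i using that Min_le[OF Suc(3), of i] by auto
  ultimately have "P (insert ?m (I - {?m}))" using assms(3) Suc(3) by blast
  then show ?case by (simp only: I)
qed

lemma minor_in: "finite I \<Longrightarrow> minor r A I \<in> ext_alg r"
  by (induction I rule: finite_min_induct) (simp_all add: ext_one_in minor_insert wedge_in ext_vec_in)

lemma homogeneous_one: "homogeneous 0 ext_one"
  using homogeneous_basis[of "{}"] by (simp add: ext_basis_empty)

lemma minor_homogeneous: "finite I \<Longrightarrow> homogeneous (card I) (minor r A I)"
proof (induction I rule: finite_min_induct)
  case (insert m I)
  then have "m \<notin> I" by auto
  then show ?case using insert homogeneous_wedge[OF homogeneous_ext_vec insert(3)] by (simp add: minor_insert)
qed (simp add: homogeneous_one)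

lemma ext_map_in: "ext_map r A u \<in> ext_alg r"
  unfolding ext_map_minor ext_alg_def mem_Collect_eq
proof (intro allI impI sum.neutral ballI)
  fix K I assume K: "\<not> K \<subseteq> {..<r}" and I: "I \<in> Pow {..<r}"
  then have "finite I" using finite_subset by auto
  then show "u I * minor r A I K = 0" using ext_zero[OF minor_in K] by simp
qed

lemma ext_map_sum: "ext_map r A (\<lambda>K. \<Sum>j\<in>S. c j * f j K) = (\<lambda>K. \<Sum>j\<in>S. c j * ext_map r A (f j) K)"
proof
  fix K
  have "ext_map r A (\<lambda>K. \<Sum>j\<in>S. c j * f j K) K = (\<Sum>I\<in>Pow {..<r}. \<Sum>j\<in>S. c j * (f j I * minor r A I K))"
    unfolding ext_map_minor by (intro sum.cong refl) (simp add: sum_distrib_right mult.assoc)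
  also have "\<dots> = (\<Sum>j\<in>S. c j * ext_map r A (f j) K)"
    by (subst sum.swap) (simp add: ext_map_minor sum_distrib_left)
  finally show "ext_map r A (\<lambda>K. \<Sum>j\<in>S. c j * f j K) K = (\<Sum>j\<in>S. c j * ext_map r A (f j) K)" .
qed

lemma ext_map_add: "ext_map r A (\<lambda>K. u K + v K) K = ext_map r A u K + ext_map r A v K"
  and ext_map_scale: "ext_map r A (\<lambda>K. c * u K) K = c * ext_map r A u K"
  and ext_map_zero: "ext_map r A (\<lambda>K. 0) K = 0"
  by (simp_all add: ext_map_minor algebra_simps sum.distrib sum_distrib_left)

lemma ext_map_basis: "I \<subseteq> {..<r} \<Longrightarrow> ext_map r A (ext_basis I) = minor r A I"
  by (auto simp: ext_map_minor ext_basis_def fun_eq_iff sum.delta' if_distrib[of "\<lambda>x. x * _"] cong: if_cong)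

lemma ext_map_one: "ext_map r A ext_one = ext_one"
  using ext_map_basis[of "{}" r A] by (simp add: ext_basis_empty)

lemma minor_singleton: "minor r A {k} = mcol r A k"
  using minor_insert[of "{}" k r A] by (simp add: wedge_one_right[OF ext_vec_in])

lemma basis_insert:
  assumes "finite I" "\<And>i. i \<in> I \<Longrightarrow> m < i"
  shows "ext_basis (insert m I) = wedge (ext_basis {m}) (ext_basis I)"
proof -
  have e: "{(i, j). i \<in> {m} \<and> j \<in> I \<and> j < i} = {}" using assms(2) by fastforce
  have "ext_sign {m} I = 1" unfolding ext_sign_def e by simp
  moreover have "m \<notin> I" using assms(2) by blast
  ultimately show ?thesis using assms(1) by (simp add: wedge_basis)
qed

text \<open>Induction along the increasing enumeration of \<open>J\<close>. If \<open>k\<close> is smaller than the least element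
  \<open>m\<close> of the set, it is put in front; if \<open>k = m\<close>, both sides are zero; if \<open>k > m\<close>, both sides
  change sign when \<open>e\<^sub>k\<close> and \<open>e\<^sub>m\<close> are exchanged, and the induction hypothesis applies behind
  \<open>e\<^sub>m\<close>.\<close>

lemma ext_map_wedge_basis:
  assumes "finite J" "J \<subseteq> {..<r}" "k < r"
  shows "ext_map r A (wedge (ext_basis {k}) (ext_basis J)) = wedge (mcol r A k) (minor r A J)"
  using assms
proof (induction J rule: finite_min_induct)
  case empty
  then show ?case
    using ext_map_basis[of "{k}" r A]
    by (simp add: ext_basis_empty wedge_one_right[OF ext_basis_in[of "{k}" r]] minor_singleton wedge_one_right[OF ext_vec_in])
next
  case (insert m J)
  then have m: "m < r" and J: "J \<subseteq> {..<r}" by auto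
  consider "k < m" | "k = m" | "m < k" by linarith
  then show ?case
  proof cases
    case 1
    then have lt: "\<And>i. i \<in> insert m J \<Longrightarrow> k < i" using insert(2) by (auto intro: less_trans)
    have "wedge (ext_basis {k}) (ext_basis (insert m J)) = ext_basis (insert k (insert m J))"
      using basis_insert[of "insert m J" k] lt insert(1) by simp
    then show ?thesis
      using ext_map_basis[of "insert k (insert m J)" r A] minor_insert[of "insert m J" k r A] lt insert m J by simp
  next
    case 2
    have "wedge (ext_basis {k}) (ext_basis (insert m J)) = (\<lambda>K. 0)"
      using insert(1) 2 by (simp add: wedge_basis fun_eq_iff)
    moreover have "wedge (mcol r A k) (minor r A (insert m J)) = (\<lambda>K. 0)"
    proof -
      have "wedge (mcol r A k) (minor r A (insert m J)) = wedge (wedge (mcol r A k) (mcol r A k)) (minor r A J)"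
        using insert(1,2) 2 by (simp add: minor_insert wedge_assoc)
      also have "wedge (mcol r A k) (mcol r A k) = (\<lambda>K. 0)"
        using wedge_square_zero[OF homogeneous_ext_vec] by (simp add: fun_eq_iff)
      also have "wedge (\<lambda>K. 0) (minor r A J) = (\<lambda>K. 0)" by (rule ext) (simp add: wedge_def)
      finally show ?thesis .
    qed
    ultimately show ?thesis by (simp add: fun_eq_iff ext_map_zero)
  next
    case 3
    define s where "s = (if k \<in> J then 0 else ext_sign {k} J)"
    have kJ: "wedge (ext_basis {k}) (ext_basis J) = (\<lambda>K. s * ext_basis (insert k J) K)"
      using insert(1) by (simp add: wedge_basis s_def)
    have lt: "\<And>i. i \<in> insert k J \<Longrightarrow> m < i" using 3 insert(2) by auto
    have IH: "ext_map r A (wedge (ext_basis {k}) (ext_basis J)) = wedge (mcol r A k) (minor r A J)"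
      using insert J by blast
    have hom1: "homogeneous 1 (ext_basis {k})" for k using homogeneous_basis[of "{k}"] by simp
    have "wedge (ext_basis {k}) (ext_basis (insert m J)) = wedge (wedge (ext_basis {k}) (ext_basis {m})) (ext_basis J)"
      using insert(1,2) by (simp add: basis_insert wedge_assoc)
    also have "wedge (ext_basis {k}) (ext_basis {m}) = (\<lambda>K. (-1) * wedge (ext_basis {m}) (ext_basis {k}) K)"
      using wedge_anticommute[OF hom1 hom1, of k m] by (auto simp: fun_eq_iff)
    also have "wedge (\<lambda>K. (-1) * wedge (ext_basis {m}) (ext_basis {k}) K) (ext_basis J) =
        (\<lambda>K. (-1) * wedge (ext_basis {m}) (wedge (ext_basis {k}) (ext_basis J)) K)"
      by (simp only: wedge_scale_left wedge_assoc fun_eq_iff) simp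
    also have "wedge (ext_basis {m}) (wedge (ext_basis {k}) (ext_basis J)) = (\<lambda>K. s * ext_basis (insert m (insert k J)) K)"
      unfolding kJ using basis_insert[of "insert k J" m] lt insert(1) by (simp add: wedge_scale_right fun_eq_iff)
    finally have kmJ: "wedge (ext_basis {k}) (ext_basis (insert m J)) = (\<lambda>K. (-1) * (s * ext_basis (insert m (insert k J)) K))" .
    have "ext_map r A (wedge (ext_basis {k}) (ext_basis (insert m J))) =
        (\<lambda>K. (-1) * (s * ext_map r A (ext_basis (insert m (insert k J))) K))"
      unfolding kmJ by (rule ext) (simp only: ext_map_scale)
    also have "ext_map r A (ext_basis (insert m (insert k J))) = wedge (mcol r A m) (minor r A (insert k J))"
      using ext_map_basis[of "insert m (insert k J)" r A] minor_insert[of "insert k J" m r A] lt insert m J by simp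
    also have "(\<lambda>K. (-1) * (s * wedge (mcol r A m) (minor r A (insert k J)) K)) =
        (\<lambda>K. (-1) * wedge (mcol r A m) (\<lambda>K. s * minor r A (insert k J) K) K)"
      by (simp only: wedge_scale_right)
    also have "(\<lambda>K. s * minor r A (insert k J) K) = wedge (mcol r A k) (minor r A J)"
      using IH ext_map_basis[of "insert k J" r A] J insert.prems unfolding kJ by (simp add: fun_eq_iff ext_map_scale)
    also have "(\<lambda>K. (-1) * wedge (mcol r A m) (wedge (mcol r A k) (minor r A J)) K) =
        wedge (wedge (mcol r A k) (mcol r A m)) (minor r A J)"
    proof -
      have km: "wedge (mcol r A k) (mcol r A m) = (\<lambda>K. (-1) * wedge (mcol r A m) (mcol r A k) K)"
        using wedge_anticommute[OF homogeneous_ext_vec homogeneous_ext_vec, of r "\<lambda>i. A i k" r "\<lambda>i. A i m"] by (auto simp: fun_eq_iff)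
      show ?thesis unfolding km by (rule ext) (simp only: wedge_scale_left wedge_assoc)
    qed
    also have "\<dots> = wedge (mcol r A k) (minor r A (insert m J))"
      using insert(1,2) by (simp add: minor_insert wedge_assoc)
    finally show ?thesis .
  qed
qed

lemma ext_map_wedge_vec:
  assumes u: "u \<in> ext_alg r" and k: "k < r"
  shows "ext_map r A (wedge (ext_basis {k}) u) = wedge (mcol r A k) (ext_map r A u)"
proof -
  have "ext_map r A (wedge (ext_basis {k}) u) = ext_map r A (\<lambda>K. \<Sum>J\<in>Pow {..<r}. u J * wedge (ext_basis {k}) (ext_basis J) K)"
    by (subst ext_expand[OF u]) (simp only: wedge_sum_right)
  also have "\<dots> = (\<lambda>K. \<Sum>J\<in>Pow {..<r}. u J * wedge (mcol r A k) (minor r A J) K)"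
    unfolding ext_map_sum using k by (intro ext sum.cong) (auto simp: ext_map_wedge_basis finite_subset)
  also have "\<dots> = wedge (mcol r A k) (ext_map r A u)"
    unfolding ext_map_minor wedge_sum_right ..
  finally show ?thesis .
qed

text \<open>Every basis element is a product of basis vectors of degree 1, for which this is
  \<open>ext_map_wedge_vec\<close>.\<close>

lemma ext_map_wedge:
  assumes u: "u \<in> ext_alg r" and v: "v \<in> ext_alg r"
  shows "ext_map r A (wedge u v) = wedge (ext_map r A u) (ext_map r A v)"
proof -
  have basis: "ext_map r A (wedge (ext_basis I) v) = wedge (minor r A I) (ext_map r A v)"
    if "finite I" "I \<subseteq> {..<r}" for I
    using that
  proof (induction I rule: finite_min_induct)
    case empty
    then show ?case by (simp add: ext_basis_empty wedge_one_left[OF v] wedge_one_left[OF ext_map_in])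
  next
    case (insert m I)
    then show ?case
      by (simp add: basis_insert wedge_assoc ext_map_wedge_vec wedge_in ext_basis_in v minor_insert)
  qed
  have "ext_map r A (wedge u v) = ext_map r A (\<lambda>K. \<Sum>J\<in>Pow {..<r}. u J * wedge (ext_basis J) v K)"
    by (subst ext_expand[OF u]) (simp only: wedge_sum_left)
  also have "\<dots> = (\<lambda>K. \<Sum>J\<in>Pow {..<r}. u J * wedge (minor r A J) (ext_map r A v) K)"
    unfolding ext_map_sum by (intro ext sum.cong) (auto simp: basis finite_subset)
  also have "\<dots> = wedge (ext_map r A u) (ext_map r A v)"
    unfolding ext_map_minor[of r A u] wedge_sum_left ..
  finally show ?thesis .
qed

lemma ext_map_vec: "ext_map r A (ext_vec r v) = ext_vec r (\<lambda>k. \<Sum>l<r. A k l * v l)"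
proof -
  have "ext_vec r v = (\<lambda>K. \<Sum>l<r. v l * ext_basis {l} K)"
    by (auto simp: ext_vec_def ext_basis_def fun_eq_iff intro!: sum.cong)
  then have "ext_map r A (ext_vec r v) = (\<lambda>K. \<Sum>l<r. v l * ext_map r A (ext_basis {l}) K)"
    by (simp only: ext_map_sum)
  also have "\<dots> = (\<lambda>K. \<Sum>l<r. v l * mcol r A l K)"
    by (intro ext sum.cong refl) (simp add: ext_map_basis minor_singleton)
  also have "\<dots> = ext_vec r (\<lambda>k. \<Sum>l<r. A k l * v l)"
  proof (rule ext)
    fix K
    have "(\<Sum>l<r. v l * mcol r A l K) = (\<Sum>l<r. \<Sum>k<r. if K = {k} then A k l * v l else 0)"
      unfolding ext_vec_def sum_distrib_left by (intro sum.cong refl) simp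
    also have "\<dots> = (\<Sum>k<r. \<Sum>l<r. if K = {k} then A k l * v l else 0)" by (rule sum.swap)
    also have "\<dots> = ext_vec r (\<lambda>k. \<Sum>l<r. A k l * v l) K"
      unfolding ext_vec_def by (intro sum.cong refl) simp
    finally show "(\<Sum>l<r. v l * mcol r A l K) = ext_vec r (\<lambda>k. \<Sum>l<r. A k l * v l) K" .
  qed
  finally show ?thesis .
qed

text \<open>Functoriality: both sides are algebra endomorphisms with the same value on degree 1.\<close>

lemma ext_map_ext_map:
  assumes u: "u \<in> ext_alg r"
  shows "ext_map r A (ext_map r B u) = ext_map r (\<lambda>k l. \<Sum>p<r. A k p * B p l) u"
proof -
  let ?AB = "\<lambda>k l. \<Sum>p<r. A k p * B p l"
  have m: "ext_map r A (minor r B I) = minor r ?AB I" if "finite I" for I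
    using that
  proof (induction I rule: finite_min_induct)
    case (insert m I)
    then show ?case
      by (simp add: minor_insert ext_map_wedge[OF ext_vec_in minor_in] ext_map_vec)
  qed (simp add: ext_map_one)
  show ?thesis
    unfolding ext_map_minor[of r B u] ext_map_sum ext_map_minor[of r ?AB u]
  proof (intro ext sum.cong refl)
    fix K I assume "I \<in> Pow {..<r}"
    then have "finite I" using finite_subset by auto
    then show "u I * ext_map r A (minor r B I) K = u I * minor r ?AB I K" by (simp only: m)
  qed
qed

lemma ext_map_cong: "(\<And>k l. k < r \<Longrightarrow> l < r \<Longrightarrow> A k l = B k l) \<Longrightarrow> ext_map r A u = ext_map r B u"
proof -
  assume AB: "\<And>k l. k < r \<Longrightarrow> l < r \<Longrightarrow> A k l = B k l"
  have "minor r A I = minor r B I" if "finite I" "I \<subseteq> {..<r}" for I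
    using that
  proof (induction I rule: finite_min_induct)
    case (insert m I)
    then have "mcol r A m = mcol r B m" unfolding ext_vec_def using AB by (intro ext sum.cong) auto
    then show ?case using insert by (simp add: minor_insert)
  qed simp
  then show ?thesis by (auto simp: ext_map_minor fun_eq_iff finite_subset intro!: sum.cong)
qed

lemma ext_map_id:
  assumes u: "u \<in> ext_alg r" and A: "\<And>k l. k < r \<Longrightarrow> l < r \<Longrightarrow> A k l = (if k = l then 1 else 0)"
  shows "ext_map r A u = u"
proof -
  have "minor r A I = ext_basis I" if "finite I" "I \<subseteq> {..<r}" for I
    using that
  proof (induction I rule: finite_min_induct)
    case (insert m I)
    have "mcol r A m K = ext_basis {m} K" for K
    proof -
      have "mcol r A m K = (\<Sum>k<r. if k = m then ext_basis {m} K else 0)"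
        unfolding ext_vec_def ext_basis_def using A insert.prems by (intro sum.cong) auto
      then show ?thesis using insert.prems by (simp add: sum.delta')
    qed
    then have "mcol r A m = ext_basis {m}" by (rule ext)
    then show ?case using insert by (simp add: minor_insert basis_insert)
  qed (simp add: ext_basis_empty)
  then show ?thesis
    by (subst (2) ext_expand[OF u]) (auto simp: ext_map_minor fun_eq_iff finite_subset intro!: sum.cong)
qed

text \<open>The induced endomorphism preserves the degree, so only index sets of the same size
  contribute.\<close>

lemma ext_map_degree:
  "ext_map r A u K = (\<Sum>I\<in>{I\<in>Pow {..<r}. card I = card K}. u I * minor r A I K)"
  unfolding ext_map_minor
proof (intro sum.mono_neutral_right ballI)
  fix I assume I: "I \<in> Pow {..<r} - {I \<in> Pow {..<r}. card I = card K}"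
  then have "finite I" using finite_subset by auto
  then show "u I * minor r A I K = 0" using minor_homogeneous[of I r A] I by (auto simp: homogeneous_def)
qed auto

lemma ext_map_degree_1:
  assumes "k < r" shows "ext_map r A u {k} = (\<Sum>l<r. A k l * u {l})"
proof -
  have e: "{I \<in> Pow {..<r}. card I = card {k}} = (\<lambda>l. {l}) ` {..<r}"
    by (auto simp: card_1_singleton_iff)
  have "mcol r A l {k} = A k l" for l
    using assms by (simp add: ext_vec_def sum.delta)
  then show ?thesis unfolding ext_map_degree e
    by (subst sum.reindex) (auto simp: minor_singleton mult.commute)
qed

lemma ext_map_vanish:
  assumes "\<And>I. card I = card K \<Longrightarrow> u I = 0" shows "ext_map r A u K = 0"
  unfolding ext_map_degree by (rule sum.neutral) (use assms in auto)

lemma wedge_degree_0: "wedge u v {} = u {} * v {}"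
  by (simp add: wedge_def)

lemma wedge_vanish_below:
  assumes "\<And>I. card I < a \<Longrightarrow> u I = 0" "\<And>I. card I < b \<Longrightarrow> v I = 0" "card K < a + b"
  shows "wedge u v K = 0"
proof (cases "finite K")
  case True
  show ?thesis
    unfolding wedge_def
  proof (rule sum.neutral, intro ballI)
    fix I assume I: "I \<in> Pow K"
    then have "card K = card I + card (K - I)"
      using True by (metis Pow_iff card_Diff_subset card_mono finite_subset le_add_diff_inverse)
    then have "card I < a \<or> card (K - I) < b" using assms(3) by linarith
    then show "ext_sign I (K - I) * u I * v (K - I) = 0" using assms(1,2) by auto
  qed
qed (simp add: wedge_infinite)

text \<open>The term with index set \<open>K\<close> is assigned to the least element of \<open>K\<close>, where it needs no sign.\<close>

lemma wedge_vec_expand: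
  assumes u: "u \<in> ext_alg r" and u0: "u {} = 0"
  shows "u = (\<lambda>K. \<Sum>l<r. wedge (ext_basis {l}) (\<lambda>J. if \<forall>j\<in>J. l < j then u (insert l J) else 0) K)"
proof
  fix K
  let ?v = "\<lambda>l J. if \<forall>j\<in>J. l < j then u (insert l J) else 0"
  show "u K = (\<Sum>l<r. wedge (ext_basis {l}) (?v l) K)"
  proof (cases "finite K")
    case True
    have w: "wedge (ext_basis {l}) (?v l) K = (if K \<noteq> {} \<and> l = Min K then u K else 0)" for l
    proof -
      have "wedge (ext_basis {l}) (?v l) K = (\<Sum>I\<in>Pow K. if I = {l} then ext_sign {l} (K - {l}) * ?v l (K - {l}) else 0)"
        unfolding wedge_def by (rule sum.cong) (auto simp: ext_basis_def)
      also have "\<dots> = (if l \<in> K then ext_sign {l} (K - {l}) * ?v l (K - {l}) else 0)"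
        using True by (simp add: sum.delta')
      also have "\<dots> = (if K \<noteq> {} \<and> l = Min K then u K else 0)"
      proof (cases "l \<in> K \<and> (\<forall>j\<in>K - {l}. l < j)")
        case t: True
        have nlt: "\<not> j < l" if "j \<in> K - {l}" for j using bspec[OF conjunct2[OF t] that] by simp
        then have e: "{(i, j). i \<in> {l} \<and> j \<in> K - {l} \<and> j < i} = {}" by blast
        have "ext_sign {l} (K - {l}) = 1" unfolding ext_sign_def e by simp
        moreover have "Min K = l" using t True by (intro Min_eqI) (auto intro: less_imp_le)
        moreover have "insert l (K - {l}) = K" using t by auto
        ultimately show ?thesis using t by auto
      next
        case f: False
        have "\<not> (K \<noteq> {} \<and> l = Min K)"
        proof
          assume a: "K \<noteq> {} \<and> l = Min K"
          then have "l \<in> K" using Min_in[OF True] by auto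
          moreover have "l < j" if "j \<in> K - {l}" for j using Min_le[OF True, of j] that a by auto
          ultimately show False using f by blast
        qed
        then show ?thesis using f by auto
      qed
      finally show ?thesis .
    qed
    show ?thesis
    proof (cases "K = {} \<or> \<not> K \<subseteq> {..<r}")
      case True
      then have "u K = 0" using u0 ext_zero[OF u, of K] by blast
      moreover from this have "(\<Sum>l<r. if K \<noteq> {} \<and> l = Min K then u K else 0) = 0"
        by (intro sum.neutral) auto
      ultimately show ?thesis unfolding w by simp
    next
      case f: False
      then have "Min K < r" using Min_in[OF True] by auto
      then show ?thesis unfolding w using f by (simp add: sum.delta)
    qed
  next
    case False
    then have "\<not> K \<subseteq> {..<r}" using finite_subset by blast
    then show ?thesis using False ext_zero[OF u] by (simp add: wedge_infinite)
  qed
qed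

section \<open>The sheaf of exterior algebras\<close>

locale split_model = manifold M for M :: "'a::{t2_space,second_countable_topology} cmanifold" +
  fixes E :: "('a, 'i) vbundle"
  assumes is_bundle: "holomorphic_bundle M E"
begin

abbreviation \<Lambda> where "\<Lambda> \<equiv> ext_sheaf M E"
abbreviation r where "r \<equiv> bdl_rank E"
abbreviation tr where "tr \<equiv> transition E"
abbreviation Sec where "Sec \<equiv> ext_sections M E"
abbreviation Fil where "Fil \<equiv> ext_filtration M E"

lemma sheaf_simps [simp]:
  "carrier (sec \<Lambda> U) = Sec U"
  "s \<otimes>\<^bsub>sec \<Lambda> U\<^esub> t = (\<lambda>i x. wedge (s i x) (t i x))"
  "s \<oplus>\<^bsub>sec \<Lambda> U\<^esub> t = (\<lambda>i x K. s i x K + t i x K)"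
  "\<one>\<^bsub>sec \<Lambda> U\<^esub> = (\<lambda>i x K. if x \<in> U \<inter> patch E i then ext_one K else 0)"
  "\<zero>\<^bsub>sec \<Lambda> U\<^esub> = (\<lambda>i x K. 0)"
  "c \<odot>\<^bsub>sec \<Lambda> U\<^esub> s = (\<lambda>i x K. c * s i x K)"
  "evens (sec \<Lambda> U) = {s \<in> Sec U. \<forall>i x K. odd (card K) \<longrightarrow> s i x K = 0}"
  "odds (sec \<Lambda> U) = {s \<in> Sec U. \<forall>i x K. even (card K) \<longrightarrow> s i x K = 0}"
  "res \<Lambda> U V s = (\<lambda>i x K. if x \<in> V then s i x K else 0)"
  by (simp_all add: ext_sheaf_def)

lemma patch_open: "open (patch E i)"
  and patch_cover: "\<exists>i. x \<in> patch E i"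
  and tr_hol: "k < r \<Longrightarrow> l < r \<Longrightarrow> hol (patch E i \<inter> patch E j) (\<lambda>x. tr i j x k l)"
  and tr_refl: "x \<in> patch E i \<Longrightarrow> k < r \<Longrightarrow> l < r \<Longrightarrow> tr i i x k l = (if k = l then 1 else 0)"
  and tr_trans: "x \<in> patch E i \<inter> patch E j \<inter> patch E m \<Longrightarrow> k < r \<Longrightarrow> l < r \<Longrightarrow>
    tr i m x k l = (\<Sum>p<r. tr i j x k p * tr j m x p l)"
  using is_bundle unfolding holomorphic_bundle_def by (blast, blast, blast, blast, blast)

lemma Sec_iff: "s \<in> Sec U \<longleftrightarrow>
     (\<forall>i x K. \<not> (x \<in> U \<inter> patch E i \<and> K \<subseteq> {..<r}) \<longrightarrow> s i x K = 0) \<and>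
     (\<forall>i K. hol (U \<inter> patch E i) (\<lambda>x. s i x K)) \<and>
     (\<forall>i j. \<forall>x\<in>U \<inter> patch E i \<inter> patch E j. s i x = ext_map r (tr i j x) (s j x))"
  by (simp add: ext_sections_def)

lemma Sec_zero: "s \<in> Sec U \<Longrightarrow> x \<notin> U \<inter> patch E i \<Longrightarrow> s i x K = 0"
  and Sec_alg: "s \<in> Sec U \<Longrightarrow> s i x \<in> ext_alg r"
  and Sec_hol: "s \<in> Sec U \<Longrightarrow> hol (U \<inter> patch E i) (\<lambda>x. s i x K)"
  and Sec_change: "s \<in> Sec U \<Longrightarrow> x \<in> U \<inter> patch E i \<inter> patch E j \<Longrightarrow> s i x = ext_map r (tr i j x) (s j x)"
  unfolding Sec_iff ext_alg_def by blast+

lemma SecI: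
  assumes "\<And>i x K. x \<notin> U \<inter> patch E i \<Longrightarrow> s i x K = 0" "\<And>i x. x \<in> U \<inter> patch E i \<Longrightarrow> s i x \<in> ext_alg r"
    "\<And>i K. hol (U \<inter> patch E i) (\<lambda>x. s i x K)"
    "\<And>i j x. x \<in> U \<inter> patch E i \<inter> patch E j \<Longrightarrow> s i x = ext_map r (tr i j x) (s j x)"
  shows "s \<in> Sec U"
  unfolding Sec_iff using assms ext_zero by (metis (no_types, lifting))

lemma hol_wedge: "(\<And>K. hol W (\<lambda>x. u x K)) \<Longrightarrow> (\<And>K. hol W (\<lambda>x. v x K)) \<Longrightarrow> hol W (\<lambda>x. wedge (u x) (v x) K)"
  unfolding wedge_def by (intro holomorphic_fun_sum holomorphic_fun_mult holomorphic_fun_const)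

lemma hol_minor:
  assumes "finite I" "I \<subseteq> {..<r}" "\<And>k l. k < r \<Longrightarrow> l < r \<Longrightarrow> hol W (\<lambda>x. A x k l)"
  shows "hol W (\<lambda>x. minor r (A x) I K)"
  using assms(1,2)
proof (induction I arbitrary: K rule: finite_min_induct)
  case (insert m I)
  have "hol W (\<lambda>x. if K = {k} then A x k m else 0)" if "k < r" for k K
    using assms(3)[OF that, of m] insert.prems by (cases "K = {k}") (simp_all add: holomorphic_fun_const)
  then have "hol W (\<lambda>x. mcol r (A x) m K)" for K
    unfolding ext_vec_def by (intro holomorphic_fun_sum) simp
  then show ?case using insert by (simp add: minor_insert hol_wedge)
qed (simp add: holomorphic_fun_const)

lemma hol_ext_map:
  assumes "\<And>K. hol W (\<lambda>x. u x K)" "\<And>k l. k < r \<Longrightarrow> l < r \<Longrightarrow> hol W (\<lambda>x. A x k l)"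
  shows "hol W (\<lambda>x. ext_map r (A x) (u x) K)"
  unfolding ext_map_minor
  by (intro holomorphic_fun_sum holomorphic_fun_mult assms(1) hol_minor assms(2)) (auto dest: finite_subset)

lemma mult_closed: "s \<in> Sec U \<Longrightarrow> t \<in> Sec U \<Longrightarrow> (\<lambda>i x. wedge (s i x) (t i x)) \<in> Sec U"
proof (rule SecI)
  fix i j x assume s: "s \<in> Sec U" and t: "t \<in> Sec U" and x: "x \<in> U \<inter> patch E i \<inter> patch E j"
  show "wedge (s i x) (t i x) = ext_map r (tr i j x) (wedge (s j x) (t j x))"
    unfolding Sec_change[OF s x] Sec_change[OF t x] by (simp add: ext_map_wedge Sec_alg[OF s] Sec_alg[OF t])
qed (simp_all add: wedge_in Sec_alg hol_wedge Sec_hol, simp add: wedge_def Sec_zero)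

lemma add_closed: "s \<in> Sec U \<Longrightarrow> t \<in> Sec U \<Longrightarrow> (\<lambda>i x K. s i x K + t i x K) \<in> Sec U"
proof (rule SecI)
  fix i j x assume s: "s \<in> Sec U" and t: "t \<in> Sec U" and x: "x \<in> U \<inter> patch E i \<inter> patch E j"
  show "(\<lambda>K. s i x K + t i x K) = ext_map r (tr i j x) (\<lambda>K. s j x K + t j x K)"
    unfolding Sec_change[OF s x] Sec_change[OF t x] by (rule ext) (simp add: ext_map_add)
qed (auto simp: Sec_zero holomorphic_fun_add Sec_hol, auto simp: ext_alg_def ext_zero[OF Sec_alg])

lemma scale_closed: "s \<in> Sec U \<Longrightarrow> (\<lambda>i x K. c * s i x K) \<in> Sec U"
proof (rule SecI)
  fix i j x assume s: "s \<in> Sec U" and x: "x \<in> U \<inter> patch E i \<inter> patch E j"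
  show "(\<lambda>K. c * s i x K) = ext_map r (tr i j x) (\<lambda>K. c * s j x K)"
    unfolding Sec_change[OF s x] by (rule ext) (simp add: ext_map_scale)
qed (auto simp: Sec_zero holomorphic_fun_mult holomorphic_fun_const Sec_hol, auto simp: ext_alg_def ext_zero[OF Sec_alg])

lemma zero_closed: "(\<lambda>i x K. 0) \<in> Sec U"
  by (rule SecI) (auto simp: ext_alg_def holomorphic_fun_const ext_map_zero)

lemma uminus_closed: "s \<in> Sec U \<Longrightarrow> (\<lambda>i x K. - s i x K) \<in> Sec U"
  using scale_closed[of s U "-1"] by simp

lemma diff_closed: "s \<in> Sec U \<Longrightarrow> t \<in> Sec U \<Longrightarrow> (\<lambda>i x K. s i x K - t i x K) \<in> Sec U"
  using add_closed[OF _ uminus_closed, of s U t] by simp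

text \<open>Functions, as the sections of degree 0.\<close>

definition emb :: "'a set \<Rightarrow> ('a \<Rightarrow> complex) \<Rightarrow> 'i \<Rightarrow> 'a \<Rightarrow> nat set \<Rightarrow> complex" where
  "emb U f = (\<lambda>i x K. if x \<in> U \<inter> patch E i then f x * ext_one K else 0)"

lemma emb_closed: "open U \<Longrightarrow> hol U f \<Longrightarrow> emb U f \<in> Sec U"
proof (rule SecI)
  fix i j x assume x: "x \<in> U \<inter> patch E i \<inter> patch E j"
  show "emb U f i x = ext_map r (tr i j x) (emb U f j x)"
    by (rule ext) (use x in \<open>simp add: emb_def ext_map_scale ext_map_one\<close>)
next
  fix i K assume U: "open U" and f: "hol U f"
  show "hol (U \<inter> patch E i) (\<lambda>x. emb U f i x K)"
    unfolding emb_def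
    by (rule hol_cong[OF _ holomorphic_fun_mult[OF holomorphic_fun_mono[OF f] holomorphic_fun_const[of _ _ "ext_one K"]]])
       (auto simp: U patch_open)
qed (auto simp: emb_def ext_alg_def ext_one_def)

lemma one_closed: "open U \<Longrightarrow> (\<lambda>i x K. if x \<in> U \<inter> patch E i then ext_one K else 0) \<in> Sec U"
  using emb_closed[of U "\<lambda>x. 1"] unfolding emb_def mult_1 by (simp add: holomorphic_fun_const)

lemma res_closed: "open U \<Longrightarrow> open V \<Longrightarrow> V \<subseteq> U \<Longrightarrow> s \<in> Sec U \<Longrightarrow> (\<lambda>i x K. if x \<in> V then s i x K else 0) \<in> Sec V"
proof (rule SecI)
  fix i K assume a: "open U" "open V" "V \<subseteq> U" "s \<in> Sec U"
  show "hol (V \<inter> patch E i) (\<lambda>x. if x \<in> V then s i x K else 0)"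
    by (rule hol_cong[OF _ holomorphic_fun_mono[OF Sec_hol[OF a(4)]]]) (use a in \<open>auto simp: patch_open\<close>)
next
  fix i x assume "open U" "open V" "V \<subseteq> U" "s \<in> Sec U"
  then show "(\<lambda>K. if x \<in> V then s i x K else 0) \<in> ext_alg r"
    using Sec_alg[of s U i x] by (auto simp: ext_alg_def)
next
  fix i j x assume a: "open U" "open V" "V \<subseteq> U" "s \<in> Sec U" and x: "x \<in> V \<inter> patch E i \<inter> patch E j"
  then have "x \<in> U \<inter> patch E i \<inter> patch E j" by blast
  from Sec_change[OF a(4) this] x
  show "(\<lambda>K. if x \<in> V then s i x K else 0) = ext_map r (tr i j x) (\<lambda>K. if x \<in> V then s j x K else 0)"
    by simp
qed (auto simp: Sec_zero)

lemma wedge_one_section: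
  assumes "s \<in> Sec U"
  shows "wedge (\<lambda>K. if x \<in> U \<inter> patch E i then ext_one K else 0) (s i x) = s i x"
    "wedge (s i x) (\<lambda>K. if x \<in> U \<inter> patch E i then ext_one K else 0) = s i x"
proof -
  have z: "wedge (\<lambda>K. 0) u = (\<lambda>K. 0)" "wedge u (\<lambda>K. 0) = (\<lambda>K. 0)" for u
    by (rule ext, simp add: wedge_def)+
  let ?e = "\<lambda>K. if x \<in> U \<inter> patch E i then ext_one K else 0"
  have "wedge ?e (s i x) = s i x \<and> wedge (s i x) ?e = s i x"
  proof (cases "x \<in> U \<inter> patch E i")
    case True
    then have "?e = ext_one" by simp
    then show ?thesis using wedge_one_left[OF Sec_alg[OF assms]] wedge_one_right[OF Sec_alg[OF assms]] by metis
  next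
    case False
    then have "?e = (\<lambda>K. 0)" "s i x = (\<lambda>K. 0)" using Sec_zero[OF assms False] by auto
    then show ?thesis unfolding z by (simp only: z)
  qed
  then show "wedge ?e (s i x) = s i x" "wedge (s i x) ?e = s i x" by blast+
qed

lemma ring_sections: assumes "open U" shows "ring (sec \<Lambda> U)"
proof (rule ringI)
  show "abelian_group (sec \<Lambda> U)"
  proof (rule abelian_groupI)
    fix s assume "s \<in> carrier (sec \<Lambda> U)"
    then show "\<exists>t\<in>carrier (sec \<Lambda> U). t \<oplus>\<^bsub>sec \<Lambda> U\<^esub> s = \<zero>\<^bsub>sec \<Lambda> U\<^esub>"
      by (intro bexI[of _ "\<lambda>i x K. - s i x K"]) (simp_all add: uminus_closed)
  qed (simp_all add: add_closed zero_closed add_ac)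
  show "monoid (sec \<Lambda> U)"
    by (rule monoidI) (simp_all only: sheaf_simps mult_closed one_closed[OF assms] wedge_assoc wedge_one_section)
qed (simp_all add: fun_eq_iff wedge_add_left wedge_add_right)

lemma minus_section:
  assumes "open U" "s \<in> Sec U" "t \<in> Sec U"
  shows "s \<ominus>\<^bsub>sec \<Lambda> U\<^esub> t = (\<lambda>i x K. s i x K - t i x K)"
proof -
  interpret ring "sec \<Lambda> U" by (rule ring_sections[OF assms(1)])
  have "\<ominus>\<^bsub>sec \<Lambda> U\<^esub> t = (\<lambda>i x K. - t i x K)"
    by (rule minus_equality) (use assms in \<open>auto simp: uminus_closed\<close>)
  then show ?thesis by (simp add: a_minus_def)
qed

lemma Sec_eqI:
  assumes "s \<in> Sec U" "t \<in> Sec U" "\<And>i x. x \<in> U \<inter> patch E i \<Longrightarrow> s i x = t i x"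
  shows "s = t"
proof (intro ext)
  fix i x K
  show "s i x K = t i x K" using assms Sec_zero[of s U x i K] Sec_zero[of t U x i K] by (cases "x \<in> U \<inter> patch E i") auto
qed

text \<open>Over a subset of one patch a section is the same as its component in the frame of that patch;
  the other components are recovered by the transition matrices.\<close>

definition from_frame :: "'i \<Rightarrow> 'a set \<Rightarrow> ('a \<Rightarrow> nat set \<Rightarrow> complex) \<Rightarrow> 'i \<Rightarrow> 'a \<Rightarrow> nat set \<Rightarrow> complex" where
  "from_frame i V u = (\<lambda>j x K. if x \<in> V \<inter> patch E j then ext_map r (tr j i x) (u x) K else 0)"

lemma tr_tr:
  assumes "x \<in> patch E i \<inter> patch E j \<inter> patch E m" "u \<in> ext_alg r"
  shows "ext_map r (tr i j x) (ext_map r (tr j m x) u) = ext_map r (tr i m x) u"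
  unfolding ext_map_ext_map[OF assms(2)]
  by (rule ext_map_cong) (use tr_trans[OF assms(1)] in simp)

lemma tr_id: "x \<in> patch E i \<Longrightarrow> u \<in> ext_alg r \<Longrightarrow> ext_map r (tr i i x) u = u"
  by (rule ext_map_id) (simp_all add: tr_refl)

lemma from_frame_closed:
  assumes V: "open V" "V \<subseteq> patch E i" and u: "\<And>K. hol V (\<lambda>x. u x K)" "\<And>x. x \<in> V \<Longrightarrow> u x \<in> ext_alg r"
  shows "from_frame i V u \<in> Sec V"
proof (rule SecI)
  fix j K
  have "hol (V \<inter> patch E j) (\<lambda>x. ext_map r (tr j i x) (u x) K)"
    by (rule hol_ext_map) (use V in \<open>auto intro: holomorphic_fun_mono[OF u(1)] holomorphic_fun_mono[OF tr_hol]\<close>)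
  then show "hol (V \<inter> patch E j) (\<lambda>x. from_frame i V u j x K)"
    by (rule hol_cong[rotated]) (use V in \<open>auto simp: from_frame_def patch_open\<close>)
next
  fix j m x assume x: "x \<in> V \<inter> patch E j \<inter> patch E m"
  have "x \<in> patch E j \<inter> patch E m \<inter> patch E i" using x V by blast
  from tr_tr[OF this u(2)] show "from_frame i V u j x = ext_map r (tr j m x) (from_frame i V u m x)"
    using x by (simp add: from_frame_def fun_eq_iff)
qed (auto simp: from_frame_def intro: ext_map_in)

lemma from_frame_same:
  assumes "V \<subseteq> patch E i" "x \<in> V" "u x \<in> ext_alg r" shows "from_frame i V u i x = u x"
  using assms tr_id[of x i "u x"] by (auto simp: from_frame_def fun_eq_iff)

lemma Sec_eq_frame:
  assumes "s \<in> Sec V" "t \<in> Sec V" "V \<subseteq> patch E i" "\<And>x. x \<in> V \<Longrightarrow> s i x = t i x"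
  shows "s = t"
proof (rule Sec_eqI[OF assms(1,2)])
  fix j x assume x: "x \<in> V \<inter> patch E j"
  then have "x \<in> V \<inter> patch E j \<inter> patch E i" using assms(3) by blast
  then show "s j x = t j x"
    using Sec_change[OF assms(1), of x j i] Sec_change[OF assms(2), of x j i] assms(4)[of x] by simp
qed

lemma Fil_iff: "s \<in> Fil k U \<longleftrightarrow> s \<in> Sec U \<and> (\<forall>i x K. card K < k \<longrightarrow> s i x K = 0)"
  by (auto simp: ext_filtration_def)

lemma Fil_mono: "k \<le> l \<Longrightarrow> s \<in> Fil l U \<Longrightarrow> s \<in> Fil k U"
  by (auto simp: Fil_iff)

lemma Fil_0: "Fil 0 U = Sec U"
  by (auto simp: Fil_iff)

lemma Fil_mult: "s \<in> Fil a U \<Longrightarrow> t \<in> Fil b U \<Longrightarrow> (\<lambda>i x. wedge (s i x) (t i x)) \<in> Fil (a + b) U"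
  unfolding Fil_iff by (simp add: mult_closed wedge_vanish_below[of a _ b])

lemma Fil_add: "s \<in> Fil a U \<Longrightarrow> t \<in> Fil a U \<Longrightarrow> (\<lambda>i x K. s i x K + t i x K) \<in> Fil a U"
  unfolding Fil_iff by (simp add: add_closed)

lemma Fil_diff: "s \<in> Fil a U \<Longrightarrow> t \<in> Fil a U \<Longrightarrow> (\<lambda>i x K. s i x K - t i x K) \<in> Fil a U"
  unfolding Fil_iff by (simp add: diff_closed)

lemma Fil_res: "open U \<Longrightarrow> open V \<Longrightarrow> V \<subseteq> U \<Longrightarrow> s \<in> Fil a U \<Longrightarrow> res \<Lambda> U V s \<in> Fil a V"
  unfolding Fil_iff by (simp add: res_closed)

lemma from_frame_Fil:
  assumes V: "open V" "V \<subseteq> patch E i" and u: "\<And>K. hol V (\<lambda>x. u x K)" "\<And>x. x \<in> V \<Longrightarrow> u x \<in> ext_alg r"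
    and low: "\<And>x K. x \<in> V \<Longrightarrow> card K < k \<Longrightarrow> u x K = 0"
  shows "from_frame i V u \<in> Fil k V"
  unfolding Fil_iff using from_frame_closed[OF V u] low
  by (auto simp: from_frame_def intro!: ext_map_vanish)

lemma Fil_top: "r < k \<Longrightarrow> s \<in> Fil k U \<Longrightarrow> s = (\<lambda>i x K. 0)"
proof (intro ext)
  fix i x K assume k: "r < k" and s: "s \<in> Fil k U"
  show "s i x K = 0"
  proof (cases "K \<subseteq> {..<r}")
    case True
    then have "card K \<le> r" using card_mono[of "{..<r}" K] by simp
    then show ?thesis using s k by (auto simp: Fil_iff)
  next
    case False
    moreover have "s \<in> Sec U" using s by (simp add: Fil_iff)
    ultimately show ?thesis using ext_zero[OF Sec_alg] by blast
  qed
qed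

definition frame :: "'i \<Rightarrow> 'a set \<Rightarrow> nat \<Rightarrow> 'i \<Rightarrow> 'a \<Rightarrow> nat set \<Rightarrow> complex" where
  "frame i V l = from_frame i V (\<lambda>x. ext_basis {l})"

lemma frame_Fil: "open V \<Longrightarrow> V \<subseteq> patch E i \<Longrightarrow> l < r \<Longrightarrow> frame i V l \<in> Fil 1 V"
  unfolding frame_def
  by (rule from_frame_Fil) (auto simp: holomorphic_fun_const ext_basis_in ext_basis_def)

lemma frame_odd: "open V \<Longrightarrow> V \<subseteq> patch E i \<Longrightarrow> l < r \<Longrightarrow> frame i V l \<in> odds (sec \<Lambda> V)"
  using frame_Fil[of V i l]
  by (auto simp: Fil_iff frame_def from_frame_def intro!: ext_map_vanish) (auto simp: ext_basis_def)

lemma frame_same: "V \<subseteq> patch E i \<Longrightarrow> l < r \<Longrightarrow> x \<in> V \<Longrightarrow> frame i V l i x = ext_basis {l}"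
  unfolding frame_def by (rule from_frame_same) (auto simp: ext_basis_in)

text \<open>Inductions on the degree go through this expansion. The component with index set \<open>K\<close> is
  assigned to the frame vector of the least element of \<open>K\<close>, as in \<open>wedge_vec_expand\<close>.\<close>

lemma Fil_Suc_expand:
  assumes V: "open V" "V \<subseteq> patch E i" and s: "s \<in> Fil (Suc k) V"
  obtains t where "\<And>l. l < r \<Longrightarrow> t l \<in> Fil k V"
    "s = (\<lambda>j x K. \<Sum>l<r. wedge (frame i V l j x) (t l j x) K)"
proof -
  define v where "v = (\<lambda>l x J. if \<forall>j\<in>J. l < j then s i x (insert l J) else 0)"
  have sS: "s \<in> Sec V" and low: "\<And>i x K. card K < Suc k \<Longrightarrow> s i x K = 0" using s by (auto simp: Fil_iff)
  have Vi: "V \<inter> patch E i = V" using V by blast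
  have h: "hol V (\<lambda>x. v l x K)" for l K
  proof (cases "\<forall>j\<in>K. l < j")
    case True
    have "(\<lambda>x. v l x K) = (\<lambda>x. s i x (insert l K))" unfolding v_def if_P[OF True] ..
    then show ?thesis using Sec_hol[OF sS, of i "insert l K"] by (simp only: Vi)
  next
    case False
    have "(\<lambda>x. v l x K) = (\<lambda>x. 0)" unfolding v_def if_not_P[OF False] ..
    then show ?thesis by (simp only: holomorphic_fun_const)
  qed
  have a: "v l x \<in> ext_alg r" for l x
    using ext_zero[OF Sec_alg[OF sS]] by (auto simp: ext_alg_def v_def)
  have lo: "v l x K = 0" if "card K < k" for l x K
  proof -
    have "card (insert l K) < Suc k" using that by (cases "finite K") (auto simp: card_insert_if)
    then show ?thesis using low by (simp add: v_def)
  qed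
  let ?t = "\<lambda>l. from_frame i V (v l)"
  have tF: "?t l \<in> Fil k V" for l
    by (rule from_frame_Fil[OF V h]) (auto simp: a lo)
  have sum: "(\<lambda>j x K. \<Sum>l<n. wedge (frame i V l j x) (?t l j x) K) \<in> Sec V" if "n \<le> r" for n
    using that
  proof (induction n)
    case (Suc n)
    have "(\<lambda>j x. wedge (frame i V n j x) (?t n j x)) \<in> Sec V"
      using Suc frame_Fil[OF V, of n] tF[of n] by (intro mult_closed) (auto simp: Fil_iff)
    from add_closed[OF _ this] Suc show ?case by simp
  qed (simp add: zero_closed)
  have "s = (\<lambda>j x K. \<Sum>l<r. wedge (frame i V l j x) (?t l j x) K)"
  proof (rule Sec_eq_frame[OF sS sum[OF order_refl] V(2)])
    fix x assume x: "x \<in> V"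
    have "s i x = (\<lambda>K. \<Sum>l<r. wedge (ext_basis {l}) (v l x) K)"
      unfolding v_def by (rule wedge_vec_expand) (simp_all add: Sec_alg[OF sS] low)
    then show "s i x = (\<lambda>K. \<Sum>l<r. wedge (frame i V l i x) (?t l i x) K)"
      using x V by (simp add: frame_same from_frame_same a)
  qed
  then show ?thesis using that[of ?t] tF by blast
qed

end

section \<open>Isomorphisms of sheaves of superalgebras\<close>

lemma super_isoD:
  assumes "super_iso_on U S T \<theta>" "open V" "V \<subseteq> U"
  shows "\<theta> V \<in> super_hom (sec S V) (sec T V)" "bij_betw (\<theta> V) (carrier (sec S V)) (carrier (sec T V))"
    "\<theta> V ` evens (sec S V) = evens (sec T V)" "\<theta> V ` odds (sec S V) = odds (sec T V)"
  using assms by (simp_all add: super_iso_on_def)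

lemma super_iso_natural:
  "\<lbrakk>super_iso_on U S T \<theta>; open V; open W; W \<subseteq> V; V \<subseteq> U; s \<in> carrier (sec S V)\<rbrakk> \<Longrightarrow> \<theta> W (res S V W s) = res T V W (\<theta> V s)"
  by (simp add: super_iso_on_def)

lemma super_iso_onI:
  assumes "\<And>V. open V \<Longrightarrow> V \<subseteq> U \<Longrightarrow> \<theta> V \<in> super_hom (sec S V) (sec T V) \<and>
      bij_betw (\<theta> V) (carrier (sec S V)) (carrier (sec T V)) \<and>
      \<theta> V ` evens (sec S V) = evens (sec T V) \<and> \<theta> V ` odds (sec S V) = odds (sec T V)"
    and "\<And>V W s. \<lbrakk>open V; open W; W \<subseteq> V; V \<subseteq> U; s \<in> carrier (sec S V)\<rbrakk> \<Longrightarrow> \<theta> W (res S V W s) = res T V W (\<theta> V s)"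
  shows "super_iso_on U S T \<theta>"
  using assms by (simp add: super_iso_on_def)

lemma super_homD:
  assumes "h \<in> super_hom A B"
  shows "x \<in> carrier A \<Longrightarrow> h x \<in> carrier B"
    "x \<in> carrier A \<Longrightarrow> y \<in> carrier A \<Longrightarrow> h (x \<otimes>\<^bsub>A\<^esub> y) = h x \<otimes>\<^bsub>B\<^esub> h y"
    "x \<in> carrier A \<Longrightarrow> y \<in> carrier A \<Longrightarrow> h (x \<oplus>\<^bsub>A\<^esub> y) = h x \<oplus>\<^bsub>B\<^esub> h y"
    "h \<one>\<^bsub>A\<^esub> = \<one>\<^bsub>B\<^esub>" "x \<in> carrier A \<Longrightarrow> h (c \<odot>\<^bsub>A\<^esub> x) = c \<odot>\<^bsub>B\<^esub> h x"
    "x \<in> evens A \<Longrightarrow> h x \<in> evens B" "x \<in> odds A \<Longrightarrow> h x \<in> odds B"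
  using assms by (auto simp: super_hom_def ring_hom_def Pi_iff)

lemma super_homI:
  assumes "\<And>x. x \<in> carrier A \<Longrightarrow> h x \<in> carrier B"
    "\<And>x y. x \<in> carrier A \<Longrightarrow> y \<in> carrier A \<Longrightarrow> h (x \<otimes>\<^bsub>A\<^esub> y) = h x \<otimes>\<^bsub>B\<^esub> h y"
    "\<And>x y. x \<in> carrier A \<Longrightarrow> y \<in> carrier A \<Longrightarrow> h (x \<oplus>\<^bsub>A\<^esub> y) = h x \<oplus>\<^bsub>B\<^esub> h y"
    "h \<one>\<^bsub>A\<^esub> = \<one>\<^bsub>B\<^esub>" "\<And>c x. x \<in> carrier A \<Longrightarrow> h (c \<odot>\<^bsub>A\<^esub> x) = c \<odot>\<^bsub>B\<^esub> h x"
    "\<And>x. x \<in> evens A \<Longrightarrow> h x \<in> evens B" "\<And>x. x \<in> odds A \<Longrightarrow> h x \<in> odds B"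
  shows "h \<in> super_hom A B"
  using assms by (auto simp: super_hom_def ring_hom_def Pi_iff)

lemma super_iso_mono:
  assumes "super_iso_on U S T \<theta>" "U' \<subseteq> U" shows "super_iso_on U' S T \<theta>"
proof (rule super_iso_onI)
  fix V assume "open V" "V \<subseteq> U'"
  then have V: "open V" "V \<subseteq> U" using assms(2) by auto
  show "\<theta> V \<in> super_hom (sec S V) (sec T V) \<and> bij_betw (\<theta> V) (carrier (sec S V)) (carrier (sec T V)) \<and>
      \<theta> V ` evens (sec S V) = evens (sec T V) \<and> \<theta> V ` odds (sec S V) = odds (sec T V)"
    by (intro conjI super_isoD[OF assms(1) V])
qed (use assms in \<open>auto intro: super_iso_natural\<close>)

lemma super_iso_closed: "\<lbrakk>super_iso_on U S T \<theta>; open V; V \<subseteq> U; s \<in> carrier (sec S V)\<rbrakk> \<Longrightarrow> \<theta> V s \<in> carrier (sec T V)"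
  using super_homD(1)[OF super_isoD(1)] .

lemma super_iso_comp:
  assumes \<theta>: "super_iso_on U S T \<theta>" and \<psi>: "super_iso_on U T R \<psi>"
  shows "super_iso_on U S R (\<lambda>V. \<psi> V \<circ> \<theta> V)"
proof (rule super_iso_onI)
  fix V assume V: "open V" "V \<subseteq> U"
  note t = super_isoD[OF \<theta> V] and p = super_isoD[OF \<psi> V]
  note th = super_homD[OF t(1)] and ph = super_homD[OF p(1)]
  have "\<psi> V \<circ> \<theta> V \<in> super_hom (sec S V) (sec R V)"
    by (rule super_homI) (simp_all add: th ph)
  moreover have "bij_betw (\<psi> V \<circ> \<theta> V) (carrier (sec S V)) (carrier (sec R V))"
    using bij_betw_trans[OF t(2) p(2)] .
  ultimately show "\<psi> V \<circ> \<theta> V \<in> super_hom (sec S V) (sec R V) \<and>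
      bij_betw (\<psi> V \<circ> \<theta> V) (carrier (sec S V)) (carrier (sec R V)) \<and>
      (\<psi> V \<circ> \<theta> V) ` evens (sec S V) = evens (sec R V) \<and> (\<psi> V \<circ> \<theta> V) ` odds (sec S V) = odds (sec R V)"
    by (simp only: image_comp[symmetric] t(3,4) p(3,4))
qed (simp add: super_iso_natural[OF \<theta>] super_iso_natural[OF \<psi>] super_iso_closed[OF \<theta>])

text \<open>The part of the structure of a presheaf of superalgebras which is needed to invert
  isomorphisms and to form the group of automorphisms.\<close>

definition algebra_presheaf :: "('a::topological_space, 's) spresheaf \<Rightarrow> bool" where
  "algebra_presheaf S \<longleftrightarrow> (\<forall>V. open V \<longrightarrow> ring (sec S V) \<and> (\<forall>c. \<forall>x\<in>carrier (sec S V). c \<odot>\<^bsub>sec S V\<^esub> x \<in> carrier (sec S V)) \<and>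
      evens (sec S V) \<subseteq> carrier (sec S V) \<and> odds (sec S V) \<subseteq> carrier (sec S V)) \<and>
    (\<forall>V W. open V \<and> open W \<and> W \<subseteq> V \<longrightarrow> res S V W \<in> carrier (sec S V) \<rightarrow> carrier (sec S W))"

lemma algebra_presheafD:
  assumes "algebra_presheaf S" "open V"
  shows "ring (sec S V)" "x \<in> carrier (sec S V) \<Longrightarrow> c \<odot>\<^bsub>sec S V\<^esub> x \<in> carrier (sec S V)"
    "x \<in> evens (sec S V) \<Longrightarrow> x \<in> carrier (sec S V)" "x \<in> odds (sec S V) \<Longrightarrow> x \<in> carrier (sec S V)"
    "open W \<Longrightarrow> W \<subseteq> V \<Longrightarrow> x \<in> carrier (sec S V) \<Longrightarrow> res S V W x \<in> carrier (sec S W)"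
  using assms by (auto simp: algebra_presheaf_def Pi_iff)

lemma super_iso_cong:
  assumes \<theta>: "super_iso_on U S T \<theta>" and S: "algebra_presheaf S"
    and e: "\<And>V s. \<lbrakk>open V; V \<subseteq> U; s \<in> carrier (sec S V)\<rbrakk> \<Longrightarrow> \<theta>' V s = \<theta> V s"
  shows "super_iso_on U S T \<theta>'"
proof (rule super_iso_onI)
  fix V assume V: "open V" "V \<subseteq> U"
  note t = super_isoD[OF \<theta> V] and g = algebra_presheafD[OF S V(1)] and e' = e[OF V]
  note th = super_homD[OF t(1)]
  interpret ring "sec S V" by (rule g)
  have "\<theta>' V \<in> super_hom (sec S V) (sec T V)"
    by (rule super_homI) (simp_all add: th e' g)
  moreover have "bij_betw (\<theta>' V) (carrier (sec S V)) (carrier (sec T V))"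
    using t(2) e' by (simp cong: bij_betw_cong)
  moreover have "\<theta>' V ` evens (sec S V) = \<theta> V ` evens (sec S V)" "\<theta>' V ` odds (sec S V) = \<theta> V ` odds (sec S V)"
    using e' g(3,4) by (auto intro!: image_cong)
  ultimately show "\<theta>' V \<in> super_hom (sec S V) (sec T V) \<and>
      bij_betw (\<theta>' V) (carrier (sec S V)) (carrier (sec T V)) \<and>
      \<theta>' V ` evens (sec S V) = evens (sec T V) \<and> \<theta>' V ` odds (sec S V) = odds (sec T V)"
    using t(3,4) by simp
next
  fix V W s assume a: "open V" "open W" "W \<subseteq> V" "V \<subseteq> U" "s \<in> carrier (sec S V)"
  then have "W \<subseteq> U" by blast
  then show "\<theta>' W (res S V W s) = res T V W (\<theta>' V s)"
    using a e super_iso_natural[OF \<theta> a] algebra_presheafD(5)[OF S] by simp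
qed

definition iso_inv :: "('a::topological_space, 's) spresheaf \<Rightarrow> ('a set \<Rightarrow> 's \<Rightarrow> 't) \<Rightarrow> 'a set \<Rightarrow> 't \<Rightarrow> 's" where
  "iso_inv S \<theta> V = inv_into (carrier (sec S V)) (\<theta> V)"

lemma iso_inv:
  assumes \<theta>: "super_iso_on U S T \<theta>" and V: "open V" "V \<subseteq> U"
  shows "s \<in> carrier (sec S V) \<Longrightarrow> iso_inv S \<theta> V (\<theta> V s) = s"
    "t \<in> carrier (sec T V) \<Longrightarrow> \<theta> V (iso_inv S \<theta> V t) = t"
    "t \<in> carrier (sec T V) \<Longrightarrow> iso_inv S \<theta> V t \<in> carrier (sec S V)"
  unfolding iso_inv_def using super_isoD(2)[OF \<theta> V]
  by (auto simp: bij_betw_def inv_into_f_f f_inv_into_f inv_into_into)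

lemma super_iso_inv:
  assumes \<theta>: "super_iso_on U S T \<theta>" and S: "algebra_presheaf S"
  shows "super_iso_on U T S (iso_inv S \<theta>)"
proof (rule super_iso_onI)
  fix V assume V: "open V" "V \<subseteq> U"
  note t = super_isoD[OF \<theta> V] and g = algebra_presheafD[OF S V(1)] and i = iso_inv[OF \<theta> V]
  note th = super_homD[OF t(1)]
  interpret ring "sec S V" by (rule g)
  let ?h = "iso_inv S \<theta> V"
  have pull: "\<And>x. x \<in> carrier (sec T V) \<Longrightarrow> \<exists>y\<in>carrier (sec S V). x = \<theta> V y" using i by metis
  have ev: "?h ` evens (sec T V) = evens (sec S V)" "?h ` odds (sec T V) = odds (sec S V)"
    unfolding t(3,4)[symmetric] image_image using i(1) g(3,4) by simp_all
  have "?h \<in> super_hom (sec T V) (sec S V)"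
  proof (rule super_homI)
    fix x y assume "x \<in> carrier (sec T V)" "y \<in> carrier (sec T V)"
    then obtain a b where ab: "a \<in> carrier (sec S V)" "b \<in> carrier (sec S V)" "x = \<theta> V a" "y = \<theta> V b"
      using pull by blast
    show "?h (x \<otimes>\<^bsub>sec T V\<^esub> y) = ?h x \<otimes>\<^bsub>sec S V\<^esub> ?h y"
      using ab i(1)[of "a \<otimes>\<^bsub>sec S V\<^esub> b"] by (simp add: th i(1))
    show "?h (x \<oplus>\<^bsub>sec T V\<^esub> y) = ?h x \<oplus>\<^bsub>sec S V\<^esub> ?h y"
      using ab i(1)[of "a \<oplus>\<^bsub>sec S V\<^esub> b"] by (simp add: th i(1))
  next
    fix c x assume "x \<in> carrier (sec T V)"
    then obtain a where a: "a \<in> carrier (sec S V)" "x = \<theta> V a" using pull by blast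
    show "?h (c \<odot>\<^bsub>sec T V\<^esub> x) = c \<odot>\<^bsub>sec S V\<^esub> ?h x"
      using a i(1)[of "c \<odot>\<^bsub>sec S V\<^esub> a"] by (simp add: th i(1) g(2))
  next
    show "?h \<one>\<^bsub>sec T V\<^esub> = \<one>\<^bsub>sec S V\<^esub>" using i(1)[of "\<one>\<^bsub>sec S V\<^esub>"] by (simp add: th)
  qed (use ev i(3) in auto)
  moreover have "bij_betw ?h (carrier (sec T V)) (carrier (sec S V))"
    unfolding iso_inv_def by (rule bij_betw_inv_into[OF t(2)])
  ultimately show "?h \<in> super_hom (sec T V) (sec S V) \<and> bij_betw ?h (carrier (sec T V)) (carrier (sec S V)) \<and>
      ?h ` evens (sec T V) = evens (sec S V) \<and> ?h ` odds (sec T V) = odds (sec S V)"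
    using ev by blast
next
  fix V W t assume a: "open V" "open W" "W \<subseteq> V" "V \<subseteq> U" "t \<in> carrier (sec T V)"
  then have W: "W \<subseteq> U" by blast
  let ?s = "iso_inv S \<theta> V t"
  have s: "?s \<in> carrier (sec S V)" "\<theta> V ?s = t" using iso_inv[OF \<theta> a(1,4)] a(5) by auto
  have "res T V W t = \<theta> W (res S V W ?s)" using super_iso_natural[OF \<theta> a(1-4) s(1)] s(2) by simp
  then show "iso_inv S \<theta> W (res T V W t) = res S V W ?s"
    using iso_inv(1)[OF \<theta> a(2) W] algebra_presheafD(5)[OF S a(1,2,3) s(1)] by simp
qed

lemma super_iso_id: "super_iso_on U S S (\<lambda>V. id)"
  by (rule super_iso_onI) (auto intro!: super_homI)

section \<open>The sheaf of automorphism groups\<close>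

lemma aut_norm_apply: "\<lbrakk>open V; V \<subseteq> U; s \<in> carrier (sec S V)\<rbrakk> \<Longrightarrow> aut_norm S U \<alpha> V s = \<alpha> V s"
  by (simp add: aut_norm_def)

lemma aut_norm_idem: "aut_norm S U (aut_norm S U \<alpha>) = aut_norm S U \<alpha>"
  by (auto simp: aut_norm_def fun_eq_iff)

lemma aut_norm_aut_norm: "V \<subseteq> U \<Longrightarrow> aut_norm S V (aut_norm S U \<alpha>) = aut_norm S V \<alpha>"
  by (auto simp: aut_norm_def fun_eq_iff)

lemma aut_norm_cong:
  "(\<And>V s. \<lbrakk>open V; V \<subseteq> U; s \<in> carrier (sec S V)\<rbrakk> \<Longrightarrow> \<alpha> V s = \<beta> V s) \<Longrightarrow> aut_norm S U \<alpha> = aut_norm S U \<beta>"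
  by (auto simp: aut_norm_def fun_eq_iff)

locale superalgebra_presheaf =
  fixes S :: "('a::topological_space, 's) spresheaf"
  assumes alg: "algebra_presheaf S"
begin

abbreviation Aut where "Aut \<equiv> aut_sheaf S"

lemma Aut_simps:
  "\<alpha> \<in> carrier (sec Aut U) \<longleftrightarrow> super_iso_on U S S \<alpha> \<and> aut_norm S U \<alpha> = \<alpha>"
  "\<alpha> \<otimes>\<^bsub>sec Aut U\<^esub> \<beta> = aut_norm S U (\<lambda>V. \<alpha> V \<circ> \<beta> V)"
  "\<one>\<^bsub>sec Aut U\<^esub> = aut_norm S U (\<lambda>V. id)"
  "res Aut U V = aut_norm S V"
  by (simp_all add: aut_sheaf_def)

lemma Aut_norm: "super_iso_on U S S \<alpha> \<Longrightarrow> aut_norm S U \<alpha> \<in> carrier (sec Aut U)"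
  unfolding Aut_simps
  using super_iso_cong[OF _ alg, of U S \<alpha> "aut_norm S U \<alpha>"] by (simp add: aut_norm_apply aut_norm_idem)

lemma Aut_closed: "\<lbrakk>\<alpha> \<in> carrier (sec Aut U); open V; V \<subseteq> U; s \<in> carrier (sec S V)\<rbrakk> \<Longrightarrow> \<alpha> V s \<in> carrier (sec S V)"
  using super_iso_closed[of U S S \<alpha> V s] by (simp add: Aut_simps(1))

lemma Aut_eqI:
  assumes "\<alpha> \<in> carrier (sec Aut U)" "\<beta> \<in> carrier (sec Aut U)"
    "\<And>V s. \<lbrakk>open V; V \<subseteq> U; s \<in> carrier (sec S V)\<rbrakk> \<Longrightarrow> \<alpha> V s = \<beta> V s"
  shows "\<alpha> = \<beta>"
proof -
  have "aut_norm S U \<alpha> = aut_norm S U \<beta>" by (rule aut_norm_cong) (rule assms(3))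
  then show ?thesis using assms(1,2) by (simp add: Aut_simps(1))
qed

lemma Aut_mult_apply: "\<lbrakk>open V; V \<subseteq> U; s \<in> carrier (sec S V)\<rbrakk> \<Longrightarrow> (\<alpha> \<otimes>\<^bsub>sec Aut U\<^esub> \<beta>) V s = \<alpha> V (\<beta> V s)"
  by (simp add: Aut_simps aut_norm_apply)

lemma Aut_one_apply: "\<lbrakk>open V; V \<subseteq> U; s \<in> carrier (sec S V)\<rbrakk> \<Longrightarrow> \<one>\<^bsub>sec Aut U\<^esub> V s = s"
  by (simp add: Aut_simps aut_norm_apply)

lemma Aut_res_apply: "\<lbrakk>open W; W \<subseteq> V; s \<in> carrier (sec S W)\<rbrakk> \<Longrightarrow> res Aut U V \<alpha> W s = \<alpha> W s"
  by (simp add: Aut_simps aut_norm_apply)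

lemma Aut_mult_closed: "\<alpha> \<in> carrier (sec Aut U) \<Longrightarrow> \<beta> \<in> carrier (sec Aut U) \<Longrightarrow> \<alpha> \<otimes>\<^bsub>sec Aut U\<^esub> \<beta> \<in> carrier (sec Aut U)"
  using Aut_norm[OF super_iso_comp, of U S \<beta> \<alpha>] by (simp add: Aut_simps(1,2))

lemma Aut_one_closed: "\<one>\<^bsub>sec Aut U\<^esub> \<in> carrier (sec Aut U)"
  using Aut_norm[OF super_iso_id] unfolding Aut_simps(3) .

lemma Aut_res_closed: "V \<subseteq> U \<Longrightarrow> \<alpha> \<in> carrier (sec Aut U) \<Longrightarrow> res Aut U V \<alpha> \<in> carrier (sec Aut V)"
  using Aut_norm[OF super_iso_mono, of U \<alpha> V] unfolding Aut_simps(4) by (simp add: Aut_simps(1))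

lemma Aut_group: "group (sec Aut U)"
proof (rule groupI)
  fix \<alpha> assume a: "\<alpha> \<in> carrier (sec Aut U)"
  then have iso: "super_iso_on U S S \<alpha>" by (simp add: Aut_simps)
  let ?\<beta> = "aut_norm S U (iso_inv S \<alpha>)"
  have b: "?\<beta> \<in> carrier (sec Aut U)" by (rule Aut_norm[OF super_iso_inv[OF iso alg]])
  have "?\<beta> \<otimes>\<^bsub>sec Aut U\<^esub> \<alpha> = \<one>\<^bsub>sec Aut U\<^esub>"
  proof (rule Aut_eqI[OF Aut_mult_closed[OF b a] Aut_one_closed])
    fix V s assume V: "open V" "V \<subseteq> U" "s \<in> carrier (sec S V)"
    then show "(?\<beta> \<otimes>\<^bsub>sec Aut U\<^esub> \<alpha>) V s = \<one>\<^bsub>sec Aut U\<^esub> V s"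
      using Aut_closed[OF a V] by (simp add: Aut_mult_apply Aut_one_apply aut_norm_apply iso_inv[OF iso])
  qed
  then show "\<exists>\<beta>\<in>carrier (sec Aut U). \<beta> \<otimes>\<^bsub>sec Aut U\<^esub> \<alpha> = \<one>\<^bsub>sec Aut U\<^esub>" using b by blast
  show "\<one>\<^bsub>sec Aut U\<^esub> \<otimes>\<^bsub>sec Aut U\<^esub> \<alpha> = \<alpha>"
    by (rule Aut_eqI[OF Aut_mult_closed[OF Aut_one_closed a] a]) (simp add: Aut_mult_apply Aut_one_apply Aut_closed[OF a])
next
  fix \<alpha> \<beta> \<gamma> assume a: "\<alpha> \<in> carrier (sec Aut U)" "\<beta> \<in> carrier (sec Aut U)" "\<gamma> \<in> carrier (sec Aut U)"
  show "\<alpha> \<otimes>\<^bsub>sec Aut U\<^esub> \<beta> \<otimes>\<^bsub>sec Aut U\<^esub> \<gamma> = \<alpha> \<otimes>\<^bsub>sec Aut U\<^esub> (\<beta> \<otimes>\<^bsub>sec Aut U\<^esub> \<gamma>)"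
    by (rule Aut_eqI[of _ U]) (simp_all add: Aut_mult_apply Aut_closed[OF a(3)] Aut_mult_closed a)
qed (simp_all add: Aut_mult_closed Aut_one_closed)

lemma Aut_inv_apply:
  assumes a: "\<alpha> \<in> carrier (sec Aut U)" and V: "open V" "V \<subseteq> U" "s \<in> carrier (sec S V)"
  shows "\<alpha> V ((inv\<^bsub>sec Aut U\<^esub> \<alpha>) V s) = s" "(inv\<^bsub>sec Aut U\<^esub> \<alpha>) V (\<alpha> V s) = s"
proof -
  interpret group "sec Aut U" by (rule Aut_group)
  have "(\<alpha> \<otimes>\<^bsub>sec Aut U\<^esub> inv\<^bsub>sec Aut U\<^esub> \<alpha>) V s = s" "(inv\<^bsub>sec Aut U\<^esub> \<alpha> \<otimes>\<^bsub>sec Aut U\<^esub> \<alpha>) V s = s"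
    using a V by (simp_all add: Aut_one_apply)
  then show "\<alpha> V ((inv\<^bsub>sec Aut U\<^esub> \<alpha>) V s) = s" "(inv\<^bsub>sec Aut U\<^esub> \<alpha>) V (\<alpha> V s) = s"
    using V by (simp_all add: Aut_mult_apply)
qed

lemma Aut_presheaf: "group_presheaf Aut"
proof (rule group_presheaf.intro)
  show "group (sec Aut U)" for U by (rule Aut_group)
  show "res Aut U V \<in> hom (sec Aut U) (sec Aut V)" if "open U" "open V" "V \<subseteq> U" for U V
  proof (rule homI)
    fix \<alpha> \<beta> assume a: "\<alpha> \<in> carrier (sec Aut U)" "\<beta> \<in> carrier (sec Aut U)"
    show "res Aut U V (\<alpha> \<otimes>\<^bsub>sec Aut U\<^esub> \<beta>) = res Aut U V \<alpha> \<otimes>\<^bsub>sec Aut V\<^esub> res Aut U V \<beta>"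
    proof (rule Aut_eqI)
      fix W s assume W: "open W" "W \<subseteq> V" "s \<in> carrier (sec S W)"
      then have "W \<subseteq> U" using that by blast
      then show "res Aut U V (\<alpha> \<otimes>\<^bsub>sec Aut U\<^esub> \<beta>) W s = (res Aut U V \<alpha> \<otimes>\<^bsub>sec Aut V\<^esub> res Aut U V \<beta>) W s"
        using W a by (simp add: Aut_res_apply Aut_mult_apply Aut_closed)
    qed (use a that in \<open>simp_all add: Aut_res_closed Aut_mult_closed\<close>)
  qed (use that in \<open>simp add: Aut_res_closed\<close>)
  show "res Aut U U \<alpha> = \<alpha>" if "\<alpha> \<in> carrier (sec Aut U)" for U \<alpha>
    using that by (simp add: Aut_simps)
  show "res Aut V W (res Aut U V \<alpha>) = res Aut U W \<alpha>" if "W \<subseteq> V" for U V W \<alpha>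
    using that by (simp add: Aut_simps aut_norm_aut_norm)
qed

end

section \<open>The filtration of the automorphism group\<close>

context split_model
begin

lemma \<Lambda>_algebra: "algebra_presheaf \<Lambda>"
  unfolding algebra_presheaf_def using ring_sections by (auto simp: scale_closed res_closed)

sublocale aut: superalgebra_presheaf \<Lambda>
  by (rule superalgebra_presheaf.intro[OF \<Lambda>_algebra])

definition G :: "nat \<Rightarrow> 'a set \<Rightarrow> ('a set \<Rightarrow> ('i \<Rightarrow> 'a \<Rightarrow> nat set \<Rightarrow> complex) \<Rightarrow> ('i \<Rightarrow> 'a \<Rightarrow> nat set \<Rightarrow> complex)) set" where
  "G k U = {\<alpha> \<in> carrier (sec aut.Aut U).
          \<forall>V u. open V \<and> V \<subseteq> U \<and> u \<in> carrier (sec \<Lambda> V) \<longrightarrow> \<alpha> V u \<ominus>\<^bsub>sec \<Lambda> V\<^esub> u \<in> Fil k V}"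

lemma G_sheaf_eq: "G_sheaf M E k = \<lparr>sec = \<lambda>U. (sec aut.Aut U)\<lparr>carrier := G k U\<rparr>, res = res aut.Aut\<rparr>"
  by (simp add: G_sheaf_def Let_def G_def)

lemma Aut_Sec: "\<lbrakk>\<alpha> \<in> carrier (sec aut.Aut U); open V; V \<subseteq> U; u \<in> Sec V\<rbrakk> \<Longrightarrow> \<alpha> V u \<in> Sec V"
  using aut.Aut_closed by simp

lemma G_iff: "\<alpha> \<in> G k U \<longleftrightarrow> \<alpha> \<in> carrier (sec aut.Aut U) \<and>
    (\<forall>V u. open V \<and> V \<subseteq> U \<and> u \<in> Sec V \<longrightarrow> (\<lambda>i x K. \<alpha> V u i x K - u i x K) \<in> Fil k V)"
  unfolding G_def using minus_section Aut_Sec by auto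

lemma Aut_add: "\<lbrakk>\<alpha> \<in> carrier (sec aut.Aut U); open V; V \<subseteq> U; u \<in> Sec V; v \<in> Sec V\<rbrakk> \<Longrightarrow>
    \<alpha> V (\<lambda>i x K. u i x K + v i x K) = (\<lambda>i x K. \<alpha> V u i x K + \<alpha> V v i x K)"
  using super_homD(3)[OF super_isoD(1), of U \<Lambda> \<Lambda> \<alpha> V u v] by (simp add: aut.Aut_simps)

lemma Aut_mult: "\<lbrakk>\<alpha> \<in> carrier (sec aut.Aut U); open V; V \<subseteq> U; u \<in> Sec V; v \<in> Sec V\<rbrakk> \<Longrightarrow>
    \<alpha> V (\<lambda>i x. wedge (u i x) (v i x)) = (\<lambda>i x. wedge (\<alpha> V u i x) (\<alpha> V v i x))"
  using super_homD(2)[OF super_isoD(1), of U \<Lambda> \<Lambda> \<alpha> V u v] by (simp add: aut.Aut_simps)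

lemma Aut_natural: "\<lbrakk>\<alpha> \<in> carrier (sec aut.Aut U); open V; open W; W \<subseteq> V; V \<subseteq> U; u \<in> Sec V\<rbrakk> \<Longrightarrow>
    \<alpha> W (res \<Lambda> V W u) = res \<Lambda> V W (\<alpha> V u)"
  using super_iso_natural[of U \<Lambda> \<Lambda> \<alpha> V W u] by (simp add: aut.Aut_simps)

lemma Aut_odd: "\<lbrakk>\<alpha> \<in> carrier (sec aut.Aut U); open V; V \<subseteq> U; u \<in> odds (sec \<Lambda> V)\<rbrakk> \<Longrightarrow> \<alpha> V u \<in> odds (sec \<Lambda> V)"
  using super_homD(7)[OF super_isoD(1), of U \<Lambda> \<Lambda> \<alpha> V u] by (simp add: aut.Aut_simps)

lemma Aut_zero: "\<lbrakk>\<alpha> \<in> carrier (sec aut.Aut U); open V; V \<subseteq> U\<rbrakk> \<Longrightarrow> \<alpha> V (\<lambda>i x K. 0) = (\<lambda>i x K. 0)"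
  using Aut_add[of \<alpha> U V "\<lambda>i x K. 0" "\<lambda>i x K. 0"] by (simp add: zero_closed fun_eq_iff)

lemma Aut_sum:
  assumes a: "\<alpha> \<in> carrier (sec aut.Aut U)" "open V" "V \<subseteq> U" and t: "\<And>l. l < (n::nat) \<Longrightarrow> t l \<in> Sec V"
  shows "(\<lambda>i x K. \<Sum>l<n. t l i x K) \<in> Sec V \<and> \<alpha> V (\<lambda>i x K. \<Sum>l<n. t l i x K) = (\<lambda>i x K. \<Sum>l<n. \<alpha> V (t l) i x K)"
  using t
proof (induction n)
  case (Suc n)
  then have IH: "(\<lambda>i x K. \<Sum>l<n. t l i x K) \<in> Sec V" "\<alpha> V (\<lambda>i x K. \<Sum>l<n. t l i x K) = (\<lambda>i x K. \<Sum>l<n. \<alpha> V (t l) i x K)"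
    by auto
  show ?case using add_closed[OF IH(1) Suc.prems[of n]] Aut_add[OF a IH(1) Suc.prems[of n]] IH(2) by simp
qed (simp add: zero_closed Aut_zero[OF a])

text \<open>Put \<open>A = \<alpha> - 1\<close>. Expanding \<open>u = \<Sum> e\<^sub>l u\<^sub>l\<close> as in \<open>Fil_Suc_expand\<close>, each term satisfies
  \<open>A(e\<^sub>l u\<^sub>l) = A(e\<^sub>l) \<alpha>(u\<^sub>l) + e\<^sub>l A(u\<^sub>l)\<close>. Here \<open>A(e\<^sub>l)\<close> is odd of degree at least \<open>j\<close>, hence of
  degree at least \<open>d + 1\<close> with \<open>d = 2 \<lfloor>j/2\<rfloor>\<close>, and \<open>A(u\<^sub>l)\<close> is covered by induction.\<close>

lemma G_raises_degree:
  assumes a: "\<alpha> \<in> G j U" and d: "d = 2 * (j div 2)" and V: "open V" "V \<subseteq> U" and u: "u \<in> Fil p V"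
  shows "(\<lambda>i x K. \<alpha> V u i x K - u i x K) \<in> Fil (p + d) V"
  using V u
proof (induction p arbitrary: V u)
  case 0
  then show ?case using a d Fil_mono[of d j] by (auto simp: G_iff Fil_0)
next
  case (Suc p)
  have A: "\<alpha> \<in> carrier (sec aut.Aut U)" using a by (simp add: G_iff)
  have uS: "u \<in> Sec V" using Suc.prems by (simp add: Fil_iff)
  have diff: "(\<lambda>i x K. \<alpha> V u i x K - u i x K) \<in> Sec V"
    using diff_closed[OF Aut_Sec[OF A Suc.prems(1,2) uS] uS] .
  have "\<alpha> V u i x K - u i x K = 0" if K: "card K < Suc p + d" and x: "x \<in> V \<inter> patch E i" for i x K
  proof -
    let ?W = "V \<inter> patch E i"
    have W: "open ?W" "?W \<subseteq> U" "?W \<subseteq> V" "?W \<subseteq> patch E i" using Suc.prems patch_open by auto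
    let ?u = "res \<Lambda> V ?W u"
    have "?u \<in> Fil (Suc p) ?W" by (rule Fil_res[OF Suc.prems(1) W(1,3) Suc.prems(3)])
    from Fil_Suc_expand[OF W(1,4) this] obtain t where t: "\<And>l. l < r \<Longrightarrow> t l \<in> Fil p ?W"
      and e: "?u = (\<lambda>j x K. \<Sum>l<r. wedge (frame i ?W l j x) (t l j x) K)" by blast
    have F: "frame i ?W l \<in> Sec ?W" "t l \<in> Sec ?W" if "l < r" for l
      using that frame_Fil[OF W(1,4)] t by (auto simp: Fil_iff)
    have "\<alpha> ?W ?u = (\<lambda>j x K. \<Sum>l<r. wedge (\<alpha> ?W (frame i ?W l) j x) (\<alpha> ?W (t l) j x) K)"
      using Aut_sum[OF A W(1,2), of r "\<lambda>l j x. wedge (frame i ?W l j x) (t l j x)"] F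
      unfolding e by (simp add: mult_closed Aut_mult[OF A W(1,2)])
    then have "\<alpha> ?W ?u i x K - ?u i x K = (\<Sum>l<r. wedge (\<alpha> ?W (frame i ?W l) i x) (\<alpha> ?W (t l) i x) K - wedge (frame i ?W l i x) (t l i x) K)"
      unfolding e by (simp add: sum_subtractf)
    also have "\<dots> = 0"
    proof (rule sum.neutral, intro ballI)
      fix l assume "l \<in> {..<r}"
      then have l: "l < r" by simp
      let ?f = "frame i ?W l"
      have td: "(\<lambda>i x K. \<alpha> ?W (t l) i x K - t l i x K) \<in> Fil (p + d) ?W" using Suc.IH[OF W(1,2) t[OF l]] .
      have at: "\<alpha> ?W (t l) i x K = 0" if "card K < p" for K
      proof -
        have "\<alpha> ?W (t l) i x K - t l i x K = 0" using td that by (simp add: Fil_iff)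
        moreover have "t l i x K = 0" using t[OF l] that by (simp add: Fil_iff)
        ultimately show ?thesis by simp
      qed
      have fj: "(\<lambda>i x K. \<alpha> ?W ?f i x K - ?f i x K) \<in> Fil j ?W" using a W F[OF l] by (simp add: G_iff)
      have odd: "?f \<in> odds (sec \<Lambda> ?W)" "\<alpha> ?W ?f \<in> odds (sec \<Lambda> ?W)"
        using frame_odd[OF W(1,4) l] Aut_odd[OF A W(1,2)] by blast+
      \<comment> \<open>both sections are odd, so even degrees do not occur; an odd degree which is at most \<open>d\<close> is below \<open>j\<close>, where the difference vanishes as \<open>\<alpha>\<close> is in \<open>G j\<close>\<close>
      have fd: "\<alpha> ?W ?f i x K - ?f i x K = 0" if K: "card K < Suc d" for K
      proof (cases "even (card K)")
        case True
        then show ?thesis using odd by simp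
      next
        case False
        then have "card K < j" using K d by (cases "even j") (auto elim!: evenE oddE)
        then show ?thesis using fj by (simp add: Fil_iff)
      qed
      have "wedge (\<lambda>K. \<alpha> ?W ?f i x K - ?f i x K) (\<alpha> ?W (t l) i x) K = 0"
        by (rule wedge_vanish_below[of "Suc d" _ p]) (use fd at K in auto)
      moreover have "wedge (?f i x) (\<lambda>K. \<alpha> ?W (t l) i x K - t l i x K) K = 0"
        by (rule wedge_vanish_below[of 1 _ "p + d"])
           (use frame_Fil[OF W(1,4) l] td K in \<open>auto simp: Fil_iff\<close>)
      moreover have "wedge (\<alpha> ?W ?f i x) (\<alpha> ?W (t l) i x) K - wedge (?f i x) (t l i x) K =
          wedge (\<lambda>K. \<alpha> ?W ?f i x K - ?f i x K) (\<alpha> ?W (t l) i x) K + wedge (?f i x) (\<lambda>K. \<alpha> ?W (t l) i x K - t l i x K) K"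
        by (simp add: wedge_def algebra_simps sum.distrib sum_subtractf)
      ultimately show "wedge (\<alpha> ?W ?f i x) (\<alpha> ?W (t l) i x) K - wedge (?f i x) (t l i x) K = 0" by simp
    qed
    finally show ?thesis
      using Aut_natural[OF A Suc.prems(1) W(1,3) Suc.prems(2) uS] x by simp
  qed
  then show ?case using diff Sec_zero[OF diff] unfolding Fil_iff by blast
qed

lemma Fil_uminus: "s \<in> Fil a U \<Longrightarrow> (\<lambda>i x K. - s i x K) \<in> Fil a U"
  unfolding Fil_iff by (simp add: uminus_closed)

lemma G_subgroup: "subgroup (G k U) (sec aut.Aut U)"
proof (rule group.subgroupI[OF aut.Aut_group])
  show "G k U \<subseteq> carrier (sec aut.Aut U)" by (auto simp: G_iff)
  have "\<one>\<^bsub>sec aut.Aut U\<^esub> \<in> G k U"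
    unfolding G_iff using aut.Aut_one_closed by (auto simp: aut.Aut_one_apply Fil_iff zero_closed)
  then show "G k U \<noteq> {}" by blast
next
  fix \<alpha> assume a: "\<alpha> \<in> G k U"
  then have A: "\<alpha> \<in> carrier (sec aut.Aut U)" by (simp add: G_iff)
  have I: "inv\<^bsub>sec aut.Aut U\<^esub> \<alpha> \<in> carrier (sec aut.Aut U)" using group.inv_closed[OF aut.Aut_group A] .
  show "inv\<^bsub>sec aut.Aut U\<^esub> \<alpha> \<in> G k U"
    unfolding G_iff
  proof (intro conjI allI impI I)
    fix V u assume V: "open V \<and> V \<subseteq> U \<and> u \<in> Sec V"
    let ?v = "(inv\<^bsub>sec aut.Aut U\<^esub> \<alpha>) V u"
    have v: "?v \<in> Sec V" using Aut_Sec[OF I] V by blast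
    have "\<alpha> V ?v = u" using aut.Aut_inv_apply(1)[OF A] V by simp
    moreover have "(\<lambda>i x K. \<alpha> V ?v i x K - ?v i x K) \<in> Fil k V" using a V v by (simp add: G_iff)
    ultimately have "(\<lambda>i x K. u i x K - ?v i x K) \<in> Fil k V" by simp
    from Fil_uminus[OF this] show "(\<lambda>i x K. ?v i x K - u i x K) \<in> Fil k V" by simp
  qed
next
  fix \<alpha> \<beta> assume a: "\<alpha> \<in> G k U" and b: "\<beta> \<in> G k U"
  then have AB: "\<alpha> \<in> carrier (sec aut.Aut U)" "\<beta> \<in> carrier (sec aut.Aut U)" by (simp_all add: G_iff)
  show "\<alpha> \<otimes>\<^bsub>sec aut.Aut U\<^esub> \<beta> \<in> G k U"
    unfolding G_iff
  proof (intro conjI allI impI aut.Aut_mult_closed AB)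
    fix V u assume V: "open V \<and> V \<subseteq> U \<and> u \<in> Sec V"
    have "\<beta> V u \<in> Sec V" using Aut_Sec[OF AB(2)] V by blast
    then have "(\<lambda>i x K. \<alpha> V (\<beta> V u) i x K - \<beta> V u i x K) \<in> Fil k V" "(\<lambda>i x K. \<beta> V u i x K - u i x K) \<in> Fil k V"
      using a b V by (simp_all add: G_iff)
    from Fil_add[OF this] show "(\<lambda>i x K. (\<alpha> \<otimes>\<^bsub>sec aut.Aut U\<^esub> \<beta>) V u i x K - u i x K) \<in> Fil k V"
      using V by (simp add: aut.Aut_mult_apply)
  qed
qed

text \<open>Applied to \<open>v = (g f)\<^sup>-\<^sup>1 u\<close>, the commutator minus the identity is \<open>f g - g f = A B - B A\<close>
  with \<open>A = f - 1\<close> and \<open>B = g - 1\<close>. Since \<open>B v\<close> has degree at least \<open>k\<close>, the value \<open>A (B v)\<close> has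
  degree at least \<open>k + 2 \<lfloor>k/2\<rfloor> \<ge> k + 2\<close>.\<close>

lemma G_commute:
  assumes k: "2 \<le> k" and f: "f \<in> G k U" and g: "g \<in> G k U"
  shows "(f \<otimes>\<^bsub>sec aut.Aut U\<^esub> g) \<otimes>\<^bsub>sec aut.Aut U\<^esub> inv\<^bsub>sec aut.Aut U\<^esub> (g \<otimes>\<^bsub>sec aut.Aut U\<^esub> f) \<in> G (k + 2) U"
proof -
  interpret A: group "sec aut.Aut U" by (rule aut.Aut_group)
  have fg: "f \<in> carrier (sec aut.Aut U)" "g \<in> carrier (sec aut.Aut U)" using f g by (simp_all add: G_iff)
  define h where "h = inv\<^bsub>sec aut.Aut U\<^esub> (g \<otimes>\<^bsub>sec aut.Aut U\<^esub> f)"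
  have h: "h \<in> carrier (sec aut.Aut U)" using fg by (simp add: h_def)
  have step: "(\<lambda>i x K. a V (\<lambda>i x K. b V v i x K - v i x K) i x K - (b V v i x K - v i x K)) \<in> Fil (k + 2) V"
    if V: "open V" "V \<subseteq> U" and v: "v \<in> Sec V" and a: "a \<in> G k U" and b: "b \<in> G k U" for a b V v
  proof -
    have "(\<lambda>i x K. b V v i x K - v i x K) \<in> Fil k V" using b V v by (simp add: G_iff)
    from G_raises_degree[OF a refl V this] show ?thesis by (rule Fil_mono[rotated]) (use k in presburger)
  qed
  show ?thesis
    unfolding G_iff h_def[symmetric]
  proof (intro conjI allI impI aut.Aut_mult_closed fg h)
    fix V u assume V: "open V \<and> V \<subseteq> U \<and> u \<in> Sec V"
    define v where "v = h V u"
    have v: "v \<in> Sec V" using Aut_Sec[OF h] V by (simp add: v_def)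
    have fv: "f V v \<in> Sec V" and gv: "g V v \<in> Sec V" using Aut_Sec fg V v by blast+
    have dv: "(\<lambda>i x K. f V v i x K - v i x K) \<in> Sec V" "(\<lambda>i x K. g V v i x K - v i x K) \<in> Sec V"
      using diff_closed fv gv v by blast+
    have u: "u = g V (f V v)"
      using aut.Aut_inv_apply(1)[OF aut.Aut_mult_closed[OF fg(2,1)], of V u] V v
      by (simp add: v_def[symmetric] h_def[symmetric] aut.Aut_mult_apply)
    have 1: "f V (g V v) = (\<lambda>i x K. f V v i x K + f V (\<lambda>i x K. g V v i x K - v i x K) i x K)"
      using Aut_add[OF fg(1) _ _ v dv(2)] V by simp
    have 2: "g V (f V v) = (\<lambda>i x K. g V v i x K + g V (\<lambda>i x K. f V v i x K - v i x K) i x K)"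
      using Aut_add[OF fg(2) _ _ v dv(1)] V by simp
    have "(\<lambda>i x K. f V (g V v) i x K - g V (f V v) i x K) =
      (\<lambda>i x K. (f V (\<lambda>i x K. g V v i x K - v i x K) i x K - (g V v i x K - v i x K)) -
        (g V (\<lambda>i x K. f V v i x K - v i x K) i x K - (f V v i x K - v i x K)))"
      unfolding 1 2 by (simp add: fun_eq_iff)
    also have "\<dots> \<in> Fil (k + 2) V"
      using Fil_diff[OF step[OF _ _ v f g] step[OF _ _ v g f]] V by blast
    finally have "(\<lambda>i x K. f V (g V v) i x K - u i x K) \<in> Fil (k + 2) V" by (simp only: u[symmetric])
    moreover have "(f \<otimes>\<^bsub>sec aut.Aut U\<^esub> g \<otimes>\<^bsub>sec aut.Aut U\<^esub> h) V u = f V (g V v)"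
      using V v by (simp add: aut.Aut_mult_apply v_def)
    ultimately show "(\<lambda>i x K. (f \<otimes>\<^bsub>sec aut.Aut U\<^esub> g \<otimes>\<^bsub>sec aut.Aut U\<^esub> h) V u i x K - u i x K) \<in> Fil (k + 2) V"
      by (simp only:)
  qed
qed

lemma G_res: "V \<subseteq> U \<Longrightarrow> \<alpha> \<in> G k U \<Longrightarrow> res aut.Aut U V \<alpha> \<in> G k V"
  unfolding G_iff using aut.Aut_res_closed[of V U \<alpha>] by (auto simp: aut.Aut_res_apply)

lemma G_local:
  assumes U: "open U" and a: "\<alpha> \<in> carrier (sec aut.Aut U)"
    and loc: "\<And>x. x \<in> U \<Longrightarrow> \<exists>V. open V \<and> x \<in> V \<and> V \<subseteq> U \<and> res aut.Aut U V \<alpha> \<in> G k V"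
  shows "\<alpha> \<in> G k U"
  unfolding G_iff
proof (intro conjI allI impI a)
  fix V u assume V: "open V \<and> V \<subseteq> U \<and> u \<in> Sec V"
  then have d: "(\<lambda>i x K. \<alpha> V u i x K - u i x K) \<in> Sec V" using diff_closed Aut_Sec[OF a] by blast
  have "\<alpha> V u i x K - u i x K = 0" if K: "card K < k" for i x K
  proof (cases "x \<in> V")
    case True
    then obtain W where W: "open W" "x \<in> W" "W \<subseteq> U" "res aut.Aut U W \<alpha> \<in> G k W" using loc V by blast
    let ?B = "V \<inter> W"
    have B: "open ?B" "?B \<subseteq> V" "?B \<subseteq> W" using V W by auto
    have uB: "res \<Lambda> V ?B u \<in> Sec ?B" unfolding sheaf_simps by (rule res_closed[of V]) (use V B in auto)
    define w where "w = res \<Lambda> V ?B u"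
    have w: "w \<in> Sec ?B" using uB by (simp only: w_def)
    have "(\<lambda>i x K. res aut.Aut U W \<alpha> ?B w i x K - w i x K) \<in> Fil k ?B"
      using W(4) B w unfolding G_iff by simp
    moreover have "res aut.Aut U W \<alpha> ?B w = \<alpha> ?B w"
      by (rule aut.Aut_res_apply) (use B w in simp_all)
    ultimately have "(\<lambda>i x K. \<alpha> ?B (res \<Lambda> V ?B u) i x K - res \<Lambda> V ?B u i x K) \<in> Fil k ?B"
      by (simp only: w_def)
    then have "\<alpha> ?B (res \<Lambda> V ?B u) i x K - res \<Lambda> V ?B u i x K = 0" using K by (simp add: Fil_iff)
    moreover have "\<alpha> ?B (res \<Lambda> V ?B u) = res \<Lambda> V ?B (\<alpha> V u)"
      using V B W by (intro Aut_natural[OF a]) auto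
    ultimately show ?thesis using True W by simp
  next
    case False
    then show ?thesis using Sec_zero[OF d] by blast
  qed
  then show "(\<lambda>i x K. \<alpha> V u i x K - u i x K) \<in> Fil k V" using d by (simp add: Fil_iff)
qed

sublocale filt: group_filtration "aut.Aut" G
proof (intro group_filtration.intro group_filtration_axioms.intro aut.Aut_presheaf)
  show "G (Suc k) U \<subseteq> G k U" for k U using Fil_mono[of k "Suc k"] by (auto simp: G_iff)
  show "\<alpha> \<in> G k U" if "open U" "\<alpha> \<in> G 2 U"
    "\<And>x. x \<in> U \<Longrightarrow> \<exists>V. open V \<and> x \<in> V \<and> V \<subseteq> U \<and> res aut.Aut U V \<alpha> \<in> G k V" for U \<alpha> k
    by (rule G_local[OF that(1) _ that(3)]) (use that(2) in \<open>simp_all add: G_iff\<close>)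
qed (rule G_subgroup G_res G_commute; assumption)+

lemma Gr_eq: "filt.Gr k = G_sheaf M E k"
  by (simp add: filt.Gr_def G_sheaf_eq)

text \<open>There is nothing of degree above the rank.\<close>

lemma G_trivial:
  assumes "r < k" "\<alpha> \<in> G k U" "open V" "V \<subseteq> U" "u \<in> Sec V" shows "\<alpha> V u = u"
proof -
  have "(\<lambda>i x K. \<alpha> V u i x K - u i x K) \<in> Fil k V" using assms by (simp add: G_iff)
  from Fil_top[OF assms(1) this] show ?thesis by (auto simp: fun_eq_iff)
qed

end

section \<open>Consequences of vanishing obstruction cohomology\<close>

lemma zero_sheaf_abelian: "abelian_presheaf (zero_sheaf :: ('a::topological_space, 'g) gpresheaf)"
proof (intro abelian_presheaf.intro group_presheaf.intro abelian_presheaf_axioms.intro)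
  fix U :: "'a set"
  show c: "comm_group (sec (zero_sheaf :: ('a, 'g) gpresheaf) U)"
    by (rule comm_groupI) (auto simp: zero_sheaf_def)
  then show "group (sec (zero_sheaf :: ('a, 'g) gpresheaf) U)" by (rule comm_group.axioms(2))
qed (auto simp: zero_sheaf_def hom_def)

lemma int_ge_2: "\<not> (j::int) < 2 \<Longrightarrow> \<exists>k. j = int k \<and> 2 \<le> k"
  by (rule exI[of _ "nat j"]) auto

text \<open>An element of one summand extends by 1 to an element of the direct sum.\<close>

lemma trivial_sum_group:
  assumes triv: "carrier (sum_group I H) = {\<one>\<^bsub>sum_group I H\<^esub>}"
    and one: "\<And>i. i \<in> I \<Longrightarrow> \<one>\<^bsub>H i\<^esub> \<in> carrier (H i)" and j: "j \<in> I" "x \<in> carrier (H j)"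
  shows "x = \<one>\<^bsub>H j\<^esub>"
proof -
  define f where "f = (\<lambda>i\<in>I. if i = j then x else \<one>\<^bsub>H i\<^esub>)"
  have "{i \<in> I. f i \<noteq> \<one>\<^bsub>H i\<^esub>} \<subseteq> {j}" by (auto simp: f_def)
  then have "finite {i \<in> I. f i \<noteq> \<one>\<^bsub>H i\<^esub>}" using finite_subset by blast
  moreover have f: "f \<in> (\<Pi>\<^sub>E i\<in>I. carrier (H i))" using one j by (auto simp: f_def)
  ultimately have "f \<in> carrier (sum_group I H)"
    unfolding sum_group_def carrier_subgroup_generated by (intro generate.incl) auto
  then have "f = \<one>\<^bsub>product_group I H\<^esub>" using triv by (simp add: sum_group_def subgroup_generated_def)
  then have "f j = \<one>\<^bsub>H j\<^esub>" using j by (simp only: one_product_group restrict_apply')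
  then show ?thesis using j by (simp add: f_def)
qed

context split_model
begin

abbreviation obs where "obs \<equiv> obstruction_sheaf M E"

lemma obs_eq: "2 \<le> k \<Longrightarrow> obs (int k) = filt.Quo k (k + 1)"
  by (simp add: obstruction_sheaf_def Gr_eq nat_int_add)

lemma obs_eq_Suc: "2 \<le> k \<Longrightarrow> obs (int k + 1) = filt.Quo (k + 1) (k + 2)"
  using obs_eq[of "k + 1"] by (simp add: add.commute)

lemma obs_bd_eq: "2 \<le> k \<Longrightarrow> obstruction_bd M E n (int k) \<xi> = filt.bd n k \<xi>"
  using obs_eq[of k] obs_eq_Suc[of k] by (simp add: obstruction_bd_def Gr_eq)

lemma obs_abelian: "abelian_presheaf (obs j)"
proof (cases "j < 2")
  case True
  then show ?thesis using zero_sheaf_abelian by (simp add: obstruction_sheaf_def)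
next
  case False
  then obtain k where k: "j = int k" "2 \<le> k" using int_ge_2 by blast
  have "exact_sequence (filt.Quo (k + 1) (k + 2)) (filt.Quo k (k + 2)) (filt.Quo k (k + 1))
    (quot_map (filt.Gr k) (filt.Gr (k + 2))) (quot_map (filt.Gr k) (filt.Gr (k + 1)))"
    by (rule filt.Quo_exact[OF k(2)])
  then interpret ex: exact_sequence "filt.Quo (k + 1) (k + 2)" "filt.Quo k (k + 2)" "filt.Quo k (k + 1)"
    "quot_map (filt.Gr k) (filt.Gr (k + 2))" "quot_map (filt.Gr k) (filt.Gr (k + 1))" .
  show ?thesis unfolding k(1) obs_eq[OF k(2)] by (rule ex.aR.abelian_presheaf_axioms)
qed

definition Ker :: "int \<Rightarrow> _ set" where
  "Ker j = {\<xi> \<in> carrier (cohom 1 (obs j)). obstruction_bd M E 1 j \<xi> = \<one>\<^bsub>cohom 2 (obs (j + 1))\<^esub>}"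

definition Img :: "int \<Rightarrow> _ set" where
  "Img j = obstruction_bd M E 0 (j - 1) ` carrier (cohom 0 (obs (j - 1)))"

lemma bd_closed:
  assumes "\<nu> \<in> carrier (cohom 0 (obs j))"
  shows "obstruction_bd M E 0 j \<nu> \<in> carrier (cohom 1 (obs (j + 1)))"
proof (cases "j < 2")
  case True
  interpret group "cohom 1 (obs (j + 1))" by (rule abelian_presheaf.cohom1_group[OF obs_abelian])
  show ?thesis using True one_closed by (simp add: obstruction_bd_def)
next
  case False
  then obtain k where k: "j = int k" "2 \<le> k" using int_ge_2 by blast
  interpret ex: exact_sequence "filt.Quo (k + 1) (k + 2)" "filt.Quo k (k + 2)" "filt.Quo k (k + 1)"
    "quot_map (filt.Gr k) (filt.Gr (k + 2))" "quot_map (filt.Gr k) (filt.Gr (k + 1))"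
    by (rule filt.Quo_exact[OF k(2)])
  have "\<nu> \<in> carrier (cohom 0 (filt.Quo k (k + 1)))" using assms unfolding k(1) obs_eq[OF k(2)] .
  then obtain U a b where r: "ex.represents 0 U a b" "\<nu> = ex.aR.hclass 0 U (ex.p.mc 0 U a)"
    by (rule ex.represents_0_ex)
  have "filt.bd 0 k \<nu> = ex.aS.hclass (Suc 0) U b" unfolding r(2) by (rule ex.connecting_eq[OF _ r(1)]) simp
  moreover have "ex.aS.hclass (Suc 0) U b \<in> carrier (cohom (Suc 0) (filt.Quo (k + 1) (k + 2)))"
  proof (rule ex.aS.hclass_in_cohom)
    show "pcover U" "b \<in> ex.aS.Z (Suc 0) U" using r(1) unfolding ex.represents_def by blast+
  qed
  ultimately show ?thesis unfolding k(1) obs_bd_eq[OF k(2)] obs_eq_Suc[OF k(2)] by simp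
qed

lemma bd_one:
  assumes "n \<le> 1"
  shows "obstruction_bd M E n j \<one>\<^bsub>cohom n (obs j)\<^esub> = \<one>\<^bsub>cohom (Suc n) (obs (j + 1))\<^esub>"
proof (cases "j < 2")
  case False
  then obtain k where k: "j = int k" "2 \<le> k" using int_ge_2 by blast
  interpret ex: exact_sequence "filt.Quo (k + 1) (k + 2)" "filt.Quo k (k + 2)" "filt.Quo k (k + 1)"
    "quot_map (filt.Gr k) (filt.Gr (k + 2))" "quot_map (filt.Gr k) (filt.Gr (k + 1))"
    by (rule filt.Quo_exact[OF k(2)])
  show ?thesis
    using ex.connecting_one[OF assms] unfolding k(1) obs_bd_eq[OF k(2)] obs_eq_Suc[OF k(2)] obs_eq[OF k(2)] .
qed (simp add: obstruction_bd_def)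

lemma one_in_cohom: "\<one>\<^bsub>cohom n (obs j)\<^esub> \<in> carrier (cohom n (obs j))"
proof -
  interpret A: abelian_presheaf "obs j" by (rule obs_abelian)
  have U: "pcover (\<lambda>x::'a. UNIV)" by (simp add: pcover_def)
  show ?thesis unfolding A.cohom_one[OF U] by (rule A.hclass_in_cohom[OF U A.one_Z[OF U]])
qed

text \<open>The coset of \<open>\<xi>\<close> is an element of the \<open>j\<close>-th summand of the first obstruction cohomology and
  hence equal to the trivial coset.\<close>

lemma Ker_subset_Img:
  assumes "carrier (first_obstruction_cohomology M E) = {\<one>\<^bsub>first_obstruction_cohomology M E\<^esub>}"
    and \<xi>: "\<xi> \<in> Ker j"
  shows "\<xi> \<in> Img j"
proof -
  let ?H = "\<lambda>j. (cohom 1 (obs j))\<lparr>carrier := Ker j\<rparr> Mod Img j"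
  have eq: "first_obstruction_cohomology M E = sum_group UNIV ?H"
    unfolding first_obstruction_cohomology_def Ker_def Img_def ..
  have carr: "carrier (?H j) = (\<lambda>\<xi>. Img j #>\<^bsub>cohom 1 (obs j)\<^esub> \<xi>) ` Ker j" for j
    by (auto simp: FactGroup_def RCOSETS_def r_coset_def)
  have one: "\<one>\<^bsub>?H j\<^esub> = Img j" for j by (simp add: FactGroup_def)
  have grp: "group (cohom 1 (obs j))" for j by (rule abelian_presheaf.cohom1_group[OF obs_abelian])
  have sub: "Img j \<subseteq> carrier (cohom 1 (obs j))" for j
    using bd_closed[of _ "j - 1"] by (auto simp: Img_def)
  have oneK: "\<one>\<^bsub>cohom 1 (obs j)\<^esub> \<in> Ker j" for j
    using bd_one[of 1 j] one_in_cohom[of 1 j] by (simp add: Ker_def numeral_2_eq_2)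
  have "Img j #>\<^bsub>cohom 1 (obs j)\<^esub> \<one>\<^bsub>cohom 1 (obs j)\<^esub> = Img j" for j
    using group.coset_mult_one[OF grp sub] .
  then have "\<one>\<^bsub>?H j\<^esub> \<in> carrier (?H j)" for j unfolding one carr using oneK[of j] by (metis image_eqI)
  moreover have "carrier (sum_group UNIV ?H) = {\<one>\<^bsub>sum_group UNIV ?H\<^esub>}" using assms(1) unfolding eq .
  moreover have "Img j #>\<^bsub>cohom 1 (obs j)\<^esub> \<xi> \<in> carrier (?H j)" unfolding carr using \<xi> by blast
  ultimately have "Img j #>\<^bsub>cohom 1 (obs j)\<^esub> \<xi> = \<one>\<^bsub>?H j\<^esub>"
    by (intro trivial_sum_group[of UNIV ?H j]) auto
  then have e: "Img j #>\<^bsub>cohom 1 (obs j)\<^esub> \<xi> = Img j" unfolding one .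
  have "\<one>\<^bsub>cohom 1 (obs j)\<^esub> \<in> Img j"
    unfolding Img_def
    by (rule image_eqI[of _ _ "\<one>\<^bsub>cohom 0 (obs (j - 1))\<^esub>"])
       (use bd_one[of 0 "j - 1"] one_in_cohom[of 0 "j - 1"] in simp_all)
  then have "\<one>\<^bsub>cohom 1 (obs j)\<^esub> \<otimes>\<^bsub>cohom 1 (obs j)\<^esub> \<xi> \<in> Img j #>\<^bsub>cohom 1 (obs j)\<^esub> \<xi>"
    by (auto simp: r_coset_def)
  moreover have "\<xi> \<in> carrier (cohom 1 (obs j))" using \<xi> by (simp add: Ker_def)
  ultimately show ?thesis unfolding e using group.is_monoid[OF grp, of j] by (simp add: monoid.l_one)
qed

text \<open>For the filtration \<open>G\<close> the vanishing of cohomology is the assumption of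
  \<open>cocycle_trivialisation\<close>. If \<open>k = 2\<close>, the obstruction sheaf in degree \<open>k - 1\<close> is zero, so the
  classes in the image of the differential are trivial.\<close>

theorem cocycle_splits:
  assumes H: "carrier (first_obstruction_cohomology M E) = {\<one>\<^bsub>first_obstruction_cohomology M E\<^esub>}"
    and g: "filt.cocycle 2 U g" and k: "2 \<le> k"
  shows "\<exists>V h. pcover V \<and> (\<forall>x. V x \<subseteq> U x) \<and> (\<forall>x. h x \<in> G 2 (V x)) \<and> filt.cocycle k V (filt.twist U V g h)"
proof (rule filt.cocycle_trivialisation[OF _ g k])
  fix k \<xi> assume k: "2 \<le> k" and \<xi>: "\<xi> \<in> carrier (cohom 1 (filt.Quo k (k + 1)))"
    and bd: "filt.bd 1 k \<xi> = \<one>\<^bsub>cohom 2 (filt.Quo (k + 1) (k + 2))\<^esub>"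
  have "\<xi> \<in> Ker (int k)"
    unfolding Ker_def obs_bd_eq[OF k] obs_eq_Suc[OF k] obs_eq[OF k] using \<xi> bd by blast
  then have Img: "\<xi> \<in> Img (int k)" by (rule Ker_subset_Img[OF H])
  show "if k = 2 then \<xi> = \<one>\<^bsub>cohom 1 (filt.Quo k (k + 1))\<^esub> else \<xi> \<in> filt.bd 0 (k - 1) ` carrier (cohom 0 (filt.Quo (k - 1) k))"
  proof (cases "k = 2")
    case True
    then have "\<xi> = \<one>\<^bsub>cohom 1 (obs (int k))\<^esub>" using Img by (auto simp: Img_def obstruction_bd_def)
    then show ?thesis using True unfolding obs_eq[OF k] by simp
  next
    case False
    then have k': "2 \<le> k - 1" "int k - 1 = int (k - 1)" "k - 1 + 1 = k" using k by auto
    have "obs (int k - 1) = filt.Quo (k - 1) k" unfolding k'(2) obs_eq[OF k'(1)] k'(3) ..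
    then have "\<xi> \<in> filt.bd 0 (k - 1) ` carrier (cohom 0 (filt.Quo (k - 1) k))"
      using Img unfolding Img_def unfolding k'(2) obs_bd_eq[OF k'(1)] by simp
    then show ?thesis using False by (simp only: if_False)
  qed
qed

end

section \<open>Supermanifolds and local trivialisations\<close>

lemma superalgebraD:
  assumes "superalgebra A"
  shows "ring A" "x \<in> carrier A \<Longrightarrow> c \<odot>\<^bsub>A\<^esub> x \<in> carrier A"
    "x \<in> evens A \<Longrightarrow> x \<in> carrier A" "x \<in> odds A \<Longrightarrow> x \<in> carrier A" "\<zero>\<^bsub>A\<^esub> \<in> odds A"
proof -
  have ev: "submodule (evens A) complex_ring A" and od: "submodule (odds A) complex_ring A"
    and mo: "Module.module complex_ring A"
    using assms by (simp_all add: superalgebra_def)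
  show "ring A" using assms by (simp add: superalgebra_def)
  show "x \<in> carrier A \<Longrightarrow> c \<odot>\<^bsub>A\<^esub> x \<in> carrier A"
    using module.smult_closed[OF mo, of c x] by (simp add: complex_ring_def)
  have "subgroup (evens A) (add_monoid A)" "subgroup (odds A) (add_monoid A)"
    using ev od by (simp_all add: submodule_def)
  from this[THEN subgroup.subset] this(2)[THEN subgroup.one_closed]
  show "x \<in> evens A \<Longrightarrow> x \<in> carrier A" "x \<in> odds A \<Longrightarrow> x \<in> carrier A" "\<zero>\<^bsub>A\<^esub> \<in> odds A"
    by auto
qed

lemma superalgebra_decomp:
  assumes "superalgebra A" "x \<in> carrier A"
  obtains a b where "a \<in> evens A" "b \<in> odds A" "x = a \<oplus>\<^bsub>A\<^esub> b"
proof -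
  have "\<forall>x\<in>carrier A. \<exists>!p. p \<in> evens A \<times> odds A \<and> x = fst p \<oplus>\<^bsub>A\<^esub> snd p"
    using assms(1) unfolding superalgebra_def by (elim conjE)
  from bspec[OF this assms(2)] obtain p where p: "p \<in> evens A \<times> odds A" "x = fst p \<oplus>\<^bsub>A\<^esub> snd p"
    by (elim ex1E conjE)
  show ?thesis by (rule that[of "fst p" "snd p"]) (use p in auto)
qed

context manifold
begin

abbreviation \<O> where "\<O> \<equiv> hol_sheaf M"

lemma O_simps [simp]:
  "carrier (sec \<O> U) = {f. (\<forall>x. x \<notin> U \<longrightarrow> f x = 0) \<and> hol U f}"
  "f \<otimes>\<^bsub>sec \<O> U\<^esub> g = (\<lambda>x. f x * g x)" "f \<oplus>\<^bsub>sec \<O> U\<^esub> g = (\<lambda>x. f x + g x)"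
  "\<one>\<^bsub>sec \<O> U\<^esub> = (\<lambda>x. if x \<in> U then 1 else 0)" "\<zero>\<^bsub>sec \<O> U\<^esub> = (\<lambda>x. 0)"
  "c \<odot>\<^bsub>sec \<O> U\<^esub> f = (\<lambda>x. c * f x)"
  "evens (sec \<O> U) = {f. (\<forall>x. x \<notin> U \<longrightarrow> f x = 0) \<and> hol U f}" "odds (sec \<O> U) = {\<lambda>x. 0}"
  "res \<O> U V f = (\<lambda>x. if x \<in> V then f x else 0)"
  by (simp_all add: hol_sheaf_def)

lemma nonzero_unit_at:
  assumes U: "open U" and f: "f \<in> carrier (sec \<O> U)" and x: "x \<in> U" "f x \<noteq> 0"
  shows "unit_at \<O> x U f"
proof -
  have fh: "hol U f" using f by simp
  obtain V where V: "open V" "x \<in> V" "V \<subseteq> U" and nz: "\<And>y. y \<in> V \<Longrightarrow> f y \<noteq> 0"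
    using hol_nonzero_nhd[OF U fh x] by metis
  have "hol V (\<lambda>x. inverse (f x))" by (rule hol_inverse[OF holomorphic_fun_mono[OF fh V(3)]]) (rule nz)
  then have "(\<lambda>x. if x \<in> V then inverse (f x) else 0) \<in> carrier (sec \<O> V)"
    using hol_restrict[OF V(1)] by simp
  moreover have "res \<O> U V f \<in> carrier (sec \<O> V)" using hol_restrict[OF V(1) fh V(3)] by simp
  ultimately have "res \<O> U V f \<in> Units (sec \<O> V)"
    unfolding Units_def mem_Collect_eq
    by (intro conjI bexI[of _ "\<lambda>x. if x \<in> V then inverse (f x) else 0"]) (simp_all add: fun_eq_iff nz)
  then show ?thesis unfolding unit_at_def using V by blast
qed

end

locale supermanifold = split_model M E for M :: "'a::{t2_space,second_countable_topology} cmanifold" and E :: "('a, 'i) vbundle" +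
  fixes S :: "('a, 's) spresheaf" and \<rho> :: "'a set \<Rightarrow> 's \<Rightarrow> 'a \<Rightarrow> complex"
    and q :: "'a set \<Rightarrow> 's \<Rightarrow> 'i \<Rightarrow> 'a \<Rightarrow> nat \<Rightarrow> complex"
  assumes space: "superspace S"
    and local_iso: "\<exists>U \<theta>. open U \<and> x \<in> U \<and> super_iso_on U S (ext_sheaf M E) \<theta>"
    and rho_morphism: "superspace_morphism (hol_sheaf M) S (id, \<rho>)"
    and rho_ker: "open U \<Longrightarrow> {s \<in> carrier (sec S U). \<rho> U s = \<zero>\<^bsub>sec (hol_sheaf M) U\<^esub>} = odd_ideal S U"
    and q_closed: "open U \<Longrightarrow> s \<in> odd_ideal S U \<Longrightarrow> q U s \<in> bdl_sections M E U"
    and q_add: "\<lbrakk>open U; s \<in> odd_ideal S U; t \<in> odd_ideal S U\<rbrakk> \<Longrightarrow> q U (s \<oplus>\<^bsub>sec S U\<^esub> t) i x k = q U s i x k + q U t i x k"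
    and q_mult: "\<lbrakk>open U; a \<in> carrier (sec S U); s \<in> odd_ideal S U\<rbrakk> \<Longrightarrow> q U (a \<otimes>\<^bsub>sec S U\<^esub> s) i x k = \<rho> U a x * q U s i x k"
    and q_ker: "open U \<Longrightarrow> {s \<in> odd_ideal S U. \<forall>i x k. q U s i x k = 0} = odd_ideal_sq S U"
    and q_surj: "\<lbrakk>open U; e \<in> bdl_sections M E U; x \<in> U\<rbrakk> \<Longrightarrow> \<exists>W s. open W \<and> x \<in> W \<and> W \<subseteq> U \<and> s \<in> odd_ideal S W \<and>
        q W s = (\<lambda>i y k. if y \<in> W then e i y k else 0)"
    and q_res: "\<lbrakk>open U; open V; V \<subseteq> U; s \<in> odd_ideal S U\<rbrakk> \<Longrightarrow>
        q V (res S U V s) = (\<lambda>i y k. if y \<in> V then q U s i y k else 0)"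
begin

lemma S_sheaf: "super_sheaf S"
  using space by (simp add: superspace_def)

lemma S_superalgebra: "open U \<Longrightarrow> superalgebra (sec S U)"
  using S_sheaf by (simp add: super_sheaf_def)

lemma S_res_hom: "\<lbrakk>open U; open V; V \<subseteq> U\<rbrakk> \<Longrightarrow> res S U V \<in> super_hom (sec S U) (sec S V)"
  using S_sheaf by (simp add: super_sheaf_def)

lemma S_res_res: "\<lbrakk>open U; open V; open W; W \<subseteq> V; V \<subseteq> U; s \<in> carrier (sec S U)\<rbrakk> \<Longrightarrow> res S V W (res S U V s) = res S U W s"
  using S_sheaf by (simp add: super_sheaf_def)

lemma S_algebra: "algebra_presheaf S"
  unfolding algebra_presheaf_def
proof (intro conjI allI impI)
  fix V :: "'a set" assume V: "open V"
  note s = superalgebraD[OF S_superalgebra[OF V]]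
  show "ring (sec S V)" by (rule s(1))
  show "\<forall>x\<in>carrier (sec S V). c \<odot>\<^bsub>sec S V\<^esub> x \<in> carrier (sec S V)" for c using s(2) by simp
  show "evens (sec S V) \<subseteq> carrier (sec S V)" "odds (sec S V) \<subseteq> carrier (sec S V)" using s(3,4) by auto
next
  fix V W :: "'a set" assume "open V \<and> open W \<and> W \<subseteq> V"
  then show "res S V W \<in> carrier (sec S V) \<rightarrow> carrier (sec S W)"
    using super_homD(1)[OF S_res_hom[of V W]] by simp
qed

lemmas S_ring = algebra_presheafD(1)[OF S_algebra]

lemma rho_hom: "open V \<Longrightarrow> \<rho> V \<in> super_hom (sec S V) (sec \<O> V)"
  and rho_res: "\<lbrakk>open V; open W; W \<subseteq> V; t \<in> carrier (sec S V)\<rbrakk> \<Longrightarrow> \<rho> W (res S V W t) = res \<O> V W (\<rho> V t)"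
  and rho_local: "\<lbrakk>open V; x \<in> V; t \<in> carrier (sec S V); unit_at \<O> x V (\<rho> V t)\<rbrakk> \<Longrightarrow> unit_at S x V t"
  using rho_morphism unfolding superspace_morphism_def by (simp_all add: vimage_id)

lemma rho_closed: "open V \<Longrightarrow> s \<in> carrier (sec S V) \<Longrightarrow> hol V (\<rho> V s)"
  and rho_zero: "open V \<Longrightarrow> s \<in> carrier (sec S V) \<Longrightarrow> x \<notin> V \<Longrightarrow> \<rho> V s x = 0"
  using super_homD(1)[OF rho_hom, of V s] by simp_all

text \<open>Let \<open>c\<close> be the degree 0 part of \<open>\<theta> s\<close> at \<open>x\<close>. If \<open>\<rho> s\<close> had another value at \<open>x\<close>, then
  \<open>\<rho> (s - c)\<close> would be invertible near \<open>x\<close>, and so would \<open>s - c\<close> be, since the stalk maps of \<open>\<rho>\<close>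
  are local. But \<open>\<theta> (s - c)\<close> has no degree 0 part at \<open>x\<close>.\<close>

lemma degree_0_value:
  assumes \<theta>: "super_iso_on U S \<Lambda> \<theta>" and V: "open V" "V \<subseteq> U" and s: "s \<in> carrier (sec S V)" and x: "x \<in> V \<inter> patch E i"
  shows "\<theta> V s i x {} = \<rho> V s x"
proof (rule ccontr)
  define c where "c = \<theta> V s i x {}"
  assume ne: "\<theta> V s i x {} \<noteq> \<rho> V s x"
  interpret ring "sec S V" by (rule S_ring[OF V(1)])
  note th = super_homD[OF super_isoD(1)[OF \<theta> V]] and rh = super_homD[OF rho_hom[OF V(1)]]
  define t where "t = s \<oplus>\<^bsub>sec S V\<^esub> ((- c) \<odot>\<^bsub>sec S V\<^esub> \<one>\<^bsub>sec S V\<^esub>)"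
  have m: "(- c) \<odot>\<^bsub>sec S V\<^esub> \<one>\<^bsub>sec S V\<^esub> \<in> carrier (sec S V)" by (rule algebra_presheafD(2)[OF S_algebra V(1)]) simp
  have t: "t \<in> carrier (sec S V)" using m s by (simp add: t_def)
  have "\<theta> V t i x {} = 0" using s m x by (simp add: t_def th c_def ext_one_def)
  have "\<rho> V t x \<noteq> 0" using s m x ne by (simp add: t_def rh c_def)
  then have "unit_at \<O> x V (\<rho> V t)"
    using x by (intro nonzero_unit_at[OF V(1) super_homD(1)[OF rho_hom[OF V(1)] t]]) auto
  then have "unit_at S x V t" using rho_local[OF V(1) _ t] x by blast
  then obtain W where W: "open W" "x \<in> W" "W \<subseteq> V" "res S V W t \<in> Units (sec S W)" by (auto simp: unit_at_def)
  then obtain u where u: "u \<in> carrier (sec S W)" "res S V W t \<otimes>\<^bsub>sec S W\<^esub> u = \<one>\<^bsub>sec S W\<^esub>" "res S V W t \<in> carrier (sec S W)"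
    by (auto simp: Units_def)
  have WU: "W \<subseteq> U" using W V by blast
  note tw = super_homD[OF super_isoD(1)[OF \<theta> W(1) WU]]
  have "\<theta> W (res S V W t) \<otimes>\<^bsub>sec \<Lambda> W\<^esub> \<theta> W u = \<one>\<^bsub>sec \<Lambda> W\<^esub>"
    unfolding tw(2)[OF u(3,1), symmetric] u(2) tw(4) ..
  from fun_cong[OF fun_cong[OF this, of i], of x] have "wedge (\<theta> W (res S V W t) i x) (\<theta> W u i x) = ext_one"
    using x W(2) by simp
  then have "\<theta> W (res S V W t) i x {} * \<theta> W u i x {} = 1"
    using wedge_degree_0[of "\<theta> W (res S V W t) i x" "\<theta> W u i x"] by (simp add: ext_one_def)
  moreover have "\<theta> W (res S V W t) i x {} = \<theta> V t i x {}"
    using super_iso_natural[OF \<theta> V(1) W(1,3) V(2) t] W(2) by simp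
  ultimately show False using \<open>\<theta> V t i x {} = 0\<close> by simp
qed

lemma Fil_1_iff: "s \<in> Fil 1 U \<longleftrightarrow> s \<in> Sec U \<and> (\<forall>i x. x \<in> U \<inter> patch E i \<longrightarrow> s i x {} = 0)"
proof
  assume s: "s \<in> Sec U \<and> (\<forall>i x. x \<in> U \<inter> patch E i \<longrightarrow> s i x {} = 0)"
  have "s i x K = 0" if "card K < 1" for i x K
  proof (cases "x \<in> U \<inter> patch E i \<and> K \<subseteq> {..<r}")
    case True
    then have "finite K" using finite_subset by auto
    then have "K = {}" using that by simp
    then show ?thesis using s True by blast
  next
    case False
    then show ?thesis using s Sec_zero[of s U] ext_zero[OF Sec_alg, of s U] by blast
  qed
  then show "s \<in> Fil 1 U" using s by (simp only: Fil_iff) blast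
qed (simp add: Fil_iff)

text \<open>The odd ideal is the kernel of \<open>\<rho>\<close>, and \<open>\<rho>\<close> is the degree 0 part.\<close>

lemma odd_ideal_iff:
  assumes \<theta>: "super_iso_on U S \<Lambda> \<theta>" and V: "open V" "V \<subseteq> U" and s: "s \<in> carrier (sec S V)"
  shows "s \<in> odd_ideal S V \<longleftrightarrow> \<theta> V s \<in> Fil 1 V"
proof -
  have "s \<in> odd_ideal S V \<longleftrightarrow> \<rho> V s = (\<lambda>x. 0)" using rho_ker[OF V(1)] s by auto
  also have "\<dots> \<longleftrightarrow> (\<forall>x\<in>V. \<rho> V s x = 0)" using rho_zero[OF V(1) s] by (auto simp: fun_eq_iff)
  also have "\<dots> \<longleftrightarrow> (\<forall>i x. x \<in> V \<inter> patch E i \<longrightarrow> \<theta> V s i x {} = 0)"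
    using degree_0_value[OF \<theta> V s] patch_cover by (metis IntD1 IntI)
  also have "\<dots> \<longleftrightarrow> \<theta> V s \<in> Fil 1 V"
    unfolding Fil_1_iff using super_iso_closed[OF \<theta> V s] by simp
  finally show ?thesis .
qed

lemma odd_ideal_carrier: "s \<in> odd_ideal S V \<Longrightarrow> s \<in> carrier (sec S V)"
  by (simp add: odd_ideal_def)

lemma Fil_local:
  assumes V: "open V" and s: "s \<in> Sec V"
    and loc: "\<And>x. x \<in> V \<Longrightarrow> \<exists>W. open W \<and> x \<in> W \<and> W \<subseteq> V \<and> res \<Lambda> V W s \<in> Fil k W"
  shows "s \<in> Fil k V"
  unfolding Fil_iff
proof (intro conjI allI impI s)
  fix i x and K :: "nat set" assume K: "card K < k"
  show "s i x K = 0"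
  proof (cases "x \<in> V")
    case True
    from loc[OF this] obtain W where "x \<in> W" "res \<Lambda> V W s \<in> Fil k W" by blast
    then have "res \<Lambda> V W s i x K = 0" using K by (simp only: Fil_iff)
    then show ?thesis using \<open>x \<in> W\<close> by simp
  qed (use Sec_zero[OF s] in blast)
qed

text \<open>The filtration of the exterior algebra is a filtration by ideals, which bounds the ideals
  generated by odd sections and by their products from above.\<close>

lemma preimage_Fil_ideal:
  assumes \<theta>: "super_iso_on U S \<Lambda> \<theta>" and V: "open V" "V \<subseteq> U"
  shows "ideal {s \<in> carrier (sec S V). \<theta> V s \<in> Fil k V} (sec S V)"
proof -
  interpret ring "sec S V" by (rule S_ring[OF V(1)])
  note th = super_homD[OF super_isoD(1)[OF \<theta> V]]
  have z: "\<theta> V \<zero>\<^bsub>sec S V\<^esub> = (\<lambda>i x K. 0)"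
    using th(3)[of "\<zero>\<^bsub>sec S V\<^esub>" "\<zero>\<^bsub>sec S V\<^esub>"] by (simp add: fun_eq_iff)
  have neg: "\<theta> V (\<ominus>\<^bsub>sec S V\<^esub> a) = (\<lambda>i x K. - \<theta> V a i x K)" if "a \<in> carrier (sec S V)" for a
  proof -
    have "\<theta> V (\<ominus>\<^bsub>sec S V\<^esub> a \<oplus>\<^bsub>sec S V\<^esub> a) = (\<lambda>i x K. 0)" using that z by (simp add: l_neg)
    then have "\<theta> V (\<ominus>\<^bsub>sec S V\<^esub> a) i x K + \<theta> V a i x K = 0" for i x K
      using that th(3)[of "\<ominus>\<^bsub>sec S V\<^esub> a" a] by (simp add: fun_eq_iff)
    then show ?thesis by (simp add: fun_eq_iff eq_neg_iff_add_eq_0)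
  qed
  have mult: "\<theta> V (a \<otimes>\<^bsub>sec S V\<^esub> b) \<in> Fil k V"
    if "a \<in> carrier (sec S V)" "b \<in> carrier (sec S V)" "\<theta> V a \<in> Fil k V \<or> \<theta> V b \<in> Fil k V" for a b
    using that Fil_mult[of "\<theta> V a" k V "\<theta> V b" 0] Fil_mult[of "\<theta> V a" 0 V "\<theta> V b" k] th(1)
    by (auto simp: th(2) Fil_0)
  show ?thesis
  proof (rule idealI[OF ring_axioms])
    show "subgroup {s \<in> carrier (sec S V). \<theta> V s \<in> Fil k V} (add_monoid (sec S V))"
    proof (rule group.subgroupI[OF add.group_axioms])
      show "{s \<in> carrier (sec S V). \<theta> V s \<in> Fil k V} \<noteq> {}"
        using z zero_closed by (auto simp: Fil_iff split_model.zero_closed[OF split_model_axioms] intro!: exI[of _ "\<zero>\<^bsub>sec S V\<^esub>"])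
    qed (auto simp: neg a_inv_def[symmetric] Fil_uminus th(3) Fil_add)
  qed (auto intro: mult)
qed

text \<open>Products of two sections of the odd ideal have degree at least 2. Conversely a section of
  degree at least 2 is, over a patch, a combination \<open>\<Sum> e\<^sub>l t\<^sub>l\<close> with \<open>t\<^sub>l\<close> of degree at least
  1 by \<open>Fil_Suc_expand\<close>.\<close>

lemma odd_ideal_sq_iff:
  assumes \<theta>: "super_iso_on U S \<Lambda> \<theta>" and V: "open V" "V \<subseteq> U" and s: "s \<in> carrier (sec S V)"
  shows "s \<in> odd_ideal_sq S V \<longleftrightarrow> \<theta> V s \<in> Fil 2 V"
proof
  assume "s \<in> odd_ideal_sq S V"
  then have loc: "\<And>x. x \<in> V \<Longrightarrow> \<exists>W. open W \<and> x \<in> W \<and> W \<subseteq> V \<and>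
      res S V W s \<in> genideal (sec S W) {a \<otimes>\<^bsub>sec S W\<^esub> b | a b. a \<in> odd_ideal S W \<and> b \<in> odd_ideal S W}"
    by (simp add: odd_ideal_sq_def)
  show "\<theta> V s \<in> Fil 2 V"
  proof (rule Fil_local[OF V(1)])
    show "\<theta> V s \<in> Sec V" using super_iso_closed[OF \<theta> V s] by simp
    fix x assume "x \<in> V"
    from loc[OF this] obtain W where W: "open W" "x \<in> W" "W \<subseteq> V"
      "res S V W s \<in> genideal (sec S W) {a \<otimes>\<^bsub>sec S W\<^esub> b | a b. a \<in> odd_ideal S W \<and> b \<in> odd_ideal S W}" by blast
    have WU: "W \<subseteq> U" using W V by blast
    interpret W: ring "sec S W" by (rule S_ring[OF W(1)])
    note tw = super_homD[OF super_isoD(1)[OF \<theta> W(1) WU]]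
    have "{a \<otimes>\<^bsub>sec S W\<^esub> b | a b. a \<in> odd_ideal S W \<and> b \<in> odd_ideal S W} \<subseteq> {s \<in> carrier (sec S W). \<theta> W s \<in> Fil 2 W}"
    proof clarify
      fix a b assume a: "a \<in> odd_ideal S W" and b: "b \<in> odd_ideal S W"
      note c = odd_ideal_carrier[OF a] odd_ideal_carrier[OF b]
      have "\<theta> W a \<in> Fil 1 W" "\<theta> W b \<in> Fil 1 W"
        using a b odd_ideal_iff[OF \<theta> W(1) WU] c by blast+
      from Fil_mult[OF this] have "\<theta> W (a \<otimes>\<^bsub>sec S W\<^esub> b) \<in> Fil 2 W" using c by (simp add: tw(2) numeral_2_eq_2)
      then show "a \<otimes>\<^bsub>sec S W\<^esub> b \<in> carrier (sec S W) \<and> \<theta> W (a \<otimes>\<^bsub>sec S W\<^esub> b) \<in> Fil 2 W" using c by simp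
    qed
    from W.genideal_minimal[OF preimage_Fil_ideal[OF \<theta> W(1) WU] this] W(4)
    have "\<theta> W (res S V W s) \<in> Fil 2 W" by blast
    then have "res \<Lambda> V W (\<theta> V s) \<in> Fil 2 W"
      using super_iso_natural[OF \<theta> V(1) W(1,3) V(2) s] by simp
    then show "\<exists>W. open W \<and> x \<in> W \<and> W \<subseteq> V \<and> res \<Lambda> V W (\<theta> V s) \<in> Fil 2 W" using W by blast
  qed
next
  assume F: "\<theta> V s \<in> Fil 2 V"
  show "s \<in> odd_ideal_sq S V"
    unfolding odd_ideal_sq_def mem_Collect_eq
  proof (intro conjI ballI s)
    fix x assume x: "x \<in> V"
    obtain i where i: "x \<in> patch E i" using patch_cover by blast
    let ?W = "V \<inter> patch E i"
    have W: "open ?W" "?W \<subseteq> V" "?W \<subseteq> U" "?W \<subseteq> patch E i" using V patch_open by auto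
    interpret W: ring "sec S ?W" by (rule S_ring[OF W(1)])
    let ?A = "{a \<otimes>\<^bsub>sec S ?W\<^esub> b | a b. a \<in> odd_ideal S ?W \<and> b \<in> odd_ideal S ?W}"
    have Ac: "?A \<subseteq> carrier (sec S ?W)" using odd_ideal_carrier by auto
    interpret I: ideal "genideal (sec S ?W) ?A" "sec S ?W" by (rule W.genideal_ideal[OF Ac])
    note inv = iso_inv[OF \<theta> W(1,3)]
    note ih = super_homD[OF super_isoD(1)[OF super_iso_inv[OF \<theta> S_algebra] W(1,3)]]
    have odd: "iso_inv S \<theta> ?W u \<in> odd_ideal S ?W" if "u \<in> Fil 1 ?W" for u
    proof -
      have u: "u \<in> carrier (sec \<Lambda> ?W)" using that by (simp add: Fil_iff)
      show ?thesis unfolding odd_ideal_iff[OF \<theta> W(1,3) inv(3)[OF u]] inv(2)[OF u] by (rule that)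
    qed
    have "res \<Lambda> V ?W (\<theta> V s) \<in> Fil (Suc 1) ?W"
      using Fil_res[OF V(1) W(1,2) F] by (simp only: numeral_2_eq_2 One_nat_def)
    from Fil_Suc_expand[OF W(1,4) this] obtain t where t: "\<And>l. l < r \<Longrightarrow> t l \<in> Fil 1 ?W"
      and e: "res \<Lambda> V ?W (\<theta> V s) = (\<lambda>j x K. \<Sum>l<r. wedge (frame i ?W l j x) (t l j x) K)" by blast
    have "(\<lambda>j x K. \<Sum>l<n. wedge (frame i ?W l j x) (t l j x) K) \<in> Sec ?W \<and>
        iso_inv S \<theta> ?W (\<lambda>j x K. \<Sum>l<n. wedge (frame i ?W l j x) (t l j x) K) \<in> genideal (sec S ?W) ?A" if "n \<le> r" for n
      using that
    proof (induction n)
      case 0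
      have "iso_inv S \<theta> ?W (\<lambda>j x K. 0) = \<zero>\<^bsub>sec S ?W\<^esub>"
      proof -
        have z: "iso_inv S \<theta> ?W (\<lambda>j x K. 0) \<in> carrier (sec S ?W)" using inv(3) by (simp add: split_model.zero_closed[OF split_model_axioms])
        have "iso_inv S \<theta> ?W (\<lambda>j x K. 0) \<oplus>\<^bsub>sec S ?W\<^esub> iso_inv S \<theta> ?W (\<lambda>j x K. 0) = iso_inv S \<theta> ?W (\<lambda>j x K. 0)"
          using ih(3)[of "\<lambda>j x K. 0" "\<lambda>j x K. 0"] by (simp add: split_model.zero_closed[OF split_model_axioms])
        then show ?thesis using z by (metis W.add.l_cancel_one)
      qed
      then show ?case using I.zero_closed by (simp add: split_model.zero_closed[OF split_model_axioms])
    next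
      case (Suc n)
      then have n: "n < r" by simp
      have f: "frame i ?W n \<in> Fil 1 ?W" "t n \<in> Fil 1 ?W" using frame_Fil[OF W(1,4) n] t[OF n] by auto
      then have fS: "frame i ?W n \<in> Sec ?W" "t n \<in> Sec ?W" by (simp_all add: Fil_iff)
      have o: "iso_inv S \<theta> ?W (frame i ?W n) \<in> odd_ideal S ?W" "iso_inv S \<theta> ?W (t n) \<in> odd_ideal S ?W"
        using odd f by blast+
      have "iso_inv S \<theta> ?W (\<lambda>j x. wedge (frame i ?W n j x) (t n j x)) =
          iso_inv S \<theta> ?W (frame i ?W n) \<otimes>\<^bsub>sec S ?W\<^esub> iso_inv S \<theta> ?W (t n)"
        using ih(2)[of "frame i ?W n" "t n"] fS by simp
      also have "\<dots> \<in> genideal (sec S ?W) ?A" using W.genideal_self[OF Ac] o by blast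
      finally have g: "iso_inv S \<theta> ?W (\<lambda>j x. wedge (frame i ?W n j x) (t n j x)) \<in> genideal (sec S ?W) ?A" .
      have IH: "(\<lambda>j x K. \<Sum>l<n. wedge (frame i ?W l j x) (t l j x) K) \<in> Sec ?W"
        "iso_inv S \<theta> ?W (\<lambda>j x K. \<Sum>l<n. wedge (frame i ?W l j x) (t l j x) K) \<in> genideal (sec S ?W) ?A"
        using Suc by auto
      have m: "(\<lambda>j x. wedge (frame i ?W n j x) (t n j x)) \<in> Sec ?W" by (rule mult_closed[OF fS])
      have "iso_inv S \<theta> ?W (\<lambda>j x K. (\<Sum>l<n. wedge (frame i ?W l j x) (t l j x) K) + wedge (frame i ?W n j x) (t n j x) K) =
         iso_inv S \<theta> ?W (\<lambda>j x K. \<Sum>l<n. wedge (frame i ?W l j x) (t l j x) K) \<oplus>\<^bsub>sec S ?W\<^esub>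
         iso_inv S \<theta> ?W (\<lambda>j x. wedge (frame i ?W n j x) (t n j x))"
        using ih(3)[of "\<lambda>j x K. \<Sum>l<n. wedge (frame i ?W l j x) (t l j x) K" "\<lambda>j x. wedge (frame i ?W n j x) (t n j x)"] IH(1) m
        by simp
      also have "\<dots> \<in> genideal (sec S ?W) ?A" using I.a_closed[OF IH(2) g] .
      finally show ?case using add_closed[OF IH(1) m] by simp
    qed
    from this[of r] have "iso_inv S \<theta> ?W (res \<Lambda> V ?W (\<theta> V s)) \<in> genideal (sec S ?W) ?A" unfolding e by simp
    moreover have "iso_inv S \<theta> ?W (res \<Lambda> V ?W (\<theta> V s)) = res S V ?W s"
      unfolding super_iso_natural[OF \<theta> V(1) W(1,2) V(2) s, symmetric]
      by (rule inv(1)[OF algebra_presheafD(5)[OF S_algebra V(1) W(1,2) s]])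
    ultimately show "\<exists>W. open W \<and> x \<in> W \<and> W \<subseteq> V \<and> res S V W s \<in> genideal (sec S W) {a \<otimes>\<^bsub>sec S W\<^esub> b | a b. a \<in> odd_ideal S W \<and> b \<in> odd_ideal S W}"
      using W x i by (intro exI[of _ ?W]) simp
  qed
qed

end

section \<open>Trivialisations adapted to the conormal bundle\<close>

context split_model
begin

definition frame_map :: "'i \<Rightarrow> ('a \<Rightarrow> nat \<Rightarrow> nat \<Rightarrow> complex) \<Rightarrow> 'a set \<Rightarrow> ('i \<Rightarrow> 'a \<Rightarrow> nat set \<Rightarrow> complex) \<Rightarrow> 'i \<Rightarrow> 'a \<Rightarrow> nat set \<Rightarrow> complex" where
  "frame_map i T V u = from_frame i V (\<lambda>y. ext_map r (T y) (u i y))"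

lemma frame_map_closed:
  assumes V: "open V" "V \<subseteq> patch E i" and T: "\<And>k l. k < r \<Longrightarrow> l < r \<Longrightarrow> hol V (\<lambda>y. T y k l)" and u: "u \<in> Sec V"
  shows "frame_map i T V u \<in> Sec V"
  unfolding frame_map_def
proof (rule from_frame_closed[OF V])
  have "V \<inter> patch E i = V" using V by blast
  then show "hol V (\<lambda>y. ext_map r (T y) (u i y) K)" for K
    using Sec_hol[OF u, of i] by (intro hol_ext_map T) simp_all
qed (rule ext_map_in)

lemma frame_map_same: "V \<subseteq> patch E i \<Longrightarrow> y \<in> V \<Longrightarrow> frame_map i T V u i y = ext_map r (T y) (u i y)"
  unfolding frame_map_def by (rule from_frame_same) (auto intro: ext_map_in)

lemma frame_map_vanish:
  assumes "\<And>y I. card I = card K \<Longrightarrow> u i y I = 0" shows "frame_map i T V u j y K = 0"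
  unfolding frame_map_def from_frame_def using assms by (auto intro!: ext_map_vanish)

text \<open>The matrix \<open>R\<close> inverse to \<open>T\<close> induces the inverse map.\<close>

lemma frame_map_iso:
  assumes W: "W \<subseteq> patch E i"
    and T: "\<And>k l. k < r \<Longrightarrow> l < r \<Longrightarrow> hol W (\<lambda>y. T y k l)" and R: "\<And>k l. k < r \<Longrightarrow> l < r \<Longrightarrow> hol W (\<lambda>y. R y k l)"
    and TR: "\<And>y k l. y \<in> W \<Longrightarrow> k < r \<Longrightarrow> l < r \<Longrightarrow> (\<Sum>p<r. T y k p * R y p l) = (if k = l then 1 else 0)"
    and RT: "\<And>y k l. y \<in> W \<Longrightarrow> k < r \<Longrightarrow> l < r \<Longrightarrow> (\<Sum>p<r. R y k p * T y p l) = (if k = l then 1 else 0)"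
  shows "super_iso_on W \<Lambda> \<Lambda> (frame_map i T)"
proof (rule super_iso_onI)
  have cl: "frame_map i T V u \<in> Sec V" "frame_map i R V u \<in> Sec V" if "open V" "V \<subseteq> W" "u \<in> Sec V" for V u
  proof -
    have Vi: "V \<subseteq> patch E i" using that W by blast
    show "frame_map i T V u \<in> Sec V" "frame_map i R V u \<in> Sec V"
      by (rule frame_map_closed[OF that(1) Vi _ that(3)],
          rule holomorphic_fun_mono[OF _ that(2)], rule T R, assumption, assumption)+
  qed
  fix V assume V: "open V" "V \<subseteq> W"
  then have Vi: "V \<subseteq> patch E i" using W by blast
  note cl = cl[OF V]
  have TRid: "frame_map i T V (frame_map i R V u) = u" if u: "u \<in> Sec V" for u
  proof (rule Sec_eq_frame[OF cl(1)[OF cl(2)[OF u]] u Vi])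
    fix x assume x: "x \<in> V"
    then have xW: "x \<in> W" using V by blast
    show "frame_map i T V (frame_map i R V u) i x = u i x"
      unfolding frame_map_same[OF Vi x] ext_map_ext_map[OF Sec_alg[OF u]]
      by (rule ext_map_id[OF Sec_alg[OF u]]) (rule TR[OF xW])
  qed
  have RTid: "frame_map i R V (frame_map i T V u) = u" if u: "u \<in> Sec V" for u
  proof (rule Sec_eq_frame[OF cl(2)[OF cl(1)[OF u]] u Vi])
    fix x assume x: "x \<in> V"
    then have xW: "x \<in> W" using V by blast
    show "frame_map i R V (frame_map i T V u) i x = u i x"
      unfolding frame_map_same[OF Vi x] ext_map_ext_map[OF Sec_alg[OF u]]
      by (rule ext_map_id[OF Sec_alg[OF u]]) (rule RT[OF xW])
  qed
  have par: "frame_map i A V u \<in> evens (sec \<Lambda> V)" if "u \<in> evens (sec \<Lambda> V)" "frame_map i A V u \<in> Sec V" for A u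
    using that by (auto intro!: frame_map_vanish)
  have par': "frame_map i A V u \<in> odds (sec \<Lambda> V)" if "u \<in> odds (sec \<Lambda> V)" "frame_map i A V u \<in> Sec V" for A u
    using that by (auto intro!: frame_map_vanish)
  have ev: "u \<in> evens (sec \<Lambda> V) \<Longrightarrow> u \<in> Sec V" "u \<in> odds (sec \<Lambda> V) \<Longrightarrow> u \<in> Sec V" for u by simp_all
  have "frame_map i T V \<in> super_hom (sec \<Lambda> V) (sec \<Lambda> V)"
  proof (rule super_homI)
    fix u v assume "u \<in> carrier (sec \<Lambda> V)" "v \<in> carrier (sec \<Lambda> V)"
    then have u: "u \<in> Sec V" and v: "v \<in> Sec V" by simp_all
    show "frame_map i T V (u \<otimes>\<^bsub>sec \<Lambda> V\<^esub> v) = frame_map i T V u \<otimes>\<^bsub>sec \<Lambda> V\<^esub> frame_map i T V v"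
      unfolding sheaf_simps
    proof (rule Sec_eq_frame[OF cl(1)[OF mult_closed[OF u v]] mult_closed[OF cl(1)[OF u] cl(1)[OF v]] Vi])
      fix x assume x: "x \<in> V"
      show "frame_map i T V (\<lambda>i x. wedge (u i x) (v i x)) i x = wedge (frame_map i T V u i x) (frame_map i T V v i x)"
        unfolding frame_map_same[OF Vi x] by (rule ext_map_wedge[OF Sec_alg[OF u] Sec_alg[OF v]])
    qed
    show "frame_map i T V (u \<oplus>\<^bsub>sec \<Lambda> V\<^esub> v) = frame_map i T V u \<oplus>\<^bsub>sec \<Lambda> V\<^esub> frame_map i T V v"
      unfolding sheaf_simps
    proof (rule Sec_eq_frame[OF cl(1)[OF add_closed[OF u v]] add_closed[OF cl(1)[OF u] cl(1)[OF v]] Vi])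
      fix x assume x: "x \<in> V"
      show "frame_map i T V (\<lambda>i x K. u i x K + v i x K) i x = (\<lambda>K. frame_map i T V u i x K + frame_map i T V v i x K)"
        unfolding frame_map_same[OF Vi x] by (rule ext) (rule ext_map_add)
    qed
  next
    fix c u assume "u \<in> carrier (sec \<Lambda> V)"
    then have u: "u \<in> Sec V" by simp
    show "frame_map i T V (c \<odot>\<^bsub>sec \<Lambda> V\<^esub> u) = c \<odot>\<^bsub>sec \<Lambda> V\<^esub> frame_map i T V u"
      unfolding sheaf_simps
    proof (rule Sec_eq_frame[OF cl(1)[OF scale_closed[OF u]] scale_closed[OF cl(1)[OF u]] Vi])
      fix x assume x: "x \<in> V"
      show "frame_map i T V (\<lambda>i x K. c * u i x K) i x = (\<lambda>K. c * frame_map i T V u i x K)"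
        unfolding frame_map_same[OF Vi x] by (rule ext) (rule ext_map_scale)
    qed
  next
    show "frame_map i T V \<one>\<^bsub>sec \<Lambda> V\<^esub> = \<one>\<^bsub>sec \<Lambda> V\<^esub>"
      unfolding sheaf_simps
    proof (rule Sec_eq_frame[OF cl(1)[OF one_closed[OF V(1)]] one_closed[OF V(1)] Vi])
      fix x assume x: "x \<in> V"
      then have e: "(\<lambda>K. if x \<in> V \<inter> patch E i then ext_one K else 0) = ext_one" using Vi by auto
      show "frame_map i T V (\<lambda>i x K. if x \<in> V \<inter> patch E i then ext_one K else 0) i x = (\<lambda>K. if x \<in> V \<inter> patch E i then ext_one K else 0)"
        unfolding frame_map_same[OF Vi x] e by (rule ext_map_one)
    qed
  next
    show "frame_map i T V u \<in> evens (sec \<Lambda> V)" if "u \<in> evens (sec \<Lambda> V)" for u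
      by (rule par[OF that cl(1)[OF ev(1)[OF that]]])
    show "frame_map i T V u \<in> odds (sec \<Lambda> V)" if "u \<in> odds (sec \<Lambda> V)" for u
      by (rule par'[OF that cl(1)[OF ev(2)[OF that]]])
  qed (simp add: cl)
  moreover have "bij_betw (frame_map i T V) (carrier (sec \<Lambda> V)) (carrier (sec \<Lambda> V))"
    by (rule bij_betw_byWitness[where f' = "frame_map i R V"]) (use cl TRid RTid in auto)
  moreover have "frame_map i T V ` evens (sec \<Lambda> V) = evens (sec \<Lambda> V)"
  proof (intro subset_antisym subsetI)
    fix u assume u: "u \<in> evens (sec \<Lambda> V)"
    have "u = frame_map i T V (frame_map i R V u)" using TRid[OF ev(1)[OF u]] by simp
    then show "u \<in> frame_map i T V ` evens (sec \<Lambda> V)" using par[OF u cl(2)[OF ev(1)[OF u]]] by blast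
  qed (use par cl(1) ev(1) in blast)
  moreover have "frame_map i T V ` odds (sec \<Lambda> V) = odds (sec \<Lambda> V)"
  proof (intro subset_antisym subsetI)
    fix u assume u: "u \<in> odds (sec \<Lambda> V)"
    have "u = frame_map i T V (frame_map i R V u)" using TRid[OF ev(2)[OF u]] by simp
    then show "u \<in> frame_map i T V ` odds (sec \<Lambda> V)" using par'[OF u cl(2)[OF ev(2)[OF u]]] by blast
  qed (use par' cl(1) ev(2) in blast)
  ultimately show "frame_map i T V \<in> super_hom (sec \<Lambda> V) (sec \<Lambda> V) \<and>
      bij_betw (frame_map i T V) (carrier (sec \<Lambda> V)) (carrier (sec \<Lambda> V)) \<and>
      frame_map i T V ` evens (sec \<Lambda> V) = evens (sec \<Lambda> V) \<and> frame_map i T V ` odds (sec \<Lambda> V) = odds (sec \<Lambda> V)"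
    by (intro conjI)
next
  fix V V' u assume a: "open V" "open V'" "V' \<subseteq> V" "V \<subseteq> W" and "u \<in> carrier (sec \<Lambda> V)"
  then have u: "u \<in> Sec V" by simp
  have Vi: "V \<subseteq> patch E i" "V' \<subseteq> patch E i" using a W by blast+
  have T': "hol V (\<lambda>y. T y k l)" "hol V' (\<lambda>y. T y k l)" if "k < r" "l < r" for k l
    using holomorphic_fun_mono[OF T[OF that]] a by auto
  have rc: "(\<lambda>i x K. if x \<in> V' then u i x K else 0) \<in> Sec V'" by (rule res_closed[OF a(1-3) u])
  show "frame_map i T V' (res \<Lambda> V V' u) = res \<Lambda> V V' (frame_map i T V u)"
    unfolding sheaf_simps
  proof (rule Sec_eq_frame[OF frame_map_closed[OF a(2) Vi(2) T'(2) rc] res_closed[OF a(1-3) frame_map_closed[OF a(1) Vi(1) T'(1) u]] Vi(2)])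
    fix x assume x: "x \<in> V'"
    then have xV: "x \<in> V" using a by blast
    show "frame_map i T V' (\<lambda>i x K. if x \<in> V' then u i x K else 0) i x = (\<lambda>K. if x \<in> V' then frame_map i T V u i x K else 0)"
      unfolding frame_map_same[OF Vi(2) x] frame_map_same[OF Vi(1) xV] using x by simp
  qed
qed

text \<open>Change of frame preserves the degree, so it is enough to look at one frame.\<close>

lemma Fil_frame:
  assumes V: "V \<subseteq> patch E i" and w: "w \<in> Sec V" and low: "\<And>y K. y \<in> V \<Longrightarrow> card K < k \<Longrightarrow> w i y K = 0"
  shows "w \<in> Fil k V"
  unfolding Fil_iff
proof (intro conjI allI impI w)
  fix j y and K :: "nat set" assume K: "card K < k"
  show "w j y K = 0"
  proof (cases "y \<in> V \<inter> patch E j")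
    case True
    then have "y \<in> V \<inter> patch E j \<inter> patch E i" using V by blast
    from Sec_change[OF w this] have e: "w j y = ext_map r (tr j i y) (w i y)" .
    show ?thesis unfolding e by (rule ext_map_vanish) (use low True K in auto)
  qed (rule Sec_zero[OF w])
qed

lemma low_degree_cases:
  assumes "card K < 2" "K \<subseteq> {..<n::nat}" obtains "K = {}" | m where "K = {m}" "m < n"
proof -
  have "finite K" using assms(2) finite_subset by blast
  then consider "K = {}" | "card K = 1" using assms(1) by (cases "card K") auto
  then show ?thesis
  proof cases
    case 2
    then obtain m where "K = {m}" by (auto simp: card_1_singleton_iff)
    then show ?thesis using that(2) assms(2) by auto
  qed (rule that(1))
qed

end

context supermanifold
begin

lemma iso_inj: "\<lbrakk>super_iso_on U S \<Lambda> \<theta>; open V; V \<subseteq> U; s \<in> carrier (sec S V); t \<in> carrier (sec S V); \<theta> V s = \<theta> V t\<rbrakk> \<Longrightarrow> s = t"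
  using super_isoD(2)[of U S \<Lambda> \<theta> V] by (auto simp: bij_betw_def inj_on_def)

lemma iso_inv_odd:
  assumes \<theta>: "super_iso_on U S \<Lambda> \<theta>" and V: "open V" "V \<subseteq> U" and u: "u \<in> Fil 1 V"
  shows "iso_inv S \<theta> V u \<in> odd_ideal S V" "\<theta> V (iso_inv S \<theta> V u) = u" "iso_inv S \<theta> V u \<in> carrier (sec S V)"
proof -
  have uc: "u \<in> carrier (sec \<Lambda> V)" using u by (simp add: Fil_iff)
  note i = iso_inv[OF \<theta> V]
  show "\<theta> V (iso_inv S \<theta> V u) = u" "iso_inv S \<theta> V u \<in> carrier (sec S V)" by (rule i(2)[OF uc], rule i(3)[OF uc])
  show "iso_inv S \<theta> V u \<in> odd_ideal S V"
    unfolding odd_ideal_iff[OF \<theta> V i(3)[OF uc]] i(2)[OF uc] by (rule u)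
qed

lemma S_add_closed: "\<lbrakk>open V; s \<in> carrier (sec S V); t \<in> carrier (sec S V)\<rbrakk> \<Longrightarrow> s \<oplus>\<^bsub>sec S V\<^esub> t \<in> carrier (sec S V)"
  using ring.ring_simprules(1)[OF S_ring] .

lemma S_mult_closed: "\<lbrakk>open V; s \<in> carrier (sec S V); t \<in> carrier (sec S V)\<rbrakk> \<Longrightarrow> s \<otimes>\<^bsub>sec S V\<^esub> t \<in> carrier (sec S V)"
  using ring.ring_simprules(5)[OF S_ring] .

lemma odd_ideal_res:
  assumes "open V" "open W" "W \<subseteq> V" "s \<in> odd_ideal S V"
  shows "res S V W s \<in> odd_ideal S W"
proof -
  have s: "s \<in> carrier (sec S V)" "\<rho> V s = (\<lambda>x. 0)" using rho_ker[OF assms(1)] assms(4) by auto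
  have "\<rho> W (res S V W s) = (\<lambda>x. 0)" using rho_res[OF assms(1-3) s(1)] s(2) by simp
  then show ?thesis using rho_ker[OF assms(2)] algebra_presheafD(5)[OF S_algebra assms(1-3) s(1)] by auto
qed

text \<open>The map \<open>q\<close> is linear over functions and kills the square of the odd ideal. Modulo this
  square, \<open>t\<close> is \<open>\<Sum> a\<^sub>l b\<^sub>l\<close>, where \<open>\<theta> b\<^sub>l\<close> is the \<open>l\<close>-th frame vector, and \<open>\<theta> a\<^sub>l\<close> is the
  \<open>l\<close>-th coefficient of the degree 1 part of \<open>\<theta> t\<close>, as a function. So \<open>q\<close> is given by the matrix
  whose columns are the values \<open>q b\<^sub>l\<close>.\<close>

lemma q_in_frame:
  assumes \<theta>: "super_iso_on U S \<Lambda> \<theta>" and U: "open U" "U \<subseteq> patch E i"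
    and V: "open V" "V \<subseteq> U" and t: "t \<in> odd_ideal S V" and y: "y \<in> V"
  shows "q V t i y k = (\<Sum>l<r. q U (iso_inv S \<theta> U (frame i U l)) i y k * \<theta> V t i y {l})"
proof -
  have Vi: "V \<subseteq> patch E i" "V \<inter> patch E i = V" using V U by auto
  have tc: "t \<in> carrier (sec S V)" by (rule odd_ideal_carrier[OF t])
  have tF: "\<theta> V t \<in> Fil 1 V" using odd_ideal_iff[OF \<theta> V tc] t by blast
  have tS: "\<theta> V t \<in> Sec V" using tF by (simp add: Fil_iff)
  note th = super_homD[OF super_isoD(1)[OF \<theta> V]]
  define b where "b = (\<lambda>l. iso_inv S \<theta> U (frame i U l))"
  define f where "f = (\<lambda>l y. if y \<in> V then \<theta> V t i y {l} else 0)"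
  have b: "b l \<in> odd_ideal S U" "\<theta> U (b l) = frame i U l" "b l \<in> carrier (sec S U)" if "l < r" for l
    unfolding b_def by (rule iso_inv_odd[OF \<theta> U(1) order_refl frame_Fil[OF U that]])+
  have f: "hol V (f l)" for l
    unfolding f_def by (rule hol_restrict[OF V(1) _ order_refl]) (use Sec_hol[OF tS, of i "{l}"] in \<open>simp only: Vi\<close>)
  define F where "F = (\<lambda>l. emb V (f l))"
  have F: "F l \<in> Sec V" for l unfolding F_def by (rule emb_closed[OF V(1) f])
  define a where "a = (\<lambda>l. iso_inv S \<theta> V (F l))"
  have a: "a l \<in> carrier (sec S V)" "\<theta> V (a l) = F l" for l
    unfolding a_def using iso_inv(2,3)[OF \<theta> V, of "F l"] F by simp_all
  have rb: "res S U V (b l) \<in> odd_ideal S V" "res S U V (b l) \<in> carrier (sec S V)" "\<theta> V (res S U V (b l)) = res \<Lambda> U V (frame i U l)" if "l < r" for l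
    using odd_ideal_res[OF U(1) V b(1)[OF that]] super_iso_natural[OF \<theta> U(1) V order_refl b(3)[OF that]] b(2)[OF that] odd_ideal_carrier by auto
  have rho_a: "\<rho> V (a l) z = f l z" if "z \<in> V" for l z
    using degree_0_value[OF \<theta> V a(1), of z i l] that Vi by (simp add: a(2) F_def emb_def ext_one_def subset_iff)
  \<comment> \<open>\<open>z\<close> is the partial sum of the products \<open>a\<^sub>l b\<^sub>l\<close>\<close>
  have "\<exists>z\<in>odd_ideal S V. (\<forall>y\<in>V. \<forall>K. \<theta> V z i y K = (\<Sum>l<n. f l y * ext_basis {l} K)) \<and>
      (\<forall>y\<in>V. \<forall>k. q V z i y k = (\<Sum>l<n. f l y * q U (b l) i y k))" if "n \<le> r" for n
    using that
  proof (induction n)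
    case 0
    define z where "z = iso_inv S \<theta> V (\<lambda>j x K. 0)"
    have z0: "(\<lambda>j x K. 0) \<in> Fil 1 V" "(\<lambda>j x K. 0) \<in> Fil 2 V" by (simp_all add: Fil_iff split_model.zero_closed[OF split_model_axioms])
    note z = iso_inv_odd[OF \<theta> V z0(1), folded z_def]
    have "z \<in> odd_ideal_sq S V" unfolding odd_ideal_sq_iff[OF \<theta> V z(3)] z(2) by (rule z0(2))
    then have "q V z i y k = 0" for y k using q_ker[OF V(1)] by auto
    then show ?case using z by (intro bexI[of _ z]) simp_all
  next
    case (Suc n)
    then have n: "n < r" by simp
    from Suc obtain z where z: "z \<in> odd_ideal S V" "\<And>y K. y \<in> V \<Longrightarrow> \<theta> V z i y K = (\<Sum>l<n. f l y * ext_basis {l} K)"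
      "\<And>y k. y \<in> V \<Longrightarrow> q V z i y k = (\<Sum>l<n. f l y * q U (b l) i y k)" by auto
    have zc: "z \<in> carrier (sec S V)" by (rule odd_ideal_carrier[OF z(1)])
    define w where "w = a n \<otimes>\<^bsub>sec S V\<^esub> res S U V (b n)"
    have wc: "w \<in> carrier (sec S V)" unfolding w_def by (rule S_mult_closed[OF V(1) a(1) rb(2)[OF n]])
    have wth: "\<theta> V w = (\<lambda>j y. wedge (F n j y) (res \<Lambda> U V (frame i U n) j y))"
      unfolding w_def th(2)[OF a(1) rb(2)[OF n]] a(2) rb(3)[OF n] by simp
    have wF: "\<theta> V w \<in> Fil 1 V"
      unfolding wth using Fil_mult[of "F n" 0 V "res \<Lambda> U V (frame i U n)" 1] F Fil_res[OF U(1) V frame_Fil[OF U n]]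
      by (simp add: Fil_0)
    have wo: "w \<in> odd_ideal S V" unfolding odd_ideal_iff[OF \<theta> V wc] by (rule wF)
    have zwc: "z \<oplus>\<^bsub>sec S V\<^esub> w \<in> carrier (sec S V)" by (rule S_add_closed[OF V(1) zc wc])
    have zth: "\<theta> V (z \<oplus>\<^bsub>sec S V\<^esub> w) = (\<lambda>j y K. \<theta> V z j y K + \<theta> V w j y K)" unfolding th(3)[OF zc wc] by simp
    have zF: "\<theta> V z \<in> Fil 1 V" using z(1) odd_ideal_iff[OF \<theta> V zc] by blast
    have zo: "z \<oplus>\<^bsub>sec S V\<^esub> w \<in> odd_ideal S V"
      unfolding odd_ideal_iff[OF \<theta> V zwc] zth by (rule Fil_add[OF zF wF])
    have wi: "\<theta> V w i y K = f n y * ext_basis {n} K" if y: "y \<in> V" for y K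
    proof -
      have yU: "y \<in> U" using y V by blast
      have F1: "F n i y = (\<lambda>K. f n y * ext_one K)" using y Vi by (auto simp: F_def emb_def fun_eq_iff)
      have "res \<Lambda> U V (frame i U n) i y = ext_basis {n}" using frame_same[OF U(2) n yU] y by simp
      then show ?thesis unfolding wth F1 wedge_scale_left using wedge_one_left[OF ext_basis_in[of "{n}" r]] n by simp
    qed
    have wq: "q V w i y k = f n y * q U (b n) i y k" if y: "y \<in> V" for y k
      unfolding w_def q_mult[OF V(1) a(1) rb(1)[OF n]] rho_a[OF y] q_res[OF U(1) V b(1)[OF n]] using y by simp
    show ?case
      using zo z(2,3) wi wq by (intro bexI[of _ "z \<oplus>\<^bsub>sec S V\<^esub> w"]) (simp_all add: zth q_add[OF V(1) z(1) wo])
  qed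
  from this[of r] obtain z where z: "z \<in> odd_ideal S V" "\<And>y K. y \<in> V \<Longrightarrow> \<theta> V z i y K = (\<Sum>l<r. f l y * ext_basis {l} K)"
      "\<And>y k. y \<in> V \<Longrightarrow> q V z i y k = (\<Sum>l<r. f l y * q U (b l) i y k)" by auto
  have zc: "z \<in> carrier (sec S V)" by (rule odd_ideal_carrier[OF z(1)])
  have zF: "\<theta> V z \<in> Fil 1 V" using z(1) odd_ideal_iff[OF \<theta> V zc] by blast
  have zS: "\<theta> V z \<in> Sec V" using zF by (simp add: Fil_iff)
  \<comment> \<open>\<open>t\<close> and the full sum have the same degree 1 part, so \<open>q\<close> does not distinguish them\<close>
  define d where "d = t \<oplus>\<^bsub>sec S V\<^esub> ((-1) \<odot>\<^bsub>sec S V\<^esub> z)"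
  have mz: "(-1) \<odot>\<^bsub>sec S V\<^esub> z \<in> carrier (sec S V)" by (rule algebra_presheafD(2)[OF S_algebra V(1) zc])
  have dc: "d \<in> carrier (sec S V)" unfolding d_def by (rule S_add_closed[OF V(1) tc mz])
  have dth: "\<theta> V d = (\<lambda>j y K. \<theta> V t j y K - \<theta> V z j y K)" unfolding d_def th(3)[OF tc mz] th(5)[OF zc] by simp
  have dF1: "\<theta> V d \<in> Fil 1 V" unfolding dth by (rule Fil_diff[OF tF zF])
  have do1: "d \<in> odd_ideal S V" unfolding odd_ideal_iff[OF \<theta> V dc] by (rule dF1)
  have "\<theta> V d \<in> Fil 2 V"
  proof (rule Fil_frame[OF Vi(1)])
    show "\<theta> V d \<in> Sec V" using dF1 by (simp add: Fil_iff)
    then have alg: "\<theta> V d i y \<in> ext_alg r" for y by (rule Sec_alg)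
    fix y and K :: "nat set" assume y: "y \<in> V" and K: "card K < 2"
    show "\<theta> V d i y K = 0"
    proof (cases "K \<subseteq> {..<r}")
      case True
      from K True show ?thesis
      proof (cases rule: low_degree_cases)
        case 1
        then show ?thesis using dF1 by (simp add: Fil_iff)
      next
        case (2 m)
        have "(\<Sum>l<r. f l y * ext_basis {l} {m}) = f m y" using 2(2) by (simp add: ext_basis_def if_distrib[of "\<lambda>c. _ * c"] cong: if_cong)
        then show ?thesis unfolding 2(1) dth z(2)[OF y] using y by (simp add: f_def)
      qed
    qed (rule ext_zero[OF alg])
  qed
  then have "d \<in> odd_ideal_sq S V" unfolding odd_ideal_sq_iff[OF \<theta> V dc] .
  then have dq: "q V d i y k = 0" using q_ker[OF V(1)] by auto
  have "t = d \<oplus>\<^bsub>sec S V\<^esub> z"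
    by (rule iso_inj[OF \<theta> V tc S_add_closed[OF V(1) dc zc]]) (simp add: th(3)[OF dc zc] dth)
  then have "q V t i y k = q V z i y k" using q_add[OF V(1) do1 z(1), of i y k] dq by simp
  then show ?thesis using z(3)[OF y] y by (simp add: f_def b_def mult.commute)
qed

end

context supermanifold
begin

lemma bdl_D:
  assumes "s \<in> bdl_sections M E U"
  shows "\<not> (x \<in> U \<inter> patch E i \<and> k < r) \<Longrightarrow> s i x k = 0" "hol (U \<inter> patch E i) (\<lambda>x. s i x k)"
    "x \<in> U \<inter> patch E i \<inter> patch E j \<Longrightarrow> k < r \<Longrightarrow> s i x k = (\<Sum>l<r. tr i j x k l * s j x l)"
proof -
  note a = assms[unfolded bdl_sections_def mem_Collect_eq]
  show "\<not> (x \<in> U \<inter> patch E i \<and> k < r) \<Longrightarrow> s i x k = 0" using a by blast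
  show "hol (U \<inter> patch E i) (\<lambda>x. s i x k)" using a by blast
  show "x \<in> U \<inter> patch E i \<inter> patch E j \<Longrightarrow> k < r \<Longrightarrow> s i x k = (\<Sum>l<r. tr i j x k l * s j x l)" using a by blast
qed

text \<open>The \<open>k\<close>-th frame vector of patch \<open>i\<close>, as a section of the bundle.\<close>

lemma bdl_frame:
  assumes U: "open U" "U \<subseteq> patch E i" and k: "k < r"
  shows "(\<lambda>j y m. if y \<in> U \<inter> patch E j \<and> m < r then tr j i y m k else 0) \<in> bdl_sections M E U"
  unfolding bdl_sections_def mem_Collect_eq
proof (intro conjI allI impI ballI)
  fix j m
  show "hol (U \<inter> patch E j) (\<lambda>x. if x \<in> U \<inter> patch E j \<and> m < r then tr j i x m k else 0)"
  proof (cases "m < r")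
    case True
    have "U \<inter> patch E j \<subseteq> patch E j \<inter> patch E i" using U by blast
    from holomorphic_fun_mono[OF tr_hol[OF True k] this] show ?thesis
      by (rule hol_cong[rotated]) (use True U in \<open>simp_all add: open_Int patch_open\<close>)
  qed (simp add: holomorphic_fun_const)
next
  fix j j' y m assume y: "y \<in> U \<inter> patch E j \<inter> patch E j'" and m: "m < r"
  have "y \<in> patch E j \<inter> patch E j' \<inter> patch E i" using y U by blast
  from tr_trans[OF this m k] show "(if y \<in> U \<inter> patch E j \<and> m < r then tr j i y m k else 0) =
    (\<Sum>l<r. tr j j' y m l * (if y \<in> U \<inter> patch E j' \<and> l < r then tr j' i y l k else 0))"
    using y m by simp
qed auto

text \<open>The degree 1 part of \<open>\<psi>\<close> is the given identification of the odd ideal modulo its square with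
  the bundle.\<close>

definition adapted :: "'a set \<Rightarrow> ('a set \<Rightarrow> 's \<Rightarrow> 'i \<Rightarrow> 'a \<Rightarrow> nat set \<Rightarrow> complex) \<Rightarrow> bool" where
  "adapted W \<psi> \<longleftrightarrow> super_iso_on W S \<Lambda> \<psi> \<and>
    (\<forall>V t j y k. open V \<and> V \<subseteq> W \<and> t \<in> odd_ideal S V \<and> y \<in> V \<inter> patch E j \<and> k < r \<longrightarrow> \<psi> V t j y {k} = q V t j y k)"

lemma adapted_mono: "adapted W \<psi> \<Longrightarrow> W' \<subseteq> W \<Longrightarrow> adapted W' \<psi>"
proof -
  assume a: "adapted W \<psi>" and W: "W' \<subseteq> W"
  have V: "V \<subseteq> W' \<Longrightarrow> V \<subseteq> W" for V using W by (rule order_trans[rotated])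
  show "adapted W' \<psi>"
    unfolding adapted_def
  proof (intro conjI allI impI)
    show "super_iso_on W' S \<Lambda> \<psi>" by (rule super_iso_mono[OF conjunct1[OF a[unfolded adapted_def]] W])
  qed (use a V in \<open>simp add: adapted_def\<close>)
qed

text \<open>A right inverse \<open>R\<close> of the matrix \<open>T\<close> of \<open>q\<close> is a left inverse because the kernel of \<open>q\<close> is
  the square of the odd ideal. The odd section \<open>t\<close> with coefficients \<open>w\<close>, a column of \<open>R T - 1\<close>, is
  sent by \<open>q\<close> to a column of \<open>T (R T - 1) = 0\<close>. So \<open>t\<close> has degree at least 2, that is \<open>w = 0\<close>.\<close>

lemma left_inverse_of_right_inverse:
  assumes \<theta>: "super_iso_on U S \<Lambda> \<theta>" and U: "open U" "U \<subseteq> patch E i" and W: "open W" "W \<subseteq> U"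
    and T: "\<And>k l y. T y k l = q U (iso_inv S \<theta> U (frame i U l)) i y k"
    and Th: "\<And>k l. k < r \<Longrightarrow> l < r \<Longrightarrow> hol W (\<lambda>y. T y k l)" and Rh: "\<And>k l. k < r \<Longrightarrow> l < r \<Longrightarrow> hol W (\<lambda>y. R y k l)"
    and TR: "\<And>y k l. y \<in> W \<Longrightarrow> k < r \<Longrightarrow> l < r \<Longrightarrow> (\<Sum>p<r. T y k p * R y p l) = (if k = l then 1 else 0)"
    and y: "y \<in> W" and k: "k < r" and l: "l < r"
  shows "(\<Sum>p<r. R y k p * T y p l) = (if k = l then 1 else 0)"
proof -
  have Wi: "W \<subseteq> patch E i" using W U by blast
  define w where "w = (\<lambda>y m. (\<Sum>p<r. R y m p * T y p l) - (if m = l then 1 else 0))"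
  define u where "u = from_frame i W (\<lambda>y. ext_vec r (w y))"
  have wh: "hol W (\<lambda>y. w y m)" if "m < r" for m
    unfolding w_def using that l
    by (intro hol_diff holomorphic_fun_sum holomorphic_fun_mult holomorphic_fun_const Th Rh) simp_all
  have vh: "hol W (\<lambda>y. ext_vec r (w y) K)" for K
    unfolding ext_vec_def
  proof (rule holomorphic_fun_sum)
    fix m assume "m \<in> {..<r}"
    then show "hol W (\<lambda>y. if K = {m} then w y m else 0)"
      using wh by (cases "K = {m}") (simp_all add: holomorphic_fun_const)
  qed
  have uF: "u \<in> Fil 1 W"
    unfolding u_def by (rule from_frame_Fil[OF W(1) Wi vh ext_vec_in]) (auto simp: ext_vec_def intro!: sum.neutral)
  have ui: "u i y {m} = w y m" if "y \<in> W" "m < r" for y m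
  proof -
    have "u i y = ext_vec r (w y)" unfolding u_def by (rule from_frame_same[OF Wi that(1)]) (rule ext_vec_in)
    then show ?thesis using that(2) by (simp add: ext_vec_def)
  qed
  note t = iso_inv_odd[OF \<theta> W uF]
  let ?t = "iso_inv S \<theta> W u"
  have qi: "q W ?t i y m = 0" if y: "y \<in> W" and m: "m < r" for y m
  proof -
    have "q W ?t i y m = (\<Sum>p<r. T y m p * w y p)"
      unfolding q_in_frame[OF \<theta> U W t(1) y] t(2) T by (rule sum.cong) (simp_all add: ui[OF y])
    also have "\<dots> = (\<Sum>p<r. \<Sum>n<r. T y m p * R y p n * T y n l) - (\<Sum>p<r. T y m p * (if p = l then 1 else 0))"
      by (simp add: w_def right_diff_distrib sum_subtractf sum_distrib_left mult.assoc)
    also have "(\<Sum>p<r. \<Sum>n<r. T y m p * R y p n * T y n l) = (\<Sum>n<r. (\<Sum>p<r. T y m p * R y p n) * T y n l)"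
      unfolding sum_distrib_right by (rule sum.swap)
    also have "\<dots> = (\<Sum>n<r. (if m = n then 1 else 0) * T y n l)"
      by (rule sum.cong) (simp_all add: TR[OF y m])
    also have "\<dots> = T y m l" using m by (simp add: if_distrib[of "\<lambda>c. c * _"] cong: if_cong)
    also have "(\<Sum>p<r. T y m p * (if p = l then 1 else 0)) = T y m l" using l by (simp add: if_distrib cong: if_cong)
    finally show ?thesis by simp
  qed
  note qb = bdl_D[OF q_closed[OF W(1) t(1)]]
  have "q W ?t j y m = 0" for j y m
  proof (cases "y \<in> W \<inter> patch E j \<and> m < r")
    case True
    then have "y \<in> W \<inter> patch E j \<inter> patch E i" using Wi by blast
    from qb(3)[OF this, of m] True show ?thesis using qi by simp
  qed (rule qb(1))
  then have "?t \<in> odd_ideal_sq S W" using q_ker[OF W(1)] t(1) by blast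
  then have "u \<in> Fil 2 W" unfolding odd_ideal_sq_iff[OF \<theta> W t(3)] t(2) .
  then have "u i y {k} = 0" by (simp add: Fil_iff)
  then show ?thesis using ui[OF y k] by (simp add: w_def)
qed

text \<open>Start from any local isomorphism \<open>\<theta>\<close>. By \<open>q_in_frame\<close> the map \<open>q\<close> is the degree 1 part of \<open>\<theta>\<close>
  followed by a matrix \<open>T\<close>. Local surjectivity of \<open>q\<close> provides preimages of the frame vectors near
  \<open>x\<^sub>0\<close>, and their coefficients form a right inverse of \<open>T\<close>. So \<open>T\<close> induces an automorphism of the
  exterior algebra, and composing \<open>\<theta>\<close> with it gives an adapted isomorphism.\<close>

lemma adapted_chart: "\<exists>W \<psi>. open W \<and> x0 \<in> W \<and> adapted W \<psi>"
proof -
  obtain U0 \<theta> where U0: "open U0" "x0 \<in> U0" "super_iso_on U0 S \<Lambda> \<theta>" using local_iso by blast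
  obtain i where i: "x0 \<in> patch E i" using patch_cover by blast
  define U where "U = U0 \<inter> patch E i"
  have U: "open U" "U \<subseteq> patch E i" "x0 \<in> U" using U0 i patch_open by (auto simp: U_def)
  have \<theta>: "super_iso_on U S \<Lambda> \<theta>" by (rule super_iso_mono[OF U0(3)]) (simp add: U_def)
  define T where "T = (\<lambda>y k l. q U (iso_inv S \<theta> U (frame i U l)) i y k)"
  have Ui: "U \<inter> patch E i = U" using U by blast
  have TU: "hol U (\<lambda>y. T y k l)" if "l < r" for k l
    using bdl_D(2)[OF q_closed[OF U(1) iso_inv_odd(1)[OF \<theta> U(1) order_refl frame_Fil[OF U(1,2) that]]], of i k]
    unfolding T_def Ui .
  \<comment> \<open>the frame vectors, whose local preimages under \<open>q\<close> give the matrix \<open>R\<close>\<close>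
  define \<beta> where "\<beta> = (\<lambda>k j y m. if y \<in> U \<inter> patch E j \<and> m < r then tr j i y m k else 0)"
  have \<beta>: "\<beta> k \<in> bdl_sections M E U" if "k < r" for k unfolding \<beta>_def by (rule bdl_frame[OF U(1,2) that])
  have "\<forall>k. \<exists>p. k < r \<longrightarrow> open (fst p) \<and> x0 \<in> fst p \<and> fst p \<subseteq> U \<and> snd p \<in> odd_ideal S (fst p) \<and>
      q (fst p) (snd p) = (\<lambda>i y m. if y \<in> fst p then \<beta> k i y m else 0)"
  proof
    fix k
    show "\<exists>p. k < r \<longrightarrow> open (fst p) \<and> x0 \<in> fst p \<and> fst p \<subseteq> U \<and> snd p \<in> odd_ideal S (fst p) \<and>
      q (fst p) (snd p) = (\<lambda>i y m. if y \<in> fst p then \<beta> k i y m else 0)"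
    proof (cases "k < r")
      case True
      from q_surj[OF U(1) \<beta>[OF True] U(3)] obtain A s where
        "open A \<and> x0 \<in> A \<and> A \<subseteq> U \<and> s \<in> odd_ideal S A \<and> q A s = (\<lambda>i y m. if y \<in> A then \<beta> k i y m else 0)" by blast
      then show ?thesis by (intro exI[of _ "(A, s)"] impI) simp
    qed simp
  qed
  then obtain p where p: "\<And>k. k < r \<Longrightarrow> open (fst (p k)) \<and> x0 \<in> fst (p k) \<and> fst (p k) \<subseteq> U \<and> snd (p k) \<in> odd_ideal S (fst (p k)) \<and>
      q (fst (p k)) (snd (p k)) = (\<lambda>i y m. if y \<in> fst (p k) then \<beta> k i y m else 0)"
    by (elim choice[elim_format] exE) blast
  define W where "W = U \<inter> (\<Inter>k\<in>{..<r}. fst (p k))"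
  have W: "open W" "W \<subseteq> U" "x0 \<in> W" "\<And>k. k < r \<Longrightarrow> W \<subseteq> fst (p k)"
    unfolding W_def using U p by (auto intro!: open_Int open_INT)
  have Wi: "W \<subseteq> patch E i" "W \<inter> patch E i = W" using W(2) U(2) by auto
  note \<theta>W = super_iso_mono[OF \<theta> W(2)]
  define s where "s = (\<lambda>k. res S (fst (p k)) W (snd (p k)))"
  have s: "s k \<in> odd_ideal S W" if "k < r" for k
    unfolding s_def by (rule odd_ideal_res) (use p[OF that] W(1) W(4)[OF that] in auto)
  have qs: "q W (s k) i y m = (if m = k then 1 else 0)" if k: "k < r" and m: "m < r" and y: "y \<in> W" for k m y
  proof -
    have yi: "y \<in> patch E i" "y \<in> fst (p k)" "y \<in> U" using y Wi W(2) W(4)[OF k] by auto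
    have "q W (s k) = (\<lambda>i y m. if y \<in> W then q (fst (p k)) (snd (p k)) i y m else 0)"
      unfolding s_def by (rule q_res) (use p[OF k] W(1) W(4)[OF k] in auto)
    then show ?thesis using p[OF k] y yi m tr_refl[OF yi(1) m k] by (simp add: \<beta>_def)
  qed
  define R where "R = (\<lambda>y l k. \<theta> W (s k) i y {l})"
  have sS: "\<theta> W (s k) \<in> Sec W" if "k < r" for k
    using super_iso_closed[OF \<theta> W(1,2) odd_ideal_carrier[OF s[OF that]]] by simp
  have Th: "hol W (\<lambda>y. T y k l)" if "k < r" "l < r" for k l by (rule holomorphic_fun_mono[OF TU[OF that(2)] W(2)])
  have Rh: "hol W (\<lambda>y. R y k l)" if "k < r" "l < r" for k l
    using Sec_hol[OF sS[OF that(2)], of i "{k}"] unfolding R_def Wi(2) .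
  have TR: "(\<Sum>p<r. T y k p * R y p l) = (if k = l then 1 else 0)" if "y \<in> W" "k < r" "l < r" for y k l
    using q_in_frame[OF \<theta> U(1,2) W(1,2) s[OF that(3)] that(1), of k] qs[OF that(3,2,1)] by (simp add: T_def R_def)
  have RT: "(\<Sum>p<r. R y k p * T y p l) = (if k = l then 1 else 0)" if "y \<in> W" "k < r" "l < r" for y k l
    by (rule left_inverse_of_right_inverse[OF \<theta> U(1,2) W(1,2) _ Th Rh TR that]) (simp add: T_def)
  have iso: "super_iso_on W \<Lambda> \<Lambda> (frame_map i T)" by (rule frame_map_iso[OF Wi(1) Th Rh TR RT])
  have "adapted W (\<lambda>V. frame_map i T V \<circ> \<theta> V)"
    unfolding adapted_def
  proof (intro conjI allI impI super_iso_comp[OF \<theta>W iso])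
    fix V t j y k assume a: "open V \<and> V \<subseteq> W \<and> t \<in> odd_ideal S V \<and> y \<in> V \<inter> patch E j \<and> k < r"
    then have V: "open V" "V \<subseteq> W" "V \<subseteq> U" and t: "t \<in> odd_ideal S V" and y: "y \<in> V" "y \<in> patch E j" and k: "k < r"
      using W(2) by auto
    have Vi: "V \<subseteq> patch E i" using V Wi by blast
    have yji: "y \<in> V \<inter> patch E j \<inter> patch E i" using y Vi by blast
    have tS: "\<theta> V t \<in> Sec V" using super_iso_closed[OF \<theta> V(1,3) odd_ideal_carrier[OF t]] by simp
    have wS: "frame_map i T V (\<theta> V t) \<in> Sec V"
      by (rule frame_map_closed[OF V(1) Vi holomorphic_fun_mono[OF Th V(2)] tS])
    have wi: "frame_map i T V (\<theta> V t) i y {l} = q V t i y l" if "l < r" for l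
      unfolding frame_map_same[OF Vi y(1)] ext_map_degree_1[OF that] q_in_frame[OF \<theta> U(1,2) V(1,3) t y(1)] T_def ..
    have "frame_map i T V (\<theta> V t) j y {k} = (\<Sum>l<r. tr j i y k l * q V t i y l)"
      unfolding Sec_change[OF wS yji] ext_map_degree_1[OF k] by (rule sum.cong) (simp_all add: wi)
    also have "\<dots> = q V t j y k" using bdl_D(3)[OF q_closed[OF V(1) t] yji k] by simp
    finally show "(frame_map i T V \<circ> \<theta> V) t j y {k} = q V t j y k" by simp
  qed
  then show ?thesis using W(1,3) by blast
qed

text \<open>The degree 0 part of \<open>s\<close> is \<open>\<rho> s\<close> under both isomorphisms. The degree 1 part only sees the
  odd part of \<open>s\<close>, which lies in the odd ideal, and there it is \<open>q\<close>.\<close>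

lemma adapted_difference:
  assumes \<psi>: "adapted U \<psi>" and \<phi>: "adapted U \<phi>" and V: "open V" "V \<subseteq> U" and s: "s \<in> carrier (sec S V)"
  shows "(\<lambda>i x K. \<psi> V s i x K - \<phi> V s i x K) \<in> Fil 2 V"
proof -
  have iso: "super_iso_on U S \<Lambda> \<psi>" "super_iso_on U S \<Lambda> \<phi>" using \<psi> \<phi> by (simp_all add: adapted_def)
  have sec: "\<psi> V s \<in> Sec V" "\<phi> V s \<in> Sec V"
    using super_iso_closed[OF iso(1) V s] super_iso_closed[OF iso(2) V s] by simp_all
  obtain a b where ab: "a \<in> evens (sec S V)" "b \<in> odds (sec S V)" "s = a \<oplus>\<^bsub>sec S V\<^esub> b"
    by (rule superalgebra_decomp[OF S_superalgebra[OF V(1)] s])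
  note abc = superalgebraD(3)[OF S_superalgebra[OF V(1)] ab(1)] superalgebraD(4)[OF S_superalgebra[OF V(1)] ab(2)]
  note P = super_homD[OF super_isoD(1)[OF iso(1) V]] and Q = super_homD[OF super_isoD(1)[OF iso(2) V]]
  have "\<psi> V b \<in> Fil 1 V" using P(7)[OF ab(2)] by (simp add: Fil_iff)
  then have bo: "b \<in> odd_ideal S V" unfolding odd_ideal_iff[OF iso(1) V abc(2)] .
  show ?thesis
    unfolding Fil_iff
  proof (intro conjI allI impI diff_closed[OF sec])
    fix i x and K :: "nat set" assume K: "card K < 2"
    show "\<psi> V s i x K - \<phi> V s i x K = 0"
    proof (cases "x \<in> V \<inter> patch E i \<and> K \<subseteq> {..<r}")
      case True
      then have x: "x \<in> V \<inter> patch E i" and Kr: "K \<subseteq> {..<r}" by auto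
      from K Kr show ?thesis
      proof (cases rule: low_degree_cases)
        case 1
        then show ?thesis using degree_0_value[OF iso(1) V s x] degree_0_value[OF iso(2) V s x] by simp
      next
        case (2 m)
        have "\<psi> V a i x {m} = 0" "\<phi> V a i x {m} = 0" using P(6)[OF ab(1)] Q(6)[OF ab(1)] by simp_all
        moreover have "\<psi> V b i x {m} = q V b i x m" "\<phi> V b i x {m} = q V b i x m"
          using \<psi> \<phi> V bo x 2(2) unfolding adapted_def by blast+
        ultimately show ?thesis unfolding ab(3) P(3)[OF abc] Q(3)[OF abc] 2(1) by simp
      qed
    next
      case False
      then show ?thesis using Sec_zero[OF sec(1)] Sec_zero[OF sec(2)] ext_zero[OF Sec_alg[OF sec(1)]] ext_zero[OF Sec_alg[OF sec(2)]]
        by (cases "x \<in> V \<inter> patch E i") simp_all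
    qed
  qed
qed

lemma adapted_transition:
  assumes \<psi>: "adapted U \<psi>" and \<phi>: "adapted U \<phi>"
  shows "aut_norm \<Lambda> U (\<lambda>V. \<psi> V \<circ> iso_inv S \<phi> V) \<in> G 2 U"
  unfolding G_iff
proof (intro conjI allI impI)
  have iso: "super_iso_on U S \<Lambda> \<psi>" "super_iso_on U S \<Lambda> \<phi>" using \<psi> \<phi> by (simp_all add: adapted_def)
  show "aut_norm \<Lambda> U (\<lambda>V. \<psi> V \<circ> iso_inv S \<phi> V) \<in> carrier (sec aut.Aut U)"
    by (rule aut.Aut_norm[OF super_iso_comp[OF super_iso_inv[OF iso(2) S_algebra] iso(1)]])
  fix V u assume a: "open V \<and> V \<subseteq> U \<and> u \<in> Sec V"
  then have V: "open V" "V \<subseteq> U" and u: "u \<in> carrier (sec \<Lambda> V)" by simp_all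
  note i = iso_inv(2,3)[OF iso(2) V u]
  show "(\<lambda>i x K. aut_norm \<Lambda> U (\<lambda>V. \<psi> V \<circ> iso_inv S \<phi> V) V u i x K - u i x K) \<in> Fil 2 V"
    using adapted_difference[OF \<psi> \<phi> V i(2)] unfolding i(1) aut_norm_apply[where S = \<Lambda>, OF V u] o_apply .
qed

text \<open>The transition functions \<open>g\<^sub>x\<^sub>y = \<psi>\<^sub>x \<psi>\<^sub>y\<^sup>-\<^sup>1\<close> of adapted isomorphisms form a cocycle in
  \<open>G\<^sub>2\<close>. By \<open>cocycle_splits\<close> it can be twisted into \<open>G\<^sub>k\<close> with \<open>k\<close> larger than the rank, where
  every automorphism is the identity. So \<open>h\<^sub>x g\<^sub>x\<^sub>y h\<^sub>y\<^sup>-\<^sup>1 = 1\<close>, which says that \<open>h\<^sub>x \<psi>\<^sub>x\<close> and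
  \<open>h\<^sub>y \<psi>\<^sub>y\<close> agree.\<close>

lemma compatible_charts_exist:
  assumes H: "carrier (first_obstruction_cohomology M E) = {\<one>\<^bsub>first_obstruction_cohomology M E\<^esub>}"
  obtains V \<tau> where "pcover V" "\<And>x. super_iso_on (V x) S \<Lambda> (\<tau> x)"
    "\<And>x y N s. \<lbrakk>open N; N \<subseteq> V x; N \<subseteq> V y; s \<in> carrier (sec S N)\<rbrakk> \<Longrightarrow> \<tau> x N s = \<tau> y N s"
proof -
  have "\<forall>x. \<exists>p. open (fst p) \<and> x \<in> fst p \<and> adapted (fst p) (snd p)"
    using adapted_chart by simp
  then obtain p where p: "\<And>x. open (fst (p x)) \<and> x \<in> fst (p x) \<and> adapted (fst (p x)) (snd (p x))"
    by (elim choice[elim_format] exE) blast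
  define U where "U = (\<lambda>x. fst (p x))"
  define \<psi> where "\<psi> = (\<lambda>x. snd (p x))"
  have U: "open (U x)" "x \<in> U x" "adapted (U x) (\<psi> x)" for x using p by (simp_all add: U_def \<psi>_def)
  have iso: "super_iso_on (U x) S \<Lambda> (\<psi> x)" for x using U(3) by (simp add: adapted_def)
  define g where "g = (\<lambda>x y. aut_norm \<Lambda> (U x \<inter> U y) (\<lambda>V. \<psi> x V \<circ> iso_inv S (\<psi> y) V))"
  have g: "g x y \<in> G 2 (U x \<inter> U y)" for x y
    unfolding g_def by (rule adapted_transition) (rule adapted_mono[OF U(3)], blast)+
  have g_apply: "g x y N u = \<psi> x N (iso_inv S (\<psi> y) N u)" if "open N" "N \<subseteq> U x" "N \<subseteq> U y" "u \<in> Sec N" for x y N u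
    unfolding g_def using that by (simp add: aut_norm_apply)
  have co: "filt.cocycle 2 U g"
    unfolding filt.cocycle_def Let_def
  proof (intro conjI allI g)
    show "pcover U" using U by (simp add: pcover_def)
    fix x y z
    let ?W = "U x \<inter> U y \<inter> U z"
    have gA: "g x y \<in> carrier (sec aut.Aut (U x \<inter> U y))" for x y using g by (simp add: G_iff)
    have m: "res aut.Aut (U x \<inter> U y) ?W (g x y) \<in> carrier (sec aut.Aut ?W)"
      "res aut.Aut (U y \<inter> U z) ?W (g y z) \<in> carrier (sec aut.Aut ?W)"
      "res aut.Aut (U x \<inter> U z) ?W (g x z) \<in> carrier (sec aut.Aut ?W)"
      by (rule aut.Aut_res_closed[OF _ gA]; blast)+
    show "res aut.Aut (U x \<inter> U y) ?W (g x y) \<otimes>\<^bsub>sec aut.Aut ?W\<^esub> res aut.Aut (U y \<inter> U z) ?W (g y z) =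
        res aut.Aut (U x \<inter> U z) ?W (g x z)"
    proof (rule aut.Aut_eqI[OF aut.Aut_mult_closed[OF m(1,2)] m(3)])
      fix N u assume N: "open N" "N \<subseteq> ?W" and uc: "u \<in> carrier (sec \<Lambda> N)"
      then have u: "u \<in> Sec N" and sub: "N \<subseteq> U x" "N \<subseteq> U y" "N \<subseteq> U z" by auto
      have s: "iso_inv S (\<psi> z) N u \<in> carrier (sec S N)" by (rule iso_inv(3)[OF iso N(1) sub(3) uc])
      have gu: "g y z N u \<in> Sec N"
        using super_iso_closed[OF iso N(1) sub(2) s] by (simp add: g_apply[OF N(1) sub(2,3) u])
      have "g x y N (g y z N u) = g x z N u"
        unfolding g_apply[OF N(1) sub(1,2) gu] unfolding g_apply[OF N(1) sub(2,3) u] g_apply[OF N(1) sub(1,3) u]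
          iso_inv(1)[OF iso N(1) sub(2) s] ..
      then show "(res aut.Aut (U x \<inter> U y) ?W (g x y) \<otimes>\<^bsub>sec aut.Aut ?W\<^esub> res aut.Aut (U y \<inter> U z) ?W (g y z)) N u =
          res aut.Aut (U x \<inter> U z) ?W (g x z) N u"
        using N uc gu by (simp add: aut.Aut_mult_apply aut.Aut_res_apply)
    qed
  qed
  obtain V h where V: "pcover V" "\<And>x. V x \<subseteq> U x" and h: "\<And>x. h x \<in> G 2 (V x)"
    and tw: "filt.cocycle (r + 2) V (filt.twist U V g h)"
    using cocycle_splits[OF H co, of "r + 2"] by auto
  have hA: "h x \<in> carrier (sec aut.Aut (V x))" for x using h by (simp add: G_iff)
  have hiso: "super_iso_on (V x) \<Lambda> \<Lambda> (h x)" for x using hA by (simp add: aut.Aut_simps(1))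
  have \<psi>V: "super_iso_on (V x) S \<Lambda> (\<psi> x)" for x by (rule super_iso_mono[OF iso V(2)])
  show thesis
  proof (rule that[of V "\<lambda>x N. h x N \<circ> \<psi> x N"])
    show "super_iso_on (V x) S \<Lambda> (\<lambda>N. h x N \<circ> \<psi> x N)" for x by (rule super_iso_comp[OF \<psi>V hiso])
    fix x y N s assume N: "open N" "N \<subseteq> V x" "N \<subseteq> V y" and s: "s \<in> carrier (sec S N)"
    let ?W = "V x \<inter> V y"
    let ?a = "res aut.Aut (V x) ?W (h x)" and ?b = "res aut.Aut (V y) ?W (h y)" and ?c = "res aut.Aut (U x \<inter> U y) ?W (g x y)"
    have NW: "N \<subseteq> ?W" and NU: "N \<subseteq> U x" "N \<subseteq> U y" using N V(2) by blast+
    have cl: "?b \<in> carrier (sec aut.Aut ?W)" by (rule aut.Aut_res_closed[OF _ hA]) blast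
    have pc: "\<psi> x N s \<in> carrier (sec \<Lambda> N)" "\<psi> y N s \<in> carrier (sec \<Lambda> N)"
      using super_iso_closed[OF iso N(1) NU(1) s] super_iso_closed[OF iso N(1) NU(2) s] .
    have c: "?c N (\<psi> y N s) = \<psi> x N s"
      using aut.Aut_res_apply[OF N(1) NW pc(2)] g_apply[OF N(1) NU, of "\<psi> y N s"] pc(2) iso_inv(1)[OF iso N(1) NU(2) s] by simp
    have hy: "?b N (\<psi> y N s) \<in> carrier (sec \<Lambda> N)" by (rule aut.Aut_closed[OF cl N(1) NW pc(2)])
    have inv: "(inv\<^bsub>sec aut.Aut ?W\<^esub> ?b) N (?b N (\<psi> y N s)) = \<psi> y N s" by (rule aut.Aut_inv_apply(2)[OF cl N(1) NW pc(2)])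
    \<comment> \<open>the twisted cocycle fixes \<open>h\<^sub>y \<psi>\<^sub>y s\<close>, and by construction sends it to \<open>h\<^sub>x \<psi>\<^sub>x s\<close>\<close>
    have "filt.twist U V g h x y \<in> G (r + 2) ?W" using tw by (simp add: filt.cocycle_def)
    then have "filt.twist U V g h x y N (?b N (\<psi> y N s)) = ?b N (\<psi> y N s)"
      using G_trivial[of "r + 2" _ ?W N] N NW hy by simp
    then have "?a N (\<psi> x N s) = ?b N (\<psi> y N s)"
      unfolding filt.twist_def Let_def aut.Aut_mult_apply[OF N(1) NW hy] inv aut.Aut_mult_apply[OF N(1) NW pc(2)] c .
    then show "(h x N \<circ> \<psi> x N) s = (h y N \<circ> \<psi> y N) s"
      unfolding o_apply aut.Aut_res_apply[OF N(1) NW pc(1)] aut.Aut_res_apply[OF N(1) NW pc(2)] .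
  qed (rule V(1))
qed

end

section \<open>Gluing the projection\<close>

context split_model
begin

lemma emb_apply: "x \<in> U \<inter> patch E i \<Longrightarrow> emb U f i x K = f x * ext_one K"
  and emb_off: "x \<notin> U \<inter> patch E i \<Longrightarrow> emb U f i x K = 0"
  unfolding emb_def by auto

lemma emb_mult:
  assumes U: "open U" and g: "hol U g"
  shows "(\<lambda>i x. wedge (emb U f i x) (emb U g i x)) = emb U (\<lambda>x. f x * g x)"
proof (intro ext)
  fix i x K
  have "emb U g \<in> Sec U" by (rule emb_closed[OF assms])
  then have one: "wedge ext_one (emb U g i x) = emb U g i x" by (rule wedge_one_left[OF Sec_alg])
  show "wedge (emb U f i x) (emb U g i x) K = emb U (\<lambda>x. f x * g x) i x K"
  proof (cases "x \<in> U \<inter> patch E i")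
    case True
    then have "emb U f i x = (\<lambda>K. f x * ext_one K)" by (intro ext emb_apply)
    then show ?thesis using True by (simp add: wedge_scale_left one emb_apply)
  next
    case False
    then have "emb U f i x = (\<lambda>K. 0)" by (intro ext emb_off)
    then show ?thesis using False by (simp add: wedge_def emb_off)
  qed
qed

lemma emb_res: "V \<subseteq> U \<Longrightarrow> res \<Lambda> U V (emb U f) = emb V f"
  by (auto simp: emb_def fun_eq_iff)

lemma emb_cong: "(\<And>x. x \<in> U \<Longrightarrow> f x = g x) \<Longrightarrow> emb U f = emb U g"
  by (auto simp: emb_def fun_eq_iff)

end

locale compatible_charts = supermanifold M E S \<rho> q
  for M :: "'a::{t2_space,second_countable_topology} cmanifold" and E :: "('a, 'i) vbundle"
    and S :: "('a, 's) spresheaf" and \<rho> q +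
  fixes V :: "'a \<Rightarrow> 'a set" and \<tau>
  assumes cover: "pcover V" and iso: "super_iso_on (V x) S (ext_sheaf M E) (\<tau> x)"
    and agree: "\<lbrakk>open N; N \<subseteq> V x; N \<subseteq> V y; s \<in> carrier (sec S N)\<rbrakk> \<Longrightarrow> \<tau> x N s = \<tau> y N s"
begin

definition lifts :: "'a set \<Rightarrow> ('a \<Rightarrow> complex) \<Rightarrow> 's \<Rightarrow> bool" where
  "lifts W f t \<longleftrightarrow> t \<in> carrier (sec S W) \<and>
    (\<forall>x N. open N \<and> N \<subseteq> W \<and> N \<subseteq> V x \<longrightarrow> \<tau> x N (res S W N t) = emb N f)"

lemma S_res_closed: "\<lbrakk>open U; open W; W \<subseteq> U; s \<in> carrier (sec S U)\<rbrakk> \<Longrightarrow> res S U W s \<in> carrier (sec S W)"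
  by (rule algebra_presheafD(5)[OF S_algebra])

text \<open>The preimages of \<open>f\<close> under the various trivialisations agree on overlaps because the
  trivialisations do. The sets contained in some \<open>V x\<close> cover \<open>W\<close>, so the preimages glue uniquely.\<close>

lemma lifts_exists:
  assumes W: "open W" and f: "hol W f"
  shows "\<exists>!t. lifts W f t"
proof -
  let ?\<U> = "{N. open N \<and> N \<subseteq> W \<and> (\<exists>x. N \<subseteq> V x)}"
  define s where "s = (\<lambda>N. iso_inv S (\<tau> (SOME x. N \<subseteq> V x)) N (emb N f))"
  have s: "s N \<in> carrier (sec S N) \<and> \<tau> x N (s N) = emb N f" if N: "open N" "N \<subseteq> W" "N \<subseteq> V x" for N x
  proof -
    define y where "y = (SOME x. N \<subseteq> V x)"
    have y: "N \<subseteq> V y" unfolding y_def by (rule someI[of "\<lambda>x. N \<subseteq> V x", OF N(3)])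
    have e: "emb N f \<in> carrier (sec \<Lambda> N)" using emb_closed[OF N(1) holomorphic_fun_mono[OF f N(2)]] by simp
    note i = iso_inv(2,3)[OF iso N(1) y e]
    show ?thesis using i agree[OF N(1,3) y i(2)] unfolding s_def y_def by simp
  qed
  have cov: "\<Union>?\<U> = W"
  proof
    show "W \<subseteq> \<Union>?\<U>"
    proof
      fix x assume x: "x \<in> W"
      have "W \<inter> V x \<in> ?\<U>" "x \<in> W \<inter> V x" using W x cover by (auto simp: pcover_def)
      then show "x \<in> \<Union>?\<U>" by blast
    qed
  qed blast
  have comp: "res S N (N \<inter> N') (s N) = res S N' (N \<inter> N') (s N')" if N: "N \<in> ?\<U>" and N': "N' \<in> ?\<U>" for N N'
  proof -
    obtain x x' where x: "N \<subseteq> V x" "N' \<subseteq> V x'" using N N' by blast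
    have o: "open N" "open N'" "N \<subseteq> W" "N' \<subseteq> W" using N N' by auto
    have B: "open (N \<inter> N')" "N \<inter> N' \<subseteq> V x" "N \<inter> N' \<subseteq> V x'" using o x by auto
    have c: "res S N (N \<inter> N') (s N) \<in> carrier (sec S (N \<inter> N'))" "res S N' (N \<inter> N') (s N') \<in> carrier (sec S (N \<inter> N'))"
      using S_res_closed[OF o(1) B(1) _ s[THEN conjunct1, OF o(1,3) x(1)]] S_res_closed[OF o(2) B(1) _ s[THEN conjunct1, OF o(2,4) x(2)]]
      by blast+
    have 1: "\<tau> x (N \<inter> N') (res S N (N \<inter> N') (s N)) = emb (N \<inter> N') f"
      unfolding super_iso_natural[OF iso o(1) B(1) Int_lower1 x(1) conjunct1[OF s[OF o(1,3) x(1)]]] conjunct2[OF s[OF o(1,3) x(1)]]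
      by (rule emb_res[OF Int_lower1])
    have 2: "\<tau> x' (N \<inter> N') (res S N' (N \<inter> N') (s N')) = emb (N \<inter> N') f"
      unfolding super_iso_natural[OF iso o(2) B(1) Int_lower2 x(2) conjunct1[OF s[OF o(2,4) x(2)]]] conjunct2[OF s[OF o(2,4) x(2)]]
      by (rule emb_res[OF Int_lower2])
    show ?thesis by (rule iso_inj[OF iso B(1,2) c]) (simp only: 1 2 agree[OF B c(2)])
  qed
  have glue: "\<exists>!t. t \<in> carrier (sec S (\<Union>?\<U>)) \<and> (\<forall>N\<in>?\<U>. res S (\<Union>?\<U>) N t = s N)"
  proof -
    have ax: "\<forall>\<U>. (\<forall>V\<in>\<U>. open V) \<longrightarrow>
        (\<forall>s. (\<forall>V\<in>\<U>. s V \<in> carrier (sec S V)) \<and> (\<forall>V\<in>\<U>. \<forall>W\<in>\<U>. res S V (V \<inter> W) (s V) = res S W (V \<inter> W) (s W)) \<longrightarrow>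
           (\<exists>!t. t \<in> carrier (sec S (\<Union>\<U>)) \<and> (\<forall>V\<in>\<U>. res S (\<Union>\<U>) V t = s V)))"
      using S_sheaf unfolding super_sheaf_def by (elim conjE)
    show ?thesis
    proof (rule ax[rule_format])
      show "(\<forall>N\<in>?\<U>. s N \<in> carrier (sec S N)) \<and> (\<forall>N\<in>?\<U>. \<forall>N'\<in>?\<U>. res S N (N \<inter> N') (s N) = res S N' (N \<inter> N') (s N'))"
      proof (intro conjI ballI)
        fix N assume N: "N \<in> ?\<U>"
        then obtain x where "N \<subseteq> V x" by blast
        then show "s N \<in> carrier (sec S N)" using s N by blast
      qed (rule comp)
    qed simp
  qed
  have "lifts W f t \<longleftrightarrow> t \<in> carrier (sec S W) \<and> (\<forall>N\<in>?\<U>. res S W N t = s N)" for t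
  proof
    assume t: "lifts W f t"
    then have tc: "t \<in> carrier (sec S W)" by (simp add: lifts_def)
    have "res S W N t = s N" if NU: "N \<in> ?\<U>" for N
    proof -
      from NU obtain x where N: "open N" "N \<subseteq> W" "N \<subseteq> V x" by blast
      note sN = s[OF N]
      show ?thesis
        by (rule iso_inj[OF iso N(1,3) S_res_closed[OF W N(1,2) tc] conjunct1[OF sN]])
           (use t N sN in \<open>simp add: lifts_def\<close>)
    qed
    then show "t \<in> carrier (sec S W) \<and> (\<forall>N\<in>?\<U>. res S W N t = s N)" using tc by blast
  next
    assume t: "t \<in> carrier (sec S W) \<and> (\<forall>N\<in>?\<U>. res S W N t = s N)"
    show "lifts W f t"
      unfolding lifts_def
    proof (intro conjI allI impI)
      fix x N assume N: "open N \<and> N \<subseteq> W \<and> N \<subseteq> V x"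
      then have "res S W N t = s N" using t by blast
      then show "\<tau> x N (res S W N t) = emb N f" using s N by simp
    qed (use t in blast)
  qed
  then show ?thesis using glue unfolding cov by simp
qed

definition lift :: "'a set \<Rightarrow> ('a \<Rightarrow> complex) \<Rightarrow> 's" where
  "lift W f = (THE t. lifts W f t)"

lemma lift_lifts: "open W \<Longrightarrow> hol W f \<Longrightarrow> lifts W f (lift W f)"
  unfolding lift_def by (rule theI'[OF lifts_exists])

lemma lift_eq: "open W \<Longrightarrow> hol W f \<Longrightarrow> lifts W f t \<Longrightarrow> lift W f = t"
  unfolding lift_def by (rule the1_equality[OF lifts_exists])

lemma lift_closed: "open W \<Longrightarrow> hol W f \<Longrightarrow> lift W f \<in> carrier (sec S W)"
  using lift_lifts by (simp add: lifts_def)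

lemma lift_apply: "\<lbrakk>open W; hol W f; open N; N \<subseteq> W; N \<subseteq> V x\<rbrakk> \<Longrightarrow> \<tau> x N (res S W N (lift W f)) = emb N f"
  using lift_lifts[of W f] unfolding lifts_def by blast

text \<open>Uniqueness of lifts turns each algebraic property of \<open>lift\<close> into the corresponding property
  of the isomorphisms.\<close>

lemma lift_operations:
  assumes W: "open W" and f: "hol W f" and g: "hol W g"
  shows "lift W (\<lambda>x. f x * g x) = lift W f \<otimes>\<^bsub>sec S W\<^esub> lift W g" (is ?m)
    "lift W (\<lambda>x. f x + g x) = lift W f \<oplus>\<^bsub>sec S W\<^esub> lift W g" (is ?a)
    "lift W (\<lambda>x. c * f x) = c \<odot>\<^bsub>sec S W\<^esub> lift W f" (is ?s)
proof -
  note c = lift_closed[OF W f] lift_closed[OF W g]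
  have m: "lifts W (\<lambda>x. f x * g x) (lift W f \<otimes>\<^bsub>sec S W\<^esub> lift W g) \<and>
      lifts W (\<lambda>x. f x + g x) (lift W f \<oplus>\<^bsub>sec S W\<^esub> lift W g) \<and> lifts W (\<lambda>x. c * f x) (c \<odot>\<^bsub>sec S W\<^esub> lift W f)"
    unfolding lifts_def
  proof (intro conjI allI impI)
    show "lift W f \<otimes>\<^bsub>sec S W\<^esub> lift W g \<in> carrier (sec S W)" by (rule S_mult_closed[OF W c])
    show "lift W f \<oplus>\<^bsub>sec S W\<^esub> lift W g \<in> carrier (sec S W)" by (rule S_add_closed[OF W c])
    show "c \<odot>\<^bsub>sec S W\<^esub> lift W f \<in> carrier (sec S W)" by (rule algebra_presheafD(2)[OF S_algebra W c(1)])
    fix x N assume "open N \<and> N \<subseteq> W \<and> N \<subseteq> V x"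
    then have N: "open N" "N \<subseteq> W" "N \<subseteq> V x" by auto
    note rh = super_homD[OF S_res_hom[OF W N(1,2)]] and ch = super_homD[OF super_isoD(1)[OF iso N(1,3)]]
    note rc = S_res_closed[OF W N(1,2) c(1)] S_res_closed[OF W N(1,2) c(2)]
    note ap = lift_apply[OF W f N] lift_apply[OF W g N]
    show "\<tau> x N (res S W N (lift W f \<otimes>\<^bsub>sec S W\<^esub> lift W g)) = emb N (\<lambda>x. f x * g x)"
      unfolding rh(2)[OF c] ch(2)[OF rc] ap sheaf_simps(2) by (rule emb_mult[OF N(1) holomorphic_fun_mono[OF g N(2)]])
    show "\<tau> x N (res S W N (lift W f \<oplus>\<^bsub>sec S W\<^esub> lift W g)) = emb N (\<lambda>x. f x + g x)"
      unfolding rh(3)[OF c] ch(3)[OF rc] ap sheaf_simps(3) by (auto simp: emb_def fun_eq_iff algebra_simps)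
    show "\<tau> x N (res S W N (c \<odot>\<^bsub>sec S W\<^esub> lift W f)) = emb N (\<lambda>x. c * f x)"
      unfolding rh(5)[OF c(1)] ch(5)[OF rc(1)] ap sheaf_simps(6) by (auto simp: emb_def fun_eq_iff)
  qed
  show ?m by (rule lift_eq[OF W holomorphic_fun_mult[OF f g]]) (use m in blast)
  show ?a by (rule lift_eq[OF W holomorphic_fun_add[OF f g]]) (use m in blast)
  show ?s by (rule lift_eq[OF W holomorphic_fun_mult[OF holomorphic_fun_const f]]) (use m in blast)
qed

lemma lift_one:
  assumes W: "open W" shows "lift W (\<lambda>x. if x \<in> W then 1 else 0) = \<one>\<^bsub>sec S W\<^esub>"
proof (rule lift_eq[OF W hol_restrict[OF W holomorphic_fun_const order_refl]])
  show "lifts W (\<lambda>x. if x \<in> W then 1 else 0) \<one>\<^bsub>sec S W\<^esub>"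
    unfolding lifts_def
  proof (intro conjI allI impI)
    show "\<one>\<^bsub>sec S W\<^esub> \<in> carrier (sec S W)" using ring.ring_simprules(6)[OF S_ring[OF W]] .
    fix x N assume "open N \<and> N \<subseteq> W \<and> N \<subseteq> V x"
    then have N: "open N" "N \<subseteq> W" "N \<subseteq> V x" by auto
    show "\<tau> x N (res S W N \<one>\<^bsub>sec S W\<^esub>) = emb N (\<lambda>x. if x \<in> W then 1 else 0)"
      unfolding super_homD(4)[OF S_res_hom[OF W N(1,2)]] super_homD(4)[OF super_isoD(1)[OF iso N(1,3)]] sheaf_simps(4)
      using N(2) by (auto simp: emb_def fun_eq_iff)
  qed
qed

text \<open>The even part of the lift is again a lift of \<open>f\<close>, since functions have no components of odd
  degree.\<close>

lemma lift_even:
  assumes W: "open W" and f: "hol W f" shows "lift W f \<in> evens (sec S W)"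
proof -
  note t = lift_closed[OF W f]
  obtain a b where ab: "a \<in> evens (sec S W)" "b \<in> odds (sec S W)" "lift W f = a \<oplus>\<^bsub>sec S W\<^esub> b"
    by (rule superalgebra_decomp[OF S_superalgebra[OF W] t])
  note abc = superalgebraD(3)[OF S_superalgebra[OF W] ab(1)] superalgebraD(4)[OF S_superalgebra[OF W] ab(2)]
  have "lifts W f a"
    unfolding lifts_def
  proof (intro conjI allI impI abc(1))
    fix x N assume "open N \<and> N \<subseteq> W \<and> N \<subseteq> V x"
    then have N: "open N" "N \<subseteq> W" "N \<subseteq> V x" by auto
    note rh = super_homD[OF S_res_hom[OF W N(1,2)]] and ch = super_homD[OF super_isoD(1)[OF iso N(1,3)]]
    let ?a = "\<tau> x N (res S W N a)" and ?b = "\<tau> x N (res S W N b)"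
    have e: "?a \<in> evens (sec \<Lambda> N)" "?b \<in> odds (sec \<Lambda> N)" by (rule ch(6)[OF rh(6)[OF ab(1)]], rule ch(7)[OF rh(7)[OF ab(2)]])
    have "emb N f = (\<lambda>i x K. ?a i x K + ?b i x K)"
      unfolding lift_apply[OF W f N, symmetric] ab(3) rh(3)[OF abc] ch(3)[OF S_res_closed[OF W N(1,2) abc(1)] S_res_closed[OF W N(1,2) abc(2)]] sheaf_simps(3) ..
    then have s: "emb N f i y K = ?a i y K + ?b i y K" for i y K by simp
    show "?a = emb N f"
    proof (intro ext)
      fix i y K
      show "?a i y K = emb N f i y K"
      proof (cases "even (card K)")
        case True
        then show ?thesis using s[of i y K] e(2) by simp
      next
        case False
        then have "K \<noteq> {}" by auto
        then show ?thesis using False e(1) by (simp add: emb_def ext_one_def)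
      qed
    qed
  qed
  then show ?thesis using lift_eq[OF W f] ab(1) by blast
qed

lemma lift_zero:
  assumes W: "open W" shows "lift W (\<lambda>x. 0) = \<zero>\<^bsub>sec S W\<^esub>"
proof -
  interpret ring "sec S W" by (rule S_ring[OF W])
  have h: "hol W (\<lambda>x. 0)" by (rule holomorphic_fun_const)
  have "lift W (\<lambda>x. 0) = lift W (\<lambda>x. 0) \<oplus>\<^bsub>sec S W\<^esub> lift W (\<lambda>x. 0)"
    using lift_operations(2)[OF W h h] by simp
  then show ?thesis using lift_closed[OF W h] by (metis add.l_cancel_one)
qed

lemma lift_res:
  assumes W: "open W" "open W'" "W' \<subseteq> W" and f: "hol W f"
  shows "lift W' (\<lambda>x. if x \<in> W' then f x else 0) = res S W W' (lift W f)"
proof (rule lift_eq[OF W(2) hol_restrict[OF W(2) f W(3)]])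
  note t = lift_closed[OF W(1) f]
  show "lifts W' (\<lambda>x. if x \<in> W' then f x else 0) (res S W W' (lift W f))"
    unfolding lifts_def
  proof (intro conjI allI impI S_res_closed[OF W t])
    fix x N assume "open N \<and> N \<subseteq> W' \<and> N \<subseteq> V x"
    then have N: "open N" "N \<subseteq> W'" "N \<subseteq> W" "N \<subseteq> V x" using W by auto
    show "\<tau> x N (res S W' N (res S W W' (lift W f))) = emb N (\<lambda>x. if x \<in> W' then f x else 0)"
      unfolding S_res_res[OF W(1,2) N(1,2) W(3) t] lift_apply[OF W(1) f N(1,3,4)]
      by (rule emb_cong) (use N(2) in auto)
  qed
qed

lemma rho_lift:
  assumes W: "open W" and f: "hol W f" and x: "x \<in> W" shows "\<rho> W (lift W f) x = f x"
proof -
  note t = lift_closed[OF W f]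
  obtain i where i: "x \<in> patch E i" using patch_cover by blast
  let ?N = "W \<inter> V x"
  have N: "open ?N" "?N \<subseteq> W" "?N \<subseteq> V x" "x \<in> ?N" using W x cover by (auto simp: pcover_def)
  have xi: "x \<in> ?N \<inter> patch E i" using N(4) i by blast
  have "\<rho> ?N (res S W ?N (lift W f)) x = f x"
    using degree_0_value[OF iso N(1,3) S_res_closed[OF W N(1,2) t] xi] xi
    unfolding lift_apply[OF W f N(1-3)] by (simp add: emb_def ext_one_def)
  then show ?thesis unfolding rho_res[OF W N(1,2) t] using N(4) by simp
qed

text \<open>Besides naturality and the algebraic laws, locality of the stalk maps is needed: if the lift
  of \<open>f\<close> is invertible near \<open>x\<close>, so is its image \<open>f\<close> under \<open>\<rho>\<close>.\<close>

theorem projectable: "projectable M S \<rho>"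
  unfolding projectable_def
proof (intro exI[of _ "(id, lift)"] conjI)
  show "superspace_morphism S \<O> (id, lift)"
    unfolding superspace_morphism_def prod.case
  proof (intro conjI allI impI ballI)
    show "continuous_on UNIV (id :: 'a \<Rightarrow> 'a)" by (simp add: id_def)
  next
    fix W :: "'a set" assume W: "open W"
    show "lift W \<in> super_hom (sec \<O> W) (sec S (id -` W))"
      unfolding vimage_id id_apply
    proof (rule super_homI)
      show "lift W x \<in> odds (sec S W)" if "x \<in> odds (sec \<O> W)" for x
        using that lift_zero[OF W] superalgebraD(5)[OF S_superalgebra[OF W]] by simp
    qed (simp_all add: lift_closed[OF W] lift_operations(1,2)[OF W] lift_operations(3)[OF W _ holomorphic_fun_const[of M W 0]] lift_one[OF W] lift_even[OF W])
  next
    fix W W' :: "'a set" and f assume a: "open W \<and> open W' \<and> W' \<subseteq> W" and f: "f \<in> carrier (sec \<O> W)"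
    show "lift W' (res \<O> W W' f) = res S (id -` W) (id -` W') (lift W f)"
      using lift_res[of W W' f] a f by (simp add: vimage_id)
  next
    fix W x f assume a: "open W \<and> id x \<in> W" and f: "f \<in> carrier (sec \<O> W)" and u: "unit_at S x (id -` W) (lift W f)"
    from a have W: "open W" and x: "x \<in> W" by auto
    have fh: "hol W f" using f by simp
    obtain N where N: "open N" "x \<in> N" "N \<subseteq> W" "res S W N (lift W f) \<in> Units (sec S N)"
      using u unfolding unit_at_def vimage_id by auto
    then obtain v where v: "v \<in> carrier (sec S N)" "res S W N (lift W f) \<otimes>\<^bsub>sec S N\<^esub> v = \<one>\<^bsub>sec S N\<^esub>" by (auto simp: Units_def)
    note rh = super_homD[OF rho_hom[OF N(1)]]
    note tc = S_res_closed[OF W N(1,3) lift_closed[OF W fh]]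
    have "(\<lambda>y. \<rho> N (res S W N (lift W f)) y * \<rho> N v y) = (\<lambda>y. if y \<in> N then 1 else 0)"
      using rh(2)[OF tc v(1)] rh(4) unfolding v(2) by simp
    from fun_cong[OF this, of x] have "\<rho> N (res S W N (lift W f)) x \<noteq> 0" using N(2) by auto
    then have "f x \<noteq> 0"
      unfolding rho_res[OF W N(1,3) lift_closed[OF W fh]] using N(2) rho_lift[OF W fh x] by simp
    then show "unit_at \<O> (id x) W f" using nonzero_unit_at[OF W f x] by simp
  qed
  show "is_identity_morphism \<O> (mor_comp (id, lift) (id, \<rho>))"
    unfolding is_identity_morphism_def mor_comp_def prod.case
  proof (intro conjI allI impI ballI)
    fix W :: "'a set" and f assume W: "open W" and f: "f \<in> carrier (sec \<O> W)"
    then have fh: "hol W f" by simp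
    have "\<rho> W (lift W f) x = f x" for x
      using rho_lift[OF W fh] rho_zero[OF W lift_closed[OF W fh]] f by (cases "x \<in> W") auto
    then show "(\<rho> (id -` W) \<circ> lift W) f = f" by (auto simp: vimage_id)
  qed simp
qed

end

theorem theorem6p11:
  fixes M :: "'a::{t2_space,second_countable_topology} cmanifold"
    and E :: "('a, 'i) vbundle"
  assumes "complex_manifold M" and "holomorphic_bundle M E"
    and "carrier (first_obstruction_cohomology M E) = {\<one>\<^bsub>first_obstruction_cohomology M E\<^esub>}"
  shows "\<forall>(S :: ('a, 's) spresheaf) \<rho>. supermanifold_modelled_on M E S \<rho> \<longrightarrow> projectable M S \<rho>"
proof (intro allI impI)
  fix S :: "('a, 's) spresheaf" and \<rho>
  assume mod: "supermanifold_modelled_on M E S \<rho>"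
  note m = mod[unfolded supermanifold_modelled_on_def]
  from m obtain q :: "'a set \<Rightarrow> 's \<Rightarrow> 'i \<Rightarrow> 'a \<Rightarrow> nat \<Rightarrow> complex" where
    q: "\<And>U. open U \<Longrightarrow>
           q U \<in> odd_ideal S U \<rightarrow> bdl_sections M E U \<and>
           (\<forall>s\<in>odd_ideal S U. \<forall>t\<in>odd_ideal S U. \<forall>i x k. q U (s \<oplus>\<^bsub>sec S U\<^esub> t) i x k = q U s i x k + q U t i x k) \<and>
           (\<forall>a\<in>carrier (sec S U). \<forall>s\<in>odd_ideal S U. \<forall>i x k. q U (a \<otimes>\<^bsub>sec S U\<^esub> s) i x k = \<rho> U a x * q U s i x k) \<and>
           {s \<in> odd_ideal S U. \<forall>i x k. q U s i x k = 0} = odd_ideal_sq S U \<and>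
           (\<forall>e\<in>bdl_sections M E U. \<forall>x\<in>U. \<exists>W s. open W \<and> x \<in> W \<and> W \<subseteq> U \<and> s \<in> odd_ideal S W \<and>
              q W s = (\<lambda>i y k. if y \<in> W then e i y k else 0))"
    and qr: "\<And>U V. open U \<and> open V \<and> V \<subseteq> U \<Longrightarrow> \<forall>s\<in>odd_ideal S U. q V (res S U V s) = (\<lambda>i y k. if y \<in> V then q U s i y k else 0)"
    by (elim conjE exE) blast
  interpret supermanifold M E S \<rho> q
  proof (intro supermanifold.intro supermanifold_axioms.intro split_model.intro manifold.intro split_model_axioms.intro assms)
    show "superspace S" using m by (elim conjE)
    show "\<exists>U \<theta>. open U \<and> x \<in> U \<and> super_iso_on U S (ext_sheaf M E) \<theta>" for x using m by (elim conjE) (erule spec)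
    show "superspace_morphism (hol_sheaf M) S (id, \<rho>)" using m by (elim conjE)
    show "{s \<in> carrier (sec S U). \<rho> U s = \<zero>\<^bsub>sec (hol_sheaf M) U\<^esub>} = odd_ideal S U" if "open U" for U
      using m that by (elim conjE) (erule allE[of _ U], erule mp, assumption)
    fix U :: "'a set" assume U: "open U"
    note qU = q[OF U]
    show "q U s \<in> bdl_sections M E U" if "s \<in> odd_ideal S U" for s using qU that by blast
    show "q U (s \<oplus>\<^bsub>sec S U\<^esub> t) i x k = q U s i x k + q U t i x k" if "s \<in> odd_ideal S U" "t \<in> odd_ideal S U" for s t i x k
      using qU that by (elim conjE) simp
    show "q U (a \<otimes>\<^bsub>sec S U\<^esub> s) i x k = \<rho> U a x * q U s i x k" if "a \<in> carrier (sec S U)" "s \<in> odd_ideal S U" for a s i x k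
      using qU that by (elim conjE) simp
    show "{s \<in> odd_ideal S U. \<forall>i x k. q U s i x k = 0} = odd_ideal_sq S U" using qU by (elim conjE)
    show "\<exists>W s. open W \<and> x \<in> W \<and> W \<subseteq> U \<and> s \<in> odd_ideal S W \<and> q W s = (\<lambda>i y k. if y \<in> W then e i y k else 0)"
      if "e \<in> bdl_sections M E U" "x \<in> U" for e x
      using qU that by (elim conjE) (drule (1) bspec, erule (1) bspec)
    show "q V (res S U V s) = (\<lambda>i y k. if y \<in> V then q U s i y k else 0)" if "open V" "V \<subseteq> U" "s \<in> odd_ideal S U" for V s
      using qr[of U V] U that by simp
  qed
  show "projectable M S \<rho>"
  proof (rule compatible_charts_exist[OF assms(3)])
    fix V \<tau>
    assume "pcover V" "\<And>x. super_iso_on (V x) S \<Lambda> (\<tau> x)"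
      "\<And>x y N s. \<lbrakk>open N; N \<subseteq> V x; N \<subseteq> V y; s \<in> carrier (sec S N)\<rbrakk> \<Longrightarrow> \<tau> x N s = \<tau> y N s"
    then interpret compatible_charts M E S \<rho> q V \<tau>
      by (intro compatible_charts.intro compatible_charts_axioms.intro supermanifold_axioms)
    show "projectable M S \<rho>" by (rule projectable)
  qed
qed

end
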